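(* There exist an open set $\mathcal{P}\subset\mathbb{C}^4$ containing $(0,0,0,0)$ and each of the parameters $(A(a),B(a),C(a),D(a))$, $a\in(-2,2)$, where $A(a)=B(a)=C(a)=2a+4$ and $D(a)=-(a^2+8a+8)$, and a countable union $\mathcal{H}\subset\mathbb{C}^4$ of real-algebraic hypersurfaces, such that for any $(A,B,C,D)\in\mathcal{P}\setminus\mathcal{H}$ there exists $p\in\mathcal{J}_{A,B,C,D}$ whose orbit closure $\overline{\{\gamma(p):\gamma\in\mathcal{G}_{A,B,C,D}\}}$ has non-empty interior in $S_{A,B,C,D}$ but is not all of the surface $S_{A,B,C,D}$.
   Context: For $(A,B,C,D)\in\mathbb{C}^4$ let $S_{A,B,C,D}=\{(x,y,z)\in\mathbb{C}^3: x^2+y^2+z^2+xyz=Ax+By+Cz+D\}$. The involutions $s_x(x,y,z)=(-x-yz+A,\,y,\,z)$, $s_y(x,y,z)=(x,\,-y-xz+B,\,z)$, $s_z(x,y,z)=(x,\,y,\,-z-xy+C)$ preserve $S_{A,B,C,D}$. Let $\mathcal{G}_{A,B,C,D}=\langle g_x,g_y,g_z\rangle$ be the group of automorphisms of $S_{A,B,C,D}$ generated by $g_x=s_z\circ s_y$, $g_y=s_x\circ s_z$, $g_z=s_y\circ s_x$. A sequence of maps $f_i$ converges to infinity on an open set $U\subset S_{A,B,C,D}$ if for every compact $\overline V\subset U$ and every compact $K\subset S_{A,B,C,D}$ only finitely many $i$ satisfy $f_i(\overline V)\cap K\neq\emptyset$. The group $\mathcal{G}_{A,B,C,D}$ forms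 a normal family on $U$ if every sequence of its elements has a subsequence that, on $U$, either converges uniformly on compact subsets or converges to infinity. The Fatou set $\mathcal{F}_{A,B,C,D}$ is the set of $p\in S_{A,B,C,D}$ having an open neighborhood on which $\mathcal{G}_{A,B,C,D}$ forms a normal family; the Julia set is $\mathcal{J}_{A,B,C,D}=S_{A,B,C,D}\setminus\mathcal{F}_{A,B,C,D}$. A real-algebraic hypersurface in $\mathbb{C}^4\cong\mathbb{R}^8$ is the zero set of a non-zero real polynomial. *)

theory Defs
  imports "HOL-Analysis.Analysis" "HOL-Algebra.Bij" "HOL-Algebra.Generated_Groups"
begin

type_synonym complex3 = "complex \<times> complex \<times> complex"
type_synonym complex4 = "complex \<times> complex \<times> complex \<times> complex"

definition cubic_surface :: "complex \<Rightarrow> complex \<Rightarrow> complex \<Rightarrow> complex \<Rightarrow> complex3 set" where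
  "cubic_surface A B C D =
    {(x, y, z). x\<^sup>2 + y\<^sup>2 + z\<^sup>2 + x * y * z = A * x + B * y + C * z + D}"

definition s_x :: "complex \<Rightarrow> complex3 \<Rightarrow> complex3" where
  "s_x A = (\<lambda>(x, y, z). (- x - y * z + A, y, z))"

definition s_y :: "complex \<Rightarrow> complex3 \<Rightarrow> complex3" where
  "s_y B = (\<lambda>(x, y, z). (x, - y - x * z + B, z))"

definition s_z :: "complex \<Rightarrow> complex3 \<Rightarrow> complex3" where
  "s_z C = (\<lambda>(x, y, z). (x, y, - z - x * y + C))"

definition g_x :: "complex \<Rightarrow> complex \<Rightarrow> complex3 \<Rightarrow> complex3" where
  "g_x B C = s_z C \<circ> s_y B"

definition g_y :: "complex \<Rightarrow> complex \<Rightarrow> complex3 \<Rightarrow> complex3" where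
  "g_y A C = s_x A \<circ> s_z C"

definition g_z :: "complex \<Rightarrow> complex \<Rightarrow> complex3 \<Rightarrow> complex3" where
  "g_z A B = s_y B \<circ> s_x A"

text \<open>The group is generated inside the group of bijections of the surface; elements of
  \<^const>\<open>BijGroup\<close> are extensional, hence the restrictions. That the generators really are
  elements of this group is shown in \<open>generators_Bij\<close> below.\<close>

definition surface_gens :: "complex \<Rightarrow> complex \<Rightarrow> complex \<Rightarrow> complex \<Rightarrow> (complex3 \<Rightarrow> complex3) set" where
  "surface_gens A B C D =
    {restrict (g_x B C) (cubic_surface A B C D),
     restrict (g_y A C) (cubic_surface A B C D),
     restrict (g_z A B) (cubic_surface A B C D)}"

definition surface_group :: "complex \<Rightarrow> complex \<Rightarrow> complex \<Rightarrow> complex \<Rightarrow> (complex3 \<Rightarrow> complex3) set" where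
  "surface_group A B C D = generate (BijGroup (cubic_surface A B C D)) (surface_gens A B C D)"

definition converges_locally_uniformly_on ::
    "complex3 set \<Rightarrow> (nat \<Rightarrow> complex3 \<Rightarrow> complex3) \<Rightarrow> bool" where
  "converges_locally_uniformly_on U f \<longleftrightarrow>
    (\<exists>g. \<forall>V. compact V \<and> V \<subseteq> U \<longrightarrow> uniform_limit V f g sequentially)"

definition converges_to_infinity_on ::
    "complex3 set \<Rightarrow> complex3 set \<Rightarrow> (nat \<Rightarrow> complex3 \<Rightarrow> complex3) \<Rightarrow> bool" where
  "converges_to_infinity_on S U f \<longleftrightarrow>
    (\<forall>V K. compact V \<and> V \<subseteq> U \<and> compact K \<and> K \<subseteq> S \<longrightarrow> finite {i. f i ` V \<inter> K \<noteq> {}})"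

definition normal_family_on ::
    "complex3 set \<Rightarrow> complex3 set \<Rightarrow> (complex3 \<Rightarrow> complex3) set \<Rightarrow> bool" where
  "normal_family_on S U G \<longleftrightarrow>
    (\<forall>f :: nat \<Rightarrow> complex3 \<Rightarrow> complex3. range f \<subseteq> G \<longrightarrow>
      (\<exists>r :: nat \<Rightarrow> nat. strict_mono r \<and>
        (converges_locally_uniformly_on U (f \<circ> r) \<or> converges_to_infinity_on S U (f \<circ> r))))"

definition fatou_set :: "complex \<Rightarrow> complex \<Rightarrow> complex \<Rightarrow> complex \<Rightarrow> complex3 set" where
  "fatou_set A B C D =
    {p \<in> cubic_surface A B C D.
      \<exists>U. openin (top_of_set (cubic_surface A B C D)) U \<and> p \<in> U \<and>
          normal_family_on (cubic_surface A B C D) U (surface_group A B C D)}"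

definition julia_set :: "complex \<Rightarrow> complex \<Rightarrow> complex \<Rightarrow> complex \<Rightarrow> complex3 set" where
  "julia_set A B C D = cubic_surface A B C D - fatou_set A B C D"

definition surface_orbit ::
    "complex \<Rightarrow> complex \<Rightarrow> complex \<Rightarrow> complex \<Rightarrow> complex3 \<Rightarrow> complex3 set" where
  "surface_orbit A B C D p = {\<gamma> p | \<gamma>. \<gamma> \<in> surface_group A B C D}"

definition orbit_closure ::
    "complex \<Rightarrow> complex \<Rightarrow> complex \<Rightarrow> complex \<Rightarrow> complex3 \<Rightarrow> complex3 set" where
  "orbit_closure A B C D p =
    top_of_set (cubic_surface A B C D) closure_of surface_orbit A B C D p"

text \<open>\<^const>\<open>real_polynomial_function\<close> on \<^typ>\<open>complex4\<close>, viewed as a real vector space, consists of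
  the real polynomials in the eight real coordinates. Over the reals a polynomial is non-zero
  iff its associated function is not identically zero.\<close>

definition real_algebraic_hypersurface :: "complex4 set \<Rightarrow> bool" where
  "real_algebraic_hypersurface Z \<longleftrightarrow>
    (\<exists>P :: complex4 \<Rightarrow> real. real_polynomial_function P \<and> P \<noteq> (\<lambda>_. 0) \<and> Z = {v. P v = 0})"

definition special_param :: "real \<Rightarrow> complex4" where
  "special_param a =
    (of_real (2 * a + 4), of_real (2 * a + 4), of_real (2 * a + 4),
     of_real (- (a\<^sup>2 + 8 * a + 8)))"

lemma s_involution [simp]:
  "s_x A (s_x A p) = p" "s_y B (s_y B p) = p" "s_z C (s_z C p) = p"
  by (auto simp: s_x_def s_y_def s_z_def split: prod.splits)

lemma s_preserves:
  assumes "p \<in> cubic_surface A B C D"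
  shows "s_x A p \<in> cubic_surface A B C D" "s_y B p \<in> cubic_surface A B C D"
    "s_z C p \<in> cubic_surface A B C D"
proof -
  obtain x y z where p: "p = (x, y, z)" by (cases p)
  have eq: "x\<^sup>2 + y\<^sup>2 + z\<^sup>2 + x * y * z = A * x + B * y + C * z + D"
    using assms by (simp add: p cubic_surface_def)
  show "s_x A p \<in> cubic_surface A B C D" "s_y B p \<in> cubic_surface A B C D"
    "s_z C p \<in> cubic_surface A B C D"
    using eq unfolding p s_x_def s_y_def s_z_def cubic_surface_def mem_Collect_eq prod.case
    by algebra+
qed

lemma generators_Bij: "surface_gens A B C D \<subseteq> carrier (BijGroup (cubic_surface A B C D))"
proof -
  let ?S = "cubic_surface A B C D"
  have "bij_betw (s \<circ> t) ?S ?S"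
    if "\<And>p. s (s p) = p" "\<And>p. t (t p) = p"
      "\<And>p. p \<in> ?S \<Longrightarrow> s p \<in> ?S" "\<And>p. p \<in> ?S \<Longrightarrow> t p \<in> ?S" for s t
    by (rule bij_betw_byWitness[where f' = "t \<circ> s"]) (simp_all add: that image_subset_iff)
  then have "bij_betw (g_x B C) ?S ?S" "bij_betw (g_y A C) ?S ?S" "bij_betw (g_z A B) ?S ?S"
    unfolding g_x_def g_y_def g_z_def by (simp_all add: s_preserves)
  then show ?thesis
    by (auto simp: surface_gens_def BijGroup_def Bij_def bij_betw_restrict_eq)
qed

end

theory Submission
  imports Defs "HOL-Complex_Analysis.Complex_Analysis"
    "HOL-Computational_Algebra.Fundamental_Theorem_Algebra"
begin

text \<open>
  Every parameter near a base parameter has a point \<open>q0\<close> fixed by \<open>s\<^sub>y\<close> and \<open>s\<^sub>z\<close> close to the common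
  fixed point of all involutions at the base parameter; there \<open>g\<^sub>x\<close> is a saddle with non-real
  multiplier \<open>\<mu>\<close>. Iterated commutators of elements close to the identity give group elements
  arbitrarily close to the identity, and outside countably many real hypersurfaces they move \<open>q0\<close>.
  Combining the saddle with these near-translations (\<open>\<int> + \<mu> \<int>\<close> is a lattice) one can return to a
  neighbourhood \<open>W\<close> of \<open>q0\<close> again and again while expanding one direction without bound. By the Schwarz
  lemma this is impossible if a holomorphic disc avoids the orbit of the walls where \<open>y\<close> or \<open>z\<close>
  lies in \<open>[-2, 2]\<close>; so the images of these walls are dense near \<open>q0\<close>.

  On the other hand, let \<open>p\<close> have generic \<open>x\<close> and \<open>y\<close> coordinates in \<open>(-2, 2)\<close>. On the fibre of \<open>x\<close>
  through \<open>p\<close> the map \<open>g\<^sub>x\<close> is an irrational rotation, so the orbit closure \<open>K\<close> contains a circle, along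
  which \<open>y\<close> becomes non-real when \<open>Im C \<noteq> 0\<close>. If points of \<open>K\<close> with non-real \<open>y\<close> converge to a point with generic
  real \<open>y\<close>, then \<open>K\<close> contains the whole limiting fibre of \<open>y\<close>, and in turn all the walls. Hence \<open>K\<close>
  contains a neighbourhood of \<open>q0\<close>. It is not the whole surface since far out, near
  \<open>(-t, -t, -t)\<close>, all words keep \<open>\<bar>x\<bar> > 2\<close>, whereas \<open>\<bar>x\<bar> < 2\<close> at \<open>p\<close>; and \<open>p\<close> is in the Julia set because the
  iterates of \<open>g\<^sub>x\<close> are bounded at \<open>p\<close> but diverge at nearby points with non-real \<open>x\<close>.
\<close>

section \<open>Words in the involutions\<close>

text \<open>All base parameters belong to one two-parameter family: (a, b, b) is fixed by the three
  involutions exactly when A = 2a + b^2 and B = C = 2b + ab, and D is chosen so that the point lies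
  on the surface. The values a = b = 0 give the origin, and b = 2 gives the parameters indexed by a
  in (-2, 2). A common fixed point is singular and need not survive perturbation; what survives is a
  point fixed by two involutions, the singular point of a degenerate fibre of x. The main tension is
  between openness and genericity. The neighbourhood must not depend on the hypersurfaces, so
  smallness of the iterated commutators is proved uniformly in their index on one neighbourhood of
  the base parameter, whereas their nontriviality at the vertex is only generic. Nontriviality is a
  polynomial condition on the vertex coordinates and A; it is seen not to be an identity at one
  explicit vertex of the Cayley cubic. Since the vertex is an algebraic and not a rational function
  of the parameters, the condition is carried to the parameter space by elimination.\<close>

datatype letter = LX | LY | LZ

primrec refl :: "complex \<Rightarrow> complex \<Rightarrow> complex \<Rightarrow> letter \<Rightarrow> complex3 \<Rightarrow> complex3" where
  "refl A B C LX = s_x A"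
| "refl A B C LY = s_y B"
| "refl A B C LZ = s_z C"

primrec act :: "complex \<Rightarrow> complex \<Rightarrow> complex \<Rightarrow> letter list \<Rightarrow> complex3 \<Rightarrow> complex3" where
  "act A B C [] = id"
| "act A B C (l # w) = refl A B C l \<circ> act A B C w"

lemma refl_refl [simp]: "refl A B C l (refl A B C l p) = p"
  by (cases l) simp_all

lemma act_append [simp]: "act A B C (u @ v) = act A B C u \<circ> act A B C v"
  by (induction u) (simp_all add: comp_assoc)

lemma act_rev_act [simp]: "act A B C (rev w) (act A B C w p) = p"
  by (induction w arbitrary: p) simp_all

lemma act_act_rev [simp]: "act A B C w (act A B C (rev w) p) = p"
  using act_rev_act[of A B C "rev w"] by simp

lemma act_in_surface [simp]:
  "p \<in> cubic_surface A B C D \<Longrightarrow> act A B C w p \<in> cubic_surface A B C D"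
proof (induction w)
  case (Cons l w)
  then show ?case by (cases l) (simp_all add: s_preserves)
qed simp

lemma act_bij_betw: "bij_betw (act A B C w) (cubic_surface A B C D) (cubic_surface A B C D)"
  by (rule bij_betw_byWitness[where f' = "act A B C (rev w)"]) auto

lemma restrict_act_Bij:
  "restrict (act A B C w) (cubic_surface A B C D) \<in> carrier (BijGroup (cubic_surface A B C D))"
  by (simp add: BijGroup_def Bij_def bij_betw_restrict_eq act_bij_betw)

lemma mult_BijGroup_act:
  fixes A B C D defines "S \<equiv> cubic_surface A B C D"
  shows "restrict (act A B C u) S \<otimes>\<^bsub>BijGroup S\<^esub> restrict (act A B C v) S = restrict (act A B C (u @ v)) S"
proof -
  have "restrict (act A B C u) S \<in> Bij S" "restrict (act A B C v) S \<in> Bij S"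
    using restrict_act_Bij[of A B C _ D] unfolding S_def by (simp_all add: BijGroup_def)
  then show ?thesis
    by (auto simp: BijGroup_def compose_def S_def fun_eq_iff)
qed

lemma inv_BijGroup_act:
  fixes A B C D defines "S \<equiv> cubic_surface A B C D"
  shows "inv\<^bsub>BijGroup S\<^esub> restrict (act A B C u) S = restrict (act A B C (rev u)) S"
proof -
  interpret group "BijGroup S" by (rule group_BijGroup)
  have "restrict (act A B C (rev u)) S \<otimes>\<^bsub>BijGroup S\<^esub> restrict (act A B C u) S = \<one>\<^bsub>BijGroup S\<^esub>"
    unfolding S_def mult_BijGroup_act by (auto simp: BijGroup_def fun_eq_iff)
  then show ?thesis
    using restrict_act_Bij unfolding S_def by (metis S_def inv_equality)
qed

lemma surface_gens_words:
  "surface_gens A B C D =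
    (\<lambda>w. restrict (act A B C w) (cubic_surface A B C D)) ` {[LZ, LY], [LX, LZ], [LY, LX]}"
  by (simp add: surface_gens_def g_x_def g_y_def g_z_def)

text \<open>A product of two letters is a generator, the inverse of a generator or the identity, and
  an even word splits into such pairs. From here on the group of restricted bijections is replaced
  by even words acting on all of \<open>complex3\<close>.\<close>

theorem surface_group_words:
  "surface_group A B C D =
    (\<lambda>w. restrict (act A B C w) (cubic_surface A B C D)) ` {w. even (length w)}"
  (is "_ = ?\<rho> ` _")
proof
  let ?S = "cubic_surface A B C D"
  interpret group "BijGroup ?S" by (rule group_BijGroup)
  have unit: "\<one>\<^bsub>BijGroup ?S\<^esub> = ?\<rho> []"
    by (auto simp: BijGroup_def fun_eq_iff)
  show "surface_group A B C D \<subseteq> ?\<rho> ` {w. even (length w)}"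
  proof
    fix \<phi> assume "\<phi> \<in> surface_group A B C D"
    then have "\<phi> \<in> generate (BijGroup ?S) (surface_gens A B C D)"
      by (simp add: surface_group_def)
    then show "\<phi> \<in> ?\<rho> ` {w. even (length w)}"
    proof induction
      case one
      show ?case unfolding unit by (rule imageI) simp
    next
      case (incl h)
      then obtain w where "h = ?\<rho> w" "w \<in> {[LZ, LY], [LX, LZ], [LY, LX]}"
        unfolding surface_gens_words by blast
      then show ?case by (intro image_eqI[of _ _ w]) (simp, force)
    next
      case (inv h)
      then obtain w where w: "h = ?\<rho> w" "w \<in> {[LZ, LY], [LX, LZ], [LY, LX]}"
        unfolding surface_gens_words by blast
      then have "even (length w)" by auto
      then show ?case by (intro image_eqI[of _ _ "rev w"]) (auto simp only: w inv_BijGroup_act length_rev mem_Collect_eq)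
    next
      case (eng h1 h2)
      then obtain u v where "h1 = ?\<rho> u" "even (length u)" "h2 = ?\<rho> v" "even (length v)"
        by blast
      then show ?case
        by (intro image_eqI[of _ _ "u @ v"]) (simp_all only: mult_BijGroup_act length_append mem_Collect_eq even_add)
    qed
  qed
  define Q where "Q k l \<longleftrightarrow> ?\<rho> [k, l] \<in> generate (BijGroup ?S) (surface_gens A B C D)" for k l
  have gen: "Q LZ LY" "Q LX LZ" "Q LY LX"
    unfolding Q_def surface_gens_words by (blast intro: generate.incl)+
  have same: "Q l l" for l
  proof -
    have "act A B C [l, l] = act A B C []" by (simp add: fun_eq_iff)
    then show ?thesis
      using generate.one[of "BijGroup ?S"] unfolding Q_def unit by simp
  qed
  have swap: "Q l k" if "[k, l] \<in> {[LZ, LY], [LX, LZ], [LY, LX]}" for k l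
  proof -
    have "inv\<^bsub>BijGroup ?S\<^esub> (?\<rho> [k, l]) \<in> generate (BijGroup ?S) (surface_gens A B C D)"
      unfolding surface_gens_words using that by (intro generate.inv) blast
    then show ?thesis by (simp only: Q_def inv_BijGroup_act rev.simps append.simps)
  qed
  have pair: "?\<rho> [k, l] \<in> generate (BijGroup ?S) (surface_gens A B C D)" for k l
    using gen same[of k] swap[of k l] swap[of l k] unfolding Q_def[symmetric]
    by (cases k; cases l) simp_all
  have "?\<rho> w \<in> generate (BijGroup ?S) (surface_gens A B C D)" if "even (length w)" for w
    using that
  proof (induction w rule: induct_list012)
    case 1
    then show ?case using generate.one[of "BijGroup ?S"] by (simp only: unit)
  next
    case (3 k l w)
    have "even (length w)" using "3.prems" by simp
    then have "?\<rho> [k, l] \<otimes>\<^bsub>BijGroup ?S\<^esub> ?\<rho> w \<in> generate (BijGroup ?S) (surface_gens A B C D)"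
      by (intro generate.eng pair "3.IH"(1))
    then show ?case by (simp only: mult_BijGroup_act append.simps)
  qed simp
  then show "?\<rho> ` {w. even (length w)} \<subseteq> surface_group A B C D"
    unfolding surface_group_def by blast
qed

lemma surface_orbit_words:
  assumes "p \<in> cubic_surface A B C D"
  shows "surface_orbit A B C D p = {act A B C w p | w. even (length w)}"
proof -
  have "surface_orbit A B C D p =
    (\<lambda>w. restrict (act A B C w) (cubic_surface A B C D) p) ` {w. even (length w)}"
    unfolding surface_orbit_def surface_group_words by blast
  then show ?thesis using assms by auto
qed

text \<open>Holomorphic curves are preserved by the whole group, which reduces all complex analysis to
  one variable.\<close>

definition holo_curve :: "complex set \<Rightarrow> (complex \<Rightarrow> complex3) \<Rightarrow> bool" where
  "holo_curve U c \<longleftrightarrow> (\<lambda>s. fst (c s)) holomorphic_on U \<and> (\<lambda>s. fst (snd (c s))) holomorphic_on U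
     \<and> (\<lambda>s. snd (snd (c s))) holomorphic_on U"

lemma holo_curve_act: "holo_curve U c \<Longrightarrow> holo_curve U (\<lambda>s. act A B C w (c s))"
proof (induction w)
  case (Cons l w)
  then show ?case
    by (cases l) (auto simp: holo_curve_def s_x_def s_y_def s_z_def split_beta intro!: holomorphic_intros)
qed (simp add: o_def)

lemma continuous_on_refl_param:
  assumes "continuous_on X F" "continuous_on X A" "continuous_on X B" "continuous_on X C"
  shows "continuous_on X (\<lambda>v. refl (A v) (B v) (C v) l (F v))"
  using assms by (cases l) (auto simp: s_x_def s_y_def s_z_def split_beta intro!: continuous_intros)

lemma continuous_on_act_param:
  assumes "continuous_on X F" "continuous_on X A" "continuous_on X B" "continuous_on X C"
  shows "continuous_on X (\<lambda>v. act (A v) (B v) (C v) w (F v))"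
  by (induction w) (use assms continuous_on_refl_param[OF _ assms(2-4)] in auto)

lemma continuous_on_act [continuous_intros]:
  "continuous_on X F \<Longrightarrow> continuous_on X (\<lambda>v. act A B C w (F v))"
  by (rule continuous_on_act_param) (auto intro: continuous_intros)

lemma isCont_act: "isCont (act A B C w) p"
  using continuous_on_act[of UNIV "\<lambda>p. p" A B C w, OF continuous_on_id]
    continuous_on_eq_continuous_at[OF open_UNIV] by blast

lemma closed_cubic_surface: "closed (cubic_surface A B C D)"
proof -
  have "cubic_surface A B C D = {p. (fst p)\<^sup>2 + (fst (snd p))\<^sup>2 + (snd (snd p))\<^sup>2
      + fst p * fst (snd p) * snd (snd p) = A * fst p + B * fst (snd p) + C * snd (snd p) + D}"
    by (auto simp: cubic_surface_def)
  also have "closed \<dots>"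
    by (intro closed_Collect_eq continuous_intros)
  finally show ?thesis .
qed

section \<open>Elimination for real polynomials\<close>

text \<open>More unknowns than homogeneous equations: the pivot \<open>i0\<close> expresses one
  unknown through the others by means of the equation \<open>j\<close>, and the reduced system has
  one equation and one unknown fewer.\<close>

lemma exists_null_combination:
  fixes M :: "'i \<Rightarrow> 'j \<Rightarrow> real"
  assumes "finite J" "finite I" "card J < card I"
  shows "\<exists>c. (\<exists>i\<in>I. c i \<noteq> 0) \<and> (\<forall>j\<in>J. (\<Sum>i\<in>I. c i * M i j) = 0)"
  using assms
proof (induction J arbitrary: I M rule: finite_induct)
  case empty
  then obtain i where "i \<in> I" by fastforce
  then show ?case by (intro exI[of _ "\<lambda>_. 1"]) auto
next
  case (insert j J)
  show ?case
  proof (cases "\<forall>i\<in>I. M i j = 0")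
    case True
    then show ?thesis using insert.IH[of I M] insert.prems insert.hyps by auto
  next
    case False
    then obtain i0 where i0: "i0 \<in> I" "M i0 j \<noteq> 0" by auto
    define M' where "M' i k = M i k - M i j / M i0 j * M i0 k" for i k
    have "card J < card (I - {i0})" "finite (I - {i0})"
      using insert.prems insert.hyps i0 by auto
    then obtain c' where c': "\<exists>i\<in>I - {i0}. c' i \<noteq> 0" "\<And>k. k \<in> J \<Longrightarrow> (\<Sum>i\<in>I - {i0}. c' i * M' i k) = 0"
      using insert.IH[of "I - {i0}" M'] by blast
    define s where "s = (\<Sum>i\<in>I - {i0}. c' i * M i j)"
    define c where "c = c'(i0 := - s / M i0 j)"
    have split: "(\<Sum>i\<in>I. c i * M i k) = - s / M i0 j * M i0 k + (\<Sum>i\<in>I - {i0}. c' i * M i k)" for k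
      using i0 insert.prems by (simp add: sum.remove c_def)
    have "(\<Sum>i\<in>I. c i * M i k) = 0" if "k \<in> insert j J" for k
    proof (cases "k = j")
      case True
      then show ?thesis unfolding split using i0 by (simp add: s_def)
    next
      case False
      then have "0 = (\<Sum>i\<in>I - {i0}. c' i * M' i k)" using that c'(2) by simp
      also have "\<dots> = (\<Sum>i\<in>I - {i0}. c' i * M i k - (c' i * M i j) * (M i0 k / M i0 j))"
        by (simp add: M'_def algebra_simps)
      also have "\<dots> = (\<Sum>i\<in>I - {i0}. c' i * M i k) - s * (M i0 k / M i0 j)"
        by (simp add: sum_subtractf sum_distrib_right s_def sum_divide_distrib)
      finally show ?thesis unfolding split by simp
    qed
    moreover have "\<exists>i\<in>I. c i \<noteq> 0" using c'(1) by (auto simp: c_def)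
    ultimately show ?thesis by blast
  qed
qed

definition monom_fun :: "nat \<Rightarrow> (nat \<Rightarrow> nat) \<Rightarrow> (nat \<Rightarrow> real) \<Rightarrow> real" where
  "monom_fun n \<beta> y = (\<Prod>i<n. y i ^ \<beta> i)"

text \<open>Extensional functions represent each exponent vector once, and bounding the exponents
  separately rather than the total degree gives the count \<open>(k + 1) ^ n\<close>.\<close>

definition exponents :: "nat \<Rightarrow> nat \<Rightarrow> (nat \<Rightarrow> nat) set" where
  "exponents n k = {..<n} \<rightarrow>\<^sub>E {..k}"

definition poly_span :: "('a \<Rightarrow> nat \<Rightarrow> real) \<Rightarrow> nat \<Rightarrow> nat \<Rightarrow> ('a \<Rightarrow> real) \<Rightarrow> bool" where
  "poly_span X n k f \<longleftrightarrow> (\<exists>c. f = (\<lambda>v. \<Sum>\<beta>\<in>exponents n k. c \<beta> * monom_fun n \<beta> (X v)))"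

lemma finite_exponents [simp]: "finite (exponents n k)"
  by (simp add: exponents_def finite_PiE)

lemma exponents_le: "\<beta> \<in> exponents n k \<Longrightarrow> i < n \<Longrightarrow> \<beta> i \<le> k"
  by (auto simp: exponents_def)

lemma card_exponents: "card (exponents n k) = (k + 1) ^ n"
  by (simp add: exponents_def card_PiE)

lemma monom_fun_cong: "(\<And>i. i < n \<Longrightarrow> \<beta> i = \<gamma> i) \<Longrightarrow> monom_fun n \<beta> y = monom_fun n \<gamma> y"
  by (simp add: monom_fun_def)

lemma poly_span_monom:
  assumes "\<And>i. i < n \<Longrightarrow> \<beta> i \<le> k"
  shows "poly_span X n k (\<lambda>v. a * monom_fun n \<beta> (X v))"
proof -
  define \<gamma> where "\<gamma> = restrict \<beta> {..<n}"
  have "\<gamma> \<in> exponents n k" using assms by (auto simp: \<gamma>_def exponents_def)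
  then have "(\<Sum>\<delta>\<in>exponents n k. (if \<delta> = \<gamma> then a else 0) * monom_fun n \<delta> (X v)) = a * monom_fun n \<gamma> (X v)" for v
    by (subst sum.remove[of _ \<gamma>]) (auto intro!: sum.neutral)
  moreover have "monom_fun n \<gamma> y = monom_fun n \<beta> y" for y
    by (rule monom_fun_cong) (simp add: \<gamma>_def)
  ultimately show ?thesis
    unfolding poly_span_def by (intro exI[of _ "\<lambda>\<delta>. if \<delta> = \<gamma> then a else 0"]) simp
qed

lemma poly_span_add:
  assumes "poly_span X n k f" "poly_span X n k g"
  shows "poly_span X n k (\<lambda>v. f v + g v)"
proof -
  obtain c d where "f = (\<lambda>v. \<Sum>\<beta>\<in>exponents n k. c \<beta> * monom_fun n \<beta> (X v))"
      "g = (\<lambda>v. \<Sum>\<beta>\<in>exponents n k. d \<beta> * monom_fun n \<beta> (X v))"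
    using assms unfolding poly_span_def by blast
  then have "(\<lambda>v. f v + g v) = (\<lambda>v. \<Sum>\<beta>\<in>exponents n k. (c \<beta> + d \<beta>) * monom_fun n \<beta> (X v))"
    by (simp add: sum.distrib algebra_simps)
  then show ?thesis unfolding poly_span_def by (intro exI[of _ "\<lambda>\<beta>. c \<beta> + d \<beta>"])
qed

lemma poly_span_sum:
  assumes "\<And>a. a \<in> I \<Longrightarrow> poly_span X n k (f a)"
  shows "poly_span X n k (\<lambda>v. \<Sum>a\<in>I. f a v)"
proof (cases "finite I")
  case True
  then show ?thesis using assms
  proof (induction I rule: finite_induct)
    case empty
    then show ?case using poly_span_monom[of n "\<lambda>_. 0" k X 0] by simp
  next
    case (insert a I)
    then show ?case using poly_span_add[of X n k "f a" "\<lambda>v. \<Sum>a\<in>I. f a v"] by simp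
  qed
next
  case False
  then show ?thesis using poly_span_monom[of n "\<lambda>_. 0" k X 0] by simp
qed

lemma poly_span_mult:
  assumes "poly_span X n k f" "poly_span X n l g"
  shows "poly_span X n (k + l) (\<lambda>v. f v * g v)"
proof -
  obtain c d where f: "f = (\<lambda>v. \<Sum>\<beta>\<in>exponents n k. c \<beta> * monom_fun n \<beta> (X v))"
    and g: "g = (\<lambda>v. \<Sum>\<beta>\<in>exponents n l. d \<beta> * monom_fun n \<beta> (X v))"
    using assms unfolding poly_span_def by blast
  have eq: "(\<lambda>v. f v * g v) = (\<lambda>v. \<Sum>\<beta>\<in>exponents n k. \<Sum>\<gamma>\<in>exponents n l.
     (c \<beta> * d \<gamma>) * monom_fun n (\<lambda>i. \<beta> i + \<gamma> i) (X v))"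
    unfolding f g sum_product by (simp add: monom_fun_def power_add prod.distrib mult_ac)
  show ?thesis unfolding eq
    by (intro poly_span_sum poly_span_monom add_mono exponents_le)
qed

lemma poly_span_mono:
  assumes "poly_span X n k f" "k \<le> l"
  shows "poly_span X n l f"
proof -
  obtain c where f: "f = (\<lambda>v. \<Sum>\<beta>\<in>exponents n k. c \<beta> * monom_fun n \<beta> (X v))"
    using assms unfolding poly_span_def by blast
  show ?thesis unfolding f
    by (intro poly_span_sum poly_span_monom) (use assms(2) exponents_le in \<open>blast intro: order_trans\<close>)
qed

lemma poly_span_power:
  assumes "poly_span X n k f"
  shows "poly_span X n (j * k) (\<lambda>v. f v ^ j)"
proof (induction j)
  case 0
  then show ?case using poly_span_monom[of n "\<lambda>_. 0" 0 X 1] by (simp add: monom_fun_def)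
next
  case (Suc j)
  then show ?case using poly_span_mult[OF assms Suc] by simp
qed

lemma poly_span_monom_fun:
  assumes "\<And>i. i < m \<Longrightarrow> poly_span X n k (F i)" "\<And>i. i < m \<Longrightarrow> \<alpha> i \<le> d"
  shows "poly_span X n (m * d * k) (\<lambda>v. monom_fun m \<alpha> (\<lambda>i. F i v))"
  using assms
proof (induction m)
  case 0
  then show ?case using poly_span_monom[of n "\<lambda>_. 0" 0 X 1] by (simp add: monom_fun_def)
next
  case (Suc m)
  have "poly_span X n (d * k) (\<lambda>v. F m v ^ \<alpha> m)"
    using Suc.prems by (intro poly_span_mono[OF poly_span_power]) auto
  from poly_span_mult[OF this Suc.IH] Suc.prems show ?case
    by (simp add: monom_fun_def algebra_simps)
qed

text \<open>Dimension count: the \<open>(d + 1) ^ Suc n\<close> monomials in the functions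
  \<open>F i\<close> lie in the span of \<open>(K + 1) ^ n\<close> monomials in the variables, where
  \<open>K\<close> is linear in \<open>d\<close>; for large \<open>d\<close> a linear relation is
  forced.\<close>

lemma algebraic_dependence:
  assumes "\<And>i. i < Suc n \<Longrightarrow> poly_span X n k (F i)"
  shows "\<exists>d c. (\<exists>\<alpha>\<in>exponents (Suc n) d. c \<alpha> \<noteq> 0) \<and>
    (\<forall>v. (\<Sum>\<alpha>\<in>exponents (Suc n) d. c \<alpha> * monom_fun (Suc n) \<alpha> (\<lambda>i. F i v)) = 0)"
proof -
  define M where "M = Suc n * k + 1"
  \<comment> \<open>With this choice \<open>(M * (d + 1)) ^ n = d * (d + 1) ^ n\<close>, which is
    visibly smaller than \<open>(d + 1) ^ Suc n\<close>.\<close>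
  define d where "d = M ^ n"
  define K where "K = Suc n * d * k"
  have "K + 1 \<le> M * (d + 1)"
    by (simp add: K_def M_def algebra_simps)
  then have "(K + 1) ^ n \<le> (M * (d + 1)) ^ n" by (intro power_mono) auto
  also have "\<dots> = d * (d + 1) ^ n" by (simp only: d_def power_mult_distrib)
  also have "\<dots> < (d + 1) ^ Suc n" by simp
  finally have card: "card (exponents n K) < card (exponents (Suc n) d)"
    by (simp only: card_exponents)
  have "\<forall>\<alpha>\<in>exponents (Suc n) d. \<exists>c. \<forall>v. monom_fun (Suc n) \<alpha> (\<lambda>i. F i v) =
      (\<Sum>\<beta>\<in>exponents n K. c \<beta> * monom_fun n \<beta> (X v))"
  proof
    fix \<alpha> assume "\<alpha> \<in> exponents (Suc n) d"
    then have "poly_span X n K (\<lambda>v. monom_fun (Suc n) \<alpha> (\<lambda>i. F i v))"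
      unfolding K_def using assms by (intro poly_span_monom_fun) (auto simp: exponents_def)
    then show "\<exists>c. \<forall>v. monom_fun (Suc n) \<alpha> (\<lambda>i. F i v) =
      (\<Sum>\<beta>\<in>exponents n K. c \<beta> * monom_fun n \<beta> (X v))"
      unfolding poly_span_def by (metis (no_types))
  qed
  then obtain m where m: "\<And>\<alpha> v. \<alpha> \<in> exponents (Suc n) d \<Longrightarrow> monom_fun (Suc n) \<alpha> (\<lambda>i. F i v) =
      (\<Sum>\<beta>\<in>exponents n K. m \<alpha> \<beta> * monom_fun n \<beta> (X v))"
    by metis
  obtain c where c: "\<exists>\<alpha>\<in>exponents (Suc n) d. c \<alpha> \<noteq> 0"
    "\<And>\<beta>. \<beta> \<in> exponents n K \<Longrightarrow> (\<Sum>\<alpha>\<in>exponents (Suc n) d. c \<alpha> * m \<alpha> \<beta>) = 0"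
    using exists_null_combination[OF _ _ card, of m] by auto
  have "(\<Sum>\<alpha>\<in>exponents (Suc n) d. c \<alpha> * monom_fun (Suc n) \<alpha> (\<lambda>i. F i v)) = 0" for v
  proof -
    have "(\<Sum>\<alpha>\<in>exponents (Suc n) d. c \<alpha> * monom_fun (Suc n) \<alpha> (\<lambda>i. F i v)) =
      (\<Sum>\<alpha>\<in>exponents (Suc n) d. \<Sum>\<beta>\<in>exponents n K. c \<alpha> * m \<alpha> \<beta> * monom_fun n \<beta> (X v))"
      by (intro sum.cong) (simp_all add: m sum_distrib_left mult.assoc)
    also have "\<dots> = (\<Sum>\<beta>\<in>exponents n K. (\<Sum>\<alpha>\<in>exponents (Suc n) d. c \<alpha> * m \<alpha> \<beta>) * monom_fun n \<beta> (X v))"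
      by (subst sum.swap) (simp add: sum_distrib_right)
    finally show ?thesis using c(2) by simp
  qed
  with c(1) show ?thesis by blast
qed

lemma digits_bound:
  fixes d :: nat
  assumes "\<And>i. i < n \<Longrightarrow> \<alpha> i \<le> d"
  shows "(\<Sum>i<n. \<alpha> i * (d + 1) ^ i) < (d + 1) ^ n"
  using assms
proof (induction n)
  case (Suc n)
  then have "(\<Sum>i<n. \<alpha> i * (d + 1) ^ i) < (d + 1) ^ n" "\<alpha> n * (d + 1) ^ n \<le> d * (d + 1) ^ n"
    by (auto intro: mult_right_mono)
  then show ?case by (simp only: sum.lessThan_Suc power_Suc distrib_right mult_1)
qed simp

lemma digits_inj:
  fixes d :: nat
  assumes "\<And>i. i < n \<Longrightarrow> \<alpha> i \<le> d" "\<And>i. i < n \<Longrightarrow> \<beta> i \<le> d"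
    and "(\<Sum>i<n. \<alpha> i * (d + 1) ^ i) = (\<Sum>i<n. \<beta> i * (d + 1) ^ i)" "i < n"
  shows "\<alpha> i = \<beta> i"
  using assms
proof (induction n)
  case (Suc n)
  let ?a = "\<Sum>i<n. \<alpha> i * (d + 1) ^ i" and ?b = "\<Sum>i<n. \<beta> i * (d + 1) ^ i"
  have lt: "?a < (d + 1) ^ n" "?b < (d + 1) ^ n"
    by (rule digits_bound; use Suc.prems in auto)+
  have eq: "?a + \<alpha> n * (d + 1) ^ n = ?b + \<beta> n * (d + 1) ^ n" using Suc.prems by simp
  have "(?a + \<alpha> n * (d + 1) ^ n) div (d + 1) ^ n = \<alpha> n"
    "(?b + \<beta> n * (d + 1) ^ n) div (d + 1) ^ n = \<beta> n" using lt by auto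
  then have "\<alpha> n = \<beta> n" using eq by metis
  then show ?case using Suc.IH Suc.prems eq by (auto simp: less_Suc_eq)
qed simp

text \<open>Kronecker substitution \<open>y\<^sub>i = t\<^bsup>(d+1)\<^bsup>i\<^esup>\<^esup>\<close> separates the monomials.\<close>

lemma monomials_independent:
  assumes "finite I" "\<alpha>0 \<in> I" "c \<alpha>0 \<noteq> 0"
    and le: "\<And>\<alpha> i. \<alpha> \<in> I \<Longrightarrow> i < n \<Longrightarrow> \<alpha> i \<le> d"
    and inj: "\<And>\<alpha>. \<alpha> \<in> I \<Longrightarrow> (\<And>i. i < n \<Longrightarrow> \<alpha> i = \<alpha>0 i) \<Longrightarrow> \<alpha> = \<alpha>0"
  shows "\<exists>y. (\<Sum>\<alpha>\<in>I. c \<alpha> * monom_fun n \<alpha> y) \<noteq> 0"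
proof -
  define code where "code \<alpha> = (\<Sum>i<n. \<alpha> i * (d + 1) ^ i)" for \<alpha> :: "nat \<Rightarrow> nat"
  define P where "P = (\<Sum>\<alpha>\<in>I. monom (c \<alpha>) (code \<alpha>))"
  have "code \<alpha> = code \<alpha>0 \<Longrightarrow> \<alpha> = \<alpha>0" if "\<alpha> \<in> I" for \<alpha>
    using inj[OF that] digits_inj[of n \<alpha> d \<alpha>0] le[OF that] le[OF assms(2)] unfolding code_def by blast
  then have "coeff P (code \<alpha>0) = (\<Sum>\<alpha>\<in>I. if \<alpha> = \<alpha>0 then c \<alpha> else 0)"
    unfolding P_def coeff_sum coeff_monom by (intro sum.cong) auto
  then have "P \<noteq> 0" using assms(1-3) by auto
  then obtain t where t: "poly P t \<noteq> 0" using poly_all_0_iff_0[of P] by auto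
  have "monom_fun n \<alpha> (\<lambda>i. t ^ ((d + 1) ^ i)) = t ^ code \<alpha>" for \<alpha>
    by (simp only: monom_fun_def code_def power_sum power_mult[symmetric] mult.commute)
  then have "(\<Sum>\<alpha>\<in>I. c \<alpha> * monom_fun n \<alpha> (\<lambda>i. t ^ ((d + 1) ^ i))) = poly P t"
    by (simp add: P_def poly_sum poly_monom)
  then show ?thesis using t by (intro exI[of _ "\<lambda>i. t ^ ((d + 1) ^ i)"]) (simp only: not_False_eq_True)
qed

text \<open>On the line through \<open>v\<close> and \<open>w\<close> the polynomial \<Phi> has one
  variable and is nonzero at \<open>w\<close>, hence has finitely many zeros there; \<open>R\<close>
  vanishes on the line off these zeros and by continuity also at \<open>v\<close>.\<close>

lemma real_polynomial_function_dense:
  fixes \<Phi> R :: "'a::euclidean_space \<Rightarrow> real"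
  assumes \<Phi>: "real_polynomial_function \<Phi>" "\<Phi> w \<noteq> 0" and R: "continuous_on UNIV R"
    and zero: "\<And>v. \<Phi> v \<noteq> 0 \<Longrightarrow> R v = 0"
  shows "R v = 0"
proof -
  define l where "l t = v + t *\<^sub>R (w - v)" for t :: real
  have "polynomial_function l" unfolding l_def
    by (intro polynomial_function_add polynomial_function_const polynomial_function_bounded_linear)
      (auto intro: bounded_linear_intros)
  then have "real_polynomial_function (\<Phi> \<circ> l)"
    using \<Phi>(1) by (intro real_polynomial_function_compose)
  then obtain a n where an: "\<And>t. \<Phi> (l t) = (\<Sum>i\<le>n. a i * t ^ i)"
    unfolding real_polynomial_function_iff_sum by (metis comp_apply)
  have "\<Phi> (l 1) \<noteq> 0" using \<Phi>(2) by (simp add: l_def)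
  then have "\<exists>i\<le>n. a i \<noteq> 0" unfolding an by (metis (no_types, lifting) atMost_iff mult_zero_left sum.neutral)
  then have fin: "finite {t. \<Phi> (l t) = 0}"
    using polyfun_finite_roots[of a n] unfolding an by auto
  have "closed {t. R (l t) = 0}"
    by (intro closed_Collect_eq continuous_on_compose2[OF R] continuous_intros)
      (auto simp: l_def intro!: continuous_intros)
  moreover have "- {t. \<Phi> (l t) = 0} \<subseteq> {t. R (l t) = 0}" using zero by auto
  ultimately have "closure (- {t. \<Phi> (l t) = 0}) \<subseteq> {t. R (l t) = 0}" by (rule closure_minimal[rotated])
  then have "0 \<in> {t. R (l t) = 0}"
    using fin by (auto simp: closure_complement empty_interior_finite)
  then show ?thesis by (simp add: l_def)
qed

section \<open>Real coordinates of the parameter space\<close>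

definition coord4 :: "complex4 \<Rightarrow> nat \<Rightarrow> real" where
  "coord4 v i = [Re (fst v), Im (fst v), Re (fst (snd v)), Im (fst (snd v)),
     Re (fst (snd (snd v))), Im (fst (snd (snd v))), Re (snd (snd (snd v))), Im (snd (snd (snd v)))] ! i"

lemma less8: "i < (8::nat) \<longleftrightarrow> i \<in> {0,1,2,3,4,5,6,7}"
  by auto

lemma coord4_surj: "\<exists>v. \<forall>i<8. coord4 v i = y i"
  by (rule exI[of _ "(Complex (y 0) (y 1), Complex (y 2) (y 3), Complex (y 4) (y 5), Complex (y 6) (y 7))"])
    (auto simp: less8 coord4_def)

lemma bounded_linear_coord4: "i < 8 \<Longrightarrow> bounded_linear (\<lambda>v. coord4 v i)"
  unfolding less8 coord4_def
  by (auto intro!: bounded_linear_compose[OF bounded_linear_Re] bounded_linear_compose[OF bounded_linear_Im]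
      bounded_linear_intros)

lemma coord4_expand:
  assumes "bounded_linear (f :: complex4 \<Rightarrow> real)"
  shows "\<exists>c. \<forall>v. f v = (\<Sum>i<8. c i * coord4 v i)"
proof -
  interpret f: bounded_linear f by fact
  define e :: "nat \<Rightarrow> complex4" where
    "e = (\<lambda>i. [(1,0,0,0), (\<i>,0,0,0), (0,1,0,0), (0,\<i>,0,0), (0,0,1,0), (0,0,\<i>,0), (0,0,0,1), (0,0,0,\<i>)] ! i)"
  have "v = (\<Sum>i<8. coord4 v i *\<^sub>R e i)" for v
    by (cases v) (simp add: eval_nat_numeral coord4_def e_def complex_eq_iff)
  then have "f v = f (\<Sum>i<8. coord4 v i *\<^sub>R e i)" for v by simp
  also have "f (\<Sum>i<8. coord4 v i *\<^sub>R e i) = (\<Sum>i<8. f (e i) * coord4 v i)" for v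
    by (simp add: f.sum f.scaleR mult.commute)
  finally show ?thesis by (intro exI[of _ "\<lambda>i. f (e i)"]) blast
qed

lemma poly_span_coord4:
  assumes "i < 8"
  shows "poly_span coord4 8 1 (\<lambda>v. a * coord4 v i)"
proof -
  have "monom_fun 8 (\<lambda>j. if j = i then 1 else 0) y = y i" for y
    using assms unfolding monom_fun_def by (subst prod.remove[of _ i]) (auto intro!: prod.neutral)
  then show ?thesis
    using poly_span_monom[of 8 "\<lambda>j. if j = i then 1 else 0" 1 coord4 a] by simp
qed

lemma real_polynomial_function_poly_span:
  assumes "real_polynomial_function (f :: complex4 \<Rightarrow> real)"
  shows "\<exists>k. poly_span coord4 8 k f"
  using assms
proof induction
  case (linear f)
  then obtain c where "f = (\<lambda>v. \<Sum>i<8. c i * coord4 v i)" using coord4_expand by blast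
  then show ?case using poly_span_sum[of "{..<8}" coord4 8 1 "\<lambda>i v. c i * coord4 v i"] poly_span_coord4 by auto
next
  case (const c)
  then show ?case using poly_span_monom[of 8 "\<lambda>_. 0" 0 coord4 c] by (auto simp: monom_fun_def)
next
  case (add f g)
  then obtain k l where "poly_span coord4 8 k f" "poly_span coord4 8 l g" by blast
  then have "poly_span coord4 8 (max k l) f" "poly_span coord4 8 (max k l) g"
    by (auto intro: poly_span_mono)
  then show ?case using poly_span_add by blast
next
  case (mult f g)
  then show ?case using poly_span_mult by blast
qed

lemma real_polynomial_function_monom_fun:
  "real_polynomial_function (\<lambda>v. monom_fun 8 \<alpha> (coord4 v))"
proof -
  have "real_polynomial_function (\<lambda>v. coord4 v i)" if "i < 8" for i
    using bounded_linear_coord4[OF that] by (rule real_polynomial_function.intros(1))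
  then show ?thesis unfolding monom_fun_def
    by (intro real_polynomial_function_prod real_polynomial_function_power) auto
qed

text \<open>Nine polynomials in eight variables are algebraically dependent; in a relation between \<open>\<Phi>\<close> and
  the components of \<open>\<pi>\<close>, the coefficient of the lowest power of \<open>\<Phi>\<close> vanishes on \<open>\<pi> {\<Phi> = 0}\<close>.\<close>

theorem elimination:
  fixes \<Phi> :: "complex4 \<Rightarrow> real" and \<pi> :: "complex4 \<Rightarrow> complex4"
  assumes \<Phi>: "real_polynomial_function \<Phi>" "\<Phi> \<noteq> (\<lambda>_. 0)"
    and \<pi>: "\<And>i. i < 8 \<Longrightarrow> real_polynomial_function (\<lambda>v. coord4 (\<pi> v) i)"
  shows "\<exists>N. real_polynomial_function N \<and> N \<noteq> (\<lambda>_. 0) \<and> (\<forall>v. \<Phi> v = 0 \<longrightarrow> N (\<pi> v) = 0)"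
proof -
  define F where "F i v = (if i < 8 then coord4 (\<pi> v) i else \<Phi> v)" for i v
  have rpf: "real_polynomial_function (F i)" for i
    using \<Phi>(1) \<pi>[of i] unfolding F_def by (cases "i < 8") simp_all
  then have "\<forall>i. \<exists>k. poly_span coord4 8 k (F i)" using real_polynomial_function_poly_span by blast
  then obtain ks where ks: "\<And>i. poly_span coord4 8 (ks i) (F i)" by metis
  have "poly_span coord4 8 (\<Sum>i<9. ks i) (F i)" if "i < Suc 8" for i
    by (rule poly_span_mono[OF ks]) (use that in \<open>auto intro!: member_le_sum\<close>)
  then have "\<exists>d c. (\<exists>\<alpha>\<in>exponents (Suc 8) d. c \<alpha> \<noteq> 0) \<and>
    (\<forall>v. (\<Sum>\<alpha>\<in>exponents (Suc 8) d. c \<alpha> * monom_fun (Suc 8) \<alpha> (\<lambda>i. F i v)) = 0)"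
    by (rule algebraic_dependence)
  then obtain d c where nz: "\<exists>\<alpha>\<in>exponents (Suc 8) d. c \<alpha> \<noteq> 0"
    and rel: "\<And>v. (\<Sum>\<alpha>\<in>exponents (Suc 8) d. c \<alpha> * monom_fun (Suc 8) \<alpha> (\<lambda>i. F i v)) = 0"
    by blast
  let ?E = "exponents (Suc 8) d"
  define e where "e = (LEAST j. \<exists>\<alpha>\<in>?E. c \<alpha> \<noteq> 0 \<and> \<alpha> 8 = j)"
  obtain \<alpha>0 where \<alpha>0: "\<alpha>0 \<in> ?E" "c \<alpha>0 \<noteq> 0" "\<alpha>0 8 = e"
    using LeastI_ex[of "\<lambda>j. \<exists>\<alpha>\<in>?E. c \<alpha> \<noteq> 0 \<and> \<alpha> 8 = j"] nz unfolding e_def by blast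
  have le: "e \<le> \<alpha> 8" if "\<alpha> \<in> ?E" "c \<alpha> \<noteq> 0" for \<alpha>
    unfolding e_def by (rule Least_le) (use that in blast)
  define I where "I = {\<alpha> \<in> ?E. \<alpha> 8 = e}"
  define N where "N v = (\<Sum>\<alpha>\<in>I. c \<alpha> * monom_fun 8 \<alpha> (coord4 v))" for v
  \<comment> \<open>The relation divided by \<open>\<Phi> v ^ e\<close>. Truncated subtraction
    occurs only where \<open>c \<alpha> = 0\<close>, since \<open>e\<close> is minimal; at a zero of
    \<Phi> the terms with \<open>\<alpha> 8 = e\<close> survive because
    \<open>0 ^ 0 = 1\<close>.\<close>
  define R where "R v = (\<Sum>\<alpha>\<in>?E. c \<alpha> * (monom_fun 8 \<alpha> (coord4 (\<pi> v)) * \<Phi> v ^ (\<alpha> 8 - e)))" for v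
  have mon: "monom_fun (Suc 8) \<alpha> (\<lambda>i. F i v) = monom_fun 8 \<alpha> (coord4 (\<pi> v)) * \<Phi> v ^ \<alpha> 8" for \<alpha> v
    unfolding monom_fun_def prod.lessThan_Suc by (simp add: F_def)
  have "\<Phi> v ^ e * R v = 0" for v
  proof -
    have "\<Phi> v ^ e * R v = (\<Sum>\<alpha>\<in>?E. c \<alpha> * monom_fun (Suc 8) \<alpha> (\<lambda>i. F i v))"
      unfolding R_def sum_distrib_left mon
    proof (rule sum.cong)
      fix \<alpha> assume "\<alpha> \<in> ?E"
      show "\<Phi> v ^ e * (c \<alpha> * (monom_fun 8 \<alpha> (coord4 (\<pi> v)) * \<Phi> v ^ (\<alpha> 8 - e))) =
         c \<alpha> * (monom_fun 8 \<alpha> (coord4 (\<pi> v)) * \<Phi> v ^ \<alpha> 8)"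
      proof (cases "c \<alpha> = 0")
        case False
        then have "\<Phi> v ^ \<alpha> 8 = \<Phi> v ^ e * \<Phi> v ^ (\<alpha> 8 - e)"
          using le[OF \<open>\<alpha> \<in> ?E\<close>] by (simp add: power_add[symmetric])
        then show ?thesis by simp
      qed simp
    qed simp
    then show ?thesis using rel by simp
  qed
  then have R0: "R v = 0" if "\<Phi> v \<noteq> 0" for v using that by (metis mult_eq_0_iff power_not_zero)
  have cont: "continuous_on UNIV f" if "real_polynomial_function f" for f :: "complex4 \<Rightarrow> real"
    by (intro continuous_at_imp_continuous_on ballI continuous_real_polymonial_function that)
  have "real_polynomial_function R" unfolding R_def monom_fun_def
    by (intro real_polynomial_function_sum real_polynomial_function_prod real_polynomial_function_power
        real_polynomial_function.intros(2,4) \<Phi>(1) \<pi>) auto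
  then have "continuous_on UNIV R" by (rule cont)
  moreover obtain w where "\<Phi> w \<noteq> 0" using \<Phi>(2) unfolding fun_eq_iff by blast
  \<comment> \<open>Dividing by \<open>\<Phi> v ^ e\<close> is possible only where \<Phi> is
    nonzero, but \<open>R\<close> is needed where \<Phi> vanishes; density bridges the gap.\<close>
  ultimately have R: "R v = 0" for v
    using real_polynomial_function_dense[OF \<Phi>(1)] R0 by blast
  have "N (\<pi> v) = 0" if "\<Phi> v = 0" for v
  proof -
    have "R v = (\<Sum>\<alpha>\<in>?E. if \<alpha> \<in> I then c \<alpha> * monom_fun 8 \<alpha> (coord4 (\<pi> v)) else 0)"
      unfolding R_def
    proof (rule sum.cong)
      fix \<alpha> assume \<alpha>: "\<alpha> \<in> ?E"
      show "c \<alpha> * (monom_fun 8 \<alpha> (coord4 (\<pi> v)) * \<Phi> v ^ (\<alpha> 8 - e)) =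
        (if \<alpha> \<in> I then c \<alpha> * monom_fun 8 \<alpha> (coord4 (\<pi> v)) else 0)"
        using le[OF \<alpha>] \<alpha> that by (cases "c \<alpha> = 0") (auto simp: I_def)
    qed simp
    also have "\<dots> = N (\<pi> v)" unfolding N_def by (subst sum.inter_restrict[symmetric]) (auto simp: I_def intro!: sum.cong)
    finally show ?thesis using R by simp
  qed
  moreover have "real_polynomial_function N" unfolding N_def
    by (intro real_polynomial_function_sum real_polynomial_function.intros(2,4) real_polynomial_function_monom_fun)
      (auto simp: I_def)
  moreover have "N \<noteq> (\<lambda>_. 0)"
  proof -
    have "\<exists>y. (\<Sum>\<alpha>\<in>I. c \<alpha> * monom_fun 8 \<alpha> y) \<noteq> 0"
    proof (rule monomials_independent)
      show "finite I" by (simp add: I_def)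
      show "\<alpha>0 \<in> I" using \<alpha>0(1,3) by (simp add: I_def)
      show "c \<alpha>0 \<noteq> 0" by fact
      show "\<alpha> i \<le> d" if "\<alpha> \<in> I" "i < 8" for \<alpha> i
        using that exponents_le[of \<alpha> "Suc 8" d i] by (simp add: I_def)
      show "\<alpha> = \<alpha>0" if \<alpha>: "\<alpha> \<in> I" and eq: "\<And>i. i < 8 \<Longrightarrow> \<alpha> i = \<alpha>0 i" for \<alpha>
      proof (rule PiE_ext)
        show "\<alpha> \<in> {..<Suc 8} \<rightarrow>\<^sub>E {..d}" "\<alpha>0 \<in> {..<Suc 8} \<rightarrow>\<^sub>E {..d}"
          using \<alpha> \<alpha>0(1) unfolding I_def exponents_def by blast+
        show "\<alpha> i = \<alpha>0 i" if "i \<in> {..<Suc 8}" for i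
        proof (cases "i = 8")
          case True
          then show ?thesis using \<alpha> \<alpha>0(3) by (simp add: I_def)
        next
          case False
          then show ?thesis using that by (intro eq) auto
        qed
      qed
    qed
    then obtain y where y: "(\<Sum>\<alpha>\<in>I. c \<alpha> * monom_fun 8 \<alpha> y) \<noteq> 0" by blast
    obtain v where v: "\<And>i. i < 8 \<Longrightarrow> coord4 v i = y i" using coord4_surj by blast
    have "monom_fun 8 \<alpha> (coord4 v) = monom_fun 8 \<alpha> y" for \<alpha>
      unfolding monom_fun_def by (intro prod.cong) (auto simp: v)
    then have "N v = (\<Sum>\<alpha>\<in>I. c \<alpha> * monom_fun 8 \<alpha> y)" unfolding N_def by simp
    with y show ?thesis by auto
  qed
  ultimately show ?thesis by blast
qed

section \<open>Iterated commutators\<close>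

lemma norm_triple_le: "norm (p :: complex3) \<le> norm (fst p) + norm (fst (snd p)) + norm (snd (snd p))"
  by (cases p) (metis add.assoc add_left_mono norm_Pair_le order_trans fst_conv snd_conv)

lemma norm_coord_le:
  "norm (fst (p :: complex3)) \<le> norm p" "norm (fst (snd p)) \<le> norm p" "norm (snd (snd p)) \<le> norm p"
proof -
  obtain x y z where p: "p = (x, y, z)" by (cases p)
  show "norm (fst p) \<le> norm p" "norm (fst (snd p)) \<le> norm p" "norm (snd (snd p)) \<le> norm p"
    using norm_fst_le[of x "(y, z)"] norm_snd_le[of "(y, z)" x] norm_fst_le[of y z] norm_snd_le[of z y]
    by (auto simp: p)
qed

definition cscale :: "complex \<Rightarrow> complex3 \<Rightarrow> complex3" where
  "cscale s p = (s * fst p, s * fst (snd p), s * snd (snd p))"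

lemma norm_cscale: "norm (cscale s p) = norm s * norm p"
proof -
  have "(norm (cscale s p))\<^sup>2 = (norm s * norm p)\<^sup>2"
    by (cases p) (simp add: cscale_def norm_Pair norm_mult power_mult_distrib algebra_simps)
  then show ?thesis by (simp add: power2_eq_iff_nonneg)
qed

text \<open>Cauchy's inequality on circles of radius \<open>\<rho> / 2\<close> bounds the derivative
  along the segment by \<open>2 * \<epsilon> / \<rho>\<close>, and the segment has length
  one.\<close>

lemma holomorphic_difference_le:
  assumes "\<phi> holomorphic_on UNIV" "\<rho> > 0"
    and "\<And>s0 s. s0 \<in> closed_segment 0 1 \<Longrightarrow> norm (s - s0) < \<rho> \<Longrightarrow> norm (\<phi> s) \<le> \<epsilon>"
  shows "norm (\<phi> 1 - \<phi> 0) \<le> 2 * \<epsilon> / \<rho>"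
proof -
  have hol: "\<phi> holomorphic_on X" for X using assms(1) holomorphic_on_subset by blast
  have "norm (deriv \<phi> s0) \<le> 2 * \<epsilon> / \<rho>" if "s0 \<in> closed_segment 0 1" for s0
  proof -
    have "norm ((deriv ^^ 1) \<phi> s0) \<le> fact 1 * \<epsilon> / (\<rho> / 2) ^ 1"
    proof (rule Cauchy_inequality)
      show "continuous_on (cball s0 (\<rho> / 2)) \<phi>" using hol by (rule holomorphic_on_imp_continuous_on)
      show "norm (\<phi> x) \<le> \<epsilon>" if "norm (s0 - x) = \<rho> / 2" for x
        using assms(3)[OF \<open>s0 \<in> closed_segment 0 1\<close>, of x] that \<open>\<rho> > 0\<close> by (simp add: norm_minus_commute)
    qed (use hol \<open>\<rho> > 0\<close> in auto)
    then show ?thesis by (simp add: mult.commute)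
  qed
  then have "norm (\<phi> 1 - \<phi> 0) \<le> 2 * \<epsilon> / \<rho> * norm (1 - 0 :: complex)"
  proof (rule field_differentiable_bound[OF convex_closed_segment, rotated])
    show "(\<phi> has_field_derivative deriv \<phi> z) (at z within closed_segment 0 1)" for z
      by (rule holomorphic_derivI[OF hol[of UNIV]]) auto
  qed auto
  then show ?thesis by simp
qed

definition near_id :: "complex3 \<Rightarrow> real \<Rightarrow> real \<Rightarrow> (complex3 \<Rightarrow> complex3) \<Rightarrow> bool" where
  "near_id p0 r \<epsilon> f \<longleftrightarrow> (\<forall>p \<in> ball p0 r. norm (f p - p) \<le> \<epsilon>)"

text \<open>Restriction to the complex line through \<open>p\<close> and \<open>q\<close> reduces
  the claim to one variable; a disc of radius \<open>\<tau> / d\<close> in the parameter is a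
  distance \<tau> in space. The factor 6 is 2 from Cauchy's inequality times 3 coordinates.\<close>

lemma near_id_lipschitz:
  assumes f: "\<And>c. holo_curve UNIV c \<Longrightarrow> holo_curve UNIV (\<lambda>s. f (c s))"
    and near: "near_id p0 r \<epsilon> f" and "\<tau> > 0" and p: "p \<in> ball p0 (r - \<tau>)" and q: "q \<in> ball p0 (r - \<tau>)"
  shows "norm ((f p - p) - (f q - q)) \<le> 6 * \<epsilon> / \<tau> * norm (p - q)"
proof (cases "p = q")
  case False
  define d where "d = norm (p - q)"
  have "d > 0" using False by (simp add: d_def)
  define c where "c s = q + cscale s (p - q)" for s
  have c01: "c 0 = q" "c 1 = p" by (cases p; cases q; simp add: c_def cscale_def zero_prod_def)+
  have "holo_curve UNIV c"
    by (auto simp: holo_curve_def c_def cscale_def intro!: holomorphic_intros)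
  then have hol: "holo_curve UNIV (\<lambda>s. f (c s))" "holo_curve UNIV c" using f by auto
  have "norm (f (c s) - c s) \<le> \<epsilon>" if s0: "s0 \<in> closed_segment 0 1" and s: "norm (s - s0) < \<tau> / d" for s0 s
  proof -
    obtain u where u: "s0 = of_real u" "0 \<le> u" "u \<le> 1"
      using s0 unfolding closed_segment_def by (auto simp: scaleR_conv_of_real)
    have "c s0 = (1 - u) *\<^sub>R q + u *\<^sub>R p"
      by (cases p; cases q) (simp add: c_def cscale_def u scaleR_conv_of_real algebra_simps)
    then have "c s0 \<in> closed_segment q p" using u by (auto simp: closed_segment_def)
    then have "c s0 \<in> ball p0 (r - \<tau>)"
      using p q by (meson convex_ball convex_contains_segment subsetD)
    moreover have "norm (c s - c s0) < \<tau>"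
    proof -
      have "c s - c s0 = cscale (s - s0) (p - q)" by (simp add: c_def cscale_def algebra_simps)
      then have "norm (c s - c s0) = norm (s - s0) * d" by (simp add: norm_cscale d_def)
      then show ?thesis using s \<open>d > 0\<close> by (simp add: field_simps)
    qed
    ultimately have "c s \<in> ball p0 r"
      using dist_triangle[of p0 "c s" "c s0"] by (auto simp: dist_norm norm_minus_commute)
    then show ?thesis using near by (auto simp: near_id_def)
  qed
  note bnd = this
  have comp: "norm (\<phi> (f p - p) - \<phi> (f q - q)) \<le> 2 * \<epsilon> / \<tau> * d"
    if "(\<lambda>s. \<phi> (f (c s) - c s)) holomorphic_on UNIV" "\<And>v. norm (\<phi> v) \<le> norm v"
    for \<phi> :: "complex3 \<Rightarrow> complex"
    using holomorphic_difference_le[OF that(1), of "\<tau> / d" \<epsilon>] order_trans[OF that(2) bnd] \<open>d > 0\<close> \<open>\<tau> > 0\<close>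
    by (simp add: c01)
  have "(\<lambda>s. fst (f (c s) - c s)) holomorphic_on UNIV"
    "(\<lambda>s. fst (snd (f (c s) - c s))) holomorphic_on UNIV"
    "(\<lambda>s. snd (snd (f (c s) - c s))) holomorphic_on UNIV"
    using hol by (auto simp: holo_curve_def intro!: holomorphic_on_diff)
  then have "norm (fst (f p - p) - fst (f q - q)) \<le> 2 * \<epsilon> / \<tau> * d"
    "norm (fst (snd (f p - p)) - fst (snd (f q - q))) \<le> 2 * \<epsilon> / \<tau> * d"
    "norm (snd (snd (f p - p)) - snd (snd (f q - q))) \<le> 2 * \<epsilon> / \<tau> * d"
    using comp[of fst] comp[of "\<lambda>v. fst (snd v)"] comp[of "\<lambda>v. snd (snd v)"] norm_coord_le by blast+
  then have "norm ((f p - p) - (f q - q)) \<le> 3 * (2 * \<epsilon> / \<tau> * d)"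
    using norm_triple_le[of "(f p - p) - (f q - q)"] by simp
  then show ?thesis by (simp add: d_def)
qed simp

text \<open>With \<open>u\<^sub>f = f - id\<close> and \<open>q = f\<inverse> g\<inverse> p\<close>, the displacement of the commutator at \<open>p\<close> is
  \<open>(u\<^sub>f (g q) - u\<^sub>f q) - (u\<^sub>g (f q) - u\<^sub>g q)\<close>, which is quadratically small.\<close>

lemma near_id_commutator:
  assumes f: "\<And>c. holo_curve UNIV c \<Longrightarrow> holo_curve UNIV (\<lambda>s. f (c s))" "\<And>p. f (f' p) = p"
    and g: "\<And>c. holo_curve UNIV c \<Longrightarrow> holo_curve UNIV (\<lambda>s. g (c s))" "\<And>p. g (g' p) = p"
    and near: "near_id p0 r \<epsilon>1 f" "near_id p0 r \<epsilon>1 f'" "near_id p0 r \<epsilon>2 g" "near_id p0 r \<epsilon>2 g'"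
    and \<tau>: "\<tau> > 0" "2 * \<epsilon>1 + 2 * \<epsilon>2 \<le> \<tau>" "\<epsilon>1 \<ge> 0" "\<epsilon>2 \<ge> 0"
  shows "near_id p0 (r - 2 * \<tau>) (12 * \<epsilon>1 * \<epsilon>2 / \<tau>) (\<lambda>p. f (g (f' (g' p))))"
  unfolding near_id_def
proof
  fix p assume p: "p \<in> ball p0 (r - 2 * \<tau>)"
  define q where "q = f' (g' p)"
  have move: "h y \<in> ball p0 (s + e) \<and> norm (h y - y) \<le> e"
    if "near_id p0 r e h" "y \<in> ball p0 s" "s \<le> r" for h y s e
  proof -
    have "norm (h y - y) \<le> e" using that by (auto simp: near_id_def)
    then show ?thesis using that(2) dist_triangle[of p0 "h y" y] by (auto simp: dist_norm norm_minus_commute)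
  qed
  have 1: "g' p \<in> ball p0 (r - 2 * \<tau> + \<epsilon>2)" using move[OF near(4) p] \<tau> by auto
  have 2: "q \<in> ball p0 (r - 2 * \<tau> + \<epsilon>2 + \<epsilon>1)" unfolding q_def using move[OF near(2) 1] \<tau> by auto
  have 3: "g q \<in> ball p0 (r - 2 * \<tau> + \<epsilon>2 + \<epsilon>1 + \<epsilon>2)" "norm (g q - q) \<le> \<epsilon>2"
    using move[OF near(3) 2] \<tau> by auto
  have 4: "f q \<in> ball p0 (r - 2 * \<tau> + \<epsilon>2 + \<epsilon>1 + \<epsilon>1)" "norm (f q - q) \<le> \<epsilon>1"
    using move[OF near(1) 2] \<tau> by auto
  have in_ball: "q \<in> ball p0 (r - \<tau>)" "g q \<in> ball p0 (r - \<tau>)" "f q \<in> ball p0 (r - \<tau>)"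
    using 2 3 4 \<tau> by auto
  have "g (f q) = p" by (simp add: q_def f g)
  then have eq: "f (g (f' (g' p))) - p = ((f (g q) - g q) - (f q - q)) - ((g (f q) - f q) - (g q - q))"
    by (simp add: q_def)
  have "norm ((f (g q) - g q) - (f q - q)) \<le> 6 * \<epsilon>1 / \<tau> * norm (g q - q)"
    by (rule near_id_lipschitz[OF f(1) near(1) \<tau>(1) in_ball(2,1)])
  also have "\<dots> \<le> 6 * \<epsilon>1 / \<tau> * \<epsilon>2" using 3 \<tau> by (intro mult_left_mono) auto
  finally have a: "norm ((f (g q) - g q) - (f q - q)) \<le> 6 * \<epsilon>1 * \<epsilon>2 / \<tau>" by simp
  have "norm ((g (f q) - f q) - (g q - q)) \<le> 6 * \<epsilon>2 / \<tau> * norm (f q - q)"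
    by (rule near_id_lipschitz[OF g(1) near(3) \<tau>(1) in_ball(3,1)])
  also have "\<dots> \<le> 6 * \<epsilon>2 / \<tau> * \<epsilon>1" using 4 \<tau> by (intro mult_left_mono) auto
  finally have b: "norm ((g (f q) - f q) - (g q - q)) \<le> 6 * \<epsilon>1 * \<epsilon>2 / \<tau>" by (simp add: mult_ac)
  have "norm (f (g (f' (g' p))) - p) \<le> norm ((f (g q) - g q) - (f q - q)) + norm ((g (f q) - f q) - (g q - q))"
    unfolding eq by (rule norm_triangle_ineq4)
  then show "norm (f (g (f' (g' p))) - p) \<le> 12 * \<epsilon>1 * \<epsilon>2 / \<tau>" using a b by simp
qed

text \<open>The seeds are the \<open>m\<close>-th power of \<open>g_x\<close> and its conjugate by
  \<open>s_x\<close>. Every later word is the commutator of its two predecessors, so that by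
  \<open>near_id_commutator\<close> the displacements multiply.\<close>

fun comm_word :: "nat \<Rightarrow> nat \<Rightarrow> letter list" where
  "comm_word m 0 = concat (replicate m [LZ, LY])"
| "comm_word m (Suc 0) = LX # concat (replicate m [LZ, LY]) @ [LX]"
| "comm_word m (Suc (Suc n)) =
    comm_word m (Suc n) @ comm_word m n @ rev (comm_word m (Suc n)) @ rev (comm_word m n)"

lemma even_length_comm_word: "even (length (comm_word m n))"
proof (induction m n rule: comm_word.induct)
  case (1 m)
  then show ?case by (induction m) auto
next
  case (2 m)
  have "even (length (concat (replicate m [LZ, LY])))" by (induction m) auto
  then show ?case by simp
qed auto

lemma near_id_mono: "near_id p0 r \<epsilon> f \<Longrightarrow> r' \<le> r \<Longrightarrow> \<epsilon> \<le> \<epsilon>' \<Longrightarrow> near_id p0 r' \<epsilon>' f"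
  unfolding near_id_def by (meson ball_subset_ball_iff order_trans subset_ball subsetD)

text \<open>Each commutator costs \<open>2 * \<tau>\<close> of the radius with \<tau> of order
  \<open>r / 2 ^ n\<close>, so the radii stay above \<open>r / 2\<close>. The new displacement is a
  product of two terms of order \<open>r / 4 ^ n\<close> divided by \<tau>, hence of order
  \<open>r / 8 ^ n\<close>; the constants 1000 and 4000 make it fit below the next bound from the
  start.\<close>

lemma comm_word_near_id:
  assumes "r > 0"
    and w0: "near_id p0 r (r / 1000) (act A B C (comm_word m 0))"
      "near_id p0 r (r / 1000) (act A B C (rev (comm_word m 0)))"
    and w1: "near_id p0 r (r / 4000) (act A B C (comm_word m 1))"
      "near_id p0 r (r / 4000) (act A B C (rev (comm_word m 1)))"
  shows "near_id p0 (r / 2 * (1 + 1 / 2 ^ n)) (r / 1000 / 4 ^ n) (act A B C (comm_word m n)) \<and>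
    near_id p0 (r / 2 * (1 + 1 / 2 ^ n)) (r / 1000 / 4 ^ n) (act A B C (rev (comm_word m n)))"
proof (induction n rule: induct_nat_012)
  case 0
  then show ?case using w0 by simp
next
  case 1
  have "r / 2 * (1 + 1 / 2 ^ 1) \<le> r" using \<open>r > 0\<close> by simp
  note mono = near_id_mono[OF _ this order_refl]
  show ?case using mono[OF w1(1)] mono[OF w1(2)] by (simp add: o_def)
next
  case (ge2 n)
  define R where "R = r / 2 * (1 + 1 / 2 ^ Suc n)"
  define \<tau> where "\<tau> = r / 2 ^ (n + 4)"
  define e1 where "e1 = r / 1000 / 4 ^ Suc n"
  define e2 where "e2 = r / 1000 / 4 ^ n"
  let ?u = "comm_word m (Suc n)" and ?v = "comm_word m n"
  have p: "2 ^ n > (0::real)" "2 ^ n \<ge> (1::real)" by auto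
  have four: "4 ^ n = (2 ^ n * 2 ^ n :: real)" by (metis mult_2_right numeral_Bit0 power_mult_distrib)
  have Rle: "R \<le> r / 2 * (1 + 1 / 2 ^ n)" using \<open>r > 0\<close> by (simp add: R_def field_simps)
  have near: "near_id p0 R e1 (act A B C ?u)" "near_id p0 R e1 (act A B C (rev ?u))"
    "near_id p0 R e2 (act A B C ?v)" "near_id p0 R e2 (act A B C (rev ?v))"
    using ge2 near_id_mono[OF _ Rle order_refl] unfolding R_def e1_def e2_def by blast+
  have \<tau>: "\<tau> > 0" using \<open>r > 0\<close> by (simp add: \<tau>_def)
  have e: "e1 \<ge> 0" "e2 \<ge> 0" using \<open>r > 0\<close> by (auto simp: e1_def e2_def)
  have small: "2 * e1 + 2 * e2 \<le> \<tau>"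
  proof -
    have "2 * e1 + 2 * e2 = (r / 400) / 2 ^ n / 2 ^ n" by (simp add: e1_def e2_def four)
    also have "\<dots> \<le> (r / 400) / 2 ^ n / 1" using \<open>r > 0\<close> p by (intro divide_left_mono) auto
    also have "\<dots> \<le> \<tau>" using \<open>r > 0\<close> by (simp add: \<tau>_def power_add field_simps)
    finally show ?thesis .
  qed
  have rad: "R - 2 * \<tau> = r / 2 * (1 + 1 / 2 ^ Suc (Suc n))"
    by (simp add: R_def \<tau>_def power_add field_simps)
  have eps: "12 * e1 * e2 / \<tau> \<le> r / 1000 / 4 ^ Suc (Suc n)"
  proof -
    have "12 * e1 * e2 / \<tau> = (r * 48 / 1000000) / (4 ^ n * 2 ^ n)"
      using \<open>r > 0\<close> by (simp add: e1_def e2_def \<tau>_def power_add four field_simps)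
    also have "\<dots> \<le> (r * 48 / 1000000) / (4 ^ n * 1)"
      using \<open>r > 0\<close> p by (intro divide_left_mono mult_left_mono) auto
    also have "\<dots> \<le> r / 1000 / 4 ^ Suc (Suc n)" using \<open>r > 0\<close> by (simp add: field_simps)
    finally show ?thesis .
  qed
  have "near_id p0 (R - 2 * \<tau>) (12 * e1 * e2 / \<tau>)
      (\<lambda>p. act A B C ?u (act A B C ?v (act A B C (rev ?u) (act A B C (rev ?v) p))))"
    by (rule near_id_commutator) (use near \<tau> e small holo_curve_act in auto)
  moreover have "near_id p0 (R - 2 * \<tau>) (12 * e2 * e1 / \<tau>)
      (\<lambda>p. act A B C ?v (act A B C ?u (act A B C (rev ?v) (act A B C (rev ?u) p))))"
    by (rule near_id_commutator) (use near \<tau> e small holo_curve_act in auto)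
  ultimately have "near_id p0 (R - 2 * \<tau>) (12 * e1 * e2 / \<tau>) (act A B C (comm_word m (Suc (Suc n))))"
    "near_id p0 (R - 2 * \<tau>) (12 * e1 * e2 / \<tau>) (act A B C (rev (comm_word m (Suc (Suc n)))))"
    by (simp_all add: near_id_def mult_ac)
  then show ?case using near_id_mono[OF _ order_refl eps] unfolding rad by blast
qed

lemma comm_word_lipschitz:
  assumes "r > 0"
    and near: "near_id p0 (r / 2) (r / 1000 / 4 ^ n) (act A B C w)"
    and "p \<in> ball p0 (r / 4)" "q \<in> ball p0 (r / 4)"
  shows "norm ((act A B C w p - p) - (act A B C w q - q)) \<le> 1 / 4 ^ n * norm (p - q)"
proof -
  have "norm ((act A B C w p - p) - (act A B C w q - q)) \<le> 6 * (r / 1000 / 4 ^ n) / (r / 4) * norm (p - q)"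
    using assms by (intro near_id_lipschitz[OF _ near]) (auto intro: holo_curve_act)
  also have "\<dots> \<le> 1 / 4 ^ n * norm (p - q)"
    using \<open>r > 0\<close> by (intro mult_right_mono) (auto simp: field_simps)
  finally show ?thesis .
qed

section \<open>The base points\<close>

primrec drefl :: "real \<Rightarrow> real \<Rightarrow> letter \<Rightarrow> complex3 \<Rightarrow> complex3" where
  "drefl a b LX = (\<lambda>(X, Y, Z). (- X - b * Z - b * Y, Y, Z))"
| "drefl a b LY = (\<lambda>(X, Y, Z). (X, - Y - a * Z - b * X, Z))"
| "drefl a b LZ = (\<lambda>(X, Y, Z). (X, Y, - Z - a * Y - b * X))"

primrec dact :: "real \<Rightarrow> real \<Rightarrow> letter list \<Rightarrow> complex3 \<Rightarrow> complex3" where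
  "dact a b [] = id"
| "dact a b (l # w) = drefl a b l \<circ> dact a b w"

lemma drefl_drefl [simp]: "drefl a b l (drefl a b l v) = v"
  by (cases l; cases v) simp_all

lemma dact_append [simp]: "dact a b (u @ v) = dact a b u \<circ> dact a b v"
  by (induction u) (simp_all add: comp_assoc)

lemma dact_rev_dact [simp]: "dact a b (rev w) (dact a b w v) = v"
  by (induction w arbitrary: v) simp_all

lemma dact_dact_rev [simp]: "dact a b w (dact a b (rev w) v) = v"
  using dact_rev_dact[of a b "rev w"] by simp

lemma dact_diff: "dact a b w (u - v) = dact a b w u - dact a b w v"
proof (induction w)
  case (Cons l w)
  have "drefl a b l (u - v) = drefl a b l u - drefl a b l v" for u v
    by (cases l; cases u; cases v) (simp_all add: algebra_simps)
  with Cons show ?case by simp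
qed simp

lemma dact_add: "dact a b w (u + v) = dact a b w u + dact a b w v"
proof (induction w)
  case (Cons l w)
  have "drefl a b l (u + v) = drefl a b l u + drefl a b l v" for u v
    by (cases l; cases u; cases v) (simp_all add: algebra_simps)
  with Cons show ?case by simp
qed simp

lemma dact_cscale: "dact a b w (cscale s v) = cscale s (dact a b w v)"
proof (induction w)
  case (Cons l w)
  have "drefl a b l (cscale s v) = cscale s (drefl a b l v)" for v
    by (cases l; cases v) (simp_all add: cscale_def algebra_simps)
  with Cons show ?case by simp
qed simp

definition base_point :: "real \<Rightarrow> real \<Rightarrow> complex3" where
  "base_point a b = (of_real a, of_real b, of_real b)"

text \<open>The parameters are forced by the requirement that (a, b, b) be fixed by every
  involution, that is 2x + yz = A and its cyclic analogues. The derivative of a word at this point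
  is then the product of the linear parts of its letters.\<close>

abbreviation base_act :: "real \<Rightarrow> real \<Rightarrow> letter list \<Rightarrow> complex3 \<Rightarrow> complex3" where
  "base_act a b \<equiv> act (of_real (2 * a + b\<^sup>2)) (of_real (2 * b + a * b)) (of_real (2 * b + a * b))"

lemma base_act_fixed [simp]: "base_act a b w (base_point a b) = base_point a b"
proof (induction w)
  case (Cons l w)
  then show ?case
    by (cases l) (simp_all add: base_point_def s_x_def s_y_def s_z_def algebra_simps power2_eq_square)
qed simp

lemma base_act_has_derivative: "(base_act a b w has_derivative dact a b w) (at (base_point a b))"
proof (induction w)
  case Nil
  show ?case by (simp add: id_def)
next
  case (Cons l w)
  have "(base_act a b [l] has_derivative drefl a b l) (at (base_point a b))"
    by (cases l) (auto simp: base_point_def s_x_def s_y_def s_z_def o_def split_beta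
        intro!: derivative_eq_intros ext)
  then have "(base_act a b [l] has_derivative drefl a b l) (at (base_act a b w (base_point a b)))"
    by (simp only: base_act_fixed)
  from has_derivative_compose[OF Cons this] show ?case by (simp add: o_def)
qed

text \<open>A Hermitian form invariant under the linear parts of \<open>s_y\<close> and \<open>s_z\<close>; it is positive definite
  because \<open>\<bar>a\<bar> < 2\<close>. The shift by \<open>b / (2 + a) * X\<close> moves the origin to the centre of the conic in
  the fibre.\<close>

definition herm :: "real \<Rightarrow> real \<Rightarrow> complex3 \<Rightarrow> real" where
  "herm a b v = (let X = fst v; Y = fst (snd v) + of_real (b / (2 + a)) * X; Z = snd (snd v) + of_real (b / (2 + a)) * X
     in (norm X)\<^sup>2 + (norm Y)\<^sup>2 + (norm Z)\<^sup>2 + a * Re (Y * cnj Z))"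

lemma herm_drefl:
  assumes "\<bar>a\<bar> < 2" "l = LY \<or> l = LZ"
  shows "herm a b (drefl a b l v) = herm a b v"
proof -
  have key: "(norm (- Y - of_real a * Z))\<^sup>2 + a * Re ((- Y - of_real a * Z) * cnj Z) = (norm Y)\<^sup>2 + a * Re (Y * cnj Z)"
    for Y Z :: complex
    unfolding cmod_power2 by (simp add: power2_eq_square algebra_simps)
  obtain X Y Z where v: "v = (X, Y, Z)" by (cases v)
  define k where "k = complex_of_real (b / (2 + a))"
  have "(2 + a) * (b / (2 + a)) = b" using assms(1) by (simp add: field_simps)
  then have k: "of_real b = (2 + of_real a) * k"
    unfolding k_def by (metis of_real_add of_real_mult of_real_numeral)
  have 1: "- Y - of_real a * Z - of_real b * X + k * X = - (Y + k * X) - of_real a * (Z + k * X)"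
    "- Z - of_real a * Y - of_real b * X + k * X = - (Z + k * X) - of_real a * (Y + k * X)"
    unfolding k by (simp_all add: algebra_simps)
  have 2: "Re (U * cnj W) = Re (W * cnj U)" for U W by (simp add: algebra_simps)
  from assms(2) show ?thesis
  proof
    assume l: "l = LY"
    show ?thesis
      unfolding v l herm_def drefl.simps prod.case Let_def fst_conv snd_conv k_def[symmetric] 1
      using key[of "Y + k * X" "Z + k * X"] by linarith
  next
    assume l: "l = LZ"
    show ?thesis
      unfolding v l herm_def drefl.simps prod.case Let_def fst_conv snd_conv k_def[symmetric] 1
      using key[of "Z + k * X" "Y + k * X"] unfolding 2[of "Y + k * X"] by linarith
  qed
qed

lemma herm_dact:
  assumes "\<bar>a\<bar> < 2" "set w \<subseteq> {LY, LZ}"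
  shows "herm a b (dact a b w v) = herm a b v"
  using assms(2) by (induction w) (auto simp: herm_drefl[OF assms(1)])

lemma herm_lower:
  assumes "\<bar>a\<bar> < 2"
  obtains c where "c > 0" "\<And>v. (norm v)\<^sup>2 \<le> c * herm a b v"
proof -
  define k where "k = b / (2 + a)"
  \<comment> \<open>The smallest eigenvalue of the form |Y|^2 + |Z|^2 + a Re(Y cnj Z), positive
    because of \<open>\<bar>a\<bar> < 2\<close>.\<close>
  define d where "d = 1 - \<bar>a\<bar> / 2"
  have d: "0 < d" "d \<le> 1" using assms by (auto simp: d_def)
  define c where "c = (2 + 4 * k\<^sup>2) / d"
  have "(norm v)\<^sup>2 \<le> c * herm a b v" for v :: complex3
  proof -
    obtain X Y Z where v: "v = (X, Y, Z)" by (cases v)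
    define U where "U = Y + of_real k * X"
    define W where "W = Z + of_real k * X"
    have sq: "(norm (P - of_real k * X))\<^sup>2 \<le> 2 * (norm P)\<^sup>2 + 2 * k\<^sup>2 * (norm X)\<^sup>2" for P :: complex
    proof -
      have "(norm (P - of_real k * X))\<^sup>2 \<le> (norm P + norm (of_real k * X))\<^sup>2"
        by (intro power_mono norm_triangle_ineq4) auto
      also have "\<dots> \<le> 2 * (norm P)\<^sup>2 + 2 * (norm (of_real k * X))\<^sup>2"
        using zero_le_power2[of "norm P - norm (of_real k * X)"] by (simp add: power2_eq_square algebra_simps)
      finally show ?thesis by (simp add: norm_mult power_mult_distrib)
    qed
    have "(norm v)\<^sup>2 = (norm X)\<^sup>2 + (norm (U - of_real k * X))\<^sup>2 + (norm (W - of_real k * X))\<^sup>2"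
      by (simp add: v norm_Pair U_def W_def)
    also have "\<dots> \<le> (norm X)\<^sup>2 + (2 * (norm U)\<^sup>2 + 2 * k\<^sup>2 * (norm X)\<^sup>2) + (2 * (norm W)\<^sup>2 + 2 * k\<^sup>2 * (norm X)\<^sup>2)"
      using sq[of U] sq[of W] by linarith
    also have "\<dots> \<le> (2 + 4 * k\<^sup>2) * ((norm X)\<^sup>2 + (norm U)\<^sup>2 + (norm W)\<^sup>2)"
      by (simp add: algebra_simps)
    also have "(norm X)\<^sup>2 + (norm U)\<^sup>2 + (norm W)\<^sup>2 \<le> herm a b v / d"
    proof -
      have "\<bar>Re (U * cnj W)\<bar> \<le> norm U * norm W" using abs_Re_le_cmod[of "U * cnj W"] by (simp add: norm_mult)
      also have "\<dots> \<le> ((norm U)\<^sup>2 + (norm W)\<^sup>2) / 2"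
        using zero_le_power2[of "norm U - norm W"] by (simp add: power2_eq_square algebra_simps)
      finally have "\<bar>a\<bar> * \<bar>Re (U * cnj W)\<bar> \<le> \<bar>a\<bar> * (((norm U)\<^sup>2 + (norm W)\<^sup>2) / 2)"
        by (intro mult_left_mono) auto
      moreover have "- (a * Re (U * cnj W)) \<le> \<bar>a\<bar> * \<bar>Re (U * cnj W)\<bar>"
        by (metis abs_ge_minus_self abs_mult)
      ultimately have "- (a * Re (U * cnj W)) \<le> (1 - d) * ((norm U)\<^sup>2 + (norm W)\<^sup>2)"
        by (simp add: d_def)
      moreover have "d * (norm X)\<^sup>2 \<le> 1 * (norm X)\<^sup>2" using d by (intro mult_right_mono) auto
      moreover have "herm a b v = (norm X)\<^sup>2 + (norm U)\<^sup>2 + (norm W)\<^sup>2 + a * Re (U * cnj W)"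
        by (simp only: v herm_def U_def W_def k_def Let_def fst_conv snd_conv)
      ultimately have "d * ((norm X)\<^sup>2 + (norm U)\<^sup>2 + (norm W)\<^sup>2) \<le> herm a b v"
        by (simp add: algebra_simps)
      then show ?thesis using d by (simp add: field_simps)
    qed
    then have "(2 + 4 * k\<^sup>2) * ((norm X)\<^sup>2 + (norm U)\<^sup>2 + (norm W)\<^sup>2) \<le> (2 + 4 * k\<^sup>2) * (herm a b v / d)"
      by (intro mult_left_mono) auto
    finally show ?thesis by (simp add: c_def)
  qed
  moreover have "c > 0" using d by (auto simp: c_def intro!: divide_pos_pos add_pos_nonneg)
  ultimately show ?thesis using that by blast
qed

lemma herm_uminus: "herm a b (- v) = herm a b v"
proof -
  have "- y + c * - x = - (y + c * x)" for x y c :: complex by simp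
  then show ?thesis
    by (simp only: herm_def Let_def fst_uminus snd_uminus norm_minus_cancel complex_cnj_minus minus_mult_minus)
qed

lemma herm_upper: "\<exists>c>0. \<forall>v. herm a b v \<le> c * (norm v)\<^sup>2"
proof (intro exI conjI allI)
  define k where "k = b / (2 + a)"
  define c where "c = 1 + 2 * (1 + \<bar>k\<bar>)\<^sup>2 + \<bar>a\<bar> * (1 + \<bar>k\<bar>)\<^sup>2"
  show "0 < c" by (auto simp: c_def intro!: add_pos_nonneg)
  fix v :: complex3
  obtain X Y Z where v: "v = (X, Y, Z)" by (cases v)
  define U where "U = Y + of_real k * X"
  define W where "W = Z + of_real k * X"
  have X: "norm X \<le> norm v" "norm Y \<le> norm v" "norm Z \<le> norm v" using norm_coord_le[of v] by (auto simp: v)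
  have bound: "norm (P + of_real k * X) \<le> (1 + \<bar>k\<bar>) * norm v" if "norm P \<le> norm v" for P
  proof -
    have "norm (P + of_real k * X) \<le> norm P + \<bar>k\<bar> * norm X"
      by (rule order_trans[OF norm_triangle_ineq]) (simp add: norm_mult)
    also have "\<dots> \<le> norm v + \<bar>k\<bar> * norm v" by (intro add_mono that mult_left_mono X) auto
    finally show ?thesis by (simp add: algebra_simps)
  qed
  have UW: "norm U \<le> (1 + \<bar>k\<bar>) * norm v" "norm W \<le> (1 + \<bar>k\<bar>) * norm v"
    unfolding U_def W_def by (intro bound X)+
  have "a * Re (U * cnj W) \<le> \<bar>a\<bar> * \<bar>Re (U * cnj W)\<bar>" by (metis abs_ge_self abs_mult)
  also have "\<dots> \<le> \<bar>a\<bar> * (norm U * norm W)"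
    using abs_Re_le_cmod[of "U * cnj W"] by (intro mult_left_mono) (auto simp: norm_mult)
  also have "\<dots> \<le> \<bar>a\<bar> * (((1 + \<bar>k\<bar>) * norm v) * ((1 + \<bar>k\<bar>) * norm v))"
    using UW by (intro mult_left_mono mult_mono) auto
  finally have 1: "a * Re (U * cnj W) \<le> \<bar>a\<bar> * (1 + \<bar>k\<bar>)\<^sup>2 * (norm v)\<^sup>2"
    by (simp add: power2_eq_square mult_ac)
  have 2: "(norm U)\<^sup>2 \<le> (1 + \<bar>k\<bar>)\<^sup>2 * (norm v)\<^sup>2" "(norm W)\<^sup>2 \<le> (1 + \<bar>k\<bar>)\<^sup>2 * (norm v)\<^sup>2"
    using power_mono[OF UW(1), of 2] power_mono[OF UW(2), of 2] by (auto simp: power_mult_distrib)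
  have 3: "(norm X)\<^sup>2 \<le> (norm v)\<^sup>2" using X by (intro power_mono) auto
  have "herm a b v = (norm X)\<^sup>2 + (norm U)\<^sup>2 + (norm W)\<^sup>2 + a * Re (U * cnj W)"
    by (simp only: v herm_def U_def W_def k_def Let_def fst_conv snd_conv)
  also have "\<dots> \<le> c * (norm v)\<^sup>2" using 1 2 3 unfolding c_def by (simp only: distrib_right mult_1)
  finally show "herm a b v \<le> c * (norm v)\<^sup>2" .
qed

lemma continuous_herm: "continuous_on UNIV (herm a b)"
  unfolding herm_def Let_def by (intro continuous_intros)

text \<open>The powers of the linear part of \<open>g_x\<close> preserve the definite form
  \<open>herm\<close> and stay in a compact set. Two powers close to each other differ by a power
  close to the identity, again by invariance of the form.\<close>

lemma dact_recurrent:
  assumes a: "\<bar>a\<bar> < 2" and "\<delta> > 0"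
  obtains m where "m \<ge> 1" "\<And>v. norm (dact a b (comm_word m 0) v - v) \<le> \<delta> * norm v"
    "\<And>v. norm (dact a b (rev (comm_word m 0)) v - v) \<le> \<delta> * norm v"
proof -
  obtain c where c: "c > 0" "\<And>v. (norm v)\<^sup>2 \<le> c * herm a b v" using herm_lower[OF a] by blast
  define k where "k = - b / (2 + a)"
  define w where "w n = concat (replicate n [LZ, LY])" for n
  have letters: "set (w n) \<subseteq> {LY, LZ}" "set (rev (w n)) \<subseteq> {LY, LZ}" for n
    by (induction n) (auto simp: w_def)
  have w_add: "w (i + j) = w i @ w j" for i j
    by (simp add: w_def replicate_add)
  define e2 e3 where "e2 = ((0, 1, 0) :: complex3)" and "e3 = ((0, 0, 1) :: complex3)"
  have bounded: "norm (dact a b (w n) e) \<le> sqrt (c * herm a b e)" for n e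
    using c(2)[of "dact a b (w n) e"] herm_dact[OF a letters(1)] by (simp add: real_le_rsqrt)
  define T where "T n = (dact a b (w n) e2, dact a b (w n) e3)" for n
  have "range T \<subseteq> cball 0 (sqrt (c * herm a b e2)) \<times> cball 0 (sqrt (c * herm a b e3))"
    unfolding T_def using bounded by (simp only: image_subset_iff mem_Times_iff fst_conv snd_conv mem_cball_0 simp_thms ball_UNIV)
  moreover have "compact (cball (0::complex3) (sqrt (c * herm a b e2)) \<times> cball (0::complex3) (sqrt (c * herm a b e3)))"
    by (intro compact_Times) auto
  ultimately obtain l r where lr: "strict_mono r" "(T \<circ> r) \<longlonglongrightarrow> l"
    unfolding compact_def by (metis UNIV_I image_subset_iff)
  have lim: "(\<lambda>n. sqrt (c * herm a b (d (T (r (Suc n))) - d (T (r n))))) \<longlonglongrightarrow> 0"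
    if "continuous_on UNIV d" for d :: "complex3 \<times> complex3 \<Rightarrow> complex3"
  proof -
    have "(\<lambda>n. d (T (r n))) \<longlonglongrightarrow> d l"
      using lr(2) that by (auto intro!: continuous_on_tendsto_compose[OF that] simp: o_def)
    then have "(\<lambda>n. d (T (r (Suc n))) - d (T (r n))) \<longlonglongrightarrow> d l - d l"
      by (intro tendsto_diff LIMSEQ_Suc)
    then have "(\<lambda>n. herm a b (d (T (r (Suc n))) - d (T (r n)))) \<longlonglongrightarrow> herm a b (d l - d l)"
      by (intro continuous_on_tendsto_compose[OF continuous_herm]) auto
    moreover have "herm a b 0 = 0" by (simp add: herm_def)
    ultimately show ?thesis by (auto intro!: tendsto_eq_intros)
  qed
  obtain c' where c': "c' > 0" "\<And>v. herm a b v \<le> c' * (norm v)\<^sup>2" using herm_upper by blast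
  \<comment> \<open>The denominator covers two losses: \<open>2 * (1 + \<bar>k\<bar>)\<close> for
    passing from \<open>e2\<close> and \<open>e3\<close> to all vectors, and
    \<open>sqrt (c * c')\<close> for comparing the norm with the form in the estimate of the
    inverse.\<close>
  define \<delta>' where "\<delta>' = \<delta> / (2 * (1 + \<bar>k\<bar>) * (1 + sqrt (c * c')))"
  have pos: "sqrt (c * c') \<ge> 0" using c c' by auto
  have \<delta>': "\<delta>' > 0" using \<open>\<delta> > 0\<close> pos by (auto simp: \<delta>'_def intro!: divide_pos_pos mult_pos_pos add_pos_nonneg)
  have "\<forall>\<^sub>F n in sequentially. sqrt (c * herm a b (fst (T (r (Suc n))) - fst (T (r n)))) < \<delta>' \<and>
      sqrt (c * herm a b (snd (T (r (Suc n))) - snd (T (r n)))) < \<delta>'"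
    by (intro eventually_conj order_tendstoD(2)[OF lim \<delta>'] continuous_intros)
  then obtain n where n: "sqrt (c * herm a b (fst (T (r (Suc n))) - fst (T (r n)))) < \<delta>'"
      "sqrt (c * herm a b (snd (T (r (Suc n))) - snd (T (r n)))) < \<delta>'"
    by (auto simp: eventually_sequentially)
  define m where "m = r (Suc n) - r n"
  have "r n < r (Suc n)" using lr(1) by (simp add: strict_mono_def)
  then have m: "m \<ge> 1" "r (Suc n) = r n + m" by (auto simp: m_def)
  have step: "norm (dact a b (w m) e - e) < \<delta>'"
    if "sqrt (c * herm a b (dact a b (w (r (Suc n))) e - dact a b (w (r n)) e)) < \<delta>'" for e
  proof -
    have "dact a b (w (r (Suc n))) e - dact a b (w (r n)) e = dact a b (w (r n)) (dact a b (w m) e - e)"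
      by (simp add: m w_add dact_diff)
    then have "sqrt (c * herm a b (dact a b (w m) e - e)) < \<delta>'"
      using that herm_dact[OF a letters(1)] by simp
    moreover have "norm (dact a b (w m) e - e) \<le> sqrt (c * herm a b (dact a b (w m) e - e))"
      using c(2) by (simp add: real_le_rsqrt)
    ultimately show ?thesis by simp
  qed
  have e2: "norm (dact a b (w m) e2 - e2) < \<delta>'" and e3: "norm (dact a b (w m) e3 - e3) < \<delta>'"
    using n by (auto intro!: step simp: T_def)
  \<comment> \<open>A vector fixed by both linear parts, since \<open>k\<close> solves 2k + ak + b =
    0. It completes \<open>e2\<close> and \<open>e3\<close> to a basis, so recurrence has to be
    established for these two only.\<close>
  define e1 :: complex3 where "e1 = (1, of_real k, of_real k)"
  have "2 + a \<noteq> 0" using a by auto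
  then have "(2 + a) * k = - b" by (simp add: k_def)
  then have "2 * k + a * k + b = 0" by (simp add: algebra_simps)
  then have "of_real (2 * k + a * k + b) = (0 :: complex)" by simp
  then have k0: "2 * of_real k + of_real a * of_real k + of_real b = (0 :: complex)" by simp
  have "drefl a b LY e1 = e1" "drefl a b LZ e1 = e1"
    using k0 by (simp_all add: e1_def algebra_simps eq_neg_iff_add_eq_0)
  then have "dact a b (w j) e1 = e1" for j
    by (induction j) (simp_all add: w_def del: drefl.simps)
  note e1 = this
  define K where "K = 2 * (1 + \<bar>k\<bar>) * \<delta>'"
  have fwd: "norm (dact a b (w m) v - v) \<le> K * norm v" for v
  proof -
    obtain X Y Z where v: "v = (X, Y, Z)" by (cases v)
    define U where "U = Y - of_real k * X"
    define W where "W = Z - of_real k * X"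
    have "v = cscale X e1 + cscale U e2 + cscale W e3"
      by (simp add: v cscale_def e1_def e2_def e3_def U_def W_def)
    then have "dact a b (w m) v - v = cscale U (dact a b (w m) e2 - e2) + cscale W (dact a b (w m) e3 - e3)"
      by (simp add: dact_add dact_cscale e1) (simp add: cscale_def algebra_simps)
    then have "norm (dact a b (w m) v - v) \<le> norm U * norm (dact a b (w m) e2 - e2) + norm W * norm (dact a b (w m) e3 - e3)"
      by (metis norm_cscale norm_triangle_ineq)
    also have "\<dots> \<le> norm U * \<delta>' + norm W * \<delta>'" using e2 e3 by (intro add_mono mult_left_mono) auto
    also have "\<dots> = (norm U + norm W) * \<delta>'" by (simp add: algebra_simps)
    also have "\<dots> \<le> (2 * (1 + \<bar>k\<bar>) * norm v) * \<delta>'"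
    proof (intro mult_right_mono)
      have X: "norm X \<le> norm v" "norm Y \<le> norm v" "norm Z \<le> norm v" using norm_coord_le[of v] by (auto simp: v)
      have "norm (P - of_real k * X) \<le> norm v + \<bar>k\<bar> * norm v" if "norm P \<le> norm v" for P
      proof -
        have "norm (P - of_real k * X) \<le> norm P + \<bar>k\<bar> * norm X"
          by (rule order_trans[OF norm_triangle_ineq4]) (simp add: norm_mult)
        also have "\<dots> \<le> norm v + \<bar>k\<bar> * norm v" by (intro add_mono that mult_left_mono X) auto
        finally show ?thesis .
      qed
      from this[OF X(2)] this[OF X(3)] show "norm U + norm W \<le> 2 * (1 + \<bar>k\<bar>) * norm v"
        by (simp add: U_def W_def algebra_simps)
    qed (use \<delta>' in auto)
    finally show ?thesis by (simp add: K_def mult_ac)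
  qed
  have K: "K \<ge> 0" using \<delta>' by (simp add: K_def)
  have Kle: "K \<le> \<delta>" "sqrt (c * c') * K \<le> \<delta>"
  proof -
    have "K * (1 + sqrt (c * c')) = \<delta>" using pos by (simp add: K_def \<delta>'_def field_simps add_nonneg_eq_0_iff)
    moreover have "0 \<le> K * sqrt (c * c')" using K pos by simp
    ultimately show "K \<le> \<delta>" "sqrt (c * c') * K \<le> \<delta>" using K by (simp_all add: algebra_simps)
  qed
  \<comment> \<open>Applying the isometry of the word \<open>w m\<close> turns the displacement of
    the inverse into minus the displacement of \<open>w m\<close>, so the forward estimate is
    reused.\<close>
  have bwd: "norm (dact a b (rev (w m)) v - v) \<le> sqrt (c * c') * K * norm v" for v
  proof -
    have "(norm (dact a b (rev (w m)) v - v))\<^sup>2 \<le> c * herm a b (dact a b (w m) (dact a b (rev (w m)) v - v))"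
      using c(2) herm_dact[OF a letters(1)] by simp
    also have "dact a b (w m) (dact a b (rev (w m)) v - v) = - (dact a b (w m) v - v)" by (simp add: dact_diff)
    also have "c * herm a b \<dots> \<le> c * (c' * (norm (dact a b (w m) v - v))\<^sup>2)"
      unfolding herm_uminus using c(1) c'(2) by (intro mult_left_mono) auto
    also have "\<dots> \<le> c * (c' * (K * norm v)\<^sup>2)"
      using c c' fwd by (intro mult_left_mono power_mono) auto
    also have "\<dots> = (sqrt (c * c') * K * norm v)\<^sup>2" using c c' by (simp add: power_mult_distrib)
    finally show ?thesis using K pos by (simp add: power2_le_iff_abs_le abs_mult)
  qed
  show ?thesis
  proof (rule that[of m])
    show "m \<ge> 1" by fact
    show "norm (dact a b (comm_word m 0) v - v) \<le> \<delta> * norm v" for v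
      using order_trans[OF fwd mult_right_mono[OF Kle(1)]] by (simp add: w_def)
    show "norm (dact a b (rev (comm_word m 0)) v - v) \<le> \<delta> * norm v" for v
      using order_trans[OF bwd mult_right_mono[OF Kle(2)]] by (simp add: w_def)
  qed
qed

section \<open>From linear parts to words near the base point and nearby parameters\<close>

lemma derivative_near_id:
  assumes "(f has_derivative f') (at p0)" "f p0 = p0" "\<And>v. norm (f' v - v) \<le> \<delta> * norm v" "\<delta> > 0"
  obtains r where "r > 0" "\<And>p s. s \<le> r \<Longrightarrow> p \<in> cball p0 s \<Longrightarrow> norm (f p - p) \<le> 2 * \<delta> * s"
proof -
  obtain d where d: "d > 0" "\<And>p. norm (p - p0) < d \<Longrightarrow> norm (f p - f p0 - f' (p - p0)) \<le> \<delta> * norm (p - p0)"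
    using assms(1,4) unfolding has_derivative_at_alt by blast
  show ?thesis
  proof (rule that[of "d / 2"])
    fix p s assume s: "s \<le> d / 2" "p \<in> cball p0 s"
    then have p: "norm (p - p0) \<le> s" by (simp add: dist_norm norm_minus_commute)
    then have "norm (f p - f p0 - f' (p - p0)) \<le> \<delta> * norm (p - p0)" using s d by (intro d(2)) auto
    moreover have "norm (f p - p) \<le> norm (f p - f p0 - f' (p - p0)) + norm (f' (p - p0) - (p - p0))"
      using norm_triangle_ineq[of "f p - f p0 - f' (p - p0)" "f' (p - p0) - (p - p0)"] assms(2) by simp
    ultimately have "norm (f p - p) \<le> \<delta> * norm (p - p0) + \<delta> * norm (p - p0)"
      using assms(3)[of "p - p0"] by linarith
    also have "\<dots> \<le> 2 * \<delta> * s" using p assms(4) by simp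
    finally show "norm (f p - p) \<le> 2 * \<delta> * s" .
  qed (use d in auto)
qed

lemma base_near_id:
  assumes a: "\<bar>a\<bar> < 2" and "\<delta> > 0"
  obtains m r where "m \<ge> 1" "r > 0"
    "\<And>w p. w \<in> {comm_word m 0, rev (comm_word m 0), comm_word m 1, rev (comm_word m 1)} \<Longrightarrow>
       p \<in> cball (base_point a b) r \<Longrightarrow> norm (base_act a b w p - p) \<le> \<delta> * r"
proof -
  have "bounded_linear (dact a b [LX])" by (rule has_derivative_bounded_linear[OF base_act_has_derivative])
  then obtain M where M: "M > 0" "\<And>v. norm (dact a b [LX] v) \<le> norm v * M"
    using bounded_linear.pos_bounded by blast
  \<comment> \<open>Conjugation by \<open>s_x\<close> can enlarge a relative displacement by the
    factor \<open>M * M\<close>; the denominator absorbs it.\<close>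
  define \<delta>1 where "\<delta>1 = \<delta> / 2 / (1 + M * M)"
  have MM: "1 + M * M > 0" using M(1) by (auto intro: add_pos_pos)
  have "\<delta>1 > 0" using \<open>\<delta> > 0\<close> MM by (simp add: \<delta>1_def)
  moreover have "\<delta>1 * (1 + M * M) = \<delta> / 2"
    unfolding \<delta>1_def using MM by (metis nonzero_eq_divide_eq less_irrefl)
  then have "\<delta>1 + M * M * \<delta>1 = \<delta> / 2" by (simp add: algebra_simps)
  moreover have "M * M * \<delta>1 \<ge> 0" using \<open>\<delta>1 > 0\<close> M by simp
  ultimately have \<delta>1: "\<delta>1 > 0" "\<delta>1 \<le> \<delta> / 2" "M * M * \<delta>1 \<le> \<delta> / 2" by linarith+
  obtain m where m: "m \<ge> 1" "\<And>v. norm (dact a b (comm_word m 0) v - v) \<le> \<delta>1 * norm v"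
    "\<And>v. norm (dact a b (rev (comm_word m 0)) v - v) \<le> \<delta>1 * norm v"
    using dact_recurrent[OF a \<delta>1(1)] by metis
  have conj: "norm (dact a b (LX # w @ [LX]) v - v) \<le> \<delta> / 2 * norm v"
    if "\<And>v. norm (dact a b w v - v) \<le> \<delta>1 * norm v" for w v
  proof -
    define u where "u = dact a b [LX] v"
    have "dact a b (LX # w @ [LX]) v - v = dact a b [LX] (dact a b w u) - dact a b [LX] u"
      by (simp add: u_def del: drefl.simps)
    also have "\<dots> = dact a b [LX] (dact a b w u - u)" by (simp only: dact_diff)
    also have "norm \<dots> \<le> norm (dact a b w u - u) * M" by (rule M)
    also have "\<dots> \<le> (\<delta>1 * (norm v * M)) * M"
    proof (intro mult_right_mono)
      have "norm (dact a b w u - u) \<le> \<delta>1 * norm u" by (rule that)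
      also have "\<dots> \<le> \<delta>1 * (norm v * M)" using \<delta>1 M unfolding u_def by (intro mult_left_mono) auto
      finally show "norm (dact a b w u - u) \<le> \<delta>1 * (norm v * M)" .
    qed (use M in auto)
    also have "\<dots> = (M * M * \<delta>1) * norm v" by (simp add: mult_ac)
    also have "\<dots> \<le> \<delta> / 2 * norm v" using \<delta>1 by (intro mult_right_mono) auto
    finally show ?thesis .
  qed
  let ?W = "{comm_word m 0, rev (comm_word m 0), comm_word m 1, rev (comm_word m 1)}"
  have "\<forall>w\<in>?W. \<forall>v. norm (dact a b w v - v) \<le> \<delta> / 2 * norm v"
  proof -
    have "norm (dact a b (comm_word m 0) v - v) \<le> \<delta> / 2 * norm v" "norm (dact a b (rev (comm_word m 0)) v - v) \<le> \<delta> / 2 * norm v" for v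
      using order_trans[OF m(2) mult_right_mono[OF \<delta>1(2)]] order_trans[OF m(3) mult_right_mono[OF \<delta>1(2)]] by auto
    moreover have "norm (dact a b (comm_word m 1) v - v) \<le> \<delta> / 2 * norm v" "norm (dact a b (rev (comm_word m 1)) v - v) \<le> \<delta> / 2 * norm v" for v
      using conj[OF m(2)] conj[OF m(3)] by (simp_all del: dact.simps dact_append)
    ultimately show ?thesis by blast
  qed
  then have "\<forall>w\<in>?W. \<exists>r>0. \<forall>s\<le>r. \<forall>p\<in>cball (base_point a b) s. norm (base_act a b w p - p) \<le> 2 * (\<delta> / 2) * s"
    using derivative_near_id[OF base_act_has_derivative base_act_fixed, of a b _ "\<delta> / 2"] \<open>\<delta> > 0\<close>
    by (metis half_gt_zero)
  then obtain r where r: "\<And>w. w \<in> ?W \<Longrightarrow> r w > 0"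
    "\<And>w s p. w \<in> ?W \<Longrightarrow> s \<le> r w \<Longrightarrow> p \<in> cball (base_point a b) s \<Longrightarrow> norm (base_act a b w p - p) \<le> 2 * (\<delta> / 2) * s"
    by metis
  define r0 where "r0 = Min (r ` ?W)"
  have "r0 > 0" unfolding r0_def by (subst Min_gr_iff) (use r in auto)
  moreover have "r0 \<le> r w" if "w \<in> ?W" for w unfolding r0_def using that by (intro Min_le) auto
  ultimately show ?thesis using that[OF m(1), of r0] r(2)[of _ r0] by auto
qed

text \<open>Compactness of the closed ball makes the word continuous in the parameters uniformly in
  the point; the factor 2 leaves room for the perturbation.\<close>

lemma near_id_params:
  assumes "\<And>p. p \<in> cball p0 r \<Longrightarrow> norm (act A0 B0 C0 w p - p) \<le> \<delta> * r" "\<delta> > 0" "r > 0"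
  obtains X where "open X" "(A0, B0, C0) \<in> X"
    "\<And>A B C. (A, B, C) \<in> X \<Longrightarrow> near_id p0 r (2 * \<delta> * r) (act A B C w)"
proof -
  define \<Phi> where "\<Phi> = (\<lambda>(v :: complex3, p). act (fst v) (fst (snd v)) (snd (snd v)) w p)"
  have "continuous_on (UNIV \<times> cball p0 r) \<Phi>"
    unfolding \<Phi>_def split_beta by (intro continuous_on_act_param continuous_intros)
  then obtain X where X: "(A0, B0, C0) \<in> X" "open X"
    "\<forall>x\<in>X \<inter> UNIV. \<forall>t\<in>cball p0 r. dist (\<Phi> (x, t)) (\<Phi> ((A0, B0, C0), t)) \<le> \<delta> * r"
    using assms by (auto elim!: continuous_on_prod_compactE[of UNIV "cball p0 r" \<Phi> "(A0, B0, C0)" "\<delta> * r"])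
  show ?thesis
  proof (rule that[OF X(2,1)])
    fix A B C assume ABC: "(A, B, C) \<in> X"
    show "near_id p0 r (2 * \<delta> * r) (act A B C w)"
      unfolding near_id_def
    proof
      fix p assume "p \<in> ball p0 r"
      then have p: "p \<in> cball p0 r" by auto
      have "norm (act A B C w p - act A0 B0 C0 w p) \<le> \<delta> * r"
        using X(3) ABC p by (auto simp: \<Phi>_def dist_norm)
      moreover have "norm (act A0 B0 C0 w p - p) \<le> \<delta> * r" by (rule assms(1)[OF p])
      ultimately show "norm (act A B C w p - p) \<le> 2 * \<delta> * r"
        using norm_triangle_ineq[of "act A B C w p - act A0 B0 C0 w p" "act A0 B0 C0 w p - p"] by simp
    qed
  qed
qed

section \<open>Commutators move generic vertices\<close>

text \<open>For \<open>A = B = C = 0\<close>, \<open>D = 4\<close> the surface is the Cayley cubic, on which the group acts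
  linearly in logarithmic coordinates.\<close>

definition cayley :: "real \<times> real \<Rightarrow> complex3" where
  "cayley = (\<lambda>(r, s). (of_real (- 2 * cosh r), of_real (- 2 * cosh s), of_real (- 2 * cosh (r + s))))"

type_synonym mat2 = "real \<times> real \<times> real \<times> real"

definition mmul :: "mat2 \<Rightarrow> mat2 \<Rightarrow> mat2" where
  "mmul = (\<lambda>(a, b, c, d) (p, q, r, s). (a * p + b * r, a * q + b * s, c * p + d * r, c * q + d * s))"

definition mapp :: "mat2 \<Rightarrow> real \<times> real \<Rightarrow> real \<times> real" where
  "mapp = (\<lambda>(a, b, c, d) (r, s). (a * r + b * s, c * r + d * s))"

definition mdet :: "mat2 \<Rightarrow> real" where "mdet = (\<lambda>(a, b, c, d). a * d - b * c)"

definition mtr :: "mat2 \<Rightarrow> real" where "mtr = (\<lambda>(a, b, c, d). a + d)"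

definition madj :: "mat2 \<Rightarrow> mat2" where "madj = (\<lambda>(a, b, c, d). (d, - b, - c, a))"

text \<open>Matrices of the involutions in the coordinates (r, s) of \<open>cayley\<close>, whose
  third logarithm is r + s; they matter there only up to sign, as cosh is even. Each letter has
  determinant -1, so even words lie in SL(2).\<close>

primrec lmat :: "letter list \<Rightarrow> mat2" where
  "lmat [] = (1, 0, 0, 1)"
| "lmat (l # w) = mmul (case l of LX \<Rightarrow> (- 1, - 2, 0, 1) | LY \<Rightarrow> (1, 0, - 2, - 1) | LZ \<Rightarrow> (1, 0, 0, - 1)) (lmat w)"

lemma mmul_assoc: "mmul (mmul M N) P = mmul M (mmul N P)"
  by (cases M; cases N; cases P) (simp add: mmul_def algebra_simps)

lemma mmul_one [simp]: "mmul (1, 0, 0, 1) M = M" "mmul M (1, 0, 0, 1) = M"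
  by (cases M; simp add: mmul_def)+

lemma lmat_append: "lmat (u @ v) = mmul (lmat u) (lmat v)"
  by (induction u) (simp_all add: mmul_assoc)

lemma mapp_mmul: "mapp (mmul M N) v = mapp M (mapp N v)"
  by (cases M; cases N; cases v) (simp add: mmul_def mapp_def algebra_simps)

lemma mdet_mmul: "mdet (mmul M N) = mdet M * mdet N"
  by (cases M; cases N) (simp add: mmul_def mdet_def algebra_simps)

lemma act_cayley: "act 0 0 0 w (cayley v) = cayley (mapp (lmat w) v)"
proof (induction w)
  case Nil
  then show ?case by (cases v) (simp add: mapp_def)
next
  case (Cons l w)
  obtain r s where rs: "mapp (lmat w) v = (r, s)" by fastforce
  have "refl 0 0 0 l (cayley (r, s)) =
      cayley (mapp (case l of LX \<Rightarrow> (- 1, - 2, 0, 1) | LY \<Rightarrow> (1, 0, - 2, - 1) | LZ \<Rightarrow> (1, 0, 0, - 1)) (r, s))"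
  proof (cases l)
    case LX
    have c1: "cosh (- 1 * r + - 2 * s) = 2 * (cosh s * cosh (r + s)) - cosh r"
      using cosh_add[of "r + s" s] cosh_diff[of "r + s" s] cosh_minus[of "r + 2 * s"] by (simp add: algebra_simps)
    have c2: "cosh (- 1 * r + - 2 * s + (0 * r + 1 * s)) = cosh (r + s)"
      using cosh_minus[of "r + s"] by (simp add: algebra_simps)
    show ?thesis unfolding LX cayley_def mapp_def refl.simps s_x_def prod.case letter.case c1 c2
      by (simp add: algebra_simps)
  next
    case LY
    have c1: "cosh (- 2 * r + - 1 * s) = 2 * (cosh r * cosh (r + s)) - cosh s"
      using cosh_add[of "r + s" r] cosh_diff[of "r + s" r] cosh_minus[of "2 * r + s"] by (simp add: algebra_simps)
    have c2: "cosh (1 * r + 0 * s + (- 2 * r + - 1 * s)) = cosh (r + s)"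
      using cosh_minus[of "r + s"] by (simp add: algebra_simps)
    show ?thesis unfolding LY cayley_def mapp_def refl.simps s_y_def prod.case letter.case c1 c2
      by (simp add: algebra_simps)
  next
    case LZ
    have c1: "cosh (1 * r + 0 * s + (0 * r + - 1 * s)) = 2 * (cosh r * cosh s) - cosh (r + s)"
      using cosh_add[of r s] cosh_diff[of r s] by (simp add: algebra_simps)
    have c2: "cosh (0 * r + - 1 * s) = cosh s" by simp
    show ?thesis unfolding LZ cayley_def mapp_def refl.simps s_z_def prod.case letter.case c1 c2
      by (simp add: algebra_simps)
  qed
  then show ?case using Cons by (simp add: mapp_mmul rs)
qed

lemma madj_mmul: "mdet M = 1 \<Longrightarrow> mmul (madj M) M = (1, 0, 0, 1)"
  by (cases M) (auto simp: mmul_def madj_def mdet_def algebra_simps)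

lemma madj_inverse: "mdet M = 1 \<Longrightarrow> mmul M N = (1, 0, 0, 1) \<Longrightarrow> N = madj M"
proof -
  assume M: "mdet M = 1" "mmul M N = (1, 0, 0, 1)"
  have "N = mmul (mmul (madj M) M) N" by (simp add: madj_mmul[OF M(1)])
  also have "\<dots> = madj M" using M(2) by (simp only: mmul_assoc mmul_one)
  finally show ?thesis .
qed

lemma lmat_rev_inverse: "mmul (lmat w) (lmat (rev w)) = (1, 0, 0, 1)"
proof (induction w)
  case (Cons l w)
  have "lmat (rev (l # w)) = mmul (lmat (rev w)) (lmat [l])" by (simp add: lmat_append del: lmat.simps)
  moreover have "lmat (l # w) = mmul (lmat [l]) (lmat w)" by simp
  ultimately have "mmul (lmat (l # w)) (lmat (rev (l # w))) =
      mmul (lmat [l]) (mmul (mmul (lmat w) (lmat (rev w))) (lmat [l]))"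
    by (simp only: mmul_assoc)
  also have "\<dots> = (1, 0, 0, 1)" unfolding Cons by (cases l) (simp_all add: mmul_def)
  finally show ?case .
qed simp

lemma mdet_lmat: "mdet (lmat w) = (- 1) ^ length w"
proof (induction w)
  case (Cons l w)
  then show ?case by (cases l) (simp_all add: mdet_mmul, simp_all add: mdet_def)
qed (simp add: mdet_def)

lemma lmat_rev: "even (length w) \<Longrightarrow> lmat (rev w) = madj (lmat w)"
  using madj_inverse lmat_rev_inverse mdet_lmat[of w] by simp

text \<open>Fricke's trace identity for a commutator in SL(2), where \<open>madj\<close> is the
  inverse.\<close>

lemma mtr_commutator:
  assumes "mdet c = 1" "mdet a = 1"
  shows "mtr (mmul c (mmul a (mmul (madj c) (madj a)))) =
    (mtr c)\<^sup>2 + (mtr a)\<^sup>2 + (mtr (mmul c a))\<^sup>2 - mtr c * mtr a * mtr (mmul c a) - 2"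
proof -
  obtain p q r s p' q' r' s' where eq: "c = (p, q, r, s)" "a = (p', q', r', s')" by (metis prod.exhaust)
  have "p * s = 1 + q * r" "p' * s' = 1 + q' * r'" using assms by (auto simp: eq mdet_def)
  then show ?thesis by (simp add: eq mmul_def madj_def mtr_def) algebra
qed

text \<open>The hypothesis turns tr(ca) = tr c tr a - tr(a^-1 c) into tr a (tr c - 1), and Fricke's
  expression minus 2 then acquires the factor tr c - 2.\<close>

lemma mtr_commutator_step:
  assumes "mdet c = 1" "mdet a = 1" "mtr (mmul (madj a) c) = mtr a"
  shows "mtr (mmul c (mmul a (mmul (madj c) (madj a)))) - 2 = (mtr c - 2) * (mtr c + 2 - (mtr a)\<^sup>2)"
proof -
  have "mtr (mmul c a) = mtr c * mtr a - mtr (mmul (madj a) c)"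
    by (cases c; cases a) (simp add: mmul_def madj_def mtr_def algebra_simps)
  then have ca: "mtr (mmul c a) = mtr c * mtr a - mtr a" using assms by simp
  show ?thesis unfolding mtr_commutator[OF assms(1,2)] ca by (simp add: power2_eq_square algebra_simps)
qed

lemma lmat_concat: "lmat (concat (replicate m [LZ, LY])) = (1, 0, 2 * real m, 1)"
  by (induction m) (simp_all add: mmul_def algebra_simps)

lemma lmat_comm_word_0: "lmat (comm_word m 0) = (1, 0, 2 * real m, 1)"
  by (simp add: lmat_concat)

lemma lmat_comm_word_1: "lmat (comm_word m (Suc 0)) = (1 + 4 * real m, 8 * real m, - 2 * real m, 1 - 4 * real m)"
  by (simp add: lmat_append lmat_concat) (simp add: mmul_def algebra_simps)

lemma mdet_comm_word: "mdet (lmat (comm_word m n)) = 1"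
  using even_length_comm_word by (simp add: mdet_lmat)

lemma lmat_comm_word_step:
  "lmat (comm_word m (Suc (Suc n))) =
    mmul (lmat (comm_word m (Suc n))) (mmul (lmat (comm_word m n))
      (mmul (madj (lmat (comm_word m (Suc n)))) (madj (lmat (comm_word m n)))))"
  by (simp add: lmat_append lmat_rev even_length_comm_word mmul_assoc)

text \<open>If c = a b a^-1 b^-1, then a^-1 c = b a^-1 b^-1 is conjugate to a^-1 and has the trace
  of a, so the factorised form of Fricke's identity applies.\<close>

lemma mtr_comm_word_step:
  fixes m defines "t n \<equiv> mtr (lmat (comm_word m n))"
  shows "t (n + 3) - 2 = (t (n + 2) - 2) * (t (n + 2) + 2 - (t (n + 1))\<^sup>2)"
proof -
  let ?a = "lmat (comm_word m (Suc n))" and ?b = "lmat (comm_word m n)"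
  let ?c = "lmat (comm_word m (Suc (Suc n)))"
  have inv: "mmul (madj ?a) (mmul ?a N) = N" for N
    by (simp only: mmul_assoc[symmetric] madj_mmul[OF mdet_comm_word] mmul_one)
  have tr: "mtr (mmul b (mmul (madj a) (madj b))) = mtr a" if "mdet b = 1" for a b
  proof -
    obtain p q r s p' q' r' s' where eq: "b = (p, q, r, s)" "a = (p', q', r', s')" by (metis prod.exhaust)
    have "p * s = 1 + q * r" using that by (auto simp: eq mdet_def)
    then show ?thesis by (simp add: eq mmul_def madj_def mtr_def) algebra
  qed
  have "mtr (mmul (madj ?a) ?c) = mtr ?a"
    unfolding lmat_comm_word_step inv by (rule tr) (rule mdet_comm_word)
  from mtr_commutator_step[OF mdet_comm_word mdet_comm_word this]
  show ?thesis unfolding t_def lmat_comm_word_step[of m "Suc n", symmetric] by (simp add: numeral_eq_Suc)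
qed

text \<open>With \<open>d\<close> the distance of the trace from 2 and \<open>e\<close> the cofactor
  in the recursion, each new \<open>d\<close> is \<open>d * e\<close> and each new \<open>e\<close>
  is \<open>- d\<close> times the square of a trace. Both start at (16 m^2)^2, and the lower bounds
  3 reproduce themselves because |t - 2| >= 3 forces |t| >= 1.\<close>

lemma mtr_comm_word_neq:
  assumes "m \<ge> 1"
  shows "mtr (lmat (comm_word m (n + 2))) \<noteq> 2"
proof -
  define t where "t n = mtr (lmat (comm_word m n))" for n
  define d where "d n = t (n + 2) - 2" for n
  define e where "e n = t (n + 2) + 2 - (t (n + 1))\<^sup>2" for n
  have t1: "t 1 = 2" unfolding t_def One_nat_def lmat_comm_word_1 by (simp add: mtr_def)
  have "mtr (mmul (lmat (comm_word m (Suc 0))) (lmat (comm_word m 0))) = 2 + 16 * (real m)\<^sup>2"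
    unfolding lmat_comm_word_1 lmat_comm_word_0 by (simp add: mmul_def mtr_def power2_eq_square)
  moreover have "mtr (lmat (comm_word m (Suc 0))) = 2" "mtr (lmat (comm_word m 0)) = 2"
    unfolding lmat_comm_word_1 lmat_comm_word_0 by (simp_all add: mtr_def)
  ultimately have "t 2 = 2 + (16 * (real m)\<^sup>2)\<^sup>2"
    unfolding t_def numeral_2_eq_2 lmat_comm_word_step mtr_commutator[OF mdet_comm_word mdet_comm_word]
    by (simp only:) (simp add: power2_eq_square algebra_simps)
  then have d0: "d 0 = (16 * (real m)\<^sup>2)\<^sup>2" by (simp add: d_def numeral_2_eq_2)
  have m2: "(real m)\<^sup>2 \<ge> 1" using assms by simp
  then have "(16 * (real m)\<^sup>2)\<^sup>2 \<ge> 16\<^sup>2" by (intro power_mono) auto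
  then have d0': "d 0 \<ge> 3" unfolding d0 by simp
  have e0: "e 0 = d 0" by (simp add: e_def d_def t1[simplified])
  have d_Suc: "d (Suc n) = d n * e n" for n
    using mtr_comm_word_step[of m n] by (simp add: d_def e_def t_def numeral_eq_Suc)
  have e_Suc: "e (Suc n) = - d n * (t (n + 1))\<^sup>2" for n
  proof -
    have "e (Suc n) = d (Suc n) + 4 - (d n + 2)\<^sup>2" by (simp add: e_def d_def)
    also have "\<dots> = d n * e n + 4 - (d n + 2)\<^sup>2" by (simp add: d_Suc)
    also have "e n = d n + 4 - (t (n + 1))\<^sup>2" by (simp add: e_def d_def)
    finally show ?thesis by (simp add: power2_eq_square algebra_simps)
  qed
  have "3 \<le> \<bar>d n\<bar> \<and> 3 \<le> \<bar>e n\<bar> \<and> 1 \<le> \<bar>t (n + 1)\<bar>" for n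
  proof (induction n)
    case 0
    then show ?case using d0' e0 t1 by simp
  next
    case (Suc n)
    have "3 * 3 \<le> \<bar>d n\<bar> * \<bar>e n\<bar>" using Suc by (intro mult_mono) auto
    moreover have "3 * 1 \<le> \<bar>d n\<bar> * (\<bar>t (n + 1)\<bar>)\<^sup>2"
      using Suc by (intro mult_mono one_le_power) auto
    moreover have "3 \<le> \<bar>t (Suc n + 1) - 2\<bar>" using Suc by (simp add: d_def)
    then have "1 \<le> \<bar>t (Suc n + 1)\<bar>" by linarith
    ultimately show ?case by (simp add: d_Suc e_Suc abs_mult)
  qed
  from this[of n] show ?thesis by (auto simp: d_def t_def)
qed

text \<open>The point \<open>cayley (0, 1)\<close> is fixed by \<open>s_y\<close> and
  \<open>s_z\<close>. Matrices of determinant 1 that fix it are lower triangular with both diagonal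
  entries 1 or both -1; if two consecutive words were of this form, their commutator would have
  trace 2. The word of index 0 does fix the point, so only pairs of words can be treated.\<close>

lemma comm_word_moves_cayley:
  assumes "m \<ge> 1"
  shows "act 0 0 0 (comm_word m n) (cayley (0, 1)) \<noteq> cayley (0, 1) \<or>
    act 0 0 0 (comm_word m (Suc n)) (cayley (0, 1)) \<noteq> cayley (0, 1)"
proof (rule ccontr)
  have shape: "\<exists>e c. lmat (comm_word m k) = (e, 0, c, e) \<and> e * e = 1"
    if fixed: "act 0 0 0 (comm_word m k) (cayley (0, 1)) = cayley (0, 1)" for k
  proof -
    obtain p q r s where M: "lmat (comm_word m k) = (p, q, r, s)" by (metis prod.exhaust)
    have "cayley (q, s) = cayley (0, 1)" using fixed by (simp add: act_cayley M mapp_def)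
    then have "complex_of_real (- 2 * cosh q) = of_real (- 2 * cosh 0)"
      "complex_of_real (- 2 * cosh s) = of_real (- 2 * cosh 1)"
      unfolding cayley_def prod.case prod.inject by blast+
    then have "cosh q = 1" "cosh s = cosh 1" unfolding of_real_eq_iff by auto
    then have q: "q = 0" and "\<bar>s\<bar> = 1"
      using cosh_real_strict_mono[of 0 "\<bar>q\<bar>"] cosh_real_nonneg_less_iff[of "\<bar>s\<bar>" 1] cosh_real_nonneg_less_iff[of 1 "\<bar>s\<bar>"]
      by (auto simp: cosh_real_abs)
    then have s: "s = 1 \<or> s = - 1" by auto
    have "p * s = 1" using mdet_comm_word[of m k] by (simp add: M mdet_def q)
    then have "p = s" using s by auto
    then show ?thesis using s q M by auto
  qed
  assume "\<not> ?thesis"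
  then obtain e c e' c' where M: "lmat (comm_word m n) = (e, 0, c, e)" "e * e = 1"
    "lmat (comm_word m (Suc n)) = (e', 0, c', e')" "e' * e' = 1"
    using shape[of n] shape[of "Suc n"] by blast
  have "mtr (lmat (comm_word m (Suc (Suc n)))) = 2 * (e * e) * (e' * e')"
    unfolding lmat_comm_word_step M(1,3) by (simp add: mmul_def madj_def mtr_def algebra_simps)
  then have "mtr (lmat (comm_word m (n + 2))) = 2" by (simp add: M numeral_2_eq_2)
  then show False using mtr_comm_word_neq[OF assms] by blast
qed

section \<open>Genericity conditions as real polynomials\<close>

definition cpoly :: "(complex4 \<Rightarrow> complex) \<Rightarrow> bool" where
  "cpoly f \<longleftrightarrow> real_polynomial_function (\<lambda>v. Re (f v)) \<and> real_polynomial_function (\<lambda>v. Im (f v))"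

lemma cpoly_add: "cpoly f \<Longrightarrow> cpoly g \<Longrightarrow> cpoly (\<lambda>v. f v + g v)"
  by (auto simp: cpoly_def)

lemma cpoly_uminus: "cpoly f \<Longrightarrow> cpoly (\<lambda>v. - f v)"
  by (auto simp: cpoly_def)

lemma cpoly_diff: "cpoly f \<Longrightarrow> cpoly g \<Longrightarrow> cpoly (\<lambda>v. f v - g v)"
  by (auto simp: cpoly_def)

lemma cpoly_mult: "cpoly f \<Longrightarrow> cpoly g \<Longrightarrow> cpoly (\<lambda>v. f v * g v)"
  by (auto simp: cpoly_def)

lemma cpoly_const: "cpoly (\<lambda>v. c)"
  by (auto simp: cpoly_def)

lemma cpoly_power: "cpoly f \<Longrightarrow> cpoly (\<lambda>v. f v ^ n)"
  by (induction n) (auto intro: cpoly_mult cpoly_const)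

lemma cpoly_proj: "cpoly (\<lambda>v. fst v)" "cpoly (\<lambda>v. fst (snd v))" "cpoly (\<lambda>v. fst (snd (snd v)))"
  "cpoly (\<lambda>v. snd (snd (snd v)))"
  unfolding cpoly_def
  by (auto intro!: real_polynomial_function.intros(1) bounded_linear_compose[OF bounded_linear_Re]
      bounded_linear_compose[OF bounded_linear_Im] bounded_linear_intros)

lemmas cpoly_intros = cpoly_add cpoly_uminus cpoly_diff cpoly_mult cpoly_const cpoly_power cpoly_proj

lemma cpoly_act:
  assumes "cpoly A" "cpoly B" "cpoly C"
    "cpoly (\<lambda>v. fst (F v))" "cpoly (\<lambda>v. fst (snd (F v)))" "cpoly (\<lambda>v. snd (snd (F v)))"
  shows "cpoly (\<lambda>v. fst (act (A v) (B v) (C v) w (F v))) \<and>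
    cpoly (\<lambda>v. fst (snd (act (A v) (B v) (C v) w (F v)))) \<and>
    cpoly (\<lambda>v. snd (snd (act (A v) (B v) (C v) w (F v))))"
proof (induction w)
  case (Cons l w)
  then show ?case using assms
    by (cases l) (auto simp: s_x_def s_y_def s_z_def split_beta intro!: cpoly_intros)
qed (use assms in simp)

text \<open>The surface on which \<open>(x, y, z)\<close> is a point fixed by \<open>s\<^sub>y\<close> and \<open>s\<^sub>z\<close>; the first parameter \<open>A\<close>
  remains free.\<close>

definition vertex_param :: "complex4 \<Rightarrow> complex4" where
  "vertex_param = (\<lambda>(x, y, z, A). (A, 2 * y + x * z, 2 * z + x * y,
     x\<^sup>2 + y\<^sup>2 + z\<^sup>2 + x * y * z - A * x - (2 * y + x * z) * y - (2 * z + x * y) * z))"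

lemma coord4_vertex_param: "i < 8 \<Longrightarrow> real_polynomial_function (\<lambda>v. coord4 (vertex_param v) i)"
proof -
  have "cpoly (\<lambda>v. fst (vertex_param v))" "cpoly (\<lambda>v. fst (snd (vertex_param v)))"
    "cpoly (\<lambda>v. fst (snd (snd (vertex_param v))))" "cpoly (\<lambda>v. snd (snd (snd (vertex_param v))))"
    unfolding vertex_param_def split_beta fst_conv snd_conv by (intro cpoly_intros)+
  then show "i < 8 \<Longrightarrow> real_polynomial_function (\<lambda>v. coord4 (vertex_param v) i)"
    unfolding less8 coord4_def cpoly_def by auto
qed

text \<open>A sum of squares, so that the three complex equations for a fixed vertex become one real
  polynomial equation.\<close>

definition word_defect :: "letter list \<Rightarrow> complex4 \<Rightarrow> real" where
  "word_defect w = (\<lambda>(x, y, z, A). (norm (fst (act A (2 * y + x * z) (2 * z + x * y) w (x, y, z)) - x))\<^sup>2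
     + (norm (fst (snd (act A (2 * y + x * z) (2 * z + x * y) w (x, y, z))) - y))\<^sup>2
     + (norm (snd (snd (act A (2 * y + x * z) (2 * z + x * y) w (x, y, z))) - z))\<^sup>2)"

lemma word_defect_eq_0:
  "word_defect w (x, y, z, A) = 0 \<longleftrightarrow> act A (2 * y + x * z) (2 * z + x * y) w (x, y, z) = (x, y, z)"
  by (cases "act A (2 * y + x * z) (2 * z + x * y) w (x, y, z)")
    (auto simp: word_defect_def add_nonneg_eq_0_iff)

lemma word_defect_poly: "real_polynomial_function (word_defect w)"
proof -
  have sq: "real_polynomial_function (\<lambda>v. (norm (f v))\<^sup>2)" if "cpoly f" for f
    using that unfolding cpoly_def cmod_power2 by auto
  have "cpoly (\<lambda>v. 2 * fst (snd v) + fst v * fst (snd (snd v)))"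
    "cpoly (\<lambda>v. 2 * fst (snd (snd v)) + fst v * fst (snd v))"
    by (intro cpoly_intros)+
  note act = cpoly_act[OF cpoly_proj(4) this, where F = "\<lambda>v. (fst v, fst (snd v), fst (snd (snd v)))" and w = w,
      unfolded fst_conv snd_conv, OF cpoly_proj(1-3)]
  show ?thesis unfolding word_defect_def split_beta
    by (intro real_polynomial_function.intros(3) sq cpoly_diff cpoly_proj
        act[THEN conjunct1] act[THEN conjunct2, THEN conjunct1] act[THEN conjunct2, THEN conjunct2])
qed

text \<open>Each bad property of a vertex is a real polynomial equation in (x, y, z, A);
  \<open>elimination\<close> applied to \<open>vertex_param\<close> encloses the affected parameters
  in a real hypersurface, for all vertices of a surface at once. The condition on \<open>C\<close>
  is a hypersurface in parameter space directly.\<close>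

theorem generic_vertices:
  "\<exists>F. countable F \<and> (\<forall>Z\<in>F. real_algebraic_hypersurface Z) \<and>
    (\<forall>A B C D. (A, B, C, D) \<notin> \<Union>F \<longrightarrow> Im C \<noteq> 0 \<and>
      (\<forall>x y z. B = 2 * y + x * z \<longrightarrow> C = 2 * z + x * y \<longrightarrow> (x, y, z) \<in> cubic_surface A B C D \<longrightarrow>
        Im (x\<^sup>2) \<noteq> 0 \<and> 2 * x + y * z \<noteq> A \<and>
        (\<forall>m n. m \<ge> 1 \<longrightarrow> act A B C (comm_word m n) (x, y, z) \<noteq> (x, y, z) \<or>
           act A B C (comm_word m (Suc n)) (x, y, z) \<noteq> (x, y, z))))"
proof -
  define \<Phi>1 :: "complex4 \<Rightarrow> real" where "\<Phi>1 v = Im ((fst v)\<^sup>2)" for v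
  define \<Phi>2 :: "complex4 \<Rightarrow> real" where
    "\<Phi>2 v = (norm (2 * fst v + fst (snd v) * fst (snd (snd v)) - snd (snd (snd v))))\<^sup>2" for v
  \<comment> \<open>Defects that vanish identically, such as that of \<open>comm_word m 0\<close>,
    yield no hypersurface and are left out.\<close>
  define \<P> where "\<P> = {\<Phi>1, \<Phi>2} \<union> {\<Phi> \<in> range (\<lambda>(m, n). word_defect (comm_word m n)). \<Phi> \<noteq> (\<lambda>_. 0)}"
  have poly: "real_polynomial_function \<Phi>1" "real_polynomial_function \<Phi>2"
  proof -
    show "real_polynomial_function \<Phi>1"
      using cpoly_power[OF cpoly_proj(1), of 2] by (simp add: cpoly_def \<Phi>1_def[abs_def])
    have "cpoly (\<lambda>v. 2 * fst v + fst (snd v) * fst (snd (snd v)) - snd (snd (snd v)))"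
      by (intro cpoly_intros)
    then show "real_polynomial_function \<Phi>2" unfolding \<Phi>2_def cpoly_def cmod_power2 by auto
  qed
  have "\<Phi>1 \<noteq> (\<lambda>_. 0)"
  proof
    assume "\<Phi>1 = (\<lambda>_. 0)"
    from fun_cong[OF this, of "(1 + \<i>, 0)"] show False by (simp add: \<Phi>1_def power2_eq_square zero_prod_def)
  qed
  moreover have "\<Phi>2 \<noteq> (\<lambda>_. 0)"
  proof
    assume "\<Phi>2 = (\<lambda>_. 0)"
    from fun_cong[OF this, of "(1, 0, 0, 0)"] show False by (simp add: \<Phi>2_def)
  qed
  ultimately have \<P>: "real_polynomial_function \<Phi> \<and> \<Phi> \<noteq> (\<lambda>_. 0)" if "\<Phi> \<in> \<P>" for \<Phi>
    using that poly word_defect_poly unfolding \<P>_def by fastforce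
  have "\<exists>N. real_polynomial_function N \<and> N \<noteq> (\<lambda>_. 0) \<and> (\<forall>v. \<Phi> v = 0 \<longrightarrow> N (vertex_param v) = 0)"
    if "\<Phi> \<in> \<P>" for \<Phi>
    using \<P>[OF that] by (intro elimination coord4_vertex_param) simp_all
  then have "\<forall>\<Phi>\<in>\<P>. \<exists>N. real_polynomial_function N \<and> N \<noteq> (\<lambda>_. 0) \<and> (\<forall>v. \<Phi> v = 0 \<longrightarrow> N (vertex_param v) = 0)"
    by blast
  then obtain N where N': "\<forall>\<Phi>\<in>\<P>. real_polynomial_function (N \<Phi>) \<and> N \<Phi> \<noteq> (\<lambda>_. 0) \<and> (\<forall>v. \<Phi> v = 0 \<longrightarrow> N \<Phi> (vertex_param v) = 0)"
    by (rule bchoice[THEN exE])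
  then have N: "real_polynomial_function (N \<Phi>)" "N \<Phi> \<noteq> (\<lambda>_. 0)" "\<And>v. \<Phi> v = 0 \<Longrightarrow> N \<Phi> (vertex_param v) = 0"
    if "\<Phi> \<in> \<P>" for \<Phi>
    using that by blast+
  define I :: "complex4 \<Rightarrow> real" where "I v = Im (fst (snd (snd v)))" for v
  define F where "F = insert {v. I v = 0} ((\<lambda>\<Phi>. {v. N \<Phi> v = 0}) ` \<P>)"
  have "countable (range (\<lambda>(m, n). word_defect (comm_word m n)))" by (intro countable_image countableI_type)
  then have "countable {\<Phi> \<in> range (\<lambda>(m, n). word_defect (comm_word m n)). \<Phi> \<noteq> (\<lambda>_. 0)}"
    by (rule countable_subset[rotated]) blast
  then have "countable F"
    unfolding F_def \<P>_def by simp
  moreover have "real_algebraic_hypersurface Z" if "Z \<in> F" for Z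
  proof -
    have "real_polynomial_function I" using cpoly_proj(3) by (simp add: cpoly_def I_def[abs_def])
    moreover have "I \<noteq> (\<lambda>_. 0)"
    proof
      assume "I = (\<lambda>_. 0)"
      from fun_cong[OF this, of "(0, 0, \<i>, 0)"] show False by (simp add: I_def)
    qed
    ultimately have "real_algebraic_hypersurface {v. I v = 0}"
      unfolding real_algebraic_hypersurface_def by blast
    moreover have "real_algebraic_hypersurface {v. N \<Phi> v = 0}" if "\<Phi> \<in> \<P>" for \<Phi>
      unfolding real_algebraic_hypersurface_def using N(1,2)[OF that] by blast
    ultimately show ?thesis using that unfolding F_def by blast
  qed
  moreover have "Im C \<noteq> 0 \<and>
      (\<forall>x y z. B = 2 * y + x * z \<longrightarrow> C = 2 * z + x * y \<longrightarrow> (x, y, z) \<in> cubic_surface A B C D \<longrightarrow>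
        Im (x\<^sup>2) \<noteq> 0 \<and> 2 * x + y * z \<noteq> A \<and>
        (\<forall>m n. m \<ge> 1 \<longrightarrow> act A B C (comm_word m n) (x, y, z) \<noteq> (x, y, z) \<or>
           act A B C (comm_word m (Suc n)) (x, y, z) \<noteq> (x, y, z)))"
    if notin: "(A, B, C, D) \<notin> \<Union>F" for A B C D
  proof (intro conjI allI impI)
    show "Im C \<noteq> 0" using notin by (auto simp: F_def I_def)
    fix x y z assume BC: "B = 2 * y + x * z" "C = 2 * z + x * y" and S: "(x, y, z) \<in> cubic_surface A B C D"
    define v where "v = (x, y, z, A)"
    have "vertex_param v = (A, B, C, D)"
      using S by (simp add: vertex_param_def v_def BC cubic_surface_def algebra_simps)
    then have nz: "\<Phi> v \<noteq> 0" if "\<Phi> \<in> \<P>" for \<Phi>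
      using N(3)[OF that, of v] notin that unfolding F_def by auto
    show "Im (x\<^sup>2) \<noteq> 0" using nz[of \<Phi>1] by (simp add: \<P>_def \<Phi>1_def v_def)
    show "2 * x + y * z \<noteq> A" using nz[of \<Phi>2] by (simp add: \<P>_def \<Phi>2_def v_def)
    fix m n :: nat assume m: "m \<ge> 1"
    obtain k where k: "k = n \<or> k = Suc n" "act 0 0 0 (comm_word m k) (cayley (0, 1)) \<noteq> cayley (0, 1)"
      using comm_word_moves_cayley[OF m, of n] by blast
    \<comment> \<open>The Cayley vertex, with A = B = C = 0, certifies that the defect of the chosen
      word is not identically zero.\<close>
    define c where "c = complex_of_real (- 2 * cosh 1)"
    have cay: "cayley (0, 1) = (- 2, c, c)" by (simp add: cayley_def c_def)
    have "word_defect (comm_word m k) (- 2, c, c, 0) \<noteq> 0"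
      using k(2) unfolding word_defect_eq_0 cay by (simp del: comm_word.simps)
    then have "word_defect (comm_word m k) \<noteq> (\<lambda>_. 0)" by metis
    moreover have "word_defect (comm_word m k) \<in> range (\<lambda>(m, n). word_defect (comm_word m n))"
      by (rule image_eqI[of _ _ "(m, k)"]) simp_all
    ultimately have "word_defect (comm_word m k) \<in> \<P>" unfolding \<P>_def by blast
    from nz[OF this] have "act A B C (comm_word m k) (x, y, z) \<noteq> (x, y, z)"
      unfolding v_def word_defect_eq_0 BC .
    then show "act A B C (comm_word m n) (x, y, z) \<noteq> (x, y, z) \<or>
           act A B C (comm_word m (Suc n)) (x, y, z) \<noteq> (x, y, z)" using k(1) by blast
  qed
  ultimately show ?thesis by (intro exI[of _ F]) blast
qed

section \<open>Functions omitting a segment\<close>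

lemma Re_csqrt_pos: "z \<notin> \<real>\<^sub>\<le>\<^sub>0 \<Longrightarrow> Re (csqrt z) > 0"
proof (rule ccontr)
  assume z: "z \<notin> \<real>\<^sub>\<le>\<^sub>0" and "\<not> Re (csqrt z) > 0"
  then have "Re (csqrt z) = 0" using Re_csqrt[of z] by linarith
  then have "csqrt z = Complex 0 (Im (csqrt z))" by (simp add: complex_eq_iff)
  then have "z = (Complex 0 (Im (csqrt z)))\<^sup>2" by (metis power2_csqrt)
  also have "\<dots> = of_real (- (Im (csqrt z))\<^sup>2)" by (simp add: complex_eq_iff power2_eq_square)
  finally have "z = of_real (- (Im (csqrt z))\<^sup>2)" .
  moreover have "complex_of_real (- (Im (csqrt z))\<^sup>2) \<in> \<real>\<^sub>\<le>\<^sub>0"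
    by (simp only: nonpos_Reals_of_real_iff neg_le_0_iff_le zero_le_power2)
  ultimately show False using z by metis
qed

text \<open>A function avoiding \<open>[-2, 2]\<close> is \<open>-(m + 1/m)\<close> with \<open>\<bar>m\<bar> < 1\<close>, so Schwarz applies to \<open>m\<close>.\<close>

lemma slit_plane_lift:
  assumes "F holomorphic_on U" "\<And>s. s \<in> U \<Longrightarrow> F s \<notin> of_real ` {-2..2}"
  obtains m where "m holomorphic_on U" "\<And>s. s \<in> U \<Longrightarrow> norm (m s) < 1" "\<And>s. s \<in> U \<Longrightarrow> m s \<noteq> 0"
    "\<And>s. s \<in> U \<Longrightarrow> F s = - (m s + 1 / m s)"
proof -
  \<comment> \<open>This Moebius map sends \<open>[-2, 2]\<close> to the nonpositive reals together
    with infinity. Hence the principal root of \<open>u\<close> is holomorphic with positive real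
    part, and its Cayley transform is the required \<open>m\<close>.\<close>
  define u where "u s = (F s - 2) / (F s + 2)" for s
  have neq: "F s + 2 \<noteq> 0" if "s \<in> U" for s
  proof
    assume "F s + 2 = 0"
    then have "F s = of_real (- 2)" by (simp add: eq_neg_iff_add_eq_0)
    moreover have "(- 2 :: real) \<in> {-2..2}" by simp
    ultimately show False using assms(2)[OF that] by blast
  qed
  have u: "u s \<notin> \<real>\<^sub>\<le>\<^sub>0" if "s \<in> U" for s
  proof
    assume "u s \<in> \<real>\<^sub>\<le>\<^sub>0"
    then obtain t where t: "u s = of_real t" "t \<le> 0" by (auto elim!: nonpos_Reals_cases)
    then have eq: "F s - 2 = of_real t * (F s + 2)" using neq[OF that] by (simp add: u_def field_simps)
    then have "F s * (1 - of_real t) = 2 * (1 + of_real t)" by (simp add: algebra_simps)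
    moreover have "1 - complex_of_real t \<noteq> 0"
    proof -
      have "1 - t \<noteq> 0" using t(2) by simp
      then have "complex_of_real (1 - t) \<noteq> 0" by (simp only: of_real_eq_0_iff not_False_eq_True)
      then show ?thesis by simp
    qed
    ultimately have "F s = 2 * (1 + of_real t) / (1 - of_real t)" by (simp add: field_simps)
    also have "\<dots> = of_real (2 * (1 + t) / (1 - t))" by simp
    finally have "F s = of_real (2 * (1 + t) / (1 - t))" .
    moreover have "2 * (1 + t) / (1 - t) \<in> {-2..2}" using t(2) by (auto simp: field_simps)
    ultimately show False using assms(2)[OF that] by (metis imageI)
  qed
  define g where "g s = csqrt (u s)" for s
  have Re_g: "Re (g s) > 0" if "s \<in> U" for s
    unfolding g_def by (rule Re_csqrt_pos[OF u[OF that]])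
  have g2: "(g s)\<^sup>2 = u s" for s by (simp add: g_def)
  have "u holomorphic_on U" unfolding u_def using assms(1) neq by (intro holomorphic_intros)
  then have g_hol: "g holomorphic_on U" unfolding g_def by (rule holomorphic_on_csqrt') (rule u)
  define m where "m s = (g s - 1) / (g s + 1)" for s
  have g1: "g s + 1 \<noteq> 0" if "s \<in> U" for s
  proof
    assume "g s + 1 = 0"
    then have "Re (g s + 1) = 0" by simp
    then show False using Re_g[OF that] by simp
  qed
  show ?thesis
  proof (rule that[of m])
    show "m holomorphic_on U" unfolding m_def using g_hol g1 by (intro holomorphic_intros)
    fix s assume s: "s \<in> U"
    have "(norm (g s - 1))\<^sup>2 < (norm (g s + 1))\<^sup>2"
      using Re_g[OF s] unfolding cmod_power2 by (simp add: power2_eq_square algebra_simps)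
    then have "norm (g s - 1) < norm (g s + 1)" by (rule power_less_imp_less_base) simp
    then show "norm (m s) < 1" using g1[OF s] by (simp add: m_def norm_divide)
    have "g s \<noteq> 1"
    proof
      assume "g s = 1"
      then have "u s = 1" using g2[of s] by simp
      then show False using neq[OF s] by (simp add: u_def)
    qed
    then show m0: "m s \<noteq> 0" using g1[OF s] by (simp add: m_def)
    have "(g s)\<^sup>2 * (F s + 2) = F s - 2" using neq[OF s] by (simp add: g2 u_def)
    then have eq: "F s * (2 * ((g s - 1) * (g s + 1))) = - 2 * ((g s - 1)\<^sup>2 + (g s + 1)\<^sup>2)" by algebra
    have "m s + 1 / m s = ((g s - 1)\<^sup>2 + (g s + 1)\<^sup>2) / ((g s - 1) * (g s + 1))"
      using g1[OF s] \<open>g s \<noteq> 1\<close> by (simp add: m_def add_frac_eq power2_eq_square)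
    moreover have "F s = - (((g s - 1)\<^sup>2 + (g s + 1)\<^sup>2) / ((g s - 1) * (g s + 1)))"
    proof -
      have "F s * ((g s - 1) * (g s + 1)) = - ((g s - 1)\<^sup>2 + (g s + 1)\<^sup>2)" using eq by algebra
      then have "F s = - ((g s - 1)\<^sup>2 + (g s + 1)\<^sup>2) / ((g s - 1) * (g s + 1))"
        using g1[OF s] \<open>g s \<noteq> 1\<close> by (subst nonzero_eq_divide_eq) auto
      then show ?thesis by (simp only: minus_divide_left)
    qed
    ultimately show "F s = - (m s + 1 / m s)" by simp
  qed
qed

text \<open>From F = -(m + 1/m) one gets |F'| <= |m'| (1 + 1/|m|^2). Cauchy's inequality gives
  |m'(0)| <= 2/r, and 1/|m(0)| <= |F(0)| + |m(0)| is at most R + 1.\<close>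

lemma slit_plane_schwarz:
  assumes F: "F holomorphic_on ball 0 r" and avoid: "\<And>s. s \<in> ball 0 r \<Longrightarrow> F s \<notin> of_real ` {-2..2}"
    and "r > 0" "norm (F 0) \<le> R"
  shows "norm (deriv F 0) \<le> (1 + (R + 1)\<^sup>2) * 2 / r"
proof -
  obtain m where m: "m holomorphic_on ball 0 r" "\<And>s. s \<in> ball 0 r \<Longrightarrow> norm (m s) < 1"
    "\<And>s. s \<in> ball 0 r \<Longrightarrow> m s \<noteq> 0" "\<And>s. s \<in> ball 0 r \<Longrightarrow> F s = - (m s + 1 / m s)"
    by (rule slit_plane_lift[OF F avoid]) blast+
  have 0: "0 \<in> ball 0 r" using \<open>r > 0\<close> by simp
  have "norm ((deriv ^^ 1) m 0) \<le> fact 1 * 1 / (r / 2) ^ 1"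
  proof (rule Cauchy_inequality)
    have sub: "cball 0 (r / 2) \<subseteq> ball (0::complex) r" using \<open>r > 0\<close> by auto
    show "m holomorphic_on ball 0 (r / 2)" "continuous_on (cball 0 (r / 2)) m"
      using m(1) sub ball_subset_cball by (blast intro: holomorphic_on_subset holomorphic_on_imp_continuous_on)+
    show "norm (m x) \<le> 1" if "norm (0 - x) = r / 2" for x
      using m(2)[of x] that \<open>r > 0\<close> by simp
  qed (use \<open>r > 0\<close> in auto)
  then have dm: "norm (deriv m 0) \<le> 2 / r" by simp
  have "(m has_field_derivative deriv m 0) (at 0)"
    by (rule holomorphic_derivI[OF m(1)]) (use 0 in auto)
  then have "((\<lambda>s. - (m s + 1 / m s)) has_field_derivative - (deriv m 0 - deriv m 0 / (m 0)\<^sup>2)) (at 0)"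
    using m(3)[OF 0] by (auto intro!: derivative_eq_intros simp: power2_eq_square)
  then have "(F has_field_derivative - (deriv m 0 - deriv m 0 / (m 0)\<^sup>2)) (at 0)"
    by (rule has_field_derivative_transform_within_open[where S = "ball 0 r"]) (use 0 m(4) in auto)
  then have "deriv F 0 = - (deriv m 0 - deriv m 0 / (m 0)\<^sup>2)" by (rule DERIV_imp_deriv)
  then have "norm (deriv F 0) \<le> norm (deriv m 0) + norm (deriv m 0) / (norm (m 0))\<^sup>2"
    using norm_triangle_ineq4[of "deriv m 0" "deriv m 0 / (m 0)\<^sup>2"]
    by (simp only: norm_minus_cancel norm_divide norm_power)
  also have "\<dots> = (1 + (1 / norm (m 0))\<^sup>2) * norm (deriv m 0)" by (simp add: field_simps power_divide)
  also have "\<dots> \<le> (1 + (R + 1)\<^sup>2) * (2 / r)"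
  proof (intro mult_mono dm add_left_mono power_mono)
    have "norm (F 0) = norm (1 / m 0 - (- m 0))"
      unfolding m(4)[OF 0] norm_minus_cancel by (simp add: add.commute)
    then have "1 / norm (m 0) - norm (m 0) \<le> norm (F 0)"
      using norm_triangle_ineq2[of "1 / m 0" "- m 0"] by (simp add: norm_divide)
    then show "1 / norm (m 0) \<le> R + 1" using m(2)[OF 0] assms(4) by linarith
  qed (use \<open>r > 0\<close> in auto)
  finally show ?thesis by simp
qed

section \<open>Steering with a saddle and a lattice of translations\<close>

text \<open>Three moves act on coordinates \<open>(a, b)\<close> approximately affinely: move \<open>0\<close> is the saddle
  \<open>(\<mu> a, b / \<mu>)\<close>, and the moves \<open>1\<close> and \<open>-1\<close> are the translations by \<open>(1, \<nu>)\<close> and its negative.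
  Since \<open>\<mu>\<close> is not real, \<open>\<int> + \<mu> \<int>\<close> is a lattice, so after two applications of the saddle the
  coordinate \<open>a\<close> can be brought back to a bounded region; the coordinate \<open>b\<close> contracts by itself.\<close>

definition move_a :: "complex \<Rightarrow> int \<Rightarrow> complex \<Rightarrow> complex" where
  "move_a \<mu> s a = (if s = 0 then \<mu> * a else a + of_int s)"

definition move_b :: "complex \<Rightarrow> complex \<Rightarrow> int \<Rightarrow> complex \<Rightarrow> complex" where
  "move_b \<mu> \<nu> s b = (if s = 0 then b / \<mu> else b + \<nu> * of_int s)"

text \<open>The linear part of a move, with factor \<mu> for \<open>move_a\<close> and
  \<open>1 / \<mu>\<close> for \<open>move_b\<close>; it governs the difference of two
  points.\<close>

definition scale_by :: "complex \<Rightarrow> int \<Rightarrow> complex \<Rightarrow> complex" where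
  "scale_by \<mu> s x = (if s = 0 then \<mu> * x else x)"

definition power_moves :: "int \<Rightarrow> int list" where
  "power_moves k = replicate (nat \<bar>k\<bar>) (sgn k)"

lemma move_a_diff: "move_a \<mu> s a - move_a \<mu> s a' = scale_by \<mu> s (a - a')"
  by (simp add: move_a_def scale_by_def algebra_simps)

lemma move_b_diff: "move_b \<mu> \<nu> s b - move_b \<mu> \<nu> s b' = scale_by (1 / \<mu>) s (b - b')"
  by (simp add: move_b_def scale_by_def diff_divide_distrib)

lemma scale_by_diff: "scale_by \<mu> s (x - y) = scale_by \<mu> s x - scale_by \<mu> s y"
  by (simp add: scale_by_def algebra_simps)

lemma norm_scale_by: "norm \<mu> \<le> L \<Longrightarrow> 1 \<le> L \<Longrightarrow> norm (scale_by \<mu> s x) \<le> L * norm x"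
  using mult_right_mono[of 1 L "norm x"] by (auto simp: scale_by_def norm_mult mult_right_mono)

lemma fold_move_a_replicate: "s \<noteq> 0 \<Longrightarrow> fold (move_a \<mu>) (replicate n s) a = a + of_nat n * of_int s"
  by (induction n arbitrary: a) (simp_all add: move_a_def algebra_simps)

lemma fold_move_b_replicate: "s \<noteq> 0 \<Longrightarrow> fold (move_b \<mu> \<nu>) (replicate n s) b = b + \<nu> * (of_nat n * of_int s)"
  by (induction n arbitrary: b) (simp_all add: move_b_def algebra_simps)

lemma fold_scale_by_replicate: "s \<noteq> 0 \<Longrightarrow> fold (scale_by \<mu>) (replicate n s) x = x"
  by (induction n) (simp_all add: scale_by_def)

lemma of_nat_abs_sgn: "of_nat (nat \<bar>k\<bar>) * of_int (sgn k) = (of_int k :: complex)"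
proof -
  have "int (nat \<bar>k\<bar>) * sgn k = k" by (simp add: abs_mult_sgn)
  then show ?thesis by (metis of_int_mult of_int_of_nat_eq)
qed

lemma fold_power_moves [simp]:
  "fold (move_a \<mu>) (power_moves k) a = a + of_int k"
  "fold (move_b \<mu> \<nu>) (power_moves k) b = b + \<nu> * of_int k"
  "fold (scale_by \<mu>) (power_moves k) x = x"
proof (atomize (full), cases "k = 0")
  case True
  then show "fold (move_a \<mu>) (power_moves k) a = a + of_int k \<and>
    fold (move_b \<mu> \<nu>) (power_moves k) b = b + \<nu> * of_int k \<and> fold (scale_by \<mu>) (power_moves k) x = x"
    by (simp add: power_moves_def)
next
  case False
  then have "sgn k \<noteq> 0" by (simp add: sgn_0_0)
  then show "fold (move_a \<mu>) (power_moves k) a = a + of_int k \<and>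
    fold (move_b \<mu> \<nu>) (power_moves k) b = b + \<nu> * of_int k \<and> fold (scale_by \<mu>) (power_moves k) x = x"
    unfolding power_moves_def
    by (simp only: fold_move_a_replicate fold_move_b_replicate fold_scale_by_replicate of_nat_abs_sgn simp_thms)
qed

text \<open>The imaginary part is rounded to a multiple of \<open>Im \<mu>\<close> by
  \<open>k1\<close>, and afterwards the real part to an integer by \<open>k2\<close>. The bounds on
  both limit the number of translations in one loop.\<close>

lemma lattice_round:
  assumes "Im \<mu> \<noteq> 0"
  obtains k1 k2 :: int where "norm (c + \<mu> * of_int k1 + of_int k2) \<le> (\<bar>Im \<mu>\<bar> + 1) / 2"
    "\<bar>of_int k1\<bar> \<le> norm c / \<bar>Im \<mu>\<bar> + 1" "\<bar>of_int k2\<bar> \<le> norm c + norm \<mu> * \<bar>of_int k1\<bar> + 1"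
proof -
  define k1 where "k1 = - round (Im c / Im \<mu>)"
  define c' where "c' = c + \<mu> * of_int k1"
  define k2 where "k2 = - round (Re c')"
  have "Im (c' + of_int k2) = Im \<mu> * (Im c / Im \<mu> - of_int (round (Im c / Im \<mu>)))"
    using assms by (simp add: c'_def k1_def algebra_simps)
  moreover have "\<bar>Im c / Im \<mu> - of_int (round (Im c / Im \<mu>))\<bar> \<le> 1 / 2"
    using of_int_round_abs_le[of "Im c / Im \<mu>"] by linarith
  ultimately have 1: "\<bar>Im (c' + of_int k2)\<bar> \<le> \<bar>Im \<mu>\<bar> * (1 / 2)"
    by (simp only: abs_mult mult_left_mono abs_ge_zero)
  have 2: "\<bar>Re (c' + of_int k2)\<bar> \<le> 1 / 2"
    using of_int_round_abs_le[of "Re c'"] by (simp add: k2_def abs_minus_commute)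
  have n: "norm (c' + of_int k2) \<le> (\<bar>Im \<mu>\<bar> + 1) / 2"
    using cmod_le[of "c' + of_int k2"] 1 2 by simp
  have "\<bar>of_int (round (Im c / Im \<mu>)) :: real\<bar> \<le> \<bar>Im c / Im \<mu>\<bar> + 1"
    using of_int_round_abs_le[of "Im c / Im \<mu>"] by linarith
  also have "\<bar>Im c / Im \<mu>\<bar> \<le> norm c / \<bar>Im \<mu>\<bar>"
    using abs_Im_le_cmod[of c] by (simp add: abs_divide divide_right_mono)
  finally have 3: "\<bar>of_int k1\<bar> \<le> norm c / \<bar>Im \<mu>\<bar> + 1" by (simp add: k1_def)
  have "\<bar>of_int (round (Re c')) :: real\<bar> \<le> \<bar>Re c'\<bar> + 1"
    using of_int_round_abs_le[of "Re c'"] by linarith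
  also have "\<bar>Re c'\<bar> \<le> norm c + norm \<mu> * \<bar>of_int k1\<bar>"
    using abs_Re_le_cmod[of c'] norm_triangle_ineq[of c "\<mu> * of_int k1"] by (simp add: c'_def norm_mult)
  finally have 4: "\<bar>of_int k2\<bar> \<le> norm c + norm \<mu> * \<bar>of_int k1\<bar> + 1" by (simp add: k2_def)
  show ?thesis using that n 3 4 by (simp add: c'_def)
qed

text \<open>\<open>J\<close> bounds the number of moves in a run, \<open>M\<close> the starting
  positions and \<open>N\<close> all positions met on the way. Positions are known up to the
  absolute error \<epsilon>, differences up to \<epsilon> times the distance: the former suffices
  for steering, the latter makes the expansion of arbitrarily close points visible.\<close>

locale approx_moves =
  fixes X :: "'p set" and T :: "int \<Rightarrow> 'p \<Rightarrow> 'p" and a b :: "'p \<Rightarrow> complex"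
    and \<mu> \<nu> :: complex and N M \<epsilon> :: real and J :: nat
  assumes \<mu>: "norm \<mu> > 1" and \<nu>: "norm \<nu> \<le> 1" and \<epsilon>: "0 \<le> \<epsilon>" "\<epsilon> \<le> 1" "J * (norm \<mu> + 1) ^ J * \<epsilon> \<le> 1"
    and M: "0 \<le> M" and N: "norm \<mu> ^ J * (M + J) + 2 \<le> N"
    and T_in: "\<And>s p. s \<in> {-1, 0, 1} \<Longrightarrow> p \<in> X \<Longrightarrow> norm (a p) \<le> N \<Longrightarrow> norm (b p) \<le> N \<Longrightarrow> T s p \<in> X"
    and T_a: "\<And>s p. s \<in> {-1, 0, 1} \<Longrightarrow> p \<in> X \<Longrightarrow> norm (a p) \<le> N \<Longrightarrow> norm (b p) \<le> N \<Longrightarrow>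
      norm (a (T s p) - move_a \<mu> s (a p)) \<le> \<epsilon>"
    and T_b: "\<And>s p. s \<in> {-1, 0, 1} \<Longrightarrow> p \<in> X \<Longrightarrow> norm (a p) \<le> N \<Longrightarrow> norm (b p) \<le> N \<Longrightarrow>
      norm (b (T s p) - move_b \<mu> \<nu> s (b p)) \<le> \<epsilon>"
    and T_da: "\<And>s p q. s \<in> {-1, 0, 1} \<Longrightarrow> p \<in> X \<Longrightarrow> norm (a p) \<le> N \<Longrightarrow> norm (b p) \<le> N \<Longrightarrow>
      q \<in> X \<Longrightarrow> norm (a q) \<le> N \<Longrightarrow> norm (b q) \<le> N \<Longrightarrow>
      norm (a (T s q) - a (T s p) - scale_by \<mu> s (a q - a p)) \<le> \<epsilon> * max (norm (a q - a p)) (norm (b q - b p))"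
    and T_db: "\<And>s p q. s \<in> {-1, 0, 1} \<Longrightarrow> p \<in> X \<Longrightarrow> norm (a p) \<le> N \<Longrightarrow> norm (b p) \<le> N \<Longrightarrow>
      q \<in> X \<Longrightarrow> norm (a q) \<le> N \<Longrightarrow> norm (b q) \<le> N \<Longrightarrow>
      norm (b (T s q) - b (T s p) - scale_by (1 / \<mu>) s (b q - b p)) \<le> \<epsilon> * max (norm (a q - a p)) (norm (b q - b p))"
begin

abbreviation "L \<equiv> norm \<mu>"

lemma inv_le: "norm (1 / \<mu>) \<le> L"
proof -
  have "1 / L \<le> 1 / 1" using \<mu> by (intro divide_left_mono) auto
  then show ?thesis using \<mu> by (simp only: norm_divide norm_one div_by_1)
qed

lemma fold_moves_le:
  assumes "set ss \<subseteq> {-1, 0, 1}" "norm x \<le> M" "norm y \<le> M"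
  shows "norm (fold (move_a \<mu>) ss x) \<le> L ^ length ss * (M + length ss)"
    "norm (fold (move_b \<mu> \<nu>) ss y) \<le> L ^ length ss * (M + length ss)"
proof -
  have step: "norm (move_a \<mu> s u) \<le> L * norm u + 1" "norm (move_b \<mu> \<nu> s u) \<le> L * norm u + 1"
    if "s \<in> {-1, 0, 1}" for s u
  proof -
    have u: "norm u \<le> L * norm u" using \<mu> by (simp add: mult_le_cancel_right1)
    have "norm (of_int s :: complex) \<le> 1" using that by auto
    then have s: "norm (of_int s :: complex) \<le> 1" "norm (\<nu> * of_int s) \<le> 1"
      using \<nu> by (auto simp: norm_mult intro: mult_le_one)
    show "norm (move_a \<mu> s u) \<le> L * norm u + 1"
      using norm_triangle_ineq[of u "of_int s"] u s by (auto simp: move_a_def norm_mult)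
    have "norm (u / \<mu>) \<le> L * norm u" using mult_right_mono[OF inv_le, of "norm u"] by (simp add: norm_divide)
    then show "norm (move_b \<mu> \<nu> s u) \<le> L * norm u + 1"
      using norm_triangle_ineq[of u "\<nu> * of_int s"] u s by (auto simp: move_b_def)
  qed
  have pow: "1 \<le> L ^ n" for n using \<mu> by (simp add: one_le_power)
  have close: "L * (L ^ n * (M + real n)) + 1 \<le> L ^ Suc n * (M + real (Suc n))" for n
    using pow[of "Suc n"] by (simp add: algebra_simps)
  have "norm (fold (move_a \<mu>) ss x) \<le> L ^ length ss * (M + length ss) \<and>
    norm (fold (move_b \<mu> \<nu>) ss y) \<le> L ^ length ss * (M + length ss)"
    using assms(1)
  proof (induction ss rule: rev_induct)
    case (snoc s ss)
    then have IH: "norm (fold (move_a \<mu>) ss x) \<le> L ^ length ss * (M + length ss)"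
      "norm (fold (move_b \<mu> \<nu>) ss y) \<le> L ^ length ss * (M + length ss)" and s: "s \<in> {-1, 0, 1}" by auto
    have "L * norm (fold (move_a \<mu>) ss x) \<le> L * (L ^ length ss * (M + length ss))"
      "L * norm (fold (move_b \<mu> \<nu>) ss y) \<le> L * (L ^ length ss * (M + length ss))"
      using IH by (auto intro!: mult_left_mono)
    then show ?case
      using step[OF s, of "fold (move_a \<mu>) ss x"] step[OF s, of "fold (move_b \<mu> \<nu>) ss y"] close[of "length ss"]
      by (simp del: power_Suc)
  qed (use assms in auto)
  then show "norm (fold (move_a \<mu>) ss x) \<le> L ^ length ss * (M + length ss)"
    "norm (fold (move_b \<mu> \<nu>) ss y) \<le> L ^ length ss * (M + length ss)" by auto
qed

text \<open>The expression \<open>n * (L + 1) ^ n * e\<close> dominates the recursion in which the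
  old error is multiplied by \<open>L\<close> and a new one of size at most
  \<open>(L + 1) ^ n * e\<close> is added.\<close>

lemma error_step:
  assumes "x \<le> n * (L + 1) ^ n * e" "0 \<le> e" "y \<le> (L + 1) ^ n * e"
  shows "L * x + y \<le> Suc n * (L + 1) ^ Suc n * e"
proof -
  define p where "p = (L + 1) ^ n * e"
  have p: "0 \<le> p" using \<mu> assms by (simp add: p_def)
  have "L * x \<le> L * (real n * p)" using assms \<mu> by (intro mult_left_mono) (auto simp: p_def mult_ac)
  moreover have "y \<le> p" using assms by (simp add: p_def)
  moreover have "0 \<le> L * p" "0 \<le> real n * p" using p \<mu> by auto
  moreover have "Suc n * (L + 1) ^ Suc n * e = real n * (L * p) + real n * p + L * p + p"
    by (simp add: p_def algebra_simps)
  ultimately show ?thesis by (simp add: algebra_simps)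
qed

lemma error_le:
  assumes "n \<le> J" "0 \<le> e"
  shows "real n * (L + 1) ^ n * e \<le> J * (L + 1) ^ J * e"
  using assms \<mu> by (intro mult_right_mono mult_mono power_increasing) auto

text \<open>The ideal run is shadowed with total error at most 1. Positions are kept below
  \<open>N - 1\<close> and not merely \<open>N\<close>, so that companions within distance 1 are
  still covered by the hypotheses.\<close>

lemma run_position:
  assumes "set ss \<subseteq> {-1, 0, 1}" "length ss \<le> J" "p \<in> X" "norm (a p) \<le> M" "norm (b p) \<le> M"
  shows "fold T ss p \<in> X \<and> norm (a (fold T ss p)) \<le> N - 1 \<and> norm (b (fold T ss p)) \<le> N - 1 \<and>
    norm (a (fold T ss p) - fold (move_a \<mu>) ss (a p)) \<le> length ss * (L + 1) ^ length ss * \<epsilon> \<and>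
    norm (b (fold T ss p) - fold (move_b \<mu> \<nu>) ss (b p)) \<le> length ss * (L + 1) ^ length ss * \<epsilon>"
proof -
  have bound: "norm u \<le> N - 1"
    if "norm (u - v) \<le> real n * (L + 1) ^ n * \<epsilon>" "norm v \<le> L ^ n * (M + n)" "n \<le> J" for u v n
  proof -
    have "real n * (L + 1) ^ n * \<epsilon> \<le> J * (L + 1) ^ J * \<epsilon>" by (rule error_le[OF that(3) \<epsilon>(1)])
    then have "norm (u - v) \<le> 1" using that(1) \<epsilon>(3) by linarith
    moreover have "L ^ n * (M + n) \<le> L ^ J * (M + J)"
      using that(3) \<mu> M by (intro mult_mono power_increasing) auto
    ultimately show ?thesis using that(2) N norm_triangle_sub[of u v] by linarith
  qed
  show ?thesis using assms(1,2)
  proof (induction ss rule: rev_induct)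
    case Nil
    show ?case using assms bound[of "a p" "a p" 0] bound[of "b p" "b p" 0] by simp
  next
    case (snoc s ss)
    let ?n = "length ss" and ?p = "fold T ss p"
    let ?u = "fold (move_a \<mu>) ss (a p)" and ?v = "fold (move_b \<mu> \<nu>) ss (b p)"
    have s: "s \<in> {-1, 0, 1}" and IH: "?p \<in> X" "norm (a ?p) \<le> N" "norm (b ?p) \<le> N"
      "norm (a ?p - ?u) \<le> ?n * (L + 1) ^ ?n * \<epsilon>" "norm (b ?p - ?v) \<le> ?n * (L + 1) ^ ?n * \<epsilon>"
      using snoc by auto
    have e: "\<epsilon> \<le> (L + 1) ^ ?n * \<epsilon>" using \<epsilon>(1) \<mu> by (simp add: mult_le_cancel_right1)
    have "norm (move_a \<mu> s (a ?p) - move_a \<mu> s ?u) \<le> L * norm (a ?p - ?u)"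
      unfolding move_a_diff by (rule norm_scale_by) (use \<mu> in auto)
    from norm_diff_triangle_le[OF T_a[OF s IH(1-3)] this]
    have 1: "norm (a (T s ?p) - move_a \<mu> s ?u) \<le> Suc ?n * (L + 1) ^ Suc ?n * \<epsilon>"
      using error_step[OF IH(4) \<epsilon>(1) e] by linarith
    have "norm (move_b \<mu> \<nu> s (b ?p) - move_b \<mu> \<nu> s ?v) \<le> L * norm (b ?p - ?v)"
      unfolding move_b_diff by (rule norm_scale_by[OF inv_le]) (use \<mu> in auto)
    from norm_diff_triangle_le[OF T_b[OF s IH(1-3)] this]
    have 2: "norm (b (T s ?p) - move_b \<mu> \<nu> s ?v) \<le> Suc ?n * (L + 1) ^ Suc ?n * \<epsilon>"
      using error_step[OF IH(5) \<epsilon>(1) e] by linarith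
    have le: "norm (move_a \<mu> s ?u) \<le> L ^ Suc ?n * (M + Suc ?n)" "norm (move_b \<mu> \<nu> s ?v) \<le> L ^ Suc ?n * (M + Suc ?n)"
      using fold_moves_le[OF snoc.prems(1) assms(4,5)] by simp_all
    have "Suc ?n \<le> J" using snoc.prems by simp
    then show ?case
      using bound[OF 1 le(1)] bound[OF 2 le(2)] 1 2 T_in[OF s IH(1-3)] by (simp del: power_Suc of_nat_Suc)
  qed
qed

abbreviation gap :: "'p \<Rightarrow> 'p \<Rightarrow> real" where
  "gap q p \<equiv> max (norm (a q - a p)) (norm (b q - b p))"

text \<open>A move enlarges the gap at most by the factor \<open>L + 1\<close>, so the gap stays
  below 1 during the whole run and both points remain where the difference estimates hold.\<close>

lemma run_difference:
  assumes ss: "set ss \<subseteq> {-1, 0, 1}" "length ss \<le> J" and p: "p \<in> X" "norm (a p) \<le> M" "norm (b p) \<le> M"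
    and q: "q \<in> X" "(L + 1) ^ J * gap q p \<le> 1"
  shows "fold T ss q \<in> X \<and> gap (fold T ss q) (fold T ss p) \<le> (L + 1) ^ length ss * gap q p \<and>
    norm (a (fold T ss q) - a (fold T ss p) - fold (scale_by \<mu>) ss (a q - a p))
      \<le> length ss * (L + 1) ^ length ss * (\<epsilon> * gap q p) \<and>
    norm (b (fold T ss q) - b (fold T ss p) - fold (scale_by (1 / \<mu>)) ss (b q - b p))
      \<le> length ss * (L + 1) ^ length ss * (\<epsilon> * gap q p)"
  using ss
proof (induction ss rule: rev_induct)
  case Nil
  then show ?case using q by simp
next
  case (snoc s ss)
  let ?n = "length ss" and ?p = "fold T ss p" and ?q = "fold T ss q"
  define d where "d = gap q p"
  define D where "D = gap ?q ?p"
  have s: "s \<in> {-1, 0, 1}" and ss: "set ss \<subseteq> {-1, 0, 1}" "?n \<le> J" using snoc.prems by auto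
  have d: "0 \<le> d" unfolding d_def by (simp add: le_max_iff_disj)
  have D: "0 \<le> D" "norm (a ?q - a ?p) \<le> D" "norm (b ?q - b ?p) \<le> D"
    unfolding D_def by (simp_all add: le_max_iff_disj)
  have P: "?p \<in> X" "norm (a ?p) \<le> N - 1" "norm (b ?p) \<le> N - 1"
    using run_position[OF ss p] by auto
  have IH: "?q \<in> X" "D \<le> (L + 1) ^ ?n * d"
    "norm (a ?q - a ?p - fold (scale_by \<mu>) ss (a q - a p)) \<le> ?n * (L + 1) ^ ?n * (\<epsilon> * d)"
    "norm (b ?q - b ?p - fold (scale_by (1 / \<mu>)) ss (b q - b p)) \<le> ?n * (L + 1) ^ ?n * (\<epsilon> * d)"
    using snoc.IH[OF ss] unfolding d_def D_def by blast+
  have "(L + 1) ^ ?n * d \<le> (L + 1) ^ J * d"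
    using ss(2) \<mu> d by (intro mult_right_mono power_increasing) auto
  then have D1: "D \<le> 1" using IH(2) q(2) unfolding d_def by linarith
  have Q: "norm (a ?q) \<le> N" "norm (b ?q) \<le> N"
    using P D D1 norm_triangle_sub[of "a ?q" "a ?p"] norm_triangle_sub[of "b ?q" "b ?p"] by linarith+
  have PN: "norm (a ?p) \<le> N" "norm (b ?p) \<le> N" using P by linarith+
  note da = T_da[OF s P(1) PN IH(1) Q, folded D_def] and db = T_db[OF s P(1) PN IH(1) Q, folded D_def]
  have eD: "\<epsilon> * D \<le> (L + 1) ^ ?n * (\<epsilon> * d)"
    using mult_left_mono[OF IH(2) \<epsilon>(1)] by (simp add: mult_ac)
  have "\<epsilon> * D \<le> 1 * D" using \<epsilon> D(1) by (intro mult_right_mono) auto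
  have LD: "L * norm (a ?q - a ?p) \<le> L * D" "L * norm (b ?q - b ?p) \<le> L * D"
    by (intro mult_left_mono D norm_ge_zero)+
  have "norm (a (T s ?q) - a (T s ?p)) \<le> L * D + D"
    using norm_triangle_sub[of "a (T s ?q) - a (T s ?p)" "scale_by \<mu> s (a ?q - a ?p)"] da
      norm_scale_by[of \<mu> L s "a ?q - a ?p"] \<mu> LD(1) \<open>\<epsilon> * D \<le> 1 * D\<close> by linarith
  moreover have "norm (b (T s ?q) - b (T s ?p)) \<le> L * D + D"
    using norm_triangle_sub[of "b (T s ?q) - b (T s ?p)" "scale_by (1 / \<mu>) s (b ?q - b ?p)"] db
      norm_scale_by[OF inv_le, of s "b ?q - b ?p"] \<mu> LD(2) \<open>\<epsilon> * D \<le> 1 * D\<close> by linarith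
  ultimately have "gap (T s ?q) (T s ?p) \<le> (L + 1) * D" by (simp add: algebra_simps)
  also have "\<dots> \<le> (L + 1) * ((L + 1) ^ ?n * d)" using IH(2) \<mu> by (intro mult_left_mono) auto
  finally have gap: "gap (T s ?q) (T s ?p) \<le> (L + 1) ^ Suc ?n * d" by (simp add: mult_ac)
  have ed: "0 \<le> \<epsilon> * d" using \<epsilon>(1) d by (rule mult_nonneg_nonneg)
  let ?x = "a ?q - a ?p" and ?y = "fold (scale_by \<mu>) ss (a q - a p)"
  have "norm (scale_by \<mu> s ?x - scale_by \<mu> s ?y) \<le> L * norm (?x - ?y)"
    unfolding scale_by_diff[symmetric] by (rule norm_scale_by) (use \<mu> in auto)
  from norm_diff_triangle_le[OF da this]
  have 1: "norm (a (T s ?q) - a (T s ?p) - scale_by \<mu> s ?y) \<le> Suc ?n * (L + 1) ^ Suc ?n * (\<epsilon> * d)"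
    using error_step[OF IH(3) ed eD] by linarith
  let ?x = "b ?q - b ?p" and ?y = "fold (scale_by (1 / \<mu>)) ss (b q - b p)"
  have "norm (scale_by (1 / \<mu>) s ?x - scale_by (1 / \<mu>) s ?y) \<le> L * norm (?x - ?y)"
    unfolding scale_by_diff[symmetric] by (rule norm_scale_by[OF inv_le]) (use \<mu> in auto)
  from norm_diff_triangle_le[OF db this]
  have 2: "norm (b (T s ?q) - b (T s ?p) - scale_by (1 / \<mu>) s ?y) \<le> Suc ?n * (L + 1) ^ Suc ?n * (\<epsilon> * d)"
    using error_step[OF IH(4) ed eD] by linarith
  show ?case using gap 1 2 unfolding d_def using T_in[OF s IH(1) Q] by (simp del: power_Suc of_nat_Suc)
qed

end

text \<open>\<rho> is the remainder of \<open>lattice_round\<close> plus 1 for the error, and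
  \<open>J\<close> leaves room for two saddle moves and all translations. The inequality for
  \<open>R\<close> makes the disc for the contracted coordinate invariant, with \<open>J\<close>
  covering translations and error.\<close>

locale steered_moves = approx_moves +
  fixes \<rho> R :: real
  assumes im: "Im \<mu> \<noteq> 0" and \<rho>: "\<rho> = (\<bar>Im \<mu>\<bar> + 1) / 2 + 1"
    and J: "L\<^sup>2 * \<rho> / \<bar>Im \<mu>\<bar> + 1 + (L\<^sup>2 * \<rho> + L * (L\<^sup>2 * \<rho> / \<bar>Im \<mu>\<bar> + 1) + 1) \<le> real J - 2"
    and R: "R / L\<^sup>2 + J \<le> R" and MR: "\<rho> \<le> M" "R \<le> M"
    and err: "J * (L + 1) ^ J * \<epsilon> \<le> (L\<^sup>2 - 1) / 2" "1 / L\<^sup>2 + J * (L + 1) ^ J * \<epsilon> \<le> 1"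
begin

definition "region = {p \<in> X. norm (a p) \<le> \<rho> \<and> norm (b p) \<le> R}"

definition "rate = (1 + L\<^sup>2) / 2"

lemma rate: "rate > 1"
  using \<mu> unfolding rate_def by (simp add: one_less_power)

text \<open>Companions are compared inside the cone where the difference in \<open>b\<close> is at
  most that in \<open>a\<close>. As \<open>a\<close> expands and \<open>b\<close> contracts up to
  the error, the cone is mapped into itself and loops can be concatenated; the final upper bound
  determines how close companions must start.\<close>

lemma loop:
  assumes "p \<in> region"
  shows "\<exists>ss. set ss \<subseteq> {-1, 0, 1} \<and> fold T ss p \<in> region \<and>
    (\<forall>q\<in>X. (L + 1) ^ J * norm (a q - a p) \<le> 1 \<longrightarrow> norm (b q - b p) \<le> norm (a q - a p) \<longrightarrow>
      fold T ss q \<in> X \<and> rate * norm (a q - a p) \<le> norm (a (fold T ss q) - a (fold T ss p)) \<and>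
      norm (b (fold T ss q) - b (fold T ss p)) \<le> norm (a (fold T ss q) - a (fold T ss p)) \<and>
      norm (a (fold T ss q) - a (fold T ss p)) \<le> (L + 1) ^ J * norm (a q - a p))"
proof -
  have p: "p \<in> X" "norm (a p) \<le> \<rho>" "norm (b p) \<le> R" "norm (a p) \<le> M" "norm (b p) \<le> M"
    using assms MR by (auto simp: region_def)
  define c where "c = \<mu>\<^sup>2 * a p"
  have c: "norm c \<le> L\<^sup>2 * \<rho>"
    using p(2) by (simp add: c_def norm_mult norm_power mult_left_mono)
  obtain k1 k2 where k: "norm (c + \<mu> * of_int k1 + of_int k2) \<le> (\<bar>Im \<mu>\<bar> + 1) / 2"
    "\<bar>of_int k1\<bar> \<le> norm c / \<bar>Im \<mu>\<bar> + 1" "\<bar>of_int k2\<bar> \<le> norm c + L * \<bar>of_int k1\<bar> + 1"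
    using lattice_round[OF im] by blast
  have "norm c / \<bar>Im \<mu>\<bar> \<le> L\<^sup>2 * \<rho> / \<bar>Im \<mu>\<bar>" using c by (rule divide_right_mono) simp
  then have k1: "\<bar>of_int k1\<bar> \<le> L\<^sup>2 * \<rho> / \<bar>Im \<mu>\<bar> + 1" using k(2) by linarith
  then have "L * \<bar>of_int k1\<bar> \<le> L * (L\<^sup>2 * \<rho> / \<bar>Im \<mu>\<bar> + 1)" by (rule mult_left_mono) simp
  then have kJ: "\<bar>of_int k1\<bar> + \<bar>of_int k2\<bar> \<le> real J - 2" using k(3) k1 c J by linarith
  \<comment> \<open>Without errors this run maps \<open>a\<close> to
    \<open>\<mu>\<^sup>2 * a + \<mu> * k1 + k2\<close>: translations made before the second saddle
    move are multiplied by \<mu>, which yields the second lattice direction.\<close>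
  define ss where "ss = 0 # power_moves k1 @ 0 # power_moves k2"
  have "set (power_moves k) \<subseteq> {-1, 0, 1}" for k
    by (auto simp: power_moves_def sgn_if split: if_splits)
  then have ss: "set ss \<subseteq> {-1, 0, 1}" by (auto simp: ss_def)
  have "real (length ss) = \<bar>of_int k1\<bar> + \<bar>of_int k2\<bar> + 2" by (simp add: ss_def power_moves_def)
  then have len: "length ss \<le> J" using kJ by linarith
  have fold_a: "fold (move_a \<mu>) ss (a p) = c + \<mu> * of_int k1 + of_int k2"
    by (simp add: ss_def move_a_def c_def power2_eq_square algebra_simps)
  have fold_b: "fold (move_b \<mu> \<nu>) ss (b p) = b p / \<mu>\<^sup>2 + (\<nu> * (of_int k1 / \<mu>) + \<nu> * of_int k2)"
    using \<mu> by (simp add: ss_def move_b_def power2_eq_square add_divide_distrib)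
  have fold_d: "fold (scale_by \<mu>) ss x = \<mu>\<^sup>2 * x" "fold (scale_by (1 / \<mu>)) ss x = x / \<mu>\<^sup>2" for x
    by (simp_all add: ss_def scale_by_def power2_eq_square)
  define e where "e = J * (L + 1) ^ J * \<epsilon>"
  have len_err: "real (length ss) * (L + 1) ^ length ss * \<epsilon> \<le> e"
    unfolding e_def by (rule error_le[OF len \<epsilon>(1)])
  have e1: "e \<le> 1" using \<epsilon>(3) by (simp add: e_def)
  have pos: "fold T ss p \<in> X" "norm (a (fold T ss p) - fold (move_a \<mu>) ss (a p)) \<le> 1"
    "norm (b (fold T ss p) - fold (move_b \<mu> \<nu>) ss (b p)) \<le> 1"
    using run_position[OF ss len p(1,4,5)] len_err e1 by auto
  have "norm (a (fold T ss p)) \<le> \<rho>"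
    using pos(2) k(1) norm_triangle_sub[of "a (fold T ss p)" "fold (move_a \<mu>) ss (a p)"]
    unfolding fold_a \<rho> by linarith
  moreover have "norm (b (fold T ss p)) \<le> R"
  proof -
    have "norm (b p / \<mu>\<^sup>2) \<le> R / L\<^sup>2" using p(3) by (simp add: norm_divide norm_power divide_right_mono)
    moreover have "norm (\<nu> * (of_int k1 / \<mu>)) \<le> \<bar>of_int k1\<bar>"
    proof -
      have "norm (of_int k1 / \<mu>) \<le> \<bar>of_int k1\<bar> / 1"
        unfolding norm_divide norm_of_int using \<mu> by (intro divide_left_mono) auto
      then have "norm \<nu> * norm (of_int k1 / \<mu>) \<le> 1 * \<bar>of_int k1\<bar>" using \<nu> by (intro mult_mono) auto
      then show ?thesis by (simp only: norm_mult mult_1)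
    qed
    moreover have "norm (\<nu> * of_int k2) \<le> \<bar>of_int k2\<bar>"
      using mult_right_mono[OF \<nu>, of "\<bar>of_int k2\<bar>"] by (simp add: norm_mult)
    ultimately have "norm (fold (move_b \<mu> \<nu>) ss (b p)) \<le> R / L\<^sup>2 + (\<bar>of_int k1\<bar> + \<bar>of_int k2\<bar>)"
      unfolding fold_b using norm_triangle_ineq[of "b p / \<mu>\<^sup>2" "\<nu> * (of_int k1 / \<mu>) + \<nu> * of_int k2"]
        norm_triangle_ineq[of "\<nu> * (of_int k1 / \<mu>)" "\<nu> * of_int k2"] by linarith
    then show ?thesis
      using pos(3) kJ R norm_triangle_sub[of "b (fold T ss p)" "fold (move_b \<mu> \<nu>) ss (b p)"] by linarith
  qed
  ultimately have reg: "fold T ss p \<in> region" using pos(1) by (simp add: region_def)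
  have "fold T ss q \<in> X \<and> rate * norm (a q - a p) \<le> norm (a (fold T ss q) - a (fold T ss p)) \<and>
      norm (b (fold T ss q) - b (fold T ss p)) \<le> norm (a (fold T ss q) - a (fold T ss p)) \<and>
      norm (a (fold T ss q) - a (fold T ss p)) \<le> (L + 1) ^ J * norm (a q - a p)"
    if q: "q \<in> X" "(L + 1) ^ J * norm (a q - a p) \<le> 1" "norm (b q - b p) \<le> norm (a q - a p)" for q
  proof -
    define d where "d = norm (a q - a p)"
    have gap: "gap q p = d" using q(3) by (simp add: d_def)
    have d: "0 \<le> d" by (simp add: d_def)
    define x where "x = a (fold T ss q) - a (fold T ss p)"
    define y where "y = b (fold T ss q) - b (fold T ss p)"
    have "(L + 1) ^ J * gap q p \<le> 1" unfolding gap using q(2) by (simp add: d_def)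
    from run_difference[OF ss len p(1,4,5) q(1) this, unfolded gap fold_d, folded x_def y_def]
    have rd: "fold T ss q \<in> X" "max (norm x) (norm y) \<le> (L + 1) ^ length ss * d"
      "norm (x - \<mu>\<^sup>2 * (a q - a p)) \<le> real (length ss) * (L + 1) ^ length ss * (\<epsilon> * d)"
      "norm (y - (b q - b p) / \<mu>\<^sup>2) \<le> real (length ss) * (L + 1) ^ length ss * (\<epsilon> * d)" by auto
    have ed: "real (length ss) * (L + 1) ^ length ss * (\<epsilon> * d) \<le> e * d"
      using mult_right_mono[OF len_err d] by (simp add: mult.assoc)
    have x1: "norm (x - \<mu>\<^sup>2 * (a q - a p)) \<le> e * d" and y1: "norm (y - (b q - b p) / \<mu>\<^sup>2) \<le> e * d"
      using rd(3,4) ed by linarith+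
    have "norm (\<mu>\<^sup>2 * (a q - a p)) = L\<^sup>2 * d" by (simp add: norm_mult norm_power d_def)
    then have "L\<^sup>2 * d - e * d \<le> norm x"
      using x1 norm_triangle_sub[of "\<mu>\<^sup>2 * (a q - a p)" x] by (simp add: norm_minus_commute)
    moreover have "e * d \<le> (L\<^sup>2 - 1) / 2 * d" using err(1) d unfolding e_def by (rule mult_right_mono)
    moreover have "rate * d = L\<^sup>2 * d - (L\<^sup>2 - 1) / 2 * d" by (simp add: rate_def field_simps)
    ultimately have x2: "rate * d \<le> norm x" by linarith
    have "norm ((b q - b p) / \<mu>\<^sup>2) \<le> d / L\<^sup>2"
      using q(3) unfolding norm_divide norm_power d_def by (rule divide_right_mono) simp
    then have "norm y \<le> d / L\<^sup>2 + e * d"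
      using y1 norm_triangle_sub[of y "(b q - b p) / \<mu>\<^sup>2"] by linarith
    also have "\<dots> = (1 / L\<^sup>2 + e) * d" by (simp add: algebra_simps)
    also have "\<dots> \<le> 1 * d" using err(2) d unfolding e_def by (rule mult_right_mono)
    also have "\<dots> \<le> rate * d" using rate d by (intro mult_right_mono) auto
    finally have y2: "norm y \<le> norm x" using x2 by linarith
    have "(L + 1) ^ length ss * d \<le> (L + 1) ^ J * d"
      using len d \<mu> by (intro mult_right_mono power_increasing) auto
    then have "norm x \<le> (L + 1) ^ J * d" using rd(2) by simp
    then show ?thesis using rd(1) x2 y2 unfolding x_def y_def d_def by blast
  qed
  with ss reg show ?thesis by (intro exI[of _ ss]) simp
qed

text \<open>A loop may stretch the gap by \<open>(L + 1) ^ J\<close>; one such factor per loop and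
  one in reserve keep every loop within the smallness condition of \<open>loop\<close>.\<close>

lemma iterated_loop:
  assumes "p \<in> region"
  shows "\<exists>ss. set ss \<subseteq> {-1, 0, 1} \<and> fold T ss p \<in> region \<and>
    (\<forall>q\<in>X. norm (b q - b p) \<le> norm (a q - a p) \<longrightarrow> ((L + 1) ^ J) ^ Suc j * norm (a q - a p) \<le> 1 \<longrightarrow>
      rate ^ j * norm (a q - a p) \<le> norm (a (fold T ss q) - a (fold T ss p)))"
  using assms
proof (induction j arbitrary: p)
  case 0
  then show ?case by (intro exI[of _ "[]"]) auto
next
  case (Suc j)
  define E where "E = (L + 1) ^ J"
  have E: "1 \<le> E" unfolding E_def using \<mu> by (intro one_le_power) auto
  obtain ss where ss: "set ss \<subseteq> {-1, 0, 1}" "fold T ss p \<in> region"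
    and ss3: "\<forall>q\<in>X. E * norm (a q - a p) \<le> 1 \<longrightarrow> norm (b q - b p) \<le> norm (a q - a p) \<longrightarrow>
      fold T ss q \<in> X \<and> rate * norm (a q - a p) \<le> norm (a (fold T ss q) - a (fold T ss p)) \<and>
      norm (b (fold T ss q) - b (fold T ss p)) \<le> norm (a (fold T ss q) - a (fold T ss p)) \<and>
      norm (a (fold T ss q) - a (fold T ss p)) \<le> E * norm (a q - a p)"
    using loop[OF Suc.prems, folded E_def] by (elim exE conjE)
  obtain ss' where ss': "set ss' \<subseteq> {-1, 0, 1}" "fold T ss' (fold T ss p) \<in> region"
    and ss3': "\<forall>q\<in>X. norm (b q - b (fold T ss p)) \<le> norm (a q - a (fold T ss p)) \<longrightarrow>
      E ^ Suc j * norm (a q - a (fold T ss p)) \<le> 1 \<longrightarrow>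
      rate ^ j * norm (a q - a (fold T ss p)) \<le> norm (a (fold T ss' q) - a (fold T ss' (fold T ss p)))"
    using Suc.IH[OF ss(2), folded E_def] by (elim exE conjE)
  show ?case
  proof (intro exI[of _ "ss @ ss'"] conjI ballI impI)
    show "set (ss @ ss') \<subseteq> {-1, 0, 1}" using ss ss' by auto
    show "fold T (ss @ ss') p \<in> region" using ss' by simp
    fix q assume q: "q \<in> X" "norm (b q - b p) \<le> norm (a q - a p)"
      "((L + 1) ^ J) ^ Suc (Suc j) * norm (a q - a p) \<le> 1"
    have q3: "E ^ Suc (Suc j) * norm (a q - a p) \<le> 1" using q(3) by (simp only: E_def)
    have "E * norm (a q - a p) \<le> E ^ Suc (Suc j) * norm (a q - a p)"
      using power_increasing[of 1 "Suc (Suc j)" E] E by (intro mult_right_mono) auto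
    then have "E * norm (a q - a p) \<le> 1" using q3 by linarith
    note l = ss3[rule_format, OF q(1) this q(2)]
    have "E ^ Suc j * norm (a (fold T ss q) - a (fold T ss p)) \<le> E ^ Suc j * (E * norm (a q - a p))"
      using l E by (intro mult_left_mono) auto
    then have "E ^ Suc j * norm (a (fold T ss q) - a (fold T ss p)) \<le> 1" using q3 by (simp add: mult_ac)
    then have "rate ^ j * norm (a (fold T ss q) - a (fold T ss p)) \<le> norm (a (fold T (ss @ ss') q) - a (fold T (ss @ ss') p))"
      using ss3'[rule_format, of "fold T ss q"] l by simp
    moreover have "rate ^ j * (rate * norm (a q - a p)) \<le> rate ^ j * norm (a (fold T ss q) - a (fold T ss p))"
      using l rate by (intro mult_left_mono) auto
    ultimately show "rate ^ Suc j * norm (a q - a p) \<le> norm (a (fold T (ss @ ss') q) - a (fold T (ss @ ss') p))"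
      by (simp add: mult_ac)
  qed
qed

end

text \<open>Everything is measured in the unit \<open>u\<close>, the displacement of
  \<open>q0\<close> by a near-translation \<open>h\<close>. At this scale \<open>h\<close> is nearly
  the translation by 1 and \<gamma> nearly its linear part, because the working region is a bounded
  number of units wide. Hence the constants are fixed in the order \<open>J\<close>,
  \<open>R\<close>, \<open>N\<close>, \<open>\<epsilon>\<close>, \<open>r\<close>,
  \<open>\<delta>\<close>, and \<open>h\<close> is chosen last. \<open>W\<close> depends on
  \<open>h\<close>, while \<open>K\<close> is arbitrary once \<open>W\<close> is fixed.\<close>

theorem steering:
  fixes S :: "complex3 set" and \<xi> \<eta> :: "complex3 \<Rightarrow> complex" and \<gamma> :: "complex3 \<Rightarrow> complex3"
  assumes \<mu>: "norm \<mu> > 1" "Im \<mu> \<noteq> 0" and q0: "q0 \<in> S" "\<xi> q0 = 0" "\<eta> q0 = 0" and C0: "C0 \<ge> 1"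
    and affine: "\<And>p q p' q'. norm ((\<xi> p - \<xi> q) - (\<xi> p' - \<xi> q')) \<le> C0 * norm ((p - q) - (p' - q'))"
      "\<And>p q p' q'. norm ((\<eta> p - \<eta> q) - (\<eta> p' - \<eta> q')) \<le> C0 * norm ((p - q) - (p' - q'))"
    and chart: "\<rho>0 > 0" "\<And>p q. p \<in> S \<inter> ball q0 \<rho>0 \<Longrightarrow> q \<in> S \<inter> ball q0 \<rho>0 \<Longrightarrow>
      norm (p - q) \<le> C0 * max (norm (\<xi> p - \<xi> q)) (norm (\<eta> p - \<eta> q))"
    and \<gamma>: "\<gamma> q0 = q0" "isCont \<gamma> q0" "\<And>p. p \<in> S \<Longrightarrow> \<gamma> p \<in> S"
    and \<gamma>_linear: "\<And>\<epsilon>. \<epsilon> > 0 \<Longrightarrow> \<exists>\<rho>>0. \<forall>p\<in>S \<inter> ball q0 \<rho>. \<forall>q\<in>S \<inter> ball q0 \<rho>.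
      norm ((\<xi> (\<gamma> p) - \<xi> (\<gamma> q)) - \<mu> * (\<xi> p - \<xi> q)) \<le> \<epsilon> * norm (p - q) \<and>
      norm ((\<eta> (\<gamma> p) - \<eta> (\<gamma> q)) - (\<eta> p - \<eta> q) / \<mu>) \<le> \<epsilon> * norm (p - q)"
    and \<rho>1: "\<rho>1 > 0" and near: "\<And>\<epsilon>. \<epsilon> > 0 \<Longrightarrow> \<exists>h\<in>G. \<exists>h'\<in>G. (\<forall>p\<in>S. h p \<in> S \<and> h' p \<in> S) \<and>
      (\<forall>p. h (h' p) = p) \<and> h q0 \<noteq> q0 \<and> norm (\<eta> (h q0)) \<le> norm (\<xi> (h q0)) \<and>
      (\<forall>f\<in>{h, h'}. \<forall>p\<in>ball q0 \<rho>1. norm (f p - p) \<le> \<epsilon> \<and>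
        (\<forall>q\<in>ball q0 \<rho>1. norm ((f p - p) - (f q - q)) \<le> \<epsilon> * norm (p - q)))"
    and G: "id \<in> G" "\<gamma> \<in> G" "\<And>f g. f \<in> G \<Longrightarrow> g \<in> G \<Longrightarrow> f \<circ> g \<in> G"
  shows "\<exists>W. open W \<and> q0 \<in> W \<and> W \<subseteq> ball q0 \<rho>0 \<and> (\<forall>K. \<forall>t\<in>W \<inter> S. \<exists>g\<in>G. g t \<in> ball q0 \<rho>0 \<and>
    (\<exists>e>0. \<forall>t'\<in>S. norm (t' - t) < e \<longrightarrow> norm (\<eta> t' - \<eta> t) \<le> norm (\<xi> t' - \<xi> t) \<longrightarrow>
      K * norm (\<xi> t' - \<xi> t) \<le> norm (\<xi> (g t') - \<xi> (g t))))"
proof -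
  define L where "L = norm \<mu>"
  have L: "L > 1" using \<mu> by (simp add: L_def)
  have L2: "L\<^sup>2 > 1" using L by (simp add: one_less_power)
  define \<rho> where "\<rho> = (\<bar>Im \<mu>\<bar> + 1) / 2 + 1"
  obtain J :: nat where J0: "real J \<ge> L\<^sup>2 * \<rho> / \<bar>Im \<mu>\<bar> + 1 + (L\<^sup>2 * \<rho> + L * (L\<^sup>2 * \<rho> / \<bar>Im \<mu>\<bar> + 1) + 1) + 2"
    using real_arch_simple by blast
  have \<rho>: "\<rho> \<ge> 1" by (simp add: \<rho>_def)
  then have \<rho>_pos: "\<rho> > 0" by linarith
  have "0 \<le> L\<^sup>2 * \<rho> / \<bar>Im \<mu>\<bar>" "0 \<le> L\<^sup>2 * \<rho>" using \<rho> by auto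
  moreover have "0 \<le> L * (L\<^sup>2 * \<rho> / \<bar>Im \<mu>\<bar> + 1)" using L \<rho> by auto
  ultimately have J2: "real J \<ge> 2" using J0 by linarith
  define R where "R = J / (1 - 1 / L\<^sup>2)"
  have "0 < L\<^sup>2" using L2 by linarith
  then have L2': "1 - 1 / L\<^sup>2 > 0" using L2 by (simp add: divide_less_eq_1_pos)
  have "R * (1 - 1 / L\<^sup>2) = J" unfolding R_def using L2' by (metis nonzero_eq_divide_eq less_irrefl)
  then have R: "R / L\<^sup>2 + J = R" by (simp add: algebra_simps)
  have "R \<ge> 0" using L2' by (simp add: R_def)
  define M where "M = max \<rho> R"
  define N where "N = L ^ J * (M + J) + 2"
  have M: "0 \<le> M" using \<rho> by (simp add: M_def)
  then have N: "N \<ge> 2" using L by (simp add: N_def)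
  define e0 where "e0 = min 1 (min ((L\<^sup>2 - 1) / 2) (1 - 1 / L\<^sup>2))"
  have e0: "e0 > 0" "e0 \<le> 1" "e0 \<le> (L\<^sup>2 - 1) / 2" "e0 \<le> 1 - 1 / L\<^sup>2"
  proof -
    have "0 < (L\<^sup>2 - 1) / 2" using L2 by simp
    then show "e0 > 0" unfolding e0_def using L2' by (simp only: min_less_iff_conj zero_less_one simp_thms)
    show "e0 \<le> 1" unfolding e0_def by (rule min.cobounded1)
    show "e0 \<le> (L\<^sup>2 - 1) / 2" unfolding e0_def by (rule min.coboundedI2[OF min.cobounded1])
    show "e0 \<le> 1 - 1 / L\<^sup>2" unfolding e0_def by (rule min.coboundedI2[OF min.cobounded2])
  qed
  define B where "B = J * (L + 1) ^ J"
  have "1 * 1 \<le> B" unfolding B_def using J2 L by (intro mult_mono one_le_power) auto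
  then have B: "B \<ge> 1" by simp
  define \<epsilon> where "\<epsilon> = e0 / B"
  have \<epsilon>: "\<epsilon> > 0" "B * \<epsilon> = e0" using e0 B by (auto simp: \<epsilon>_def)
  have "\<epsilon> \<le> e0 / 1" unfolding \<epsilon>_def using B e0 by (intro divide_left_mono) auto
  then have \<epsilon>1: "\<epsilon> \<le> 1" using e0 by simp

  have "\<epsilon> / (C0 * N) > 0" using \<epsilon> C0 N by simp
  from \<gamma>_linear[OF this] obtain \<rho>2 where \<rho>2: "\<rho>2 > 0"
    and lin: "\<forall>p\<in>S \<inter> ball q0 \<rho>2. \<forall>q\<in>S \<inter> ball q0 \<rho>2.
      norm ((\<xi> (\<gamma> p) - \<xi> (\<gamma> q)) - \<mu> * (\<xi> p - \<xi> q)) \<le> \<epsilon> / (C0 * N) * norm (p - q) \<and>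
      norm ((\<eta> (\<gamma> p) - \<eta> (\<gamma> q)) - (\<eta> p - \<eta> q) / \<mu>) \<le> \<epsilon> / (C0 * N) * norm (p - q)"
    by (elim exE conjE)
  define r where "r = min \<rho>0 (min \<rho>1 \<rho>2)"
  have r: "r > 0" "r \<le> \<rho>0" "r \<le> \<rho>1" "r \<le> \<rho>2" using chart \<rho>1 \<rho>2 by (auto simp: r_def)
  have "\<exists>d>0. \<forall>p. norm (p - q0) < d \<longrightarrow> norm (\<gamma> p - \<gamma> q0) < r"
    using \<gamma>(2) r(1) unfolding continuous_at_eps_delta dist_norm by blast
  then obtain d where d0: "d > 0" and d: "\<And>p. norm (p - q0) < d \<Longrightarrow> norm (\<gamma> p - q0) < r"
    unfolding \<gamma>(1) by (elim exE conjE) (rule that, assumption, blast)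
  define r' where "r' = min d r"
  have r': "r' > 0" "r' \<le> r" "r' \<le> d" using d0 r by (auto simp: r'_def)
  \<comment> \<open>\<open>N\<close> accounts for points up to \<open>N\<close> units away from
    \<open>q0\<close>, and 2 for the error in the displacement of \<open>q0\<close> itself by
    \<open>h'\<close>.\<close>
  define D where "D = C0 * C0 * (N + 2)"
  have D: "D \<ge> 4" "C0 * C0 \<le> D"
  proof -
    have "1 * 1 \<le> C0 * C0" using C0 by (intro mult_mono) auto
    then have "1 * 4 \<le> C0 * C0 * (N + 2)" "C0 * C0 * 1 \<le> C0 * C0 * (N + 2)" using N C0 by (intro mult_mono; simp)+
    then show "D \<ge> 4" "C0 * C0 \<le> D" by (auto simp: D_def)
  qed
  define \<delta> where "\<delta> = min (r' / (2 * (D + 1))) (\<epsilon> / (2 * D))"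
  have \<delta>0: "\<delta> > 0" using r' \<epsilon> D by (simp add: \<delta>_def)
  have "\<delta> * (2 * (D + 1)) \<le> r'" "\<delta> * (2 * D) \<le> \<epsilon>"
    using D by (auto simp: \<delta>_def min_le_iff_disj pos_le_divide_eq[symmetric])
  then have \<delta>: "\<delta> * D + \<delta> < r'" "D * \<delta> \<le> \<epsilon>" "D * \<delta> \<le> 1 / 2" using \<delta>0 D \<epsilon> \<epsilon>1 r' by (auto simp: algebra_simps)
  obtain h h' where hG: "h \<in> G" "h' \<in> G" and "(\<forall>p\<in>S. h p \<in> S \<and> h' p \<in> S) \<and>
      (\<forall>p. h (h' p) = p) \<and> h q0 \<noteq> q0 \<and> norm (\<eta> (h q0)) \<le> norm (\<xi> (h q0)) \<and>
      (\<forall>f\<in>{h, h'}. \<forall>p\<in>ball q0 \<rho>1. norm (f p - p) \<le> \<delta> \<and>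
        (\<forall>q\<in>ball q0 \<rho>1. norm ((f p - p) - (f q - q)) \<le> \<delta> * norm (p - q)))"
    using near[OF \<delta>0] by (elim bexE)
  then have h: "\<And>p. p \<in> S \<Longrightarrow> h p \<in> S" "\<And>p. p \<in> S \<Longrightarrow> h' p \<in> S"
    "\<And>p. h (h' p) = p" "h q0 \<noteq> q0" "norm (\<eta> (h q0)) \<le> norm (\<xi> (h q0))"
    and hf: "\<forall>f\<in>{h, h'}. \<forall>p\<in>ball q0 \<rho>1. norm (f p - p) \<le> \<delta> \<and>
        (\<forall>q\<in>ball q0 \<rho>1. norm ((f p - p) - (f q - q)) \<le> \<delta> * norm (p - q))"
    by blast+
  have move: "norm (f p - p) \<le> \<delta>" if "f \<in> {h, h'}" "p \<in> ball q0 \<rho>1" for f p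
    using hf that by blast
  have lip: "norm ((f p - p) - (f q - q)) \<le> \<delta> * norm (p - q)"
    if "f \<in> {h, h'}" "p \<in> ball q0 \<rho>1" "q \<in> ball q0 \<rho>1" for f p q
    using hf that by blast

  define X where "X = S \<inter> ball q0 r"
  have q0X: "q0 \<in> X" using q0 r by (simp add: X_def)
  have X_ball: "p \<in> ball q0 \<rho>1" "p \<in> S \<inter> ball q0 \<rho>0" "p \<in> S \<inter> ball q0 \<rho>2" if "p \<in> X" for p
    using that r by (auto simp: X_def)
  \<comment> \<open>The new unit of length. It is nonzero since \<open>h\<close> moves
    \<open>q0\<close> and \<xi> dominates \<eta> at \<open>h q0\<close>; the same domination gives
    \<open>norm \<nu> \<le> 1\<close> for the translation vector \<open>(1, \<nu>)\<close>.\<close>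
  define u where "u = \<xi> (h q0)"
  define \<sigma> where "\<sigma> = norm u"
  have "\<delta> \<le> \<delta> * D" using \<delta>0 D by simp
  then have \<delta>r: "\<delta> < r" using \<delta> r' \<delta>0 by linarith
  have hq0X: "h q0 \<in> X" "h' q0 \<in> X"
    using move[of h q0] move[of h' q0] h(1,2)[OF q0(1)] \<delta>r \<rho>1 unfolding X_def
    by (auto simp: dist_norm norm_minus_commute)
  have "norm (h q0 - q0) \<le> C0 * max (norm (\<xi> (h q0) - \<xi> q0)) (norm (\<eta> (h q0) - \<eta> q0))"
    by (intro chart X_ball hq0X q0X)
  also have "\<dots> = C0 * \<sigma>" using h(5) by (simp add: q0 \<sigma>_def u_def max_def)
  finally have "norm (h q0 - q0) \<le> C0 * \<sigma>" .
  then have \<sigma>: "\<sigma> > 0" using h(4) C0 by (cases "\<sigma> = 0") (auto simp: \<sigma>_def)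
  then have u: "u \<noteq> 0" by (auto simp: \<sigma>_def)
  have "norm ((\<xi> (h q0) - \<xi> q0) - (\<xi> q0 - \<xi> q0)) \<le> C0 * norm ((h q0 - q0) - (q0 - q0))" by (rule affine)
  also have "\<dots> \<le> C0 * \<delta>" using move[of h q0] C0 \<rho>1 by (intro mult_left_mono) auto
  finally have \<sigma>\<delta>: "\<sigma> \<le> C0 * \<delta>" by (simp add: q0 \<sigma>_def u_def)

  define a where "a p = \<xi> p / u" for p
  define b where "b p = \<eta> p / u" for p
  define \<nu> where "\<nu> = \<eta> (h q0) / u"
  define T where "T s = (if s = 0 then \<gamma> else if s = 1 then h else h')" for s :: int
  have ab_diff: "\<xi> p - \<xi> q = u * (a p - a q)" "\<eta> p - \<eta> q = u * (b p - b q)" for p q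
    using u by (auto simp: a_def b_def field_simps)
  have ab0: "a q0 = 0" "b q0 = 0" by (auto simp: a_def b_def q0)
  have scaled: "norm (u * z) \<le> x * \<sigma> \<Longrightarrow> norm z \<le> x" for z x
    using \<sigma> by (simp add: norm_mult \<sigma>_def[symmetric])
  define gap where "gap q p = max (norm (a q - a p)) (norm (b q - b p))" for p q
  have dist_gap: "norm (q - p) \<le> C0 * (\<sigma> * gap q p)" if "p \<in> X" "q \<in> X" for p q
  proof -
    have "norm (q - p) \<le> C0 * max (norm (\<xi> q - \<xi> p)) (norm (\<eta> q - \<eta> p))"
      by (intro chart X_ball that)
    also have "max (norm (\<xi> q - \<xi> p)) (norm (\<eta> q - \<eta> p)) = \<sigma> * gap q p"
      using \<sigma> by (simp add: ab_diff norm_mult \<sigma>_def gap_def max_mult_distrib_left)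
    finally show ?thesis .
  qed
  have gap0: "gap p q0 \<le> N" if "norm (a p) \<le> N" "norm (b p) \<le> N" for p
    using that by (simp add: gap_def ab0)
  have dist_q0: "norm (p - q0) \<le> C0 * (\<sigma> * N)" if "p \<in> X" "norm (a p) \<le> N" "norm (b p) \<le> N" for p
  proof -
    have "C0 * (\<sigma> * gap p q0) \<le> C0 * (\<sigma> * N)"
      using gap0[OF that(2,3)] C0 \<sigma> by (intro mult_left_mono) auto
    then show ?thesis using dist_gap[OF q0X that(1)] by linarith
  qed
  have "C0 * (\<sigma> * N) \<le> C0 * ((C0 * \<delta>) * N)" using \<sigma>\<delta> C0 N by (intro mult_left_mono mult_right_mono) auto
  also have "\<dots> \<le> \<delta> * D" using \<delta>0 C0 by (simp add: D_def algebra_simps)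
  finally have CN: "C0 * (\<sigma> * N) \<le> \<delta> * D" .
  have gap_pos: "0 \<le> gap q p" for p q by (simp add: gap_def le_max_iff_disj)

  have trans: "norm ((a (f q) - a (f p)) - (a q - a p)) \<le> C0 * C0 * \<delta> * gap q p \<and>
      norm ((b (f q) - b (f p)) - (b q - b p)) \<le> C0 * C0 * \<delta> * gap q p"
    if f: "f \<in> {h, h'}" and pq: "p \<in> X" "q \<in> X" for f p q
  proof -
    have "norm ((f q - f p) - (q - p)) \<le> \<delta> * norm (q - p)"
      using lip[OF f X_ball(1)[OF pq(2)] X_ball(1)[OF pq(1)]] by (simp add: algebra_simps)
    also have "\<dots> \<le> \<delta> * (C0 * (\<sigma> * gap q p))" using dist_gap[OF pq] \<delta>0 by (intro mult_left_mono) auto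
    finally have "C0 * norm ((f q - f p) - (q - p)) \<le> C0 * (\<delta> * (C0 * (\<sigma> * gap q p)))"
      using C0 by (intro mult_left_mono) auto
    then have le: "C0 * norm ((f q - f p) - (q - p)) \<le> (C0 * C0 * \<delta> * gap q p) * \<sigma>" by (simp add: mult_ac)
    have "norm (u * ((a (f q) - a (f p)) - (a q - a p))) \<le> (C0 * C0 * \<delta> * gap q p) * \<sigma>"
      using affine(1)[of "f q" "f p" q p] le unfolding ab_diff right_diff_distrib[symmetric] by linarith
    moreover have "norm (u * ((b (f q) - b (f p)) - (b q - b p))) \<le> (C0 * C0 * \<delta> * gap q p) * \<sigma>"
      using affine(2)[of "f q" "f p" q p] le unfolding ab_diff right_diff_distrib[symmetric] by linarith
    ultimately show ?thesis using scaled by blast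
  qed
  have CD: "C0 * C0 * \<delta> * x \<le> \<epsilon> * x" if "0 \<le> x" for x
  proof (rule mult_right_mono[OF _ that])
    have "C0 * C0 * \<delta> \<le> D * \<delta>" using D \<delta>0 by (intro mult_right_mono) auto
    then show "C0 * C0 * \<delta> \<le> \<epsilon>" using \<delta> by linarith
  qed
  have ah: "a (h q0) = 1" "b (h q0) = \<nu>" using u by (auto simp: a_def b_def u_def \<nu>_def)
  have \<nu>: "norm \<nu> \<le> 1" using h(5) \<sigma> by (simp add: \<nu>_def norm_divide \<sigma>_def u_def)

  \<comment> \<open>Only \<open>h (h' p) = p\<close> is known. Comparing \<open>h\<close> at
    \<open>q0\<close> and at \<open>h' q0\<close> shows that \<open>h' q0\<close> has coordinates
    \<open>- 1\<close> and \<open>- \<nu>\<close> up to \<open>c * x\<close>, where \<open>x\<close>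
    is its own gap from \<open>q0\<close>; as \<open>c \<le> 1 / 2\<close>, this bootstraps to
    \<open>x \<le> 2\<close>.\<close>
  have ah': "norm (a (h' q0) + 1) \<le> 2 * (C0 * C0 * \<delta>) \<and> norm (b (h' q0) + \<nu>) \<le> 2 * (C0 * C0 * \<delta>)"
  proof -
    define x where "x = gap (h' q0) q0"
    define c where "c = C0 * C0 * \<delta>"
    have c: "0 \<le> c" "c \<le> 1 / 2"
    proof -
      show "0 \<le> c" using C0 \<delta>0 by (simp add: c_def)
      have "C0 * C0 * \<delta> \<le> D * \<delta>" using D \<delta>0 by (intro mult_right_mono) auto
      then show "c \<le> 1 / 2" using \<delta> unfolding c_def by linarith
    qed
    have "h \<in> {h, h'}" by simp
    note t = trans[OF this q0X hq0X(2), folded c_def x_def]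
    have eq: "- 1 - a (h' q0) = (a (h (h' q0)) - a (h q0)) - (a (h' q0) - a q0)"
      "- \<nu> - b (h' q0) = (b (h (h' q0)) - b (h q0)) - (b (h' q0) - b q0)"
      by (simp_all add: h(3) ab0 ah)
    have "norm (- 1 - a (h' q0)) \<le> c * x" "norm (- \<nu> - b (h' q0)) \<le> c * x"
      unfolding eq using t by blast+
    moreover have "norm (a (h' q0) + 1) = norm (- 1 - a (h' q0))" "norm (b (h' q0) + \<nu>) = norm (- \<nu> - b (h' q0))"
      by (metis add.commute minus_add_distrib norm_minus_cancel uminus_add_conv_diff diff_minus_eq_add)+
    ultimately have 1: "norm (a (h' q0) + 1) \<le> c * x" "norm (b (h' q0) + \<nu>) \<le> c * x" by auto
    have "0 \<le> x" unfolding x_def by (rule gap_pos)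
    then have "c * x \<le> 1 / 2 * x" using c by (intro mult_right_mono) auto
    moreover have "norm (a (h' q0)) \<le> 1 + c * x" "norm (b (h' q0)) \<le> 1 + c * x"
      using norm_triangle_ineq4[of "a (h' q0) + 1" 1] norm_triangle_ineq4[of "b (h' q0) + \<nu>" \<nu>] 1 \<nu> by auto
    then have "x \<le> 1 + c * x" by (simp add: x_def gap_def ab0)
    ultimately have "x \<le> 2" by linarith
    then have "c * x \<le> c * 2" using c by (intro mult_left_mono) auto
    then show ?thesis using 1 unfolding c_def by linarith
  qed

  interpret steered_moves X T a b \<mu> \<nu> N M \<epsilon> J \<rho> R
  proof
    show "cmod \<mu> ^ J * (M + real J) + 2 \<le> N" "1 < cmod \<mu>" using L by (simp_all add: N_def L_def)
    show "real J * (cmod \<mu> + 1) ^ J * \<epsilon> \<le> 1" "real J * (cmod \<mu> + 1) ^ J * \<epsilon> \<le> ((cmod \<mu>)\<^sup>2 - 1) / 2"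
      "1 / (cmod \<mu>)\<^sup>2 + real J * (cmod \<mu> + 1) ^ J * \<epsilon> \<le> 1"
      using \<epsilon>(2) e0 unfolding B_def L_def by auto
    show "(cmod \<mu>)\<^sup>2 * \<rho> / \<bar>Im \<mu>\<bar> + 1 + ((cmod \<mu>)\<^sup>2 * \<rho> + cmod \<mu> * ((cmod \<mu>)\<^sup>2 * \<rho> / \<bar>Im \<mu>\<bar> + 1) + 1) \<le> real J - 2"
      using J0 unfolding L_def by linarith
    show "R / (cmod \<mu>)\<^sup>2 + real J \<le> R" using R unfolding L_def by simp
    fix s :: int and p assume s: "s \<in> {-1, 0, 1}" and p: "p \<in> X" "norm (a p) \<le> N" "norm (b p) \<le> N"
    have pq0: "norm (p - q0) < r'" using dist_q0[OF p] CN \<delta> \<delta>0 by linarith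
    show "T s p \<in> X"
    proof (cases "s = 0")
      case True
      have "norm (\<gamma> p - q0) < r" using d pq0 r' by simp
      then show ?thesis using \<gamma>(3) p True by (simp add: T_def X_def dist_norm norm_minus_commute)
    next
      case False
      then have f: "T s \<in> {h, h'}" by (simp add: T_def)
      have "norm (T s p - q0) \<le> norm (T s p - p) + norm (p - q0)"
        using norm_triangle_ineq[of "T s p - p" "p - q0"] by simp
      also have "\<dots> < r" using move[OF f X_ball(1)[OF p(1)]] dist_q0[OF p] CN \<delta> r' by linarith
      finally have "norm (T s p - q0) < r" .
      moreover have "T s p \<in> S" using p(1) f h(1,2)[of p] unfolding X_def by blast
      ultimately show ?thesis by (simp add: X_def dist_norm norm_minus_commute)
    qed
    have "norm (a (T s p) - move_a \<mu> s (a p)) \<le> \<epsilon> \<and> norm (b (T s p) - move_b \<mu> \<nu> s (b p)) \<le> \<epsilon>"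
    proof (cases "s = 0")
      case True
      have "\<epsilon> / (C0 * N) * norm (p - q0) \<le> \<epsilon> / (C0 * N) * (C0 * (\<sigma> * N))"
        using dist_q0[OF p] \<epsilon> C0 N by (intro mult_left_mono) auto
      also have "\<dots> = \<epsilon> * \<sigma>" using C0 N by (simp add: field_simps)
      finally have "norm ((\<xi> (\<gamma> p) - \<xi> (\<gamma> q0)) - \<mu> * (\<xi> p - \<xi> q0)) \<le> \<epsilon> * \<sigma> \<and>
        norm ((\<eta> (\<gamma> p) - \<eta> (\<gamma> q0)) - (\<eta> p - \<eta> q0) / \<mu>) \<le> \<epsilon> * \<sigma>"
        using lin[rule_format, OF X_ball(3)[OF p(1)] X_ball(3)[OF q0X]] by linarith
      moreover have "(\<xi> (\<gamma> p) - \<xi> (\<gamma> q0)) - \<mu> * (\<xi> p - \<xi> q0) = u * (a (\<gamma> p) - \<mu> * a p)"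
        "(\<eta> (\<gamma> p) - \<eta> (\<gamma> q0)) - (\<eta> p - \<eta> q0) / \<mu> = u * (b (\<gamma> p) - b p / \<mu>)"
        unfolding ab_diff \<gamma>(1) ab0 by (simp_all add: algebra_simps)
      ultimately show ?thesis using scaled True by (simp add: T_def move_a_def move_b_def)
    next
      case False
      then have f: "T s \<in> {h, h'}" by (simp add: T_def)
      note t = trans[OF f q0X p(1)]
      have c: "0 \<le> C0 * C0 * \<delta>" using C0 \<delta>0 by simp
      have "C0 * C0 * \<delta> * gap p q0 \<le> C0 * C0 * \<delta> * N" using gap0[OF p(2,3)] c by (rule mult_left_mono)
      then have t': "norm ((a (T s p) - a (T s q0)) - (a p - a q0)) \<le> C0 * C0 * \<delta> * N"
        "norm ((b (T s p) - b (T s q0)) - (b p - b q0)) \<le> C0 * C0 * \<delta> * N"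
        using t by auto
      have base: "norm (a (T s q0) - of_int s) \<le> 2 * (C0 * C0 * \<delta>)" "norm (b (T s q0) - \<nu> * of_int s) \<le> 2 * (C0 * C0 * \<delta>)"
        using s False ah ah' c by (auto simp: T_def)
      have "norm (a (T s p) - (a p + of_int s)) \<le> C0 * C0 * \<delta> * N + 2 * (C0 * C0 * \<delta>)"
        using norm_triangle_ineq[of "(a (T s p) - a (T s q0)) - (a p - a q0)" "a (T s q0) - of_int s"] t' base
        by (simp add: ab0 algebra_simps)
      moreover have "norm (b (T s p) - (b p + \<nu> * of_int s)) \<le> C0 * C0 * \<delta> * N + 2 * (C0 * C0 * \<delta>)"
        using norm_triangle_ineq[of "(b (T s p) - b (T s q0)) - (b p - b q0)" "b (T s q0) - \<nu> * of_int s"] t' base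
        by (simp add: ab0 algebra_simps)
      moreover have "C0 * C0 * \<delta> * N + 2 * (C0 * C0 * \<delta>) = D * \<delta>" by (simp add: D_def algebra_simps)
      ultimately show ?thesis using False \<delta>(2) by (simp add: move_a_def move_b_def)
    qed
    then show "norm (a (T s p) - move_a \<mu> s (a p)) \<le> \<epsilon>" "norm (b (T s p) - move_b \<mu> \<nu> s (b p)) \<le> \<epsilon>" by auto
    fix q assume q: "q \<in> X" "norm (a q) \<le> N" "norm (b q) \<le> N"
    have "norm (a (T s q) - a (T s p) - scale_by \<mu> s (a q - a p)) \<le> \<epsilon> * gap q p \<and>
      norm (b (T s q) - b (T s p) - scale_by (1 / \<mu>) s (b q - b p)) \<le> \<epsilon> * gap q p"
    proof (cases "s = 0")
      case True
      have "\<epsilon> / (C0 * N) * norm (q - p) \<le> \<epsilon> / (C0 * N) * (C0 * (\<sigma> * gap q p))"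
        using dist_gap[OF p(1) q(1)] \<epsilon> C0 N by (intro mult_left_mono) auto
      also have "\<dots> = \<epsilon> * gap q p * \<sigma> / N" using C0 N by (simp add: field_simps)
      also have "\<dots> \<le> \<epsilon> * gap q p * \<sigma> / 1"
        using N \<epsilon> \<sigma> gap_pos[of q p] by (intro divide_left_mono) auto
      finally have "norm ((\<xi> (\<gamma> q) - \<xi> (\<gamma> p)) - \<mu> * (\<xi> q - \<xi> p)) \<le> \<epsilon> * gap q p * \<sigma> \<and>
        norm ((\<eta> (\<gamma> q) - \<eta> (\<gamma> p)) - (\<eta> q - \<eta> p) / \<mu>) \<le> \<epsilon> * gap q p * \<sigma>"
        using lin[rule_format, OF X_ball(3)[OF q(1)] X_ball(3)[OF p(1)]] by linarith
      moreover have "(\<xi> (\<gamma> q) - \<xi> (\<gamma> p)) - \<mu> * (\<xi> q - \<xi> p) = u * (a (\<gamma> q) - a (\<gamma> p) - \<mu> * (a q - a p))"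
        "(\<eta> (\<gamma> q) - \<eta> (\<gamma> p)) - (\<eta> q - \<eta> p) / \<mu> = u * (b (\<gamma> q) - b (\<gamma> p) - (b q - b p) / \<mu>)"
        unfolding ab_diff by (simp_all add: algebra_simps)
      ultimately show ?thesis using scaled True by (simp add: T_def scale_by_def)
    next
      case False
      then have f: "T s \<in> {h, h'}" by (simp add: T_def)
      show ?thesis using trans[OF f p(1) q(1)] CD[OF gap_pos[of q p]] False by (auto simp: scale_by_def)
    qed
    then show "norm (a (T s q) - a (T s p) - scale_by \<mu> s (a q - a p)) \<le> \<epsilon> * max (norm (a q - a p)) (norm (b q - b p))"
      "norm (b (T s q) - b (T s p) - scale_by (1 / \<mu>) s (b q - b p)) \<le> \<epsilon> * max (norm (a q - a p)) (norm (b q - b p))"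
      by (auto simp: gap_def)
  qed (use \<nu> \<epsilon> \<epsilon>1 M \<mu> in \<open>auto simp: \<rho>_def M_def\<close>)

  have GT: "fold T ss \<in> G" for ss
  proof (induction ss rule: rev_induct)
    case Nil
    then show ?case using G by (simp add: id_def)
  next
    case (snoc s ss)
    have "fold T (ss @ [s]) = T s \<circ> fold T ss" by (simp add: fun_eq_iff)
    moreover have "T s \<in> G" using G(2) hG by (simp add: T_def)
    ultimately show ?case using G(3)[OF _ snoc] by (simp only:)
  qed
  have cont: "continuous_on UNIV \<xi>" "continuous_on UNIV \<eta>"
  proof -
    have "C0-lipschitz_on UNIV \<xi>" "C0-lipschitz_on UNIV \<eta>"
      using affine(1)[of _ _ q0 q0] affine(2)[of _ _ q0 q0] C0 by (auto intro!: lipschitz_onI simp: dist_norm)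
    then show "continuous_on UNIV \<xi>" "continuous_on UNIV \<eta>" by (auto intro: lipschitz_on_continuous_on)
  qed
  define W where "W = ball q0 r \<inter> ({p. norm (\<xi> p) < \<rho> * \<sigma>} \<inter> {p. norm (\<eta> p) < R * \<sigma>})"
  have "R > 0" using J2 L2' by (simp add: R_def)
  have "open W" unfolding W_def
    by (intro open_Int open_ball open_Collect_less continuous_intros cont)
  moreover have "q0 \<in> W"
  proof -
    show ?thesis using \<rho>_pos r \<sigma> \<open>R > 0\<close> by (simp add: W_def q0)
  qed
  moreover have "W \<subseteq> ball q0 \<rho>0" using r by (auto simp: W_def)
  moreover have "\<exists>g\<in>G. g t \<in> ball q0 \<rho>0 \<and>
    (\<exists>e>0. \<forall>t'\<in>S. norm (t' - t) < e \<longrightarrow> norm (\<eta> t' - \<eta> t) \<le> norm (\<xi> t' - \<xi> t) \<longrightarrow>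
      K * norm (\<xi> t' - \<xi> t) \<le> norm (\<xi> (g t') - \<xi> (g t)))" if t: "t \<in> W \<inter> S" for K t
  proof -
    have tX: "t \<in> X" "norm (t - q0) < r" using t by (auto simp: W_def X_def dist_norm norm_minus_commute)
    have "norm (\<xi> t) \<le> \<rho> * \<sigma>" "norm (\<eta> t) \<le> R * \<sigma>" using t by (auto simp: W_def)
    then have "t \<in> region" using tX \<sigma> by (simp add: region_def a_def b_def norm_divide \<sigma>_def[symmetric] field_simps)
    obtain j where j: "K < rate ^ j" using rate real_arch_pow by blast
    obtain ss where ss: "fold T ss t \<in> region"
      and ss2: "\<forall>q\<in>X. norm (b q - b t) \<le> norm (a q - a t) \<longrightarrow> ((cmod \<mu> + 1) ^ J) ^ Suc j * norm (a q - a t) \<le> 1 \<longrightarrow>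
      rate ^ j * norm (a q - a t) \<le> norm (a (fold T ss q) - a (fold T ss t))"
      using iterated_loop[OF \<open>t \<in> region\<close>, of j] by (elim exE conjE)
    define E where "E = ((cmod \<mu> + 1) ^ J) ^ Suc j"
    have E: "E > 0" unfolding E_def by (intro zero_less_power) (use L in \<open>auto simp: L_def\<close>)
    \<comment> \<open>The first bound keeps \<open>t'\<close> in \<open>X\<close>; the second makes
      its distance from \<open>t\<close> in the coordinate \<open>a\<close> at most
      \<open>1 / E\<close>, as \<open>iterated_loop\<close> demands.\<close>
    define e where "e = min (r - norm (t - q0)) (\<sigma> / (E * C0))"
    have "e > 0" using tX \<sigma> E C0 by (simp add: e_def)
    moreover have "K * norm (\<xi> t' - \<xi> t) \<le> norm (\<xi> (fold T ss t') - \<xi> (fold T ss t))"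
      if t': "t' \<in> S" "norm (t' - t) < e" "norm (\<eta> t' - \<eta> t) \<le> norm (\<xi> t' - \<xi> t)" for t'
    proof -
      have "norm (t' - q0) < r" using t'(2) norm_triangle_ineq[of "t' - t" "t - q0"] by (simp add: e_def)
      then have t'X: "t' \<in> X" using t' by (simp add: X_def dist_norm norm_minus_commute)
      have "norm (b t' - b t) \<le> norm (a t' - a t)"
        using t'(3) \<sigma> unfolding ab_diff norm_mult \<sigma>_def[symmetric] by simp
      moreover have "E * norm (a t' - a t) \<le> 1"
      proof -
        have "\<sigma> * norm (a t' - a t) \<le> C0 * norm (t' - t)"
          using affine(1)[of t' t q0 q0] unfolding ab_diff by (simp add: norm_mult \<sigma>_def)
        also have "\<dots> \<le> C0 * (\<sigma> / (E * C0))" using t'(2) C0 by (intro mult_left_mono) (auto simp: e_def)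
        also have "\<dots> = \<sigma> * (1 / E)" using C0 by simp
        finally have "norm (a t' - a t) \<le> 1 / E" using \<sigma> by (simp only: mult_le_cancel_left_pos)
        then show ?thesis using E by (simp add: field_simps)
      qed
      ultimately have exp: "rate ^ j * norm (a t' - a t) \<le> norm (a (fold T ss t') - a (fold T ss t))"
        using ss2[rule_format, OF t'X] by (simp only: E_def)
      have "K * norm (a t' - a t) \<le> rate ^ j * norm (a t' - a t)" using j by (intro mult_right_mono) auto
      then have "K * norm (a t' - a t) \<le> norm (a (fold T ss t') - a (fold T ss t))" using exp by linarith
      from mult_left_mono[OF this, of \<sigma>] show ?thesis
        using \<sigma> unfolding ab_diff norm_mult \<sigma>_def[symmetric] by (simp add: mult_ac)
    qed
    moreover have "fold T ss t \<in> ball q0 \<rho>0" using ss X_ball(2) unfolding region_def by blast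
    ultimately show ?thesis using GT by blast
  qed
  ultimately show ?thesis by blast
qed

section \<open>The saddle at a vertex\<close>

definition loc_lip :: "complex3 \<Rightarrow> (complex3 \<Rightarrow> complex) \<Rightarrow> bool" where
  "loc_lip q0 f \<longleftrightarrow> (\<exists>K\<ge>0. \<forall>p\<in>ball q0 1. \<forall>q\<in>ball q0 1. norm (f p - f q) \<le> K * norm (p - q))"

lemma loc_lip_bounded:
  assumes "loc_lip q0 f"
  obtains M where "M \<ge> 0" "\<And>p. p \<in> ball q0 1 \<Longrightarrow> norm (f p) \<le> M"
proof -
  obtain K where K: "K \<ge> 0" "\<And>p q. p \<in> ball q0 1 \<Longrightarrow> q \<in> ball q0 1 \<Longrightarrow> norm (f p - f q) \<le> K * norm (p - q)"
    using assms unfolding loc_lip_def by blast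
  show ?thesis
  proof (rule that[of "norm (f q0) + K"])
    fix p assume p: "p \<in> ball q0 1"
    have "norm (f p - f q0) \<le> K * norm (p - q0)" using K(2)[OF p, of q0] by simp
    also have "\<dots> \<le> K * 1" using p K(1) by (intro mult_left_mono) (auto simp: dist_norm norm_minus_commute)
    finally show "norm (f p) \<le> norm (f q0) + K" using norm_triangle_sub[of "f p" "f q0"] by linarith
  qed (use K in auto)
qed

lemma norm_mult_diff_le:
  fixes a b c d :: complex
  shows "norm (a * b - c * d) \<le> norm a * norm (b - d) + norm d * norm (a - c)"
proof -
  have "a * b - c * d = a * (b - d) + (a - c) * d" by (simp add: algebra_simps)
  then show ?thesis by (metis norm_mult norm_triangle_ineq mult.commute)
qed

lemma loc_lip_mult:
  assumes "loc_lip q0 f" "loc_lip q0 g"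
  shows "loc_lip q0 (\<lambda>p. f p * g p)"
proof -
  obtain M N where MN: "M \<ge> 0" "\<And>p. p \<in> ball q0 1 \<Longrightarrow> norm (f p) \<le> M"
     "N \<ge> 0" "\<And>p. p \<in> ball q0 1 \<Longrightarrow> norm (g p) \<le> N"
    using loc_lip_bounded assms by metis
  obtain K L where K: "K \<ge> 0" "\<And>p q. p \<in> ball q0 1 \<Longrightarrow> q \<in> ball q0 1 \<Longrightarrow> norm (f p - f q) \<le> K * norm (p - q)"
    and L: "L \<ge> 0" "\<And>p q. p \<in> ball q0 1 \<Longrightarrow> q \<in> ball q0 1 \<Longrightarrow> norm (g p - g q) \<le> L * norm (p - q)"
    using assms unfolding loc_lip_def by blast
  show ?thesis unfolding loc_lip_def
  proof (intro exI[of _ "M * L + N * K"] conjI ballI)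
    fix p q assume pq: "p \<in> ball q0 1" "q \<in> ball q0 1"
    have "norm (f p * g p - f q * g q) \<le> norm (f p) * norm (g p - g q) + norm (g q) * norm (f p - f q)"
      by (rule norm_mult_diff_le)
    also have "\<dots> \<le> M * (L * norm (p - q)) + N * (K * norm (p - q))"
      using MN K L pq by (intro add_mono mult_mono) auto
    finally show "norm (f p * g p - f q * g q) \<le> (M * L + N * K) * norm (p - q)" by (simp add: algebra_simps)
  qed (use MN K L in auto)
qed

lemma loc_lip_add:
  assumes "loc_lip q0 f" "loc_lip q0 g"
  shows "loc_lip q0 (\<lambda>p. f p + g p)"
proof -
  obtain K L where K: "K \<ge> 0" "\<And>p q. p \<in> ball q0 1 \<Longrightarrow> q \<in> ball q0 1 \<Longrightarrow> norm (f p - f q) \<le> K * norm (p - q)"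
    and L: "L \<ge> 0" "\<And>p q. p \<in> ball q0 1 \<Longrightarrow> q \<in> ball q0 1 \<Longrightarrow> norm (g p - g q) \<le> L * norm (p - q)"
    using assms unfolding loc_lip_def by blast
  show ?thesis unfolding loc_lip_def
  proof (intro exI[of _ "K + L"] conjI ballI)
    fix p q assume pq: "p \<in> ball q0 1" "q \<in> ball q0 1"
    have "norm ((f p + g p) - (f q + g q)) \<le> norm (f p - f q) + norm (g p - g q)"
      using norm_triangle_ineq[of "f p - f q" "g p - g q"] by (simp add: algebra_simps)
    then show "norm (f p + g p - (f q + g q)) \<le> (K + L) * norm (p - q)"
      using K(2)[OF pq] L(2)[OF pq] by (simp add: algebra_simps)
  qed (use K L in auto)
qed

lemma loc_lip_const: "loc_lip q0 (\<lambda>_. c)"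
  unfolding loc_lip_def by (intro exI[of _ 0]) auto

lemma loc_lip_diff: "loc_lip q0 f \<Longrightarrow> loc_lip q0 g \<Longrightarrow> loc_lip q0 (\<lambda>p. f p - g p)"
  using loc_lip_add[of q0 f "\<lambda>p. - 1 * g p"] loc_lip_mult[OF loc_lip_const, of q0 g "- 1"] by simp

lemma loc_lip_uminus: "loc_lip q0 f \<Longrightarrow> loc_lip q0 (\<lambda>p. - f p)"
  using loc_lip_mult[OF loc_lip_const, of q0 f "- 1"] by simp

lemma loc_lip_coord: "loc_lip q0 (\<lambda>p. fst p)" "loc_lip q0 (\<lambda>p. fst (snd p))" "loc_lip q0 (\<lambda>p. snd (snd p))"
proof -
  have "norm (fst p - fst q) \<le> 1 * norm (p - q) \<and> norm (fst (snd p) - fst (snd q)) \<le> 1 * norm (p - q) \<and>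
    norm (snd (snd p) - snd (snd q)) \<le> 1 * norm (p - q)" for p q :: complex3
    using norm_coord_le[of "p - q"] by simp
  then show "loc_lip q0 (\<lambda>p. fst p)" "loc_lip q0 (\<lambda>p. fst (snd p))" "loc_lip q0 (\<lambda>p. snd (snd p))"
    unfolding loc_lip_def by (blast intro: zero_le_one)+
qed

lemmas loc_lip_intros = loc_lip_mult loc_lip_add loc_lip_const loc_lip_diff loc_lip_uminus loc_lip_coord

text \<open>The restriction to \<open>S\<close> has strict derivative \<open>0\<close> at \<open>q0\<close>.\<close>

definition flat_at :: "complex3 set \<Rightarrow> complex3 \<Rightarrow> (complex3 \<Rightarrow> complex) \<Rightarrow> bool" where
  "flat_at S q0 f \<longleftrightarrow> (\<forall>\<epsilon>>0. \<exists>\<rho>>0. \<forall>p\<in>S \<inter> ball q0 \<rho>. \<forall>q\<in>S \<inter> ball q0 \<rho>. norm (f p - f q) \<le> \<epsilon> * norm (p - q))"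

lemma flat_atD:
  "flat_at S q0 f \<Longrightarrow> \<epsilon> > 0 \<Longrightarrow>
    \<exists>\<rho>>0. \<forall>p\<in>S \<inter> ball q0 \<rho>. \<forall>q\<in>S \<inter> ball q0 \<rho>. norm (f p - f q) \<le> \<epsilon> * norm (p - q)"
  unfolding flat_at_def by (drule spec[of _ \<epsilon>]) (erule mp)

lemma flat_at_mult_loc_lip:
  assumes f: "flat_at S q0 f" "f q0 = 0" "q0 \<in> S" and g: "loc_lip q0 g"
  shows "flat_at S q0 (\<lambda>p. f p * g p)"
  unfolding flat_at_def
proof (intro allI impI)
  fix \<epsilon> :: real assume "\<epsilon> > 0"
  obtain M where M: "M \<ge> 0" "\<And>p. p \<in> ball q0 1 \<Longrightarrow> norm (g p) \<le> M" using loc_lip_bounded[OF g] by blast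
  obtain K where K: "K \<ge> 0" "\<And>p q. p \<in> ball q0 1 \<Longrightarrow> q \<in> ball q0 1 \<Longrightarrow> norm (g p - g q) \<le> K * norm (p - q)"
    using g unfolding loc_lip_def by blast
  define e where "e = \<epsilon> / (K + M + 1)"
  have e: "e > 0" using \<open>\<epsilon> > 0\<close> K M by (simp add: e_def add_nonneg_pos)
  obtain \<rho> where \<rho>: "\<rho> > 0" "\<And>p q. p \<in> S \<inter> ball q0 \<rho> \<Longrightarrow> q \<in> S \<inter> ball q0 \<rho> \<Longrightarrow> norm (f p - f q) \<le> e * norm (p - q)"
    using f(1) e unfolding flat_at_def by blast
  show "\<exists>\<rho>>0. \<forall>p\<in>S \<inter> ball q0 \<rho>. \<forall>q\<in>S \<inter> ball q0 \<rho>. norm (f p * g p - f q * g q) \<le> \<epsilon> * norm (p - q)"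
  proof (intro exI[of _ "min \<rho> 1"] conjI ballI)
    fix p q assume p: "p \<in> S \<inter> ball q0 (min \<rho> 1)" and q: "q \<in> S \<inter> ball q0 (min \<rho> 1)"
    have "norm (f p - f q0) \<le> e * norm (p - q0)" using p f(3) \<rho> by (intro \<rho>(2)) auto
    also have "\<dots> \<le> e * 1" using p e by (intro mult_left_mono) (auto simp: dist_norm norm_minus_commute)
    finally have fp: "norm (f p) \<le> e" using f(2) by simp
    have "norm (f p * g p - f q * g q) \<le> norm (f p) * norm (g p - g q) + norm (g q) * norm (f p - f q)"
      by (rule norm_mult_diff_le)
    also have "\<dots> \<le> e * (K * norm (p - q)) + M * (e * norm (p - q))"
      using fp p q K M \<rho> e by (intro add_mono mult_mono) auto
    also have "\<dots> = e * (K + M) * norm (p - q)" by (simp add: algebra_simps)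
    also have "\<dots> \<le> e * (K + M + 1) * norm (p - q)"
      using e by (intro mult_right_mono mult_left_mono) auto
    also have "e * (K + M + 1) = \<epsilon>" using K M by (simp add: e_def)
    finally show "norm (f p * g p - f q * g q) \<le> \<epsilon> * norm (p - q)" .
  qed (use \<rho> in auto)
qed

text \<open>Both factors are of order \<open>e\<close> on a ball of radius \<open>e\<close>, so the
  product has a Lipschitz constant of order \<open>e\<close> there.\<close>

lemma flat_at_mult:
  assumes f: "loc_lip q0 f" "f q0 = 0" and g: "loc_lip q0 g" "g q0 = 0"
  shows "flat_at S q0 (\<lambda>p. f p * g p)"
  unfolding flat_at_def
proof (intro allI impI)
  fix \<epsilon> :: real assume "\<epsilon> > 0"
  obtain K where K: "K \<ge> 0" "\<And>p q. p \<in> ball q0 1 \<Longrightarrow> q \<in> ball q0 1 \<Longrightarrow> norm (f p - f q) \<le> K * norm (p - q)"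
    using f unfolding loc_lip_def by blast
  obtain L where L: "L \<ge> 0" "\<And>p q. p \<in> ball q0 1 \<Longrightarrow> q \<in> ball q0 1 \<Longrightarrow> norm (g p - g q) \<le> L * norm (p - q)"
    using g unfolding loc_lip_def by blast
  define e where "e = \<epsilon> / (2 * K * L + 1)"
  have KL: "2 * K * L + 1 > 0" using K L by (simp add: add_nonneg_pos)
  have e: "e > 0" using \<open>\<epsilon> > 0\<close> KL by (simp add: e_def)
  show "\<exists>\<rho>>0. \<forall>p\<in>S \<inter> ball q0 \<rho>. \<forall>q\<in>S \<inter> ball q0 \<rho>. norm (f p * g p - f q * g q) \<le> \<epsilon> * norm (p - q)"
  proof (intro exI[of _ "min e 1"] conjI ballI)
    fix p q assume p: "p \<in> S \<inter> ball q0 (min e 1)" and q: "q \<in> S \<inter> ball q0 (min e 1)"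
    have "norm (f p) \<le> K * norm (p - q0)" using K(2)[of p q0] p f by auto
    also have "\<dots> \<le> K * e" using p K by (intro mult_left_mono) (auto simp: dist_norm norm_minus_commute)
    finally have fp: "norm (f p) \<le> K * e" .
    have "norm (g q) \<le> L * norm (q - q0)" using L(2)[of q q0] q g by auto
    also have "\<dots> \<le> L * e" using q L by (intro mult_left_mono) (auto simp: dist_norm norm_minus_commute)
    finally have gq: "norm (g q) \<le> L * e" .
    have "norm (f p * g p - f q * g q) \<le> norm (f p) * norm (g p - g q) + norm (g q) * norm (f p - f q)"
      by (rule norm_mult_diff_le)
    also have "\<dots> \<le> (K * e) * (L * norm (p - q)) + (L * e) * (K * norm (p - q))"
      using fp gq p q K L e by (intro add_mono mult_mono) auto
    also have "\<dots> = e * (2 * K * L) * norm (p - q)" by (simp add: algebra_simps)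
    also have "\<dots> \<le> e * (2 * K * L + 1) * norm (p - q)"
      using e by (intro mult_right_mono mult_left_mono) auto
    also have "e * (2 * K * L + 1) = \<epsilon>" using KL by (simp add: e_def)
    finally show "norm (f p * g p - f q * g q) \<le> \<epsilon> * norm (p - q)" .
  qed (use e in auto)
qed

lemma flat_at_add:
  assumes "flat_at S q0 f" "flat_at S q0 g"
  shows "flat_at S q0 (\<lambda>p. f p + g p)"
  unfolding flat_at_def
proof (intro allI impI)
  fix \<epsilon> :: real assume "\<epsilon> > 0"
  then have e: "\<epsilon> / 2 > 0" by simp
  obtain \<rho> where \<rho>: "\<rho> > 0" "\<And>p q. p \<in> S \<inter> ball q0 \<rho> \<Longrightarrow> q \<in> S \<inter> ball q0 \<rho> \<Longrightarrow> norm (f p - f q) \<le> \<epsilon> / 2 * norm (p - q)"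
    using assms(1) e unfolding flat_at_def by blast
  obtain \<rho>' where \<rho>': "\<rho>' > 0" "\<And>p q. p \<in> S \<inter> ball q0 \<rho>' \<Longrightarrow> q \<in> S \<inter> ball q0 \<rho>' \<Longrightarrow> norm (g p - g q) \<le> \<epsilon> / 2 * norm (p - q)"
    using assms(2) e unfolding flat_at_def by blast
  show "\<exists>\<rho>>0. \<forall>p\<in>S \<inter> ball q0 \<rho>. \<forall>q\<in>S \<inter> ball q0 \<rho>. norm (f p + g p - (f q + g q)) \<le> \<epsilon> * norm (p - q)"
  proof (intro exI[of _ "min \<rho> \<rho>'"] conjI ballI)
    fix p q assume pq: "p \<in> S \<inter> ball q0 (min \<rho> \<rho>')" "q \<in> S \<inter> ball q0 (min \<rho> \<rho>')"
    have "norm (f p - f q) \<le> \<epsilon> / 2 * norm (p - q)" "norm (g p - g q) \<le> \<epsilon> / 2 * norm (p - q)"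
      using pq by (intro \<rho>(2) \<rho>'(2); simp)+
    moreover have "f p + g p - (f q + g q) = (f p - f q) + (g p - g q)" by simp
    ultimately show "norm (f p + g p - (f q + g q)) \<le> \<epsilon> * norm (p - q)"
      using norm_triangle_ineq[of "f p - f q" "g p - g q"] by (simp only:)
  qed (use \<rho> \<rho>' in auto)
qed

lemma flat_at_cmult:
  assumes "flat_at S q0 f"
  shows "flat_at S q0 (\<lambda>p. c * f p)"
  unfolding flat_at_def
proof (intro allI impI)
  fix \<epsilon> :: real assume "\<epsilon> > 0"
  then have e: "\<epsilon> / (norm c + 1) > 0" by (simp add: add_nonneg_pos)
  obtain \<rho> where \<rho>: "\<rho> > 0" "\<And>p q. p \<in> S \<inter> ball q0 \<rho> \<Longrightarrow> q \<in> S \<inter> ball q0 \<rho> \<Longrightarrow> norm (f p - f q) \<le> \<epsilon> / (norm c + 1) * norm (p - q)"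
    using assms(1) e unfolding flat_at_def by blast
  show "\<exists>\<rho>>0. \<forall>p\<in>S \<inter> ball q0 \<rho>. \<forall>q\<in>S \<inter> ball q0 \<rho>. norm (c * f p - c * f q) \<le> \<epsilon> * norm (p - q)"
  proof (intro exI[of _ \<rho>] conjI ballI)
    fix p q assume pq: "p \<in> S \<inter> ball q0 \<rho>" "q \<in> S \<inter> ball q0 \<rho>"
    have "norm (c * f p - c * f q) = norm c * norm (f p - f q)" by (simp add: norm_mult flip: right_diff_distrib)
    also have "\<dots> \<le> (norm c + 1) * (\<epsilon> / (norm c + 1) * norm (p - q))"
      using \<rho>(2)[OF pq] by (intro mult_mono) auto
    also have "\<dots> = \<epsilon> * norm (p - q)" by (simp add: add_nonneg_eq_0_iff)
    finally show "norm (c * f p - c * f q) \<le> \<epsilon> * norm (p - q)" .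
  qed (use \<rho> in auto)
qed

text \<open>A point \<open>q0\<close> fixed by \<open>s\<^sub>y\<close> and \<open>s\<^sub>z\<close> but not by \<open>s\<^sub>x\<close>: the surface is tangent to the fibre of
  \<open>x\<close> there, and \<open>y\<close>, \<open>z\<close> are local coordinates.\<close>

locale vertex =
  fixes A B C D x0 y0 z0 :: complex
  assumes BC: "B = 2 * y0 + x0 * z0" "C = 2 * z0 + x0 * y0"
    and on_surface: "(x0, y0, z0) \<in> cubic_surface A B C D"
    and smooth: "2 * x0 + y0 * z0 \<noteq> A"
    and im: "Im (x0\<^sup>2) \<noteq> 0"
begin

abbreviation "S \<equiv> cubic_surface A B C D"
abbreviation "q0 \<equiv> (x0, y0, z0)"

lemma x0: "x0 \<noteq> 0"
  using im by auto

text \<open>For \<nu> + 1/\<nu> = x0^2 - 2 this is an eigenfunction with eigenvalue \<nu> of the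
  affine map that \<open>g_x\<close> induces on the plane x = x0.\<close>

definition lin :: "complex \<Rightarrow> complex3 \<Rightarrow> complex" where
  "lin \<nu> p = x0 * (fst (snd p) - y0) + (1 + \<nu>) * (snd (snd p) - z0)"

text \<open>The y- and z-derivatives of the surface equation vanish at the vertex, so the equation
  expresses x - x0, times the nonzero x-derivative, by terms of second order.\<close>

lemma flat_x: "flat_at S q0 (\<lambda>p. fst p - x0)"
proof -
  let ?X = "\<lambda>p :: complex3. fst p - x0" and ?Y = "\<lambda>p :: complex3. fst (snd p) - y0"
    and ?Z = "\<lambda>p :: complex3. snd (snd p) - z0"
  let ?b = "2 * x0 + y0 * z0 - A"
  define F where "F p = (- 1 / ?b) * (?X p * (?X p + y0 * ?Z p + z0 * ?Y p + ?Y p * ?Z p) +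
      ?Y p * (?Y p + x0 * ?Z p) + ?Z p * ?Z p)" for p
  have "flat_at S q0 F" unfolding F_def
    by (intro flat_at_cmult flat_at_add flat_at_mult loc_lip_intros) auto
  moreover have "?X p = F p" if "p \<in> S" for p
  proof -
    obtain x y z where p: "p = (x, y, z)" by (cases p)
    have "x\<^sup>2 + y\<^sup>2 + z\<^sup>2 + x * y * z = A * x + B * y + C * z + D"
      "x0\<^sup>2 + y0\<^sup>2 + z0\<^sup>2 + x0 * y0 * z0 = A * x0 + B * y0 + C * z0 + D"
      using that on_surface by (auto simp: p cubic_surface_def)
    then have "?X p * ?b = - (?X p * (?X p + y0 * ?Z p + z0 * ?Y p + ?Y p * ?Z p) + ?Y p * (?Y p + x0 * ?Z p) + ?Z p * ?Z p)"
      unfolding p fst_conv snd_conv BC by algebra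
    then show ?thesis using smooth by (simp add: F_def field_simps)
  qed
  ultimately show ?thesis unfolding flat_at_def by (metis IntE)
qed

lemma lin_zero [simp]: "lin \<nu> q0 = 0"
  by (simp add: lin_def)

lemma lin_affine: "norm ((lin \<nu> p - lin \<nu> q) - (lin \<nu> p' - lin \<nu> q')) \<le> (norm x0 + 1 + norm \<nu>) * norm ((p - q) - (p' - q'))"
proof -
  let ?d = "(p - q) - (p' - q')"
  have "(lin \<nu> p - lin \<nu> q) - (lin \<nu> p' - lin \<nu> q') = x0 * fst (snd ?d) + (1 + \<nu>) * snd (snd ?d)"
    by (simp add: lin_def algebra_simps)
  also have "norm \<dots> \<le> norm x0 * norm (fst (snd ?d)) + norm (1 + \<nu>) * norm (snd (snd ?d))"
    by (metis norm_mult norm_triangle_ineq)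
  also have "\<dots> \<le> norm x0 * norm ?d + (1 + norm \<nu>) * norm ?d"
    using norm_coord_le[of ?d] norm_triangle_ineq[of 1 \<nu>] by (intro add_mono mult_mono) auto
  finally show ?thesis by (simp add: algebra_simps)
qed

text \<open>Off the plane x = x0 the eigenfunction property fails by a multiple of x - x0, which is
  of second order on the surface.\<close>

lemma lin_g:
  assumes \<nu>: "\<nu> \<noteq> 0" "\<nu> + 1 / \<nu> = x0\<^sup>2 - 2"
  shows "lin \<nu> (act A B C [LZ, LY] p) = \<nu> * lin \<nu> p +
      (fst p - x0) * (\<nu> * x0 * snd (snd p) - (1 + \<nu>) * (- fst (snd p) - fst p * snd (snd p) + B))"
    and "lin \<nu> (act A B C [LY, LZ] p) = lin \<nu> p / \<nu> +
      (fst p - x0) * ((1 + \<nu>) / \<nu> * fst (snd p) - x0 * (- snd (snd p) - fst p * fst (snd p) + C))"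
proof -
  obtain x y z where p: "p = (x, y, z)" by (cases p)
  have r: "\<nu>\<^sup>2 + 1 = (x0\<^sup>2 - 2) * \<nu>" using \<nu> by (simp add: field_simps power2_eq_square)
  show "lin \<nu> (act A B C [LZ, LY] p) = \<nu> * lin \<nu> p +
      (fst p - x0) * (\<nu> * x0 * snd (snd p) - (1 + \<nu>) * (- fst (snd p) - fst p * snd (snd p) + B))"
    using r by (simp add: p lin_def s_y_def s_z_def BC) algebra
  have "\<nu> * lin \<nu> (act A B C [LY, LZ] p) = lin \<nu> p +
      (fst p - x0) * ((1 + \<nu>) * fst (snd p) - \<nu> * x0 * (- snd (snd p) - fst p * fst (snd p) + C))"
    using r by (simp add: p lin_def s_y_def s_z_def BC) algebra
  then have "lin \<nu> (act A B C [LY, LZ] p) = (lin \<nu> p +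
      (fst p - x0) * ((1 + \<nu>) * fst (snd p) - \<nu> * x0 * (- snd (snd p) - fst p * fst (snd p) + C))) / \<nu>"
    using \<nu>(1) by (simp add: nonzero_eq_divide_eq mult.commute)
  also have "\<dots> = lin \<nu> p / \<nu> +
      (fst p - x0) * ((1 + \<nu>) / \<nu> * fst (snd p) - x0 * (- snd (snd p) - fst p * fst (snd p) + C))"
    using \<nu>(1) by (simp add: field_simps)
  finally show "lin \<nu> (act A B C [LY, LZ] p) = lin \<nu> p / \<nu> +
      (fst p - x0) * ((1 + \<nu>) / \<nu> * fst (snd p) - x0 * (- snd (snd p) - fst p * fst (snd p) + C))" .
qed

lemma lin_g_flat:
  assumes \<nu>: "\<nu> \<noteq> 0" "\<nu> + 1 / \<nu> = x0\<^sup>2 - 2"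
  shows "flat_at S q0 (\<lambda>p. lin \<nu> (act A B C [LZ, LY] p) - \<nu> * lin \<nu> p)"
    and "flat_at S q0 (\<lambda>p. lin \<nu> (act A B C [LY, LZ] p) - lin \<nu> p / \<nu>)"
  unfolding lin_g[OF \<nu>] add_diff_cancel_left'
  by (intro flat_at_mult_loc_lip flat_x on_surface loc_lip_intros; simp)+

text \<open>The solutions of \<mu> + 1/\<mu> = t are some w and 1/w. A solution that is real or of
  modulus one would make t real, contrary to \<open>Im (x0\<^sup>2) \<noteq> 0\<close>; so one of
  the two lies outside the unit circle.\<close>

lemma exists_multiplier:
  obtains \<mu> where "norm \<mu> > 1" "Im \<mu> \<noteq> 0" "\<mu> + 1 / \<mu> = x0\<^sup>2 - 2"
proof -
  define t where "t = x0\<^sup>2 - 2"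
  have t: "Im t \<noteq> 0" using im by (simp add: t_def)
  define w where "w = (t + csqrt (t\<^sup>2 - 4)) / 2"
  have "2 * w - t = csqrt (t\<^sup>2 - 4)" by (simp add: w_def field_simps)
  then have "(2 * w - t)\<^sup>2 = t\<^sup>2 - 4" by simp
  then have "4 * (w * (t - w)) = 4 * 1" by algebra
  then have w: "w * (t - w) = 1" by simp
  then have "w \<noteq> 0" by auto
  moreover from this have "t - w = 1 / w" using w by (simp add: nonzero_eq_divide_eq mult.commute)
  ultimately have w0: "w \<noteq> 0" "t - w = 1 / w" by auto
  have sum: "w + 1 / w = t" using w0 by (simp add: algebra_simps)
  have n1: "norm v \<noteq> 1" and im: "Im v \<noteq> 0" if "v + 1 / v = t" for v
  proof -
    show "norm v \<noteq> 1"
    proof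
      assume "norm v = 1"
      then have "1 / v = cnj v" by (metis complex_div_cnj complex_norm_square div_by_1 mult_1 of_real_1 one_power2 norm_one)
      then have "t = v + cnj v" using that by simp
      then have "Im t = 0" by simp
      then show False using t by simp
    qed
    show "Im v \<noteq> 0"
    proof
      assume "Im v = 0"
      then have "v = of_real (Re v)" by (simp add: complex_eq_iff)
      then have "t = of_real (Re v + 1 / Re v)" using that by (metis of_real_1 of_real_add of_real_divide)
      then have "Im t = 0" by simp
      then show False using t by simp
    qed
  qed
  show ?thesis
  proof (cases "norm w > 1")
    case True
    then show ?thesis using that[of w] im[OF sum] sum by (simp add: t_def)
  next
    case False
    then have "norm w < 1" using n1[OF sum] by linarith
    then have "norm (1 / w) > 1" using w0 by (simp add: norm_divide)
    moreover have "1 / w + 1 / (1 / w) = t" using sum by (simp add: add.commute)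
    ultimately show ?thesis using that[of "1 / w"] im[of "1 / w"] by (simp add: t_def)
  qed
qed

text \<open>The two linear forms are independent in y and z since \<mu> differs from 1/\<mu> and x0
  is nonzero; the difference in x is at most half of the total by \<open>flat_x\<close> and is
  absorbed on the left.\<close>

lemma chart:
  assumes \<mu>: "norm \<mu> > 1"
  obtains K \<rho> where "K \<ge> 1" "\<rho> > 0" "\<And>p q. p \<in> S \<inter> ball q0 \<rho> \<Longrightarrow> q \<in> S \<inter> ball q0 \<rho> \<Longrightarrow>
    norm (p - q) \<le> K * max (norm (lin \<mu> p - lin \<mu> q)) (norm (lin (1 / \<mu>) p - lin (1 / \<mu>) q))"
proof -
  have "\<exists>\<rho>>0. \<forall>p\<in>S \<inter> ball q0 \<rho>. \<forall>q\<in>S \<inter> ball q0 \<rho>.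
      norm ((fst p - x0) - (fst q - x0)) \<le> 1 / 2 * norm (p - q)"
    by (rule flat_x[unfolded flat_at_def, rule_format]) simp
  then obtain \<rho> where \<rho>0: "\<rho> > 0" and flat: "\<forall>p\<in>S \<inter> ball q0 \<rho>. \<forall>q\<in>S \<inter> ball q0 \<rho>.
      norm ((fst p - x0) - (fst q - x0)) \<le> 1 / 2 * norm (p - q)"
    by (elim exE conjE) (rule that)
  have \<rho>: "\<rho> > 0" "norm ((fst p - x0) - (fst q - x0)) \<le> 1 / 2 * norm (p - q)"
    if "p \<in> S \<inter> ball q0 \<rho>" "q \<in> S \<inter> ball q0 \<rho>" for p q
    using flat[rule_format, OF that] \<rho>0 by auto
  define d where "d = \<mu> - 1 / \<mu>"
  have "norm (1 / \<mu>) < norm \<mu>"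
  proof -
    have "1 / norm \<mu> < 1 / 1" using \<mu> by (intro divide_strict_left_mono) auto
    then show ?thesis using \<mu> unfolding norm_divide norm_one by linarith
  qed
  then have d: "d \<noteq> 0" by (auto simp: d_def)
  define k1 where "k1 = 2 / norm d"
  define k2 where "k2 = (1 + (1 + norm \<mu>) * k1) / norm x0"
  have k: "k1 \<ge> 0" "k2 \<ge> 0" by (auto simp: k1_def k2_def intro!: divide_nonneg_nonneg add_nonneg_nonneg mult_nonneg_nonneg)
  show ?thesis
  proof (rule that[of "1 + 2 * (k1 + k2)" \<rho>])
    fix p q assume pq: "p \<in> S \<inter> ball q0 \<rho>" "q \<in> S \<inter> ball q0 \<rho>"
    let ?y = "fst (snd p) - fst (snd q)" and ?z = "snd (snd p) - snd (snd q)"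
    define m where "m = max (norm (lin \<mu> p - lin \<mu> q)) (norm (lin (1 / \<mu>) p - lin (1 / \<mu>) q))"
    have m: "norm (lin \<mu> p - lin \<mu> q) \<le> m" "norm (lin (1 / \<mu>) p - lin (1 / \<mu>) q) \<le> m"
      by (auto simp: m_def)
    then have m0: "m \<ge> 0" using norm_ge_zero order_trans by blast
    have "d * ?z = (lin \<mu> p - lin \<mu> q) - (lin (1 / \<mu>) p - lin (1 / \<mu>) q)"
      by (simp add: lin_def d_def algebra_simps diff_divide_distrib)
    then have "norm d * norm ?z \<le> 2 * m"
      using norm_triangle_ineq4[of "lin \<mu> p - lin \<mu> q" "lin (1 / \<mu>) p - lin (1 / \<mu>) q"] m by (simp add: norm_mult[symmetric])
    then have z: "norm ?z \<le> k1 * m" using d by (simp add: k1_def field_simps)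
    have "x0 * ?y = (lin \<mu> p - lin \<mu> q) - (1 + \<mu>) * ?z"
      by (simp add: lin_def algebra_simps)
    then have "norm x0 * norm ?y \<le> norm (lin \<mu> p - lin \<mu> q) + norm (1 + \<mu>) * norm ?z"
      by (metis norm_mult norm_triangle_ineq4)
    also have "\<dots> \<le> m + (1 + norm \<mu>) * (k1 * m)"
      using m z norm_triangle_ineq[of 1 \<mu>] k m0 by (intro add_mono mult_mono) auto
    finally have y: "norm ?y \<le> k2 * m" using x0 by (simp add: k2_def field_simps)
    have "norm (p - q) \<le> norm (fst p - fst q) + norm ?y + norm ?z"
      using norm_triple_le[of "p - q"] by simp
    also have "norm (fst p - fst q) \<le> 1 / 2 * norm (p - q)" using \<rho>(2)[OF pq] by simp
    finally have "norm (p - q) \<le> 2 * (k1 + k2) * m" using y z by (simp add: algebra_simps)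
    also have "\<dots> \<le> (1 + 2 * (k1 + k2)) * m" using m0 by (intro mult_right_mono) auto
    finally show "norm (p - q) \<le> (1 + 2 * (k1 + k2)) * max (norm (lin \<mu> p - lin \<mu> q)) (norm (lin (1 / \<mu>) p - lin (1 / \<mu>) q))"
      by (simp add: m_def)
  qed (use k \<rho>0 in auto)
qed

end

section \<open>Density of the images of the walls\<close>

text \<open>The surface equation is quadratic in x with discriminant
  \<open>\<delta>\<^sup>2 * g s\<close>, where \<open>g 0 = 1\<close>. Near the point the principal
  root of \<open>g\<close> is holomorphic, so x becomes a holomorphic function along any line in the
  (y, z)-plane.\<close>

lemma surface_disc:
  assumes t: "(x, y, z) \<in> cubic_surface A B C D" and d: "2 * x + y * z \<noteq> A"
  obtains r p where "r > 0" "holo_curve (ball 0 r) p" "p 0 = (x, y, z)"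
    "\<And>s. s \<in> ball 0 r \<Longrightarrow> p s \<in> cubic_surface A B C D"
    "\<And>s. snd (p s) = (y + s * u, z + s * v)"
proof -
  define \<beta> where "\<beta> s = (y + s * u) * (z + s * v) - A" for s
  define c where "c s = (y + s * u)\<^sup>2 + (z + s * v)\<^sup>2 - B * (y + s * u) - C * (z + s * v) - D" for s
  define \<delta> where "\<delta> = 2 * x + y * z - A"
  define g where "g s = ((\<beta> s)\<^sup>2 - 4 * c s) / \<delta>\<^sup>2" for s
  have \<delta>: "\<delta> \<noteq> 0" using d by (simp add: \<delta>_def)
  have eq: "x\<^sup>2 + \<beta> 0 * x + c 0 = 0"
    using t by (simp add: cubic_surface_def \<beta>_def c_def algebra_simps)
  have "\<delta> = 2 * x + \<beta> 0" by (simp add: \<delta>_def \<beta>_def)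
  then have "\<delta>\<^sup>2 = (\<beta> 0)\<^sup>2 - 4 * c 0" using eq by algebra
  then have "g 0 = \<delta>\<^sup>2 / \<delta>\<^sup>2" by (simp only: g_def)
  then have g0: "g 0 = 1" using \<delta> by simp
  have g_hol: "g holomorphic_on UNIV"
    unfolding g_def \<beta>_def c_def using \<delta> by (intro holomorphic_intros) auto
  then have "isCont g 0"
    using holomorphic_on_imp_continuous_on continuous_on_eq_continuous_at[OF open_UNIV] by blast
  then obtain r where r: "r > 0" "\<And>s. norm s < r \<Longrightarrow> norm (g s - 1) < 1"
    unfolding continuous_at_eps_delta dist_norm g0 by (metis diff_zero zero_less_one)
  have slit: "g s \<notin> \<real>\<^sub>\<le>\<^sub>0" if "s \<in> ball 0 r" for s
  proof
    assume "g s \<in> \<real>\<^sub>\<le>\<^sub>0"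
    then have "Re (g s) \<le> 0" by (auto simp: complex_nonpos_Reals_iff)
    moreover have "\<bar>Re (g s - 1)\<bar> \<le> norm (g s - 1)" by (rule abs_Re_le_cmod)
    ultimately show False using r(2)[of s] that by simp
  qed
  define p where "p s = ((- \<beta> s + \<delta> * csqrt (g s)) / 2, y + s * u, z + s * v)" for s
  show ?thesis
  proof (rule that[of r p])
    have "(\<lambda>s. csqrt (g s)) holomorphic_on ball 0 r"
      by (rule holomorphic_on_csqrt'[OF holomorphic_on_subset[OF g_hol]]) (use slit in auto)
    moreover have "\<beta> holomorphic_on ball 0 r"
      unfolding \<beta>_def[abs_def] by (intro holomorphic_intros)
    ultimately have "(\<lambda>s. (- \<beta> s + \<delta> * csqrt (g s)) / 2) holomorphic_on ball 0 r"
      by (intro holomorphic_on_divide holomorphic_on_add holomorphic_on_minus holomorphic_on_mult holomorphic_on_const) auto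
    moreover have "(\<lambda>s. y + s * u) holomorphic_on ball 0 r" "(\<lambda>s. z + s * v) holomorphic_on ball 0 r"
      by (intro holomorphic_intros)+
    ultimately show "holo_curve (ball 0 r) p"
      unfolding holo_curve_def p_def fst_conv snd_conv by blast
    show "p 0 = (x, y, z)" using g0 by (simp add: p_def \<delta>_def \<beta>_def)
    show "snd (p s) = (y + s * u, z + s * v)" for s by (simp add: p_def)
    fix s :: complex assume "s \<in> ball 0 r"
    define X where "X = (- \<beta> s + \<delta> * csqrt (g s)) / 2"
    have "2 * X + \<beta> s = \<delta> * csqrt (g s)" by (simp add: X_def field_simps)
    then have "(2 * X + \<beta> s)\<^sup>2 = \<delta>\<^sup>2 * g s" by (simp add: power_mult_distrib)
    also have "\<dots> = (\<beta> s)\<^sup>2 - 4 * c s" using \<delta> by (simp add: g_def)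
    finally have "4 * (X\<^sup>2 + \<beta> s * X + c s) = 4 * 0" by algebra
    then have "X\<^sup>2 + \<beta> s * X + c s = 0" unfolding mult_cancel_left by simp
    moreover have "p s = (X, y + s * u, z + s * v)" by (simp add: p_def X_def)
    ultimately show "p s \<in> cubic_surface A B C D"
      by (simp add: cubic_surface_def \<beta>_def c_def algebra_simps)
  qed (use r in auto)
qed

lemma deriv_lower_bound:
  assumes F: "F field_differentiable (at 0)" and "e > 0"
    and le: "\<And>s. norm s < e \<Longrightarrow> K * norm s \<le> norm (F s - F 0)"
  shows "K \<le> norm (deriv F 0 :: complex)"
proof -
  have "((\<lambda>s. (F s - F 0) / (s - 0)) \<longlongrightarrow> deriv F 0) (at 0)"
    using F field_differentiable_derivI has_field_derivative_iff by blast
  then have "((\<lambda>s. norm ((F s - F 0) / (s - 0))) \<longlongrightarrow> norm (deriv F 0)) (at 0)"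
    by (rule tendsto_norm)
  moreover have "\<forall>\<^sub>F s in at 0. K \<le> norm ((F s - F 0) / (s - 0))"
    unfolding eventually_at
  proof (intro exI[of _ e] conjI ballI impI)
    fix s :: complex assume "s \<noteq> 0 \<and> dist s 0 < e"
    then show "K \<le> norm ((F s - F 0) / (s - 0))"
      using le[of s] by (simp add: norm_divide pos_le_divide_eq)
  qed fact
  ultimately show ?thesis by (intro tendsto_lowerbound) auto
qed

section \<open>Expansion against the Schwarz lemma\<close>

context vertex
begin

definition crosses_real :: "complex3 \<Rightarrow> bool" where
  "crosses_real s \<longleftrightarrow> (\<exists>w. even (length w) \<and>
     (fst (snd (act A B C w s)) \<in> of_real ` {-2..2} \<or> snd (snd (act A B C w s)) \<in> of_real ` {-2..2}))"

text \<open>If no point of \<open>U\<close> has a coordinate in \<open>[-2, 2]\<close> along its orbit, then derivatives along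
  bounded pieces of orbits are uniformly bounded; arbitrarily strong expansion contradicts this.\<close>

lemma expansion_imp_crossing:
  assumes \<nu>: "\<nu> - 1 / \<nu> \<noteq> 0"
    and W: "W \<subseteq> ball q0 \<rho>" and smooth': "\<And>x y z. (x, y, z) \<in> ball q0 \<rho> \<Longrightarrow> 2 * x + y * z \<noteq> A"
    and expand: "\<And>K t. t \<in> W \<inter> S \<Longrightarrow> \<exists>w. even (length w) \<and> act A B C w t \<in> ball q0 \<rho> \<and>
      (\<exists>e>0. \<forall>t'\<in>S. norm (t' - t) < e \<longrightarrow> norm (lin (1 / \<nu>) t' - lin (1 / \<nu>) t) \<le> norm (lin \<nu> t' - lin \<nu> t) \<longrightarrow>
        K * norm (lin \<nu> t' - lin \<nu> t) \<le> norm (lin \<nu> (act A B C w t') - lin \<nu> (act A B C w t)))"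
    and U: "open U" "U \<inter> W \<inter> S \<noteq> {}"
  shows "\<exists>s\<in>U \<inter> S. crosses_real s"
proof (rule ccontr)
  assume no: "\<not> ?thesis"
  obtain x y z where t: "(x, y, z) \<in> U" "(x, y, z) \<in> W" "(x, y, z) \<in> S" using U(2) by auto
  \<comment> \<open>The direction \<open>(u, v)\<close> is chosen so that along the disc
    \<open>lin (1 / \<nu>)\<close> is constant and \<open>lin \<nu>\<close> has derivative one: the
    disc lies in the cone on which expansion is known.\<close>
  define v where "v = 1 / (\<nu> - 1 / \<nu>)"
  define u where "u = - (1 + 1 / \<nu>) * v / x0"
  have uv: "x0 * u + (1 + 1 / \<nu>) * v = 0" "x0 * u + (1 + \<nu>) * v = 1"
  proof -
    show *: "x0 * u + (1 + 1 / \<nu>) * v = 0" using x0 by (simp add: u_def del: minus_add_distrib)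
    have "(1 + \<nu>) * v - (1 + 1 / \<nu>) * v = (\<nu> - 1 / \<nu>) * v" by (simp add: algebra_simps)
    also have "\<dots> = 1" using \<nu> by (simp add: v_def)
    finally show "x0 * u + (1 + \<nu>) * v = 1" using * by (simp add: algebra_simps)
  qed
  have "2 * x + y * z \<noteq> A" using smooth' t(2) W by blast
  from surface_disc[OF t(3) this, of u v] obtain r0 p where p: "r0 > 0" "holo_curve (ball 0 r0) p" "p 0 = (x, y, z)"
    "\<And>s. s \<in> ball 0 r0 \<Longrightarrow> p s \<in> S" "\<And>s. snd (p s) = (y + s * u, z + s * v)"
    by blast
  have "continuous_on (ball 0 r0) (\<lambda>s. (fst (p s), fst (snd (p s)), snd (snd (p s))))"
    using p(2) unfolding holo_curve_def
    by (intro continuous_intros holomorphic_on_imp_continuous_on) auto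
  then have "isCont p 0" using p(1) by (simp add: continuous_on_eq_continuous_at)
  obtain e0 where e0: "e0 > 0" "ball (x, y, z) e0 \<subseteq> U" using U(1) t(1) open_contains_ball by blast
  obtain r1 where r1: "r1 > 0" "\<forall>s. dist s 0 < r1 \<longrightarrow> dist (p s) (p 0) < e0"
    using \<open>isCont p 0\<close>[unfolded continuous_at_eps_delta, rule_format, OF e0(1)] by (elim exE conjE) (rule that)
  have r1': "p s \<in> U" if "norm s < r1" for s
    using r1(2)[rule_format, of s] that e0(2) p(3) by (auto simp: dist_commute)
  define r where "r = min r0 r1"
  have r: "r > 0" using p(1) r1 by (simp add: r_def)
  have in_S: "p s \<in> S" "p s \<in> U" if "s \<in> ball 0 r" for s using that p(4) r1' by (auto simp: r_def)
  have hol_p: "holo_curve (ball 0 r) p"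
    using p(2) unfolding holo_curve_def by (auto simp: r_def elim!: holomorphic_on_subset)
  define R where "R = norm q0 + \<rho>"
  define M where "M = (1 + (R + 1)\<^sup>2) * 2 / r"
  \<comment> \<open>\<open>M\<close> depends on the disc and on \<rho> but not on the word, so an
    expansion factor beyond the Schwarz bound can be prescribed before a word is chosen.\<close>
  define K where "K = (norm x0 + norm (1 + \<nu>)) * M + 1"
  obtain w e where w: "even (length w)" "act A B C w (x, y, z) \<in> ball q0 \<rho>" and e: "e > 0"
    and grow: "\<forall>t'\<in>S. norm (t' - (x, y, z)) < e \<longrightarrow> norm (lin (1 / \<nu>) t' - lin (1 / \<nu>) (x, y, z)) \<le> norm (lin \<nu> t' - lin \<nu> (x, y, z)) \<longrightarrow>
        K * norm (lin \<nu> t' - lin \<nu> (x, y, z)) \<le> norm (lin \<nu> (act A B C w t') - lin \<nu> (act A B C w (x, y, z)))"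
    using expand[of "(x, y, z)" K] t by blast
  define Y where "Y s = fst (snd (act A B C w (p s)))" for s
  define Z where "Z s = snd (snd (act A B C w (p s)))" for s
  have hol: "Y holomorphic_on ball 0 r" "Z holomorphic_on ball 0 r"
    using holo_curve_act[OF hol_p, of A B C w] unfolding holo_curve_def Y_def Z_def by auto
  have avoid: "Y s \<notin> of_real ` {-2..2}" "Z s \<notin> of_real ` {-2..2}" if "s \<in> ball 0 r" for s
    using no in_S[OF that] w(1) unfolding crosses_real_def Y_def Z_def by blast+
  have "norm (act A B C w (x, y, z)) \<le> R"
    using w(2) norm_triangle_sub[of "act A B C w (x, y, z)" q0] by (simp add: R_def dist_norm norm_minus_commute)
  then have bd: "norm (Y 0) \<le> R" "norm (Z 0) \<le> R"
    using norm_coord_le[of "act A B C w (x, y, z)"] unfolding Y_def Z_def p(3) by linarith+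
  have dY: "norm (deriv Y 0) \<le> M" unfolding M_def
    by (rule slit_plane_schwarz[OF hol(1) _ r bd(1)]) (rule avoid)
  have dZ: "norm (deriv Z 0) \<le> M" unfolding M_def
    by (rule slit_plane_schwarz[OF hol(2) _ r bd(2)]) (rule avoid)
  define F where "F s = lin \<nu> (act A B C w (p s))" for s
  have F: "F = (\<lambda>s. x0 * (Y s - y0) + (1 + \<nu>) * (Z s - z0))" by (simp add: fun_eq_iff F_def lin_def Y_def Z_def)
  have "(Y has_field_derivative deriv Y 0) (at 0)" "(Z has_field_derivative deriv Z 0) (at 0)"
    using hol r by (auto intro!: holomorphic_derivI[where S = "ball 0 r"])
  then have dF: "(F has_field_derivative (x0 * deriv Y 0 + (1 + \<nu>) * deriv Z 0)) (at 0)"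
    unfolding F by (auto intro!: derivative_eq_intros)
  have "norm (deriv F 0) \<le> norm x0 * norm (deriv Y 0) + norm (1 + \<nu>) * norm (deriv Z 0)"
    unfolding DERIV_imp_deriv[OF dF] by (metis norm_mult norm_triangle_ineq)
  also have "\<dots> \<le> norm x0 * M + norm (1 + \<nu>) * M" using dY dZ by (intro add_mono mult_left_mono) auto
  also have "\<dots> < K" by (simp add: K_def algebra_simps)
  finally have less: "norm (deriv F 0) < K" .
  obtain r2 where r2: "r2 > 0" "\<forall>s. dist s 0 < r2 \<longrightarrow> dist (p s) (p 0) < e"
    using \<open>isCont p 0\<close>[unfolded continuous_at_eps_delta, rule_format, OF e] by (elim exE conjE) (rule that)
  have r2': "norm (p s - (x, y, z)) < e" if "norm s < r2" for s
    using r2(2)[rule_format, of s] that p(3) by (simp add: dist_norm)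
  have "K \<le> norm (deriv F 0)"
  proof (rule deriv_lower_bound)
    show "F field_differentiable at 0" using dF by (auto simp: field_differentiable_def)
    show "min r2 r > 0" using r2 r by simp
    fix s :: complex assume s: "norm s < min r2 r"
    have lin_p: "lin \<nu>' (p s) - lin \<nu>' (x, y, z) = s * (x0 * u + (1 + \<nu>') * v)" for \<nu>'
      by (simp add: lin_def p(5) algebra_simps)
    note 1 = lin_p[of \<nu>] and 2 = lin_p[of "1 / \<nu>"]
    have "p s \<in> S" "norm (p s - (x, y, z)) < e" using s in_S r2' by auto
    then have "K * norm (lin \<nu> (p s) - lin \<nu> (x, y, z)) \<le> norm (lin \<nu> (act A B C w (p s)) - lin \<nu> (act A B C w (x, y, z)))"
      by (rule grow[rule_format]) (simp add: 1 2 uv)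
    then show "K * norm s \<le> norm (F s - F 0)" unfolding 1 uv F_def p(3) by simp
  qed
  then show False using less by simp
qed

definition moves_near :: "real \<Rightarrow> real \<Rightarrow> letter list \<Rightarrow> bool" where
  "moves_near r \<epsilon> w \<longleftrightarrow> even (length w) \<and> act A B C w q0 \<noteq> q0 \<and>
    (\<forall>f\<in>{act A B C w, act A B C (rev w)}. \<forall>p\<in>ball q0 r. norm (f p - p) \<le> \<epsilon> \<and>
      (\<forall>q\<in>ball q0 r. norm ((f p - p) - (f q - q)) \<le> \<epsilon> * norm (p - q)))"

lemma moves_near_mono: "moves_near r \<epsilon> w \<Longrightarrow> \<epsilon> \<le> \<epsilon>' \<Longrightarrow> moves_near r \<epsilon>' w"
  unfolding moves_near_def by (meson mult_right_mono norm_ge_zero order_trans)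

text \<open>The saddle is \<open>g_x\<close> or its inverse, whichever expands the coordinate that
  dominates the displacements of \<open>q0\<close>; in both cases the multiplier on the coordinate
  named \<xi> is \<nu>.\<close>

lemma dense_crossings_aux:
  assumes \<nu>: "norm \<nu> > 1" "Im \<nu> \<noteq> 0"
    and main: "\<xi> = lin \<nu> \<and> \<eta> = lin (1 / \<nu>) \<and> g = [LZ, LY] \<or> \<xi> = lin (1 / \<nu>) \<and> \<eta> = lin \<nu> \<and> g = [LY, LZ]"
    and sum: "\<nu> + 1 / \<nu> = x0\<^sup>2 - 2" and r: "r > 0"
    and near: "\<And>\<epsilon>. \<epsilon> > 0 \<Longrightarrow> \<exists>w. moves_near r \<epsilon> w \<and> norm (\<eta> (act A B C w q0)) \<le> norm (\<xi> (act A B C w q0))"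
  shows "\<exists>W. open W \<and> q0 \<in> W \<and> (\<forall>U. open U \<longrightarrow> U \<inter> W \<inter> S \<noteq> {} \<longrightarrow> (\<exists>s\<in>U \<inter> S. crosses_real s))"
proof -
  have \<nu>0: "\<nu> \<noteq> 0" using \<nu> by auto
  have ne: "\<nu> - 1 / \<nu> \<noteq> 0"
  proof
    assume "\<nu> - 1 / \<nu> = 0"
    then have "norm \<nu> = norm (1 / \<nu>)" by simp
    then have "norm \<nu> * norm \<nu> = 1" using \<nu>0 by (simp add: norm_divide field_simps)
    then show False using \<nu>(1) by (metis less_1_mult less_irrefl)
  qed
  obtain K0 \<rho>0 where K0: "K0 \<ge> 1" "\<rho>0 > 0" and chart0: "\<And>p q. p \<in> S \<inter> ball q0 \<rho>0 \<Longrightarrow> q \<in> S \<inter> ball q0 \<rho>0 \<Longrightarrow>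
    norm (p - q) \<le> K0 * max (norm (lin \<nu> p - lin \<nu> q)) (norm (lin (1 / \<nu>) p - lin (1 / \<nu>) q))"
    using chart[OF \<nu>(1)] by metis
  define df where "df p = 2 * fst p + fst (snd p) * snd (snd p) - A" for p :: complex3
  have "isCont df q0" unfolding df_def[abs_def] by (intro continuous_intros)
  moreover have df0: "0 < norm (df q0)" using smooth by (simp add: df_def)
  ultimately have "\<exists>d>0. \<forall>p. dist p q0 < d \<longrightarrow> dist (df p) (df q0) < norm (df q0)"
    unfolding continuous_at_eps_delta by simp
  then obtain \<rho>' where \<rho>': "\<rho>' > 0" "\<forall>p. dist p q0 < \<rho>' \<longrightarrow> dist (df p) (df q0) < norm (df q0)"
    by (elim exE conjE) (rule that)
  define \<rho> where "\<rho> = min \<rho>0 \<rho>'"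
  have \<rho>: "\<rho> > 0" using K0 \<rho>' by (simp add: \<rho>_def)
  have smooth': "2 * x + y * z \<noteq> A" if "(x, y, z) \<in> ball q0 \<rho>" for x y z
  proof -
    have "dist (df (x, y, z)) (df q0) < norm (df q0)"
      using \<rho>'(2)[rule_format, of "(x, y, z)"] that by (simp add: \<rho>_def dist_commute)
    then have "df (x, y, z) \<noteq> 0" by (auto simp: dist_norm)
    then show ?thesis by (simp add: df_def)
  qed
  define C0 where "C0 = K0 + (norm x0 + 1 + norm \<nu>) + (norm x0 + 1 + norm (1 / \<nu>))"
  have C0: "C0 \<ge> 1" "C0 \<ge> K0" "C0 \<ge> norm x0 + 1 + norm \<nu>" "C0 \<ge> norm x0 + 1 + norm (1 / \<nu>)"
    using K0 norm_ge_zero[of x0] norm_ge_zero[of \<nu>] norm_ge_zero[of "1 / \<nu>"] unfolding C0_def by linarith+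
  have aff: "norm ((lin \<nu>' p - lin \<nu>' q) - (lin \<nu>' p' - lin \<nu>' q')) \<le> C0 * norm ((p - q) - (p' - q'))"
    if "\<nu>' = \<nu> \<or> \<nu>' = 1 / \<nu>" for \<nu>' p q p' q'
  proof -
    have "norm x0 + 1 + norm \<nu>' \<le> C0" using C0 that by auto
    then show ?thesis by (rule order_trans[OF lin_affine mult_right_mono]) simp
  qed
  have sum': "1 / \<nu> + 1 / (1 / \<nu>) = x0\<^sup>2 - 2" using sum by (simp add: add.commute)
  have inv0: "1 / \<nu> \<noteq> 0" using \<nu>0 by simp
  have fl: "flat_at S q0 (\<lambda>p. \<xi> (act A B C g p) - \<nu> * \<xi> p)" "flat_at S q0 (\<lambda>p. \<eta> (act A B C g p) - \<eta> p / \<nu>)"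
    using main lin_g_flat[OF \<nu>0 sum] lin_g_flat[OF inv0 sum'] by (auto simp: mult.commute)
  have chart1: "norm (p - q) \<le> C0 * max (norm (\<xi> p - \<xi> q)) (norm (\<eta> p - \<eta> q))"
    if "p \<in> S \<inter> ball q0 \<rho>" "q \<in> S \<inter> ball q0 \<rho>" for p q
  proof -
    have "norm (p - q) \<le> K0 * max (norm (lin \<nu> p - lin \<nu> q)) (norm (lin (1 / \<nu>) p - lin (1 / \<nu>) q))"
      using that by (intro chart0) (auto simp: \<rho>_def)
    also have "\<dots> \<le> C0 * max (norm (lin \<nu> p - lin \<nu> q)) (norm (lin (1 / \<nu>) p - lin (1 / \<nu>) q))"
      using C0 by (intro mult_right_mono) (auto simp: le_max_iff_disj)
    finally show ?thesis using main by (auto simp: max.commute)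
  qed
  define G where "G = {act A B C w | w. even (length w)}"
  have G: "id \<in> G" "act A B C g \<in> G" "f \<in> G \<Longrightarrow> f' \<in> G \<Longrightarrow> f \<circ> f' \<in> G" for f f'
  proof -
    show "id \<in> G" unfolding G_def by (rule CollectI, rule exI[of _ "[]"]) simp
    show "act A B C g \<in> G" unfolding G_def by (rule CollectI, rule exI[of _ g]) (use main in auto)
    assume "f \<in> G" "f' \<in> G"
    then obtain w w' where "f = act A B C w" "f' = act A B C w'" "even (length w)" "even (length w')"
      unfolding G_def by blast
    then show "f \<circ> f' \<in> G" unfolding G_def by (intro CollectI exI[of _ "w @ w'"]) simp
  qed
  have "\<exists>W. open W \<and> q0 \<in> W \<and> W \<subseteq> ball q0 \<rho> \<and> (\<forall>K. \<forall>t\<in>W \<inter> S. \<exists>f\<in>G. f t \<in> ball q0 \<rho> \<and>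
    (\<exists>e>0. \<forall>t'\<in>S. norm (t' - t) < e \<longrightarrow> norm (\<eta> t' - \<eta> t) \<le> norm (\<xi> t' - \<xi> t) \<longrightarrow>
      K * norm (\<xi> t' - \<xi> t) \<le> norm (\<xi> (f t') - \<xi> (f t))))"
  proof (rule steering[OF \<nu>])
    show "q0 \<in> S" by (rule on_surface)
    show "\<xi> q0 = 0" "\<eta> q0 = 0" using main by auto
    show "C0 \<ge> 1" "\<rho> > 0" "r > 0" by fact+
    have "\<xi> = lin \<nu> \<or> \<xi> = lin (1 / \<nu>)" "\<eta> = lin \<nu> \<or> \<eta> = lin (1 / \<nu>)" using main by auto
    then show "norm ((\<xi> p - \<xi> q) - (\<xi> p' - \<xi> q')) \<le> C0 * norm ((p - q) - (p' - q'))"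
      "norm ((\<eta> p - \<eta> q) - (\<eta> p' - \<eta> q')) \<le> C0 * norm ((p - q) - (p' - q'))" for p q p' q'
      using aff[of \<nu> p q p' q'] aff[of "1 / \<nu>" p q p' q'] by auto
    show "norm (p - q) \<le> C0 * max (norm (\<xi> p - \<xi> q)) (norm (\<eta> p - \<eta> q))"
      if "p \<in> S \<inter> ball q0 \<rho>" "q \<in> S \<inter> ball q0 \<rho>" for p q by (rule chart1[OF that])
    show "act A B C g q0 = q0" using main by (auto simp: s_y_def s_z_def BC)
    show "isCont (act A B C g) q0" by (rule isCont_act)
    show "act A B C g p \<in> S" if "p \<in> S" for p using that by simp
    show "id \<in> G" "act A B C g \<in> G" by (rule G)+
    show "f \<circ> f' \<in> G" if "f \<in> G" "f' \<in> G" for f f' by (rule G(3)[OF that])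
  next
    fix \<epsilon> :: real assume \<epsilon>: "\<epsilon> > 0"
    obtain \<rho>1 where \<rho>1: "\<rho>1 > 0" "\<forall>p\<in>S \<inter> ball q0 \<rho>1. \<forall>q\<in>S \<inter> ball q0 \<rho>1.
        norm ((\<xi> (act A B C g p) - \<nu> * \<xi> p) - (\<xi> (act A B C g q) - \<nu> * \<xi> q)) \<le> \<epsilon> * norm (p - q)"
      using flat_atD[OF fl(1) \<epsilon>] by (elim exE conjE) (rule that)
    obtain \<rho>2 where \<rho>2: "\<rho>2 > 0" "\<forall>p\<in>S \<inter> ball q0 \<rho>2. \<forall>q\<in>S \<inter> ball q0 \<rho>2.
        norm ((\<eta> (act A B C g p) - \<eta> p / \<nu>) - (\<eta> (act A B C g q) - \<eta> q / \<nu>)) \<le> \<epsilon> * norm (p - q)"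
      using flat_atD[OF fl(2) \<epsilon>] by (elim exE conjE) (rule that)
    show "\<exists>\<rho>>0. \<forall>p\<in>S \<inter> ball q0 \<rho>. \<forall>q\<in>S \<inter> ball q0 \<rho>.
      norm ((\<xi> (act A B C g p) - \<xi> (act A B C g q)) - \<nu> * (\<xi> p - \<xi> q)) \<le> \<epsilon> * norm (p - q) \<and>
      norm ((\<eta> (act A B C g p) - \<eta> (act A B C g q)) - (\<eta> p - \<eta> q) / \<nu>) \<le> \<epsilon> * norm (p - q)"
    proof (intro exI[of _ "min \<rho>1 \<rho>2"] conjI ballI)
      fix p q assume pq: "p \<in> S \<inter> ball q0 (min \<rho>1 \<rho>2)" "q \<in> S \<inter> ball q0 (min \<rho>1 \<rho>2)"
      show "norm ((\<xi> (act A B C g p) - \<xi> (act A B C g q)) - \<nu> * (\<xi> p - \<xi> q)) \<le> \<epsilon> * norm (p - q)"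
        using \<rho>1(2)[rule_format, of p q] pq by (simp add: algebra_simps)
      show "norm ((\<eta> (act A B C g p) - \<eta> (act A B C g q)) - (\<eta> p - \<eta> q) / \<nu>) \<le> \<epsilon> * norm (p - q)"
        using \<rho>2(2)[rule_format, of p q] pq by (simp add: algebra_simps diff_divide_distrib)
    qed (use \<rho>1 \<rho>2 in auto)
    obtain w where w: "moves_near r \<epsilon> w" "norm (\<eta> (act A B C w q0)) \<le> norm (\<xi> (act A B C w q0))"
      using near[OF \<epsilon>] by blast
    show "\<exists>h\<in>G. \<exists>h'\<in>G. (\<forall>p\<in>S. h p \<in> S \<and> h' p \<in> S) \<and>
      (\<forall>p. h (h' p) = p) \<and> h q0 \<noteq> q0 \<and> norm (\<eta> (h q0)) \<le> norm (\<xi> (h q0)) \<and>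
      (\<forall>f\<in>{h, h'}. \<forall>p\<in>ball q0 r. norm (f p - p) \<le> \<epsilon> \<and>
        (\<forall>q\<in>ball q0 r. norm ((f p - p) - (f q - q)) \<le> \<epsilon> * norm (p - q)))"
    proof (rule bexI[of _ "act A B C w"], rule bexI[of _ "act A B C (rev w)"])
      show "act A B C w \<in> G" using w(1) unfolding G_def moves_near_def by blast
      have "even (length (rev w))" using w(1) by (simp add: moves_near_def)
      then show "act A B C (rev w) \<in> G" unfolding G_def by blast
      show "(\<forall>p\<in>S. act A B C w p \<in> S \<and> act A B C (rev w) p \<in> S) \<and>
        (\<forall>p. act A B C w (act A B C (rev w) p) = p) \<and> act A B C w q0 \<noteq> q0 \<and>
        norm (\<eta> (act A B C w q0)) \<le> norm (\<xi> (act A B C w q0)) \<and>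
        (\<forall>f\<in>{act A B C w, act A B C (rev w)}. \<forall>p\<in>ball q0 r. norm (f p - p) \<le> \<epsilon> \<and>
          (\<forall>q\<in>ball q0 r. norm ((f p - p) - (f q - q)) \<le> \<epsilon> * norm (p - q)))"
        using w(1)[unfolded moves_near_def, THEN conjunct2, THEN conjunct1]
          w(1)[unfolded moves_near_def, THEN conjunct2, THEN conjunct2] w(2)
        by (intro conjI) simp_all
    qed
  qed
  then obtain W where W: "open W" "q0 \<in> W" "W \<subseteq> ball q0 \<rho>" and expand: "\<forall>K. \<forall>t\<in>W \<inter> S. \<exists>f\<in>G. f t \<in> ball q0 \<rho> \<and>
    (\<exists>e>0. \<forall>t'\<in>S. norm (t' - t) < e \<longrightarrow> norm (\<eta> t' - \<eta> t) \<le> norm (\<xi> t' - \<xi> t) \<longrightarrow>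
      K * norm (\<xi> t' - \<xi> t) \<le> norm (\<xi> (f t') - \<xi> (f t)))"
    by (elim exE conjE) (rule that)
  define \<nu>' where "\<nu>' = (if \<xi> = lin \<nu> \<and> \<eta> = lin (1 / \<nu>) then \<nu> else 1 / \<nu>)"
  have \<xi>\<eta>: "\<xi> = lin \<nu>'" "\<eta> = lin (1 / \<nu>')" using main by (auto simp: \<nu>'_def)
  have "\<nu>' - 1 / \<nu>' \<noteq> 0" using ne by (auto simp: \<nu>'_def)
  then have "\<exists>s\<in>U \<inter> S. crosses_real s" if U: "open U" "U \<inter> W \<inter> S \<noteq> {}" for U
  proof (rule expansion_imp_crossing[OF _ W(3) smooth' _ U])
    fix K t assume "t \<in> W \<inter> S"
    then have "\<exists>f\<in>G. f t \<in> ball q0 \<rho> \<and> (\<exists>e>0. \<forall>t'\<in>S. norm (t' - t) < e \<longrightarrow> norm (lin (1 / \<nu>') t' - lin (1 / \<nu>') t) \<le> norm (lin \<nu>' t' - lin \<nu>' t) \<longrightarrow>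
        K * norm (lin \<nu>' t' - lin \<nu>' t) \<le> norm (lin \<nu>' (f t') - lin \<nu>' (f t)))"
      using expand[rule_format, of t K] unfolding \<xi>\<eta> by simp
    then obtain f where f: "f \<in> G" "f t \<in> ball q0 \<rho> \<and> (\<exists>e>0. \<forall>t'\<in>S. norm (t' - t) < e \<longrightarrow> norm (lin (1 / \<nu>') t' - lin (1 / \<nu>') t) \<le> norm (lin \<nu>' t' - lin \<nu>' t) \<longrightarrow>
        K * norm (lin \<nu>' t' - lin \<nu>' t) \<le> norm (lin \<nu>' (f t') - lin \<nu>' (f t)))"
      by (elim bexE) (rule that)
    obtain w where w: "f = act A B C w" "even (length w)" using f(1) unfolding G_def by blast
    show "\<exists>w. even (length w) \<and> act A B C w t \<in> ball q0 \<rho> \<and>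
      (\<exists>e>0. \<forall>t'\<in>S. norm (t' - t) < e \<longrightarrow> norm (lin (1 / \<nu>') t' - lin (1 / \<nu>') t) \<le> norm (lin \<nu>' t' - lin \<nu>' t) \<longrightarrow>
        K * norm (lin \<nu>' t' - lin \<nu>' t) \<le> norm (lin \<nu>' (act A B C w t') - lin \<nu>' (act A B C w t)))"
      using f(2) w(2) unfolding w(1) by (intro exI[of _ w]) (rule conjI)
  qed
  with W(1,2) show ?thesis by blast
qed

text \<open>Steering needs, for every \<epsilon>, a displacement dominated by the expanding
  coordinate. If those dominated by \<open>lin \<mu>\<close> stop occurring below some
  \<open>\<epsilon>1\<close>, all smaller ones are dominated by \<open>lin (1 / \<mu>)\<close>, the
  expanding coordinate of the inverse saddle.\<close>

theorem dense_crossings: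
  assumes r: "r > 0" and near: "\<And>\<epsilon>. \<epsilon> > 0 \<Longrightarrow> \<exists>w. moves_near r \<epsilon> w"
  shows "\<exists>W. open W \<and> q0 \<in> W \<and> (\<forall>U. open U \<longrightarrow> U \<inter> W \<inter> S \<noteq> {} \<longrightarrow> (\<exists>s\<in>U \<inter> S. crosses_real s))"
proof -
  obtain \<mu> where \<mu>: "norm \<mu> > 1" "Im \<mu> \<noteq> 0" "\<mu> + 1 / \<mu> = x0\<^sup>2 - 2" by (rule exists_multiplier)
  let ?le = "\<lambda>w. norm (lin (1 / \<mu>) (act A B C w q0)) \<le> norm (lin \<mu> (act A B C w q0))"
  let ?ge = "\<lambda>w. norm (lin \<mu> (act A B C w q0)) \<le> norm (lin (1 / \<mu>) (act A B C w q0))"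
  show ?thesis
  proof (cases "\<forall>\<epsilon>>0. \<exists>w. moves_near r \<epsilon> w \<and> ?le w")
    case True
    then show ?thesis
      by (intro dense_crossings_aux[OF \<mu>(1,2) _ \<mu>(3) r, of "lin \<mu>" "lin (1 / \<mu>)" "[LZ, LY]"]) auto
  next
    case False
    then obtain \<epsilon>1 where \<epsilon>1: "\<epsilon>1 > 0" "\<And>w. moves_near r \<epsilon>1 w \<Longrightarrow> \<not> ?le w" by blast
    have "\<exists>w. moves_near r \<epsilon> w \<and> ?ge w" if "\<epsilon> > 0" for \<epsilon>
    proof -
      have *: "min \<epsilon> \<epsilon>1 > 0" using that \<epsilon>1(1) by simp
      obtain w where w: "moves_near r (min \<epsilon> \<epsilon>1) w" using near[OF *] by blast
      have "moves_near r \<epsilon> w" "moves_near r \<epsilon>1 w" using moves_near_mono[OF w] by auto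
      then show ?thesis using \<epsilon>1(2)[of w] by (intro exI[of _ w]) simp
    qed
    then show ?thesis
      by (intro dense_crossings_aux[OF \<mu>(1,2) _ \<mu>(3) r, of "lin (1 / \<mu>)" "lin \<mu>" "[LY, LZ]"]) auto
  qed
qed

end

section \<open>The rational fibrations\<close>

text \<open>On the fibre over x this is (4 - x^2) times the product of the coordinates u and v
  introduced below. For x^2 other than 4 it vanishes where the conic degenerates into two lines; as
  a polynomial in x it is monic of degree four.\<close>

definition fibre_energy :: "complex \<Rightarrow> complex \<Rightarrow> complex \<Rightarrow> complex \<Rightarrow> complex \<Rightarrow> complex" where
  "fibre_energy A B C D x = (D + A * x - x\<^sup>2) * (4 - x\<^sup>2) + B\<^sup>2 + C\<^sup>2 - x * B * C"

text \<open>On the fibre over \<open>x = \<rho> + 1 / \<rho>\<close> the coordinates \<open>u\<close>, \<open>v\<close> below diagonalise \<open>g_x\<close>, with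
  eigenvalues \<open>\<rho>\<^sup>2\<close> and \<open>1 / \<rho>\<^sup>2\<close>, and the surface becomes the hyperbola \<open>uv = const\<close>.\<close>

definition fibre_center :: "complex \<Rightarrow> complex \<Rightarrow> complex \<Rightarrow> complex" where
  "fibre_center B C x = (2 * B - x * C) / (4 - x\<^sup>2)"

definition fibre_point :: "complex \<Rightarrow> complex \<Rightarrow> complex \<Rightarrow> complex \<Rightarrow> complex \<Rightarrow> complex3" where
  "fibre_point B C \<rho> u v = (\<rho> + 1 / \<rho>,
     fibre_center B C (\<rho> + 1 / \<rho>) + (\<rho> * v - u / \<rho>) / (\<rho> - 1 / \<rho>),
     fibre_center C B (\<rho> + 1 / \<rho>) + (u - v) / (\<rho> - 1 / \<rho>))"

definition fibre_u :: "complex \<Rightarrow> complex \<Rightarrow> complex \<Rightarrow> complex3 \<Rightarrow> complex" where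
  "fibre_u B C \<rho> p = (fst (snd p) - fibre_center B C (fst p)) + \<rho> * (snd (snd p) - fibre_center C B (fst p))"

lemma four_minus_square: "\<rho> \<noteq> 0 \<Longrightarrow> 4 - (\<rho> + 1 / \<rho>)\<^sup>2 = - ((\<rho> - 1 / \<rho>)\<^sup>2)" for \<rho> :: complex
  by (simp add: power2_eq_square field_simps)

lemma square_ne_1: "\<rho>\<^sup>2 \<noteq> 1 \<Longrightarrow> \<rho> \<noteq> 0 \<Longrightarrow> \<rho> - 1 / \<rho> \<noteq> 0" for \<rho> :: complex
  by (auto simp: power2_eq_square field_simps)

lemma fibre_center_eqs:
  assumes "x\<^sup>2 \<noteq> 4"
  shows "2 * fibre_center B C x + x * fibre_center C B x = B"
    "2 * fibre_center C B x + x * fibre_center B C x = C"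
    "(4 - x\<^sup>2) * (B * fibre_center B C x + C * fibre_center C B x) = 2 * (B\<^sup>2 + C\<^sup>2 - x * B * C)"
proof -
  define y z where "y = fibre_center B C x" and "z = fibre_center C B x"
  have d: "4 - x\<^sup>2 \<noteq> 0" using assms by auto
  have y: "(4 - x\<^sup>2) * y = 2 * B - x * C" and z: "(4 - x\<^sup>2) * z = 2 * C - x * B"
    using d by (simp_all add: y_def z_def fibre_center_def)
  have "(4 - x\<^sup>2) * (2 * y + x * z) = (4 - x\<^sup>2) * B" "(4 - x\<^sup>2) * (2 * z + x * y) = (4 - x\<^sup>2) * C"
    using y z by algebra+
  then show "2 * fibre_center B C x + x * fibre_center C B x = B"
    "2 * fibre_center C B x + x * fibre_center B C x = C"
    using d unfolding y_def z_def by simp_all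
  show "(4 - x\<^sup>2) * (B * fibre_center B C x + C * fibre_center C B x) = 2 * (B\<^sup>2 + C\<^sup>2 - x * B * C)"
    using y z unfolding y_def[symmetric] z_def[symmetric] by algebra
qed

text \<open>Completing the square in y and z around the centre of the conic; the factor 4 - x^2
  clears the denominators of the centre.\<close>

lemma surface_fibre_iff:
  assumes "x\<^sup>2 \<noteq> 4"
  shows "(x, y, z) \<in> cubic_surface A B C D \<longleftrightarrow>
    (4 - x\<^sup>2) * ((y - fibre_center B C x)\<^sup>2 + (z - fibre_center C B x)\<^sup>2
      + x * (y - fibre_center B C x) * (z - fibre_center C B x)) = fibre_energy A B C D x"
proof -
  define b c where "b = fibre_center B C x" and "c = fibre_center C B x"
  note eqs = fibre_center_eqs[OF assms, where B = B and C = C, folded b_def c_def]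
  define k where "k = (4 - x\<^sup>2) * (x\<^sup>2 + y\<^sup>2 + z\<^sup>2 + x * y * z - (A * x + B * y + C * z + D))"
  have "(4 - x\<^sup>2) * ((y - b)\<^sup>2 + (z - c)\<^sup>2 + x * (y - b) * (z - c)) - fibre_energy A B C D x = k"
  proof -
    define Q where "Q = (y - b)\<^sup>2 + (z - c)\<^sup>2 + x * (y - b) * (z - c)"
    have "2 * Q = 2 * (y\<^sup>2 + z\<^sup>2 + x * y * z - (2 * b + x * c) * y - (2 * c + x * b) * z) + ((2 * b + x * c) * b + (2 * c + x * b) * c)"
      unfolding Q_def by (simp add: power2_eq_square algebra_simps)
    then have "2 * Q = 2 * (y\<^sup>2 + z\<^sup>2 + x * y * z - B * y - C * z) + (B * b + C * c)" unfolding eqs(1,2) .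
    then have "2 * ((4 - x\<^sup>2) * Q - fibre_energy A B C D x) = 2 * k"
      using eqs(3) unfolding k_def fibre_energy_def by algebra
    then show ?thesis unfolding mult_cancel_left by (simp add: Q_def)
  qed
  moreover have "k = 0 \<longleftrightarrow> (x, y, z) \<in> cubic_surface A B C D"
    using assms by (auto simp: k_def cubic_surface_def)
  ultimately show ?thesis unfolding b_def c_def by auto
qed

context
  fixes B C \<rho> :: complex
  assumes \<rho>: "\<rho> \<noteq> 0" "\<rho>\<^sup>2 \<noteq> 1"
begin

lemma x_square_ne_4: "(\<rho> + 1 / \<rho>)\<^sup>2 \<noteq> 4"
proof
  assume "(\<rho> + 1 / \<rho>)\<^sup>2 = 4"
  then have "(\<rho> - 1 / \<rho>)\<^sup>2 = 0" using four_minus_square[OF \<rho>(1)] by simp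
  then show False using square_ne_1[OF \<rho>(2,1)] by simp
qed

lemma fibre_point_step:
  "s_z C (s_y B (fibre_point B C \<rho> u v)) = fibre_point B C \<rho> (\<rho>\<^sup>2 * u) (v / \<rho>\<^sup>2)"
proof -
  define x where "x = \<rho> + 1 / \<rho>"
  define b c where "b = fibre_center B C x" and "c = fibre_center C B x"
  have eqs: "2 * b + x * c = B" "2 * c + x * b = C"
    using fibre_center_eqs[OF x_square_ne_4, where B = B and C = C, folded x_def] by (simp_all add: b_def c_def)
  define d where "d = \<rho> - 1 / \<rho>"
  have d: "d \<noteq> 0" using square_ne_1 \<rho> by (simp add: d_def)
  define Y where "Y = (\<rho> * v - u / \<rho>) / d"
  define Z where "Z = (u - v) / d"
  have 1: "- Y - x * Z = (\<rho> * (- u) - (- v) / \<rho>) / d"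
  proof -
    have "d * (- Y - x * Z) = \<rho> * (- u) - (- v) / \<rho>"
      using d \<rho>(1) by (simp add: Y_def Z_def x_def right_diff_distrib) (simp add: field_simps)
    then show ?thesis using d by (simp add: field_simps)
  qed
  define Y' where "Y' = (v / \<rho> - \<rho> * u) / d"
  have 2: "- Z - x * Y' = (\<rho>\<^sup>2 * u - v / \<rho>\<^sup>2) / d"
  proof -
    have "d * (- Z - x * Y') = \<rho>\<^sup>2 * u - v / \<rho>\<^sup>2"
      using d \<rho>(1) by (simp add: Y'_def Z_def x_def right_diff_distrib) (simp add: power2_eq_square field_simps)
    then show ?thesis using d by (simp add: field_simps)
  qed
  have 3: "(\<rho> * (v / \<rho>\<^sup>2) - \<rho>\<^sup>2 * u / \<rho>) / d = Y'"
    using \<rho>(1) by (simp add: Y'_def power2_eq_square)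
  have "- (b + Y) - x * (c + Z) + B = b + (- Y - x * Z)" by (subst eqs(1)[symmetric]) (simp add: algebra_simps)
  also have "- Y - x * Z = Y'" using 1 by (simp add: Y'_def)
  finally have y': "- (b + Y) - x * (c + Z) + B = b + Y'" .
  have z': "- (c + Z) - x * (b + Y') + C = c + (- Z - x * Y')"
    by (subst eqs(2)[symmetric]) (simp add: algebra_simps)
  have "fibre_point B C \<rho> u v = (x, b + Y, c + Z)"
    by (simp add: fibre_point_def x_def b_def c_def Y_def Z_def d_def)
  moreover have "fibre_point B C \<rho> (\<rho>\<^sup>2 * u) (v / \<rho>\<^sup>2) = (x, b + Y', c + (\<rho>\<^sup>2 * u - v / \<rho>\<^sup>2) / d)"
    using 3 by (simp add: fibre_point_def x_def b_def c_def d_def)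
  ultimately show ?thesis by (simp only: s_y_def s_z_def prod.case y' z' 2)
qed

lemma fibre_point_back:
  "s_y B (s_z C (fibre_point B C \<rho> u v)) = fibre_point B C \<rho> (u / \<rho>\<^sup>2) (\<rho>\<^sup>2 * v)"
proof -
  have "fibre_point B C \<rho> u v = s_z C (s_y B (fibre_point B C \<rho> (u / \<rho>\<^sup>2) (\<rho>\<^sup>2 * v)))"
    unfolding fibre_point_step using \<rho>(1) by simp
  then show ?thesis by simp
qed

lemma fibre_point_eq:
  assumes "fst p = \<rho> + 1 / \<rho>"
  shows "fibre_point B C \<rho> (fibre_u B C \<rho> p) (fibre_u B C (1 / \<rho>) p) = p"
proof -
  obtain y z where p: "p = (\<rho> + 1 / \<rho>, y, z)" using assms by (cases p) auto
  define d where "d = \<rho> - 1 / \<rho>"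
  have d: "d \<noteq> 0" using square_ne_1 \<rho> by (simp add: d_def)
  define Y Z where "Y = y - fibre_center B C (\<rho> + 1 / \<rho>)" and "Z = z - fibre_center C B (\<rho> + 1 / \<rho>)"
  have "\<rho> * (Y + (1 / \<rho>) * Z) - (Y + \<rho> * Z) / \<rho> = Y * d" "(Y + \<rho> * Z) - (Y + (1 / \<rho>) * Z) = Z * d"
    using \<rho>(1) by (simp_all add: d_def field_simps)
  then show ?thesis
    using d by (simp add: p fibre_point_def fibre_u_def flip: d_def Y_def Z_def) (simp add: Y_def Z_def)
qed

lemma fibre_u_product:
  assumes p: "fst p = \<rho> + 1 / \<rho>"
  shows "p \<in> cubic_surface A B C D \<longleftrightarrow>
    (4 - (fst p)\<^sup>2) * (fibre_u B C \<rho> p * fibre_u B C (1 / \<rho>) p) = fibre_energy A B C D (fst p)"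
proof -
  define Y Z where "Y = fst (snd p) - fibre_center B C (fst p)" and "Z = snd (snd p) - fibre_center C B (fst p)"
  have "(Y + \<rho> * Z) * (Y + (1 / \<rho>) * Z) = Y\<^sup>2 + Z\<^sup>2 + (\<rho> + 1 / \<rho>) * Y * Z"
    using \<rho>(1) by (simp add: power2_eq_square field_simps)
  then have "fibre_u B C \<rho> p * fibre_u B C (1 / \<rho>) p = Y\<^sup>2 + Z\<^sup>2 + fst p * Y * Z"
    by (simp add: fibre_u_def Y_def Z_def p)
  then show ?thesis
    using surface_fibre_iff[of "fst p" "fst (snd p)" "snd (snd p)" A B C D] x_square_ne_4
    unfolding Y_def Z_def by (simp add: p del: prod.collapse) (simp flip: p)
qed

lemma fibre_orbit:
  assumes K: "\<And>p. p \<in> K \<Longrightarrow> s_z C (s_y B p) \<in> K" "\<And>p. p \<in> K \<Longrightarrow> s_y B (s_z C p) \<in> K"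
    and p: "fibre_point B C \<rho> u v \<in> K"
  shows "fibre_point B C \<rho> ((\<rho>\<^sup>2) powi k * u) (v / (\<rho>\<^sup>2) powi k) \<in> K"
proof -
  have 1: "fibre_point B C \<rho> ((\<rho>\<^sup>2) ^ n * u) (v / (\<rho>\<^sup>2) ^ n) \<in> K" for n
  proof (induction n)
    case (Suc n)
    then show ?case using K(1)[OF Suc] unfolding fibre_point_step by (simp add: mult_ac)
  qed (use p in simp)
  have 2: "fibre_point B C \<rho> (u / (\<rho>\<^sup>2) ^ n) ((\<rho>\<^sup>2) ^ n * v) \<in> K" for n
  proof (induction n)
    case (Suc n)
    then show ?case using K(2)[OF Suc] unfolding fibre_point_back by (simp add: mult_ac)
  qed (use p in simp)
  show ?thesis
    using 1[of "nat k"] 2[of "nat (- k)"] by (cases "k \<ge> 0") (auto simp: power_int_def field_simps)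
qed

end


section \<open>Rotations of infinite order and fibres close to them\<close>

lemma LIMSEQ_if_less_inverse_Suc:
  fixes X :: "nat \<Rightarrow> 'a::real_normed_vector"
  assumes "\<And>j. norm (X j - L) < 1 / real (Suc j)"
  shows "X \<longlonglongrightarrow> L"
proof -
  have "(\<lambda>j. X j - L) \<longlonglongrightarrow> 0"
    by (rule Lim_null_comparison[OF _ LIMSEQ_Suc[OF lim_1_over_n]]) (intro always_eventually allI less_imp_le assms)
  then show ?thesis by (simp add: LIM_zero_iff)
qed

text \<open>The number \<open>a / (2 * pi)\<close> is irrational, so Kronecker's theorem makes its
  multiples dense modulo one, and continuity of \<open>cis\<close> transfers the density to the
  circle.\<close>

lemma cis_powers_dense:
  assumes "\<And>n. n > 0 \<Longrightarrow> cis a ^ n \<noteq> 1" and "\<epsilon> > 0"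
  shows "\<exists>n. norm (cis a ^ n - cis b) < \<epsilon>"
proof -
  have "isCont (\<lambda>t. exp (\<i> * of_real t)) b" by (intro continuous_intros)
  then have "isCont cis b" by (simp add: cis_conv_exp[abs_def])
  then obtain \<delta> where \<delta>: "\<delta> > 0" "\<And>t. \<bar>t - b\<bar> < \<delta> \<Longrightarrow> norm (cis t - cis b) < \<epsilon>"
    using \<open>\<epsilon> > 0\<close> unfolding continuous_at_eps_delta dist_norm real_norm_def by meson
  define \<theta> where "\<theta> = a / (2 * pi)"
  have "\<theta> \<notin> \<rat>"
  proof
    assume "\<theta> \<in> \<rat>"
    then obtain i j where ij: "j > 0" "\<theta> = of_int i / of_int j" by (meson Rats_cases')
    have ja: "real (nat j) * a = 2 * pi * of_int i" using ij by (simp add: \<theta>_def field_simps)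
    have "cis a ^ nat j = 1" unfolding Complex.DeMoivre ja by simp
    then show False using assms(1)[of "nat j"] ij(1) by simp
  qed
  then obtain h k where k: "k > 0" "\<bar>of_int k * \<theta> - of_int h - b / (2 * pi)\<bar> < \<delta> / (2 * pi)"
    by (rule sequence_of_fractional_parts_is_dense[of \<theta> "\<delta> / (2 * pi)" "b / (2 * pi)"]) (use \<delta>(1) in auto)
  define t where "t = of_int k * a - 2 * pi * of_int h"
  have "t - b = (of_int k * \<theta> - of_int h - b / (2 * pi)) * (2 * pi)" by (simp add: t_def \<theta>_def field_simps)
  then have tb: "\<bar>t - b\<bar> < \<delta>" using k(2) by (simp add: abs_mult pos_less_divide_eq)
  have "cis a ^ nat k = cis (t + 2 * pi * of_int h)" using k(1) unfolding Complex.DeMoivre by (simp add: t_def)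
  also have "\<dots> = cis t" unfolding cis_mult[symmetric] by simp
  finally show ?thesis using \<delta>(2)[OF tb] by (intro exI[of _ "nat k"]) simp
qed

text \<open>Over a real base value \<open>g_x\<close> is a rotation of the fibre, of infinite order if
  \<open>\<rho>\<close> is not a root of unity.\<close>

lemma fibre_circle:
  assumes K: "closed K" "\<And>p. p \<in> K \<Longrightarrow> s_z C (s_y B p) \<in> K" "\<And>p. p \<in> K \<Longrightarrow> s_y B (s_z C p) \<in> K"
    and \<theta>: "\<And>n. n > 0 \<Longrightarrow> cis (2 * \<theta>) ^ n \<noteq> 1"
    and p: "fibre_point B C (cis \<theta>) u v \<in> K"
  shows "fibre_point B C (cis \<theta>) (cis b * u) (v / cis b) \<in> K"
proof -
  have sq: "(cis \<theta>)\<^sup>2 = cis (2 * \<theta>)" by (simp add: power2_eq_square cis_mult)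
  have \<rho>: "cis \<theta> \<noteq> 0" "(cis \<theta>)\<^sup>2 \<noteq> 1" using \<theta>[of 1] by (simp_all add: sq)
  have d: "cis \<theta> - 1 / cis \<theta> \<noteq> 0" using square_ne_1 \<rho> by blast
  have "\<forall>j. \<exists>n. norm (cis (2 * \<theta>) ^ n - cis b) < 1 / real (Suc j)"
    by (intro allI cis_powers_dense \<theta>) auto
  then obtain n where n: "\<And>j. norm (cis (2 * \<theta>) ^ n j - cis b) < 1 / real (Suc j)" by metis
  have lim: "(\<lambda>j. cis (2 * \<theta>) ^ n j) \<longlonglongrightarrow> cis b"
    by (rule LIMSEQ_if_less_inverse_Suc[OF n])
  show ?thesis
  proof (rule closed_sequentially[OF K(1)])
    show "fibre_point B C (cis \<theta>) (cis (2 * \<theta>) ^ n j * u) (v / cis (2 * \<theta>) ^ n j) \<in> K" for j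
      using fibre_orbit[OF \<rho> K(2,3) p, of "int (n j)"] unfolding sq by simp
    show "(\<lambda>j. fibre_point B C (cis \<theta>) (cis (2 * \<theta>) ^ n j * u) (v / cis (2 * \<theta>) ^ n j)) \<longlonglongrightarrow>
      fibre_point B C (cis \<theta>) (cis b * u) (v / cis b)"
      unfolding fibre_point_def using d by (intro tendsto_intros lim) auto
  qed
qed

text \<open>For \<rho> = \<open>cis (arccos (a / 2))\<close>, which satisfies \<rho> + 1/\<rho> = a,
  the second condition says that the multiplier \<rho>^2 of the rotation is not a root of unity; the
  last one says that the conic is nondegenerate.\<close>

definition good_fibre :: "complex \<Rightarrow> complex \<Rightarrow> complex \<Rightarrow> complex \<Rightarrow> real \<Rightarrow> bool" where
  "good_fibre A B C D a \<longleftrightarrow> \<bar>a\<bar> < 2 \<and> (\<forall>n>0. cis (2 * arccos (a / 2)) ^ n \<noteq> 1) \<and>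
     fibre_energy A B C D (of_real a) \<noteq> 0"

text \<open>Taken through \<open>Arccos\<close>, this inverse branch of \<rho> + 1/\<rho> is
  continuous at the points of (-2, 2), where a branch selected by its modulus would jump.\<close>

definition joukowsky_inv :: "complex \<Rightarrow> complex" where
  "joukowsky_inv x = exp (\<i> * Arccos (x / 2))"

lemma joukowsky_inv_nz [simp]: "joukowsky_inv x \<noteq> 0"
  by (simp add: joukowsky_inv_def)

lemma joukowsky_inv_eq: "joukowsky_inv x + 1 / joukowsky_inv x = x"
proof -
  have "x = 2 * cos (Arccos (x / 2))" by simp
  also have "\<dots> = joukowsky_inv x + 1 / joukowsky_inv x"
    unfolding joukowsky_inv_def cos_exp_eq exp_minus by (simp add: field_simps)
  finally show ?thesis by (rule sym)
qed

lemma joukowsky_inv_real: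
  assumes "\<bar>a\<bar> \<le> 2"
  shows "joukowsky_inv (of_real a) = cis (arccos (a / 2))"
  using of_real_arccos[of "a / 2"] assms by (simp add: joukowsky_inv_def cis_conv_exp)

lemma norm_joukowsky_inv:
  assumes "Im x \<noteq> 0"
  shows "norm (joukowsky_inv x) \<noteq> 1" "(joukowsky_inv x)\<^sup>2 \<noteq> 1"
proof -
  show *: "norm (joukowsky_inv x) \<noteq> 1"
  proof
    assume "norm (joukowsky_inv x) = 1"
    then have eq: "1 / joukowsky_inv x = cnj (joukowsky_inv x)" using complex_div_cnj[of 1 "joukowsky_inv x"] by simp
    have "Im (joukowsky_inv x + 1 / joukowsky_inv x) = 0" unfolding eq by simp
    then show False unfolding joukowsky_inv_eq using assms by simp
  qed
  then show "(joukowsky_inv x)\<^sup>2 \<noteq> 1"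
    by (auto simp: power2_eq_1_iff)
qed

lemma isCont_joukowsky_inv: "\<bar>a\<bar> < 2 \<Longrightarrow> isCont joukowsky_inv (of_real a)"
  unfolding joukowsky_inv_def[abs_def] by (intro continuous_intros isCont_Arccos') auto

text \<open>The multipliers \<open>\<rho>\<^sup>2\<close> of nearby fibres over non-real values have modulus different from but
  close to \<open>1\<close>, so suitable powers of \<open>g_x\<close> scale by any prescribed factor in the limit.\<close>

theorem fibre_absorb:
  assumes K: "closed K" "\<And>p. p \<in> K \<Longrightarrow> s_z C (s_y B p) \<in> K" "\<And>p. p \<in> K \<Longrightarrow> s_y B (s_z C p) \<in> K"
    and a: "good_fibre A B C D a"
    and q: "\<And>j. q j \<in> K" "\<And>j. Im (fst (q j)) \<noteq> 0"
    and lim: "q \<longlonglongrightarrow> q'" "q' \<in> cubic_surface A B C D" "fst q' = of_real a"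
    and s: "s \<in> cubic_surface A B C D" "fst s = of_real a"
  shows "s \<in> K"
proof -
  define \<theta> where "\<theta> = arccos (a / 2)"
  define R where "R j = joukowsky_inv (fst (q j))" for j
  have a2: "\<bar>a\<bar> < 2" using a by (simp add: good_fibre_def)
  have \<theta>: "\<And>n. n > 0 \<Longrightarrow> cis (2 * \<theta>) ^ n \<noteq> 1" using a unfolding good_fibre_def \<theta>_def by blast
  have sq: "(cis \<theta>)\<^sup>2 = cis (2 * \<theta>)" by (simp add: power2_eq_square cis_mult)
  have \<rho>: "cis \<theta> \<noteq> 0" "(cis \<theta>)\<^sup>2 \<noteq> 1" using \<theta>[of 1] by (simp_all add: sq)
  have d: "cis \<theta> - 1 / cis \<theta> \<noteq> 0" using square_ne_1 \<rho> by blast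
  have Ja: "joukowsky_inv (of_real a) = cis \<theta>" using joukowsky_inv_real[of a] a2 unfolding \<theta>_def by linarith
  have xa: "of_real a = cis \<theta> + 1 / cis \<theta>" using joukowsky_inv_eq[of "of_real a"] unfolding Ja by (rule sym)
  have a4: "(of_real a :: complex)\<^sup>2 \<noteq> 4" using x_square_ne_4[OF \<rho>] unfolding xa .
  have fst_lim: "(\<lambda>j. fst (q j)) \<longlonglongrightarrow> of_real a" using tendsto_fst[OF lim(1)] lim(3) by simp
  have R_lim: "R \<longlonglongrightarrow> cis \<theta>"
    using isCont_tendsto_compose[OF isCont_joukowsky_inv[OF a2] fst_lim] unfolding R_def[abs_def] Ja .
  have R: "R j \<noteq> 0" "(R j)\<^sup>2 \<noteq> 1" "norm (R j) \<noteq> 1" "fst (q j) = R j + 1 / R j" for j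
    unfolding R_def joukowsky_inv_eq using norm_joukowsky_inv[OF q(2)] by simp_all
  have fu_lim: "(\<lambda>j. fibre_u B C (f (R j)) (q j)) \<longlonglongrightarrow> fibre_u B C (f (cis \<theta>)) q'"
    if "(\<lambda>j. f (R j)) \<longlonglongrightarrow> f (cis \<theta>)" for f
    unfolding fibre_u_def fibre_center_def
    by (intro tendsto_intros that lim(1)) (use a4 in \<open>simp_all add: lim(3)\<close>)
  define u v where "u j = fibre_u B C (R j) (q j)" and "v j = fibre_u B C (1 / R j) (q j)" for j
  define u' v' where "u' = fibre_u B C (cis \<theta>) q'" and "v' = fibre_u B C (1 / cis \<theta>) q'"
  define us vs where "us = fibre_u B C (cis \<theta>) s" and "vs = fibre_u B C (1 / cis \<theta>) s"
  have u_lim: "u \<longlonglongrightarrow> u'" unfolding u_def[abs_def] u'_def using fu_lim[of "\<lambda>r. r"] R_lim by simp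
  have "(\<lambda>j. 1 / R j) \<longlonglongrightarrow> 1 / cis \<theta>" by (intro tendsto_intros R_lim) simp
  then have v_lim: "v \<longlonglongrightarrow> v'" unfolding v_def[abs_def] v'_def using fu_lim[of "\<lambda>r. 1 / r"] by simp
  have E: "(4 - (of_real a)\<^sup>2) * (u' * v') = fibre_energy A B C D (of_real a)"
    "(4 - (of_real a)\<^sup>2) * (us * vs) = fibre_energy A B C D (of_real a)"
    using fibre_u_product[OF \<rho>, of q' A B C D] fibre_u_product[OF \<rho>, of s A B C D] lim s xa
    by (simp_all add: u'_def v'_def us_def vs_def)
  have "fibre_energy A B C D (of_real a) \<noteq> 0" using a by (simp add: good_fibre_def)
  then have nz: "u' \<noteq> 0" "v' \<noteq> 0" "us \<noteq> 0" "vs \<noteq> 0" using E by auto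
  have "(4 - (of_real a)\<^sup>2) * (us * vs) = (4 - (of_real a)\<^sup>2) * (u' * v')" using E by simp
  then have uv: "us * vs = u' * v'" using a4 unfolding mult_cancel_left by auto
  \<comment> \<open>The product of the two coordinates is the same at \<open>s\<close> and
    \<open>q'\<close>, so \<open>s\<close> arises from \<open>q'\<close> by scaling with
    \<open>w\<close> and \<open>1 / w\<close>. It remains to realise this scaling by powers of the
    multipliers.\<close>
  define w where "w = us / u'"
  have w: "w \<noteq> 0" "us = w * u'" "vs = v' / w"
  proof -
    show "w \<noteq> 0" "us = w * u'" using nz by (simp_all add: w_def)
    have "v' / w = (u' * v') / us" using nz by (simp add: w_def)
    also have "\<dots> = vs" unfolding uv[symmetric] using nz by simp
    finally show "vs = v' / w" by simp
  qed
  define b where "b j = ln (norm ((R j)\<^sup>2))" for j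
  have b0: "b j \<noteq> 0" for j
  proof -
    have "norm ((R j)\<^sup>2) \<noteq> 1" using R(3)[of j] norm_ge_zero[of "R j"] unfolding norm_power power2_eq_1_iff by linarith
    then show ?thesis using R(1)[of j] by (simp add: b_def)
  qed
  have "(\<lambda>j. ln (norm ((R j)\<^sup>2))) \<longlonglongrightarrow> ln (norm ((cis \<theta>)\<^sup>2))"
    by (intro tendsto_intros R_lim) simp
  then have b_lim: "b \<longlonglongrightarrow> 0" unfolding b_def[abs_def] by (simp add: norm_power)
  \<comment> \<open>\<open>b j\<close> is nonzero but tends to 0, so an integer multiple of it comes
    within \<open>\<bar>b j\<bar>\<close> of the logarithm of the modulus of
    \<open>w\<close>.\<close>
  define k where "k j = \<lfloor>ln (norm w) / b j\<rfloor>" for j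
  define T where "T j = (R j)\<^sup>2 powi k j" for j
  have T: "norm (T j) = exp (of_int (k j) * b j)" for j
  proof -
    have "norm (T j) = exp (b j) powi k j" using R(1)[of j] by (simp add: T_def b_def norm_power_int)
    then show ?thesis by (simp add: exp_power_int)
  qed
  have kb: "\<bar>of_int (k j) * b j - ln (norm w)\<bar> \<le> \<bar>b j\<bar>" for j
  proof -
    define t where "t = ln (norm w) / b j"
    have "of_int (k j) \<le> t" "t < of_int (k j) + 1" unfolding k_def t_def[symmetric] by linarith+
    then have "\<bar>of_int (k j) - t\<bar> \<le> 1" by linarith
    moreover have "of_int (k j) * b j - ln (norm w) = (of_int (k j) - t) * b j"
      using b0[of j] by (simp add: t_def field_simps)
    ultimately show ?thesis by (simp add: abs_mult mult_left_le_one_le)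
  qed
  have "(\<lambda>j. of_int (k j) * b j - ln (norm w)) \<longlonglongrightarrow> 0"
    by (rule Lim_null_comparison[OF _ tendsto_rabs_zero[OF b_lim]]) (use kb in auto)
  then have "(\<lambda>j. of_int (k j) * b j) \<longlonglongrightarrow> ln (norm w)" by (simp add: LIM_zero_iff)
  then have "(\<lambda>j. exp (of_int (k j) * b j)) \<longlonglongrightarrow> exp (ln (norm w))" by (rule tendsto_exp)
  then have T_lim: "(\<lambda>j. norm (T j)) \<longlonglongrightarrow> norm w" using w(1) by (simp add: T)
  then have "bounded (range (\<lambda>j. norm (T j)))" by (rule convergent_imp_bounded)
  then have "bounded (range T)" by (simp add: bounded_iff)
  then obtain t r where r: "strict_mono r" "(T \<circ> r) \<longlonglongrightarrow> t"
    using bounded_imp_convergent_subsequence by blast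
  have t_norm: "norm t = norm w"
    using LIMSEQ_unique[OF tendsto_norm[OF r(2)]] LIMSEQ_subseq_LIMSEQ[OF T_lim r(1)] by (simp add: o_def)
  then have t0: "t \<noteq> 0" using w(1) by auto
  have "fibre_point B C (cis \<theta>) (t * u') (v' / t) \<in> K"
  proof (rule closed_sequentially[OF K(1)])
    show "fibre_point B C (R (r j)) (T (r j) * u (r j)) (v (r j) / T (r j)) \<in> K" for j
    proof -
      have "fibre_point B C (R (r j)) (u (r j)) (v (r j)) \<in> K"
        unfolding u_def v_def fibre_point_eq[OF R(1,2,4)] by (rule q)
      from fibre_orbit[OF R(1,2) K(2,3) this, of "k (r j)"] show ?thesis by (simp add: T_def)
    qed
    show "(\<lambda>j. fibre_point B C (R (r j)) (T (r j) * u (r j)) (v (r j) / T (r j))) \<longlonglongrightarrow>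
      fibre_point B C (cis \<theta>) (t * u') (v' / t)"
      unfolding fibre_point_def fibre_center_def using d t0 x_square_ne_4[OF \<rho>]
        r(2)[unfolded o_def] LIMSEQ_subseq_LIMSEQ[OF R_lim r(1), unfolded o_def]
        LIMSEQ_subseq_LIMSEQ[OF u_lim r(1), unfolded o_def] LIMSEQ_subseq_LIMSEQ[OF v_lim r(1), unfolded o_def]
      by (intro tendsto_intros) auto
  qed
  \<comment> \<open>The limit \<open>t\<close> has the right modulus; the missing argument is
    supplied by the irrational rotation of the limiting fibre.\<close>
  moreover have "cis (Arg (w / t)) = w / t"
    using t_norm t0 w(1) by (simp add: cis_Arg sgn_div_norm norm_divide scaleR_conv_of_real)
  ultimately have "fibre_point B C (cis \<theta>) ((w / t) * (t * u')) ((v' / t) / (w / t)) \<in> K"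
    using fibre_circle[OF K \<theta>, of "t * u'" "v' / t" "Arg (w / t)"] by simp
  then have "fibre_point B C (cis \<theta>) us vs \<in> K" using t0 w by simp
  then show ?thesis unfolding us_def vs_def using fibre_point_eq[OF \<rho>, of s B C] s(2) xa by simp
qed

section \<open>Orbit closures containing the walls\<close>

text \<open>The product of the distances from \<open>a\<close> to the roots is
  \<open>norm (poly p a)\<close>, and the nearest root contributes the smallest factor. This serves
  as continuity of roots, multiple ones included.\<close>

lemma monic_root_near:
  fixes p :: "complex poly"
  assumes "lead_coeff p = 1" "degree p > 0"
  shows "\<exists>r. poly p r = 0 \<and> norm (r - a) ^ degree p \<le> norm (poly p a)"
  using assms
proof (induction "degree p" arbitrary: p)
  case (Suc n)
  have "\<not> constant (poly p)" using Suc.prems by (simp add: constant_degree)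
  then obtain r where r: "poly p r = 0" using fundamental_theorem_of_algebra by blast
  then obtain q where q: "p = [:- r, 1:] * q" by (metis dvdE poly_eq_0_iff_dvd)
  have q0: "q \<noteq> 0" using Suc.prems q by auto
  have deg: "degree p = Suc (degree q)" using q0 unfolding q by (subst degree_mult_eq) auto
  have lc: "lead_coeff q = 1" using Suc.prems(1) unfolding q lead_coeff_mult by simp
  have val: "norm (poly p a) = norm (r - a) * norm (poly q a)"
  proof -
    have "poly [:- r, 1:] a = a - r" by simp
    then show ?thesis unfolding q poly_mult norm_mult by (simp only: norm_minus_commute)
  qed
  show ?case
  proof (cases "degree q = 0")
    case True
    then have "q = [:lead_coeff q:]" by (metis degree_0_id)
    then have "poly q a = 1" unfolding lc by simp
    then show ?thesis using r val deg True by auto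
  next
    case False
    then obtain r' where r': "poly q r' = 0" "norm (r' - a) ^ degree q \<le> norm (poly q a)"
      using Suc.hyps(1)[of q] Suc.hyps(2) lc deg by auto
    show ?thesis
    proof (cases "norm (r - a) \<le> norm (r' - a)")
      case True
      have "norm (r - a) ^ degree p = norm (r - a) * norm (r - a) ^ degree q" by (simp add: deg)
      also have "\<dots> \<le> norm (r - a) * norm (r' - a) ^ degree q" by (intro mult_left_mono power_mono True) auto
      also have "\<dots> \<le> norm (poly p a)" unfolding val by (intro mult_left_mono r') auto
      finally show ?thesis using r by blast
    next
      case False
      have "norm (r' - a) ^ degree p = norm (r' - a) * norm (r' - a) ^ degree q" by (simp add: deg)
      also have "\<dots> \<le> norm (r - a) * norm (poly q a)" using False by (intro mult_mono r') auto
      finally have "norm (r' - a) ^ degree p \<le> norm (poly p a)" unfolding val .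
      moreover have "poly p r' = 0" using r'(1) by (simp add: q)
      ultimately show ?thesis by blast
    qed
  qed
qed simp

lemma surface_point_near:
  "\<exists>x'. (x', y, z) \<in> cubic_surface A B C D \<and>
    (norm (x' - x))\<^sup>2 \<le> norm (x\<^sup>2 + y\<^sup>2 + z\<^sup>2 + x * y * z - (A * x + B * y + C * z + D))"
proof -
  define p where "p = [: y\<^sup>2 + z\<^sup>2 - B * y - C * z - D, y * z - A, 1 :]"
  have p: "poly p x' = x'\<^sup>2 + y\<^sup>2 + z\<^sup>2 + x' * y * z - (A * x' + B * y + C * z + D)" for x'
    by (simp add: p_def algebra_simps power2_eq_square)
  have "degree p = 2" "lead_coeff p = 1" by (simp_all add: p_def)
  then show ?thesis using monic_root_near[of p x] unfolding p by (auto simp: cubic_surface_def)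
qed

lemma surface_lift:
  assumes "(x, y, z) \<in> cubic_surface A B C D" "Y \<longlonglongrightarrow> y" "Z \<longlonglongrightarrow> z"
  obtains X where "X \<longlonglongrightarrow> x" "\<And>j. (X j, Y j, Z j) \<in> cubic_surface A B C D"
proof -
  define e where "e j = norm (x\<^sup>2 + (Y j)\<^sup>2 + (Z j)\<^sup>2 + x * Y j * Z j - (A * x + B * Y j + C * Z j + D))" for j :: nat
  have "\<forall>j. \<exists>x'. (x', Y j, Z j) \<in> cubic_surface A B C D \<and> (norm (x' - x))\<^sup>2 \<le> e j"
    unfolding e_def using surface_point_near by blast
  then obtain X where X: "\<And>j. (X j, Y j, Z j) \<in> cubic_surface A B C D" "\<And>j. (norm (X j - x))\<^sup>2 \<le> e j"
    by metis
  have "e \<longlonglongrightarrow> norm (x\<^sup>2 + y\<^sup>2 + z\<^sup>2 + x * y * z - (A * x + B * y + C * z + D))"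
    unfolding e_def[abs_def] by (intro tendsto_intros assms)
  then have "e \<longlonglongrightarrow> 0" using assms(1) by (simp add: cubic_surface_def)
  then have "(\<lambda>j. sqrt (e j)) \<longlonglongrightarrow> 0" using tendsto_real_sqrt by fastforce
  moreover have "norm (X j - x) \<le> sqrt (e j)" for j using X(2) by (simp add: real_le_rsqrt)
  ultimately have "(\<lambda>j. X j - x) \<longlonglongrightarrow> 0" by (intro Lim_null_comparison[of "\<lambda>j. X j - x"] always_eventually allI)
  then show ?thesis using X(1) by (intro that[of X]) (simp_all add: LIM_zero_iff)
qed

text \<open>Only countably many values are bad: those with \<open>a\<^sup>2 = 2 + 2 * Re z\<close>
  for a root of unity \<open>z\<close>, and the real zeros of the quartic
  \<open>fibre_energy\<close>.\<close>

lemma good_fibre_exists: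
  assumes "- 2 \<le> c" "c < d" "d \<le> 2" "countable X"
  obtains a where "c < a" "a < d" "good_fibre A B C D a" "a \<notin> X"
proof -
  define U where "U = (\<Union>n\<in>{0<..}. {z :: complex. z ^ n = 1})"
  have "countable U" unfolding U_def
    by (intro countable_UN) (auto intro!: countable_finite finite_roots_unity simp: Suc_leI)
  define bad where "bad = (\<Union>z\<in>U. {sqrt (2 + 2 * Re z), - sqrt (2 + 2 * Re z)})"
  have "countable bad" unfolding bad_def using \<open>countable U\<close> by (intro countable_UN) auto
  define p where "p = ([:D, A, - 1:] * [:4, 0, - 1:] + [:B\<^sup>2 + C\<^sup>2, - (B * C):] :: complex poly)"
  have p: "poly p x = fibre_energy A B C D x" for x
    by (simp add: p_def fibre_energy_def algebra_simps power2_eq_square)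
  have "coeff p 4 = 1" by (simp add: p_def numeral_eq_Suc)
  then have "p \<noteq> 0" by auto
  then have "finite {x. fibre_energy A B C D x = 0}" using poly_roots_finite[of p] unfolding p by simp
  then have "finite (of_real -` {x. fibre_energy A B C D x = 0} :: real set)"
    by (rule finite_vimageI) (simp add: inj_of_real)
  then have "countable (bad \<union> of_real -` {x. fibre_energy A B C D x = 0} \<union> X)" (is "countable ?N")
    using \<open>countable bad\<close> assms(4) by (simp add: countable_finite)
  then have "\<not> {c<..<d} \<subseteq> ?N" using uncountable_open_interval[of c d] assms(2) countable_subset by blast
  then obtain a where "a \<in> {c<..<d}" and aN: "a \<notin> ?N" by blast
  then have a: "c < a" "a < d" by auto
  have a2: "\<bar>a\<bar> < 2" using a assms by auto
  have "cis (2 * arccos (a / 2)) ^ n \<noteq> 1" if "n > 0" for n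
  proof
    assume *: "cis (2 * arccos (a / 2)) ^ n = 1"
    have "Re (cis (2 * arccos (a / 2))) = 2 * (a / 2)\<^sup>2 - 1"
      using a2 unfolding cis.sel cos_double_cos by (subst cos_arccos_abs) auto
    then have "a\<^sup>2 = 2 + 2 * Re (cis (2 * arccos (a / 2)))" by (simp add: power_divide)
    then have "\<bar>a\<bar> = sqrt (2 + 2 * Re (cis (2 * arccos (a / 2))))" using real_sqrt_abs[of a] by simp
    then have "a = sqrt (2 + 2 * Re (cis (2 * arccos (a / 2)))) \<or> a = - sqrt (2 + 2 * Re (cis (2 * arccos (a / 2))))"
      by linarith
    moreover have "cis (2 * arccos (a / 2)) \<in> U" using * that by (auto simp: U_def)
    ultimately have "a \<in> bad" unfolding bad_def by blast
    then show False using aN by blast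
  qed
  moreover have "fibre_energy A B C D (of_real a) \<noteq> 0" "a \<notin> X" using aN by auto
  ultimately show ?thesis using a a2 by (intro that[of a]) (simp_all add: good_fibre_def)
qed

text \<open>The three fibrations are exchanged by the cyclic permutation of the coordinates.\<close>

definition rot :: "complex3 \<Rightarrow> complex3" where
  "rot p = (fst (snd p), snd (snd p), fst p)"

lemma rot_simp [simp]: "rot (x, y, z) = (y, z, x)"
  by (simp add: rot_def)

lemma rot_in_surface: "rot p \<in> cubic_surface B C A D \<longleftrightarrow> p \<in> cubic_surface A B C D"
  by (cases p) (auto simp: cubic_surface_def algebra_simps)

primrec shift :: "letter \<Rightarrow> letter" where
  "shift LX = LZ"
| "shift LY = LX"
| "shift LZ = LY"

lemma rot_act: "rot (act A B C w p) = act B C A (map shift w) (rot p)"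
proof (induction w)
  case (Cons l w)
  have "rot (refl A B C l q) = refl B C A (shift l) (rot q)" for q
    by (cases l; cases q) (simp_all add: s_x_def s_y_def s_z_def mult.commute)
  then show ?case using Cons by simp
qed simp

lemma unshift: "\<exists>w'. map shift w' = w"
proof (induction w)
  case (Cons l w)
  then obtain w' where "map shift w' = w" by blast
  then have "map shift ((case l of LX \<Rightarrow> LY | LY \<Rightarrow> LZ | LZ \<Rightarrow> LX) # w') = l # w" by (cases l) simp_all
  then show ?case by (rule exI)
qed simp

definition closed_invariant :: "complex \<Rightarrow> complex \<Rightarrow> complex \<Rightarrow> complex \<Rightarrow> complex3 set \<Rightarrow> bool" where
  "closed_invariant A B C D K \<longleftrightarrow> closed K \<and> K \<subseteq> cubic_surface A B C D \<and>
     (\<forall>w p. even (length w) \<longrightarrow> p \<in> K \<longrightarrow> act A B C w p \<in> K)"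

lemma closed_invariant_rot:
  assumes "closed_invariant A B C D K"
  shows "closed_invariant B C A D (rot ` K)"
  unfolding closed_invariant_def
proof (intro conjI allI impI)
  have "rot ` K = (\<lambda>p. rot (rot p)) -` K"
  proof (intro equalityI subsetI)
    fix p assume "p \<in> (\<lambda>p. rot (rot p)) -` K"
    then show "p \<in> rot ` K" by (intro image_eqI[of _ _ "rot (rot p)"]) (simp_all add: rot_def)
  qed (auto simp: rot_def)
  also have "closed \<dots>"
    using assms by (intro closed_vimage) (auto simp: closed_invariant_def rot_def[abs_def] intro!: continuous_intros)
  finally show "closed (rot ` K)" .
  show "rot ` K \<subseteq> cubic_surface B C A D"
    using assms rot_in_surface unfolding closed_invariant_def by (intro image_subsetI) blast
  fix w :: "letter list" and p assume w: "even (length w)" and "p \<in> rot ` K"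
  then obtain q where q: "p = rot q" "q \<in> K" by blast
  obtain w' where w': "map shift w' = w" using unshift by blast
  have "act A B C w' q \<in> K" using assms q(2) w w' unfolding closed_invariant_def by (metis length_map)
  then show "act B C A w p \<in> rot ` K" unfolding q(1) w'[symmetric] rot_act[symmetric] by blast
qed

lemma closed_invariant_absorb:
  assumes K: "closed_invariant A B C D K" and a: "good_fibre A B C D a"
    and q: "\<And>j. q j \<in> K" "\<And>j. Im (fst (q j)) \<noteq> 0" "q \<longlonglongrightarrow> q'" "fst q' = of_real a"
    and s: "s \<in> cubic_surface A B C D" "fst s = of_real a"
  shows "s \<in> K"
proof (rule fibre_absorb[OF _ _ _ a q(1,2,3) _ q(4) s])
  show "closed K" using K by (simp add: closed_invariant_def)
  show "s_z C (s_y B p) \<in> K" if "p \<in> K" for p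
    using K[unfolded closed_invariant_def, THEN conjunct2, THEN conjunct2, rule_format, of "[LZ, LY]" p] that by simp
  show "s_y B (s_z C p) \<in> K" if "p \<in> K" for p
    using K[unfolded closed_invariant_def, THEN conjunct2, THEN conjunct2, rule_format, of "[LY, LZ]" p] that by simp
  have "q' \<in> K" by (rule closed_sequentially[OF \<open>closed K\<close> q(1,3)])
  then show "q' \<in> cubic_surface A B C D" using K by (auto simp: closed_invariant_def)
qed

lemma mem_rot_iff: "rot p \<in> rot ` K \<longleftrightarrow> p \<in> K"
  by (auto simp: rot_def)

lemma tendsto_rot: "q \<longlonglongrightarrow> q' \<Longrightarrow> (\<lambda>j. rot (q j)) \<longlonglongrightarrow> rot q'"
  unfolding rot_def by (intro tendsto_intros)

text \<open>A complete fibre of x contains points with non-real y that converge to a point with y =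
  a, so the absorption argument applies in the direction of y.\<close>

lemma fibre_spread:
  assumes K: "closed_invariant A B C D K" and c: "\<And>s. s \<in> cubic_surface A B C D \<Longrightarrow> fst s = c \<Longrightarrow> s \<in> K"
    and a: "good_fibre B C A D a"
    and s: "s \<in> cubic_surface A B C D" "fst (snd s) = of_real a"
  shows "s \<in> K"
proof -
  obtain z where z: "(z, c, of_real a) \<in> cubic_surface C A B D" using surface_point_near by blast
  define Y :: "nat \<Rightarrow> complex" where "Y j = of_real a + \<i> * of_real (1 / real (Suc j))" for j
  have "(\<lambda>j. of_real a + \<i> * of_real (1 / real (Suc j))) \<longlonglongrightarrow> of_real a + \<i> * of_real 0"
    by (intro tendsto_intros LIMSEQ_Suc[OF lim_1_over_n])
  then have Y: "Y \<longlonglongrightarrow> of_real a" by (simp add: Y_def[abs_def])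
  from surface_lift[OF z tendsto_const Y] obtain Z where
    Z: "Z \<longlonglongrightarrow> z" "\<And>j. (Z j, c, Y j) \<in> cubic_surface C A B D" by blast
  define q where "q j = (c, Y j, Z j)" for j
  have qK: "q j \<in> K" for j
    using Z(2)[of j] rot_in_surface[of "(Z j, c, Y j)" A B C D] unfolding q_def by (intro c) simp_all
  have q_lim: "(\<lambda>j. rot (q j)) \<longlonglongrightarrow> rot (c, of_real a, z)"
    unfolding q_def by (intro tendsto_rot tendsto_intros Y Z(1))
  have "rot s \<in> rot ` K"
  proof (rule closed_invariant_absorb[OF closed_invariant_rot[OF K] a _ _ q_lim])
    show "rot (q j) \<in> rot ` K" for j using qK by (simp add: mem_rot_iff)
    show "Im (fst (rot (q j))) \<noteq> 0" for j by (simp add: q_def Y_def)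
    show "rot s \<in> cubic_surface B C A D" using s(1) by (simp only: rot_in_surface)
    show "fst (rot s) = of_real a" using s(2) by (simp add: rot_def)
  qed simp
  then show ?thesis by (simp add: mem_rot_iff)
qed

lemma good_fibre_seq:
  assumes "t \<in> {- 2..2}"
  obtains c where "\<And>j. good_fibre A B C D (c j)" "c \<longlonglongrightarrow> t"
proof -
  have "\<exists>c. good_fibre A B C D c \<and> norm (c - t) < 1 / real (Suc j)" for j
  proof -
    define \<epsilon> where "\<epsilon> = 1 / real (Suc j)"
    have \<epsilon>: "\<epsilon> > 0" by (simp add: \<epsilon>_def)
    obtain c where "max (- 2) (t - \<epsilon>) < c" "c < min 2 (t + \<epsilon>)" "good_fibre A B C D c"
      by (rule good_fibre_exists[of "max (- 2) (t - \<epsilon>)" "min 2 (t + \<epsilon>)" "{}"]) (use assms \<epsilon> in auto)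
    then show ?thesis unfolding \<epsilon>_def[symmetric] by (intro exI[of _ c]) auto
  qed
  then obtain c where c: "\<And>j. good_fibre A B C D (c j)" "\<And>j. norm (c j - t) < 1 / real (Suc j)" by metis
  from LIMSEQ_if_less_inverse_Suc[OF c(2)] c(1) show ?thesis by (intro that)
qed

text \<open>The values at \<open>\<tau>\<close> and \<open>- \<tau>\<close> of a trigonometric polynomial \<open>y\<^sub>c + \<alpha> cis \<tau> + \<beta> cis (- \<tau>)\<close> cannot
  both be real when the value at \<open>0\<close> is real and \<open>y\<^sub>c\<close> is not.\<close>

lemma circle_leaves_real:
  assumes K: "closed_invariant A B C D K" and a: "good_fibre A B C D a"
    and p: "p \<in> K" "fst p = of_real a" "Im (fst (snd p)) = 0" and im: "2 * Im B \<noteq> a * Im C"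
  obtains q where "\<And>j. q j \<in> K" "\<And>j. Im (fst (snd (q j))) \<noteq> 0" "q \<longlonglongrightarrow> p"
proof -
  define \<theta> where "\<theta> = arccos (a / 2)"
  have a2: "\<bar>a\<bar> < 2" using a by (simp add: good_fibre_def)
  have \<theta>: "\<And>n. n > 0 \<Longrightarrow> cis (2 * \<theta>) ^ n \<noteq> 1" using a unfolding good_fibre_def \<theta>_def by blast
  have sq: "(cis \<theta>)\<^sup>2 = cis (2 * \<theta>)" by (simp add: power2_eq_square cis_mult)
  have \<rho>: "cis \<theta> \<noteq> 0" "(cis \<theta>)\<^sup>2 \<noteq> 1" using \<theta>[of 1] by (simp_all add: sq)
  have d: "cis \<theta> - 1 / cis \<theta> \<noteq> 0" using square_ne_1 \<rho> by blast
  have Ja: "joukowsky_inv (of_real a) = cis \<theta>" using joukowsky_inv_real[of a] a2 unfolding \<theta>_def by linarith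
  have xa: "of_real a = cis \<theta> + 1 / cis \<theta>" using joukowsky_inv_eq[of "of_real a"] unfolding Ja by (rule sym)
  define u v where "u = fibre_u B C (cis \<theta>) p" and "v = fibre_u B C (1 / cis \<theta>) p"
  define P where "P \<tau> = fibre_point B C (cis \<theta>) (cis \<tau> * u) (v / cis \<tau>)" for \<tau>
  have P0: "P 0 = p" using fibre_point_eq[OF \<rho>, of p B C] p(2) xa by (simp add: P_def u_def v_def)
  have PK: "P \<tau> \<in> K" for \<tau> unfolding P_def
  proof (rule fibre_circle)
    show "closed K" using K by (simp add: closed_invariant_def)
    show "s_z C (s_y B p) \<in> K" if "p \<in> K" for p
      using K[unfolded closed_invariant_def, THEN conjunct2, THEN conjunct2, rule_format, of "[LZ, LY]" p] that by simp
    show "s_y B (s_z C p) \<in> K" if "p \<in> K" for p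
      using K[unfolded closed_invariant_def, THEN conjunct2, THEN conjunct2, rule_format, of "[LY, LZ]" p] that by simp
    show "fibre_point B C (cis \<theta>) u v \<in> K" using P0 p(1) by (simp add: P_def)
  qed (rule \<theta>)
  define y where "y \<tau> = fst (snd (P \<tau>))" for \<tau>
  define c where "c = fibre_center B C (of_real a)"
  define k where "k = (cis \<theta> * v - u / cis \<theta>) / (cis \<theta> - 1 / cis \<theta>)"
  have "c = (2 * B - of_real a * C) / of_real (4 - a\<^sup>2)" by (simp add: c_def fibre_center_def)
  then have "Im c = (2 * Im B - a * Im C) / (4 - a\<^sup>2)" by simp
  moreover have "a\<^sup>2 < 2\<^sup>2" using a2 by (intro power2_strict_mono) auto
  ultimately have Im_c: "Im c \<noteq> 0" using im by simp
  have y: "y \<tau> = c + (cis \<theta> * (v / cis \<tau>) - cis \<tau> * u / cis \<theta>) / (cis \<theta> - 1 / cis \<theta>)" for \<tau>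
    by (simp add: y_def P_def fibre_point_def c_def xa)
  have "cis (- \<tau>) = 1 / cis \<tau>" for \<tau> by (simp only: cis_inverse[symmetric] inverse_eq_divide)
  then have "y \<tau> + y (- \<tau>) = 2 * c + (cis \<tau> + cis (- \<tau>)) * k" for \<tau>
    unfolding y k_def by (simp add: add_divide_distrib diff_divide_distrib algebra_simps)
  moreover have "cis \<tau> + cis (- \<tau>) = of_real (2 * cos \<tau>)" for \<tau> by (simp add: complex_eq_iff)
  ultimately have sum: "y \<tau> + y (- \<tau>) = 2 * c + of_real (2 * cos \<tau>) * k" for \<tau> by simp
  have "Im (y 0 + y (- 0)) = 2 * Im c + 2 * Im k" unfolding sum by simp
  then have "Im k = - Im c" using p(3) P0 by (simp add: y_def)
  then have Im_sum: "Im (y \<tau>) + Im (y (- \<tau>)) = 2 * (1 - cos \<tau>) * Im c" for \<tau>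
    using arg_cong[OF sum[of \<tau>], of Im] by (simp add: algebra_simps)
  have "\<exists>\<sigma>. \<bar>\<sigma>\<bar> \<le> 1 / real (Suc j) \<and> Im (y \<sigma>) \<noteq> 0" for j
  proof -
    define \<tau> where "\<tau> = 1 / real (Suc j)"
    have "0 < \<tau>" "\<tau> \<le> 1" by (simp_all add: \<tau>_def)
    then have "cos \<tau> < cos 0" using pi_gt3 by (intro cos_monotone_0_pi) auto
    then have "Im (y \<tau>) + Im (y (- \<tau>)) \<noteq> 0" unfolding Im_sum using Im_c by simp
    then have "Im (y \<tau>) \<noteq> 0 \<or> Im (y (- \<tau>)) \<noteq> 0" by linarith
    moreover have "\<bar>\<tau>\<bar> \<le> 1 / real (Suc j)" "\<bar>- \<tau>\<bar> \<le> 1 / real (Suc j)" by (simp_all add: \<tau>_def)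
    ultimately show ?thesis by blast
  qed
  then obtain \<sigma> where \<sigma>: "\<And>j. \<bar>\<sigma> j\<bar> \<le> 1 / real (Suc j)" "\<And>j. Im (y (\<sigma> j)) \<noteq> 0" by metis
  have "\<sigma> \<longlonglongrightarrow> 0"
    by (rule Lim_null_comparison[OF _ LIMSEQ_Suc[OF lim_1_over_n]]) (intro always_eventually allI, use \<sigma>(1) in simp)
  then have "(\<lambda>j. exp (\<i> * of_real (\<sigma> j))) \<longlonglongrightarrow> exp (\<i> * of_real 0)" by (intro tendsto_intros)
  then have cis_lim: "(\<lambda>j. cis (\<sigma> j)) \<longlonglongrightarrow> 1" by (simp add: cis_conv_exp)
  have "(\<lambda>j. P (\<sigma> j)) \<longlonglongrightarrow> fibre_point B C (cis \<theta>) (1 * u) (v / 1)"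
    unfolding P_def fibre_point_def by (intro tendsto_intros cis_lim) (use d in auto)
  then have "(\<lambda>j. P (\<sigma> j)) \<longlonglongrightarrow> p" using P0 by (simp add: P_def)
  with PK \<sigma>(2) show ?thesis by (intro that[of "\<lambda>j. P (\<sigma> j)"]) (simp_all add: y_def)
qed

text \<open>The non-real points near the given one absorb one fibre of y, over \<open>b\<close>.
  From there \<open>fibre_spread\<close> goes around the cycle: all good fibres of z, one fibre of
  x, all good fibres of y. Good values are dense in \<open>[-2, 2]\<close>, and closedness supplies
  the rest.\<close>

theorem real_walls_absorbed:
  assumes K: "closed_invariant A B C D K" and a: "good_fibre A B C D a" and b: "good_fibre B C A D b"
    and im: "2 * Im B \<noteq> a * Im C" and p: "(of_real a, of_real b, z) \<in> K"
    and s: "s \<in> cubic_surface A B C D" "fst (snd s) \<in> of_real ` {- 2..2} \<or> snd (snd s) \<in> of_real ` {- 2..2}"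
  shows "s \<in> K"
proof -
  note K' = closed_invariant_rot[OF K] and K'' = closed_invariant_rot[OF closed_invariant_rot[OF K]]
  have closed: "closed K" using K by (simp add: closed_invariant_def)
  obtain q where q: "\<And>j. q j \<in> K" "\<And>j. Im (fst (snd (q j))) \<noteq> 0" "q \<longlonglongrightarrow> (of_real a, of_real b, z)"
    by (rule circle_leaves_real[OF K a p _ _ im]) auto
  have 1: "s' \<in> rot ` K" if "s' \<in> cubic_surface B C A D" "fst s' = of_real b" for s'
  proof (rule closed_invariant_absorb[OF K' b _ _ tendsto_rot[OF q(3)] _ that])
    show "rot (q j) \<in> rot ` K" "Im (fst (rot (q j))) \<noteq> 0" for j using q by (simp_all add: rot_def)
  qed simp
  have 2: "s' \<in> rot ` rot ` K" if "s' \<in> cubic_surface C A B D" "fst s' = of_real c" "good_fibre C A B D c" for s' c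
  proof -
    define s where "s = rot (rot s')"
    have "rot s = s'" by (simp add: s_def rot_def)
    moreover have "s \<in> rot ` K"
    proof (rule fibre_spread[OF K' _ that(3)])
      show "s' \<in> rot ` K" if "s' \<in> cubic_surface B C A D" "fst s' = of_real b" for s' by (rule 1[OF that])
      show "s \<in> cubic_surface B C A D" unfolding s_def rot_in_surface by (rule that)
      show "fst (snd s) = of_real c" using that(2) by (simp add: s_def rot_def)
    qed
    ultimately show ?thesis by blast
  qed
  obtain c where c: "good_fibre C A B D c" by (rule good_fibre_exists[of "- 2" 2 "{}"]) auto
  obtain a' where a': "good_fibre A B C D a'" by (rule good_fibre_exists[of "- 2" 2 "{}"]) auto
  have 3: "s \<in> K" if "s \<in> cubic_surface A B C D" "fst s = of_real a'" for s
  proof -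
    have "rot (rot s) \<in> rot ` rot ` K"
    proof (rule fibre_spread[OF K'' _ a'])
      show "s' \<in> rot ` rot ` K" if "s' \<in> cubic_surface C A B D" "fst s' = of_real c" for s'
        by (rule 2[OF that c])
      show "rot (rot s) \<in> cubic_surface C A B D" unfolding rot_in_surface by (rule that)
      show "fst (snd (rot (rot s))) = of_real a'" using that(2) by (simp add: rot_def)
    qed
    then show ?thesis unfolding mem_rot_iff .
  qed
  have y_good: "s \<in> K" if "good_fibre B C A D t" "s \<in> cubic_surface A B C D" "fst (snd s) = of_real t" for s t
    by (rule fibre_spread[OF K _ that]) (rule 3)
  have z_good: "s \<in> K" if "good_fibre C A B D t" "s \<in> cubic_surface A B C D" "snd (snd s) = of_real t" for s t
  proof -
    have "rot (rot s) \<in> rot ` rot ` K"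
      by (rule 2[OF _ _ that(1)]) (use that in \<open>simp_all add: rot_in_surface\<close>, simp add: rot_def)
    then show ?thesis unfolding mem_rot_iff .
  qed
  obtain x0 y0 z0 where s_eq: "s = (x0, y0, z0)" by (cases s)
  from s(2) show ?thesis
  proof
    assume "fst (snd s) \<in> of_real ` {- 2..2}"
    then obtain t where t: "t \<in> {- 2..2}" "y0 = of_real t" by (auto simp: s_eq)
    obtain c where c: "\<And>j. good_fibre B C A D (c j)" "c \<longlonglongrightarrow> t" by (rule good_fibre_seq[OF t(1), where A = B and B = C and C = A and D = D]) (rule that)
    have "(\<lambda>j. of_real (c j)) \<longlonglongrightarrow> y0" unfolding t(2) by (intro tendsto_intros c)
    from surface_lift[OF s(1)[unfolded s_eq] this tendsto_const] obtain X where
      X: "X \<longlonglongrightarrow> x0" "\<And>j. (X j, of_real (c j), z0) \<in> cubic_surface A B C D" by blast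
    show "s \<in> K" unfolding s_eq t(2)
    proof (rule closed_sequentially[OF closed, of "\<lambda>j. (X j, of_real (c j), z0)"])
      show "(X j, of_real (c j), z0) \<in> K" for j by (rule y_good[OF c(1) X(2)]) simp
    qed (intro tendsto_intros X c)
  next
    assume "snd (snd s) \<in> of_real ` {- 2..2}"
    then obtain t where t: "t \<in> {- 2..2}" "z0 = of_real t" by (auto simp: s_eq)
    obtain c where c: "\<And>j. good_fibre C A B D (c j)" "c \<longlonglongrightarrow> t" by (rule good_fibre_seq[OF t(1), where A = C and B = A and C = B and D = D]) (rule that)
    have "(\<lambda>j. of_real (c j)) \<longlonglongrightarrow> z0" unfolding t(2) by (intro tendsto_intros c)
    from surface_lift[OF s(1)[unfolded s_eq] tendsto_const this] obtain X where
      X: "X \<longlonglongrightarrow> x0" "\<And>j. (X j, y0, of_real (c j)) \<in> cubic_surface A B C D" by blast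
    show "s \<in> K" unfolding s_eq t(2)
    proof (rule closed_sequentially[OF closed, of "\<lambda>j. (X j, y0, of_real (c j))"])
      show "(X j, y0, of_real (c j)) \<in> K" for j by (rule z_good[OF c(1) X(2)]) simp
    qed (intro tendsto_intros X c)
  qed
qed

text \<open>The value excluded for \<open>a\<close> is the one for which the fibre centre has a real
  y-coordinate.\<close>

lemma starting_point_exists:
  assumes "Im C \<noteq> 0"
  obtains a b z where "good_fibre A B C D a" "good_fibre B C A D b" "2 * Im B \<noteq> a * Im C"
    "(of_real a, of_real b, z) \<in> cubic_surface A B C D"
proof -
  obtain a where a: "good_fibre A B C D a" "a \<notin> {2 * Im B / Im C}"
    by (rule good_fibre_exists[of "- 2" 2 "{2 * Im B / Im C}"]) auto
  obtain b where b: "good_fibre B C A D b" by (rule good_fibre_exists[of "- 2" 2 "{}"]) auto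
  obtain z where z: "(z, of_real a, of_real b) \<in> cubic_surface C A B D" using surface_point_near by blast
  have "(of_real a, of_real b, z) \<in> cubic_surface A B C D"
    using z rot_in_surface[of "(z, of_real a, of_real b)" A B C D] by simp
  moreover have "2 * Im B \<noteq> a * Im C" using a(2) assms by auto
  ultimately show ?thesis using a(1) b by (intro that)
qed

section \<open>Escaping orbits and nearby parameters\<close>

lemma reduced_word: "\<exists>w'. act A B C w' = act A B C w \<and> successively (\<noteq>) w'"
proof (induction w)
  case (Cons l w)
  then obtain w' where w': "act A B C w' = act A B C w" "successively (\<noteq>) w'" by blast
  show ?case
  proof (cases "w' \<noteq> [] \<and> hd w' = l")
    case True
    then obtain w'' where w'': "w' = l # w''" by (cases w') auto
    have "act A B C (l # w) = act A B C w''"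
      unfolding act.simps w'(1)[symmetric] w'' by (simp add: fun_eq_iff)
    moreover have "successively (\<noteq>) w''" using w'(2) unfolding w'' by (auto simp: successively_Cons)
    ultimately show ?thesis by (intro exI[of _ w'']) simp
  next
    case False
    then have "successively (\<noteq>) (l # w')" using w'(2) by (auto simp: successively_Cons)
    moreover have "act A B C (l # w') = act A B C (l # w)" using w'(1) by simp
    ultimately show ?thesis by blast
  qed
qed (intro exI[of _ "[]"], simp)

primrec coord :: "letter \<Rightarrow> complex3 \<Rightarrow> complex" where
  "coord LX p = fst p"
| "coord LY p = fst (snd p)"
| "coord LZ p = snd (snd p)"

lemma reflection_grows:
  fixes x y z A :: complex
  assumes "c > 2" "c * (c - 2) \<ge> M" "norm A \<le> M" "norm x \<le> norm y" "c \<le> norm y" "c \<le> norm z"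
  shows "norm y \<le> norm (- x - y * z + A)"
proof -
  have "norm (y * z) \<le> norm (- x - y * z + A) + norm x + norm A"
    using norm_triangle_ineq4[of "A - x" "- x - y * z + A"] norm_triangle_ineq4[of A x] by simp
  moreover have "norm y * c \<le> norm (y * z)" unfolding norm_mult using assms by (intro mult_left_mono) auto
  moreover have "c * (c - 2) \<le> norm y * (c - 2)" using assms by (intro mult_right_mono) auto
  moreover have "norm y * c = norm y * (c - 2) + 2 * norm y" by (simp add: algebra_simps)
  ultimately show ?thesis using assms by linarith
qed

text \<open>Once the most recently changed coordinate is the largest one, this persists along reduced words.\<close>

lemma reduced_word_escape:
  assumes c: "c > 2" "c\<^sup>2 \<ge> 2 * c' + M" and M: "norm A \<le> M" "norm B \<le> M" "norm C \<le> M"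
    and q: "\<And>l. c \<le> norm (coord l q)" "\<And>l. norm (coord l q) \<le> c'"
    and w: "successively (\<noteq>) (l # w)"
  shows "\<forall>k. c \<le> norm (coord k (act A B C (l # w) q)) \<and>
    norm (coord k (act A B C (l # w) q)) \<le> norm (coord l (act A B C (l # w) q))"
  using w
proof (induction w arbitrary: l)
  case Nil
  obtain x y z where xyz: "q = (x, y, z)" by (cases q)
  have cc: "c \<le> norm x" "c \<le> norm y" "c \<le> norm z" "norm x \<le> c'" "norm y \<le> c'" "norm z \<le> c'"
    using q(1)[of LX] q(1)[of LY] q(1)[of LZ] q(2)[of LX] q(2)[of LY] q(2)[of LZ] by (simp_all add: xyz)
  \<comment> \<open>A new coordinate has modulus at least \<open>c\<^sup>2 - c' - M\<close>, hence
    at least \<open>c'\<close>, so already after one letter the changed coordinate is the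
    largest.\<close>
  have big: "c' \<le> norm (- u - v * t + E)"
    if "norm u \<le> c'" "c \<le> norm v" "c \<le> norm t" "norm E \<le> M" for u v t E :: complex
  proof -
    have "norm (v * t) \<le> norm (- u - v * t + E) + norm u + norm E"
      using norm_triangle_ineq4[of "E - u" "- u - v * t + E"] norm_triangle_ineq4[of E u] by simp
    moreover have "c * c \<le> norm (v * t)" unfolding norm_mult using that c by (intro mult_mono) auto
    ultimately show ?thesis using that c(2) by (simp add: power2_eq_square)
  qed
  have "c' \<le> norm (- x - y * z + A)" "c' \<le> norm (- y - x * z + B)" "c' \<le> norm (- z - x * y + C)"
    using big cc M by blast+
  then show ?case using cc
    by (intro allI, case_tac k; cases l) (simp_all add: xyz s_x_def s_y_def s_z_def)
next
  case (Cons l' w)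
  have ne: "l \<noteq> l'" and succ: "successively (\<noteq>) (l' # w)" using Cons.prems by simp_all
  obtain x y z where xyz: "act A B C (l' # w) q = (x, y, z)" by (cases "act A B C (l' # w) q")
  have IH: "c \<le> norm (coord k (x, y, z))" "norm (coord k (x, y, z)) \<le> norm (coord l' (x, y, z))" for k
    using Cons.IH[OF succ] unfolding xyz by blast+
  have "c \<le> c'" using q(1)[of LX] q(2)[of LX] by linarith
  then have cM: "c * (c - 2) \<ge> M" using c(2) by (simp add: power2_eq_square algebra_simps)
  have cc: "c \<le> norm x" "c \<le> norm y" "c \<le> norm z" using IH(1)[of LX] IH(1)[of LY] IH(1)[of LZ] by simp_all
  have mx: "norm x \<le> norm (coord l' (x, y, z))" "norm y \<le> norm (coord l' (x, y, z))" "norm z \<le> norm (coord l' (x, y, z))"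
    using IH(2)[of LX] IH(2)[of LY] IH(2)[of LZ] by simp_all
  note grow = reflection_grows[OF c(1) cM]
  have eq: "act A B C (l # l' # w) q = refl A B C l (x, y, z)" using xyz by simp
  have larger: "norm (coord l' (x, y, z)) \<le> norm (coord l (refl A B C l (x, y, z)))"
    using ne cc mx M grow[of A x y z] grow[of A x z y] grow[of B y x z] grow[of B y z x] grow[of C z x y] grow[of C z y x]
    by (cases l; cases l') (simp_all add: s_x_def s_y_def s_z_def mult.commute)
  have same: "coord k (refl A B C l (x, y, z)) = coord k (x, y, z)" if "k \<noteq> l" for k
    using that by (cases k; cases l) (simp_all add: s_x_def s_y_def s_z_def)
  show ?case unfolding eq
  proof
    fix k
    show "c \<le> norm (coord k (refl A B C l (x, y, z))) \<and>
      norm (coord k (refl A B C l (x, y, z))) \<le> norm (coord l (refl A B C l (x, y, z)))"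
    proof (cases "k = l")
      case True
      then show ?thesis using order_trans[OF IH(1)[of l'] larger] by simp
    next
      case False
      then show ?thesis using IH(1)[of k] order_trans[OF IH(2)[of k] larger] by (simp add: same)
    qed
  qed
qed

lemma word_escape:
  assumes c: "c > 2" "c\<^sup>2 \<ge> 2 * c' + M" and M: "norm A \<le> M" "norm B \<le> M" "norm C \<le> M"
    and q: "\<And>l. c \<le> norm (coord l q)" "\<And>l. norm (coord l q) \<le> c'"
  shows "c \<le> norm (fst (act A B C w q))"
proof -
  obtain w' where w': "act A B C w' = act A B C w" "successively (\<noteq>) w'" using reduced_word by blast
  show ?thesis
  proof (cases w')
    case Nil
    then show ?thesis using w'(1) q(1)[of LX] by (metis act.simps(1) coord.simps(1) id_apply)
  next
    case (Cons l w'')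
    have "c \<le> norm (coord LX (act A B C w' q))"
      using reduced_word_escape[OF c M q, of l w''] w'(2) unfolding Cons by blast
    then show ?thesis unfolding w'(1) by simp
  qed
qed

lemma coord_near: "norm (coord l p - coord l q) \<le> norm (p - q)"
  using norm_coord_le[of "p - q"] by (cases l) simp_all

lemma power_le_tendsto_zero:
  fixes X :: "nat \<Rightarrow> 'a::real_normed_vector"
  assumes "\<And>j. norm (X j) ^ k \<le> e j" "e \<longlonglongrightarrow> 0" "k > 0"
  shows "X \<longlonglongrightarrow> 0"
proof -
  have "norm (X j) \<le> root k (e j)" for j
    using real_root_le_mono[OF assms(3) assms(1)[of j]] real_root_power_cancel[OF assms(3), of "norm (X j)"] by simp
  moreover have "(\<lambda>j. root k (e j)) \<longlonglongrightarrow> root k 0" by (intro tendsto_intros assms(2))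
  ultimately show ?thesis
    by (intro Lim_null_comparison[of X "\<lambda>j. root k (e j)"] always_eventually allI) simp_all
qed

text \<open>Quantifying over all words, thus also over inverses, keeps any orbit that has a point
  with |x| < 2 out of \<open>V\<close>.\<close>

definition escapes :: "complex \<Rightarrow> complex \<Rightarrow> complex \<Rightarrow> complex \<Rightarrow> bool" where
  "escapes A B C D \<longleftrightarrow> (\<exists>q V. q \<in> cubic_surface A B C D \<and> open V \<and> q \<in> V \<and>
     (\<forall>q'\<in>V. \<forall>w. 2 \<le> norm (fst (act A B C w q'))))"

text \<open>Nearby surfaces still have a point close to (-t, -t, -t), and \<open>word_escape\<close>
  works on a box of half-width \<delta> around that point.\<close>

lemma eventually_escapes:
  fixes t :: real
  assumes t: "t > 2" "norm A0 < t * (t - 2)" "norm B0 < t * (t - 2)" "norm C0 < t * (t - 2)"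
    and on: "(- of_real t, - of_real t, - of_real t) \<in> cubic_surface A0 B0 C0 D0"
  shows "\<forall>\<^sub>F v in nhds (A0, B0, C0, D0). escapes (fst v) (fst (snd v)) (fst (snd (snd v))) (snd (snd (snd v)))"
unfolding eventually_nhds_iff_sequentially
proof (intro allI impI)
  fix f :: "nat \<Rightarrow> complex4" assume f: "f \<longlonglongrightarrow> (A0, B0, C0, D0)"
  define A B C D where "A j = fst (f j)" and "B j = fst (snd (f j))" and "C j = fst (snd (snd (f j)))"
    and "D j = snd (snd (snd (f j)))" for j
  have lim: "A \<longlonglongrightarrow> A0" "B \<longlonglongrightarrow> B0" "C \<longlonglongrightarrow> C0" "D \<longlonglongrightarrow> D0"
    using tendsto_fst[OF f] tendsto_fst[OF tendsto_snd[OF f]] tendsto_fst[OF tendsto_snd[OF tendsto_snd[OF f]]]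
      tendsto_snd[OF tendsto_snd[OF tendsto_snd[OF f]]] by (simp_all add: A_def[abs_def] B_def[abs_def] C_def[abs_def] D_def[abs_def])
  obtain M where M: "norm A0 < M" "norm B0 < M" "norm C0 < M" "M < t * (t - 2)"
    using dense[of "max (norm A0) (max (norm B0) (norm C0))" "t * (t - 2)"] t by auto
  \<comment> \<open>The first bound gives \<open>t - \<delta> > 2\<close>; the second spends the
    slack in \<open>M < t * (t - 2)\<close> to obtain
    \<open>(t - \<delta>)\<^sup>2 \<ge> 2 * (t + \<delta>) + M\<close>.\<close>
  define \<delta> where "\<delta> = min ((t - 2) / 2) ((t * (t - 2) - M) / (2 * t + 2))"
  have \<delta>: "\<delta> > 0" "\<delta> \<le> (t - 2) / 2" "\<delta> \<le> (t * (t - 2) - M) / (2 * t + 2)" unfolding \<delta>_def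
    by (intro min.cobounded1 min.cobounded2 | use t M in simp)+
  have "\<delta> * (2 * t + 2) \<le> t * (t - 2) - M" using \<delta>(3) t by (simp add: pos_le_divide_eq)
  moreover have "(t - \<delta>)\<^sup>2 = t * (t - 2) - \<delta> * (2 * t + 2) + 2 * (t + \<delta>) + \<delta> * \<delta>"
    by (simp add: power2_eq_square algebra_simps)
  moreover have "\<delta> * \<delta> \<ge> 0" by simp
  ultimately have box2: "(t - \<delta>)\<^sup>2 \<ge> 2 * (t + \<delta>) + M" by linarith
  have box1: "t - \<delta> > 2" using \<delta>(2) t(1) by simp
  note box = box1 box2
  let ?m = "- of_real t :: complex"
  define e where "e j = norm (?m\<^sup>2 + ?m\<^sup>2 + ?m\<^sup>2 + ?m * ?m * ?m - (A j * ?m + B j * ?m + C j * ?m + D j))" for j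
  have "\<forall>j. \<exists>x. (x, ?m, ?m) \<in> cubic_surface (A j) (B j) (C j) (D j) \<and> (norm (x - ?m))\<^sup>2 \<le> e j"
    unfolding e_def using surface_point_near by blast
  then obtain x where x: "\<And>j. (x j, ?m, ?m) \<in> cubic_surface (A j) (B j) (C j) (D j)" "\<And>j. (norm (x j - ?m))\<^sup>2 \<le> e j"
    by metis
  have "e \<longlonglongrightarrow> norm (?m\<^sup>2 + ?m\<^sup>2 + ?m\<^sup>2 + ?m * ?m * ?m - (A0 * ?m + B0 * ?m + C0 * ?m + D0))"
    unfolding e_def[abs_def] by (intro tendsto_intros lim)
  also have "norm (?m\<^sup>2 + ?m\<^sup>2 + ?m\<^sup>2 + ?m * ?m * ?m - (A0 * ?m + B0 * ?m + C0 * ?m + D0)) = 0"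
    using on by (simp only: cubic_surface_def mem_Collect_eq prod.case right_minus_eq norm_eq_zero)
  finally have "(\<lambda>j. x j - ?m) \<longlonglongrightarrow> 0" by (rule power_le_tendsto_zero[OF x(2)]) simp
  then have "(\<lambda>j. norm (x j - ?m)) \<longlonglongrightarrow> 0" by (rule tendsto_norm_zero)
  then have "\<forall>\<^sub>F j in sequentially. norm (x j - ?m) < \<delta> / 2"
    by (rule order_tendstoD) (use \<delta> in simp)
  moreover have "\<forall>\<^sub>F j in sequentially. norm (A j) < M" "\<forall>\<^sub>F j in sequentially. norm (B j) < M"
    "\<forall>\<^sub>F j in sequentially. norm (C j) < M"
    using order_tendstoD(2)[OF tendsto_norm[OF lim(1)] M(1)] order_tendstoD(2)[OF tendsto_norm[OF lim(2)] M(2)]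
      order_tendstoD(2)[OF tendsto_norm[OF lim(3)] M(3)] by auto
  ultimately have "\<forall>\<^sub>F j in sequentially. escapes (A j) (B j) (C j) (D j)"
  proof eventually_elim
    case (elim j)
    have near: "norm (coord l (x j, ?m, ?m) - ?m) \<le> \<delta> / 2" for l using elim(1) \<delta>(1) by (cases l) simp_all
    have "2 \<le> norm (fst (act (A j) (B j) (C j) w q))" if q: "q \<in> ball (x j, ?m, ?m) (\<delta> / 2)" for q w
    proof -
      have close: "norm (coord l q - ?m) \<le> \<delta>" for l
        using coord_near[of l q "(x j, ?m, ?m)"] near[of l] q
          norm_triangle_ineq[of "coord l q - coord l (x j, ?m, ?m)" "coord l (x j, ?m, ?m) - ?m"]
        by (simp add: dist_norm norm_minus_commute)
      have nt: "norm ?m = t" using t(1) by simp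
      have "t - \<delta> \<le> norm (coord l q)" for l
        using norm_triangle_ineq2[of ?m "coord l q"] close[of l] unfolding nt norm_minus_commute[of ?m] by linarith
      moreover have "norm (coord l q) \<le> t + \<delta>" for l
        using norm_triangle_ineq2[of "coord l q" ?m] close[of l] unfolding nt by linarith
      ultimately have "t - \<delta> \<le> norm (fst (act (A j) (B j) (C j) w q))"
        using elim(2-4) by (intro word_escape[OF box]) auto
      then show ?thesis using box(1) by linarith
    qed
    then show ?case unfolding escapes_def using x(1) \<delta>(1)
      by (intro exI[of _ "(x j, ?m, ?m)"] exI[of _ "ball (x j, ?m, ?m) (\<delta> / 2)"]) auto
  qed
  then show "\<forall>\<^sub>F n in sequentially. escapes (fst (f n)) (fst (snd (f n))) (fst (snd (snd (f n)))) (snd (snd (snd (f n))))"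
    by (simp add: A_def B_def C_def D_def)
qed

text \<open>A vertex is the centre of a degenerate fibre, so its x-coordinate is a zero of the monic
  quartic \<open>fibre_energy\<close>. At the base parameter \<open>a\<close> is a zero, and nearby
  parameters have a zero near \<open>a\<close>, whatever its multiplicity.\<close>

lemma eventually_vertex:
  assumes a: "\<bar>a\<bar> < 2" and "e > 0"
  shows "\<forall>\<^sub>F v in nhds (of_real (2 * a + b\<^sup>2), of_real (2 * b + a * b), of_real (2 * b + a * b), of_real (- (a\<^sup>2 + 2 * b\<^sup>2 + 2 * a * b\<^sup>2))).
    \<exists>x y z. (x, y, z) \<in> ball (base_point a b) e \<and> fst (snd v) = 2 * y + x * z \<and> fst (snd (snd v)) = 2 * z + x * y \<and>
      (x, y, z) \<in> cubic_surface (fst v) (fst (snd v)) (fst (snd (snd v))) (snd (snd (snd v)))"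
    (is "\<forall>\<^sub>F v in nhds (?A0, ?B0, ?C0, ?D0). ?P v")
unfolding eventually_nhds_iff_sequentially
proof (intro allI impI)
  fix f :: "nat \<Rightarrow> complex4" assume f: "f \<longlonglongrightarrow> (?A0, ?B0, ?C0, ?D0)"
  define A B C D where "A j = fst (f j)" and "B j = fst (snd (f j))" and "C j = fst (snd (snd (f j)))"
    and "D j = snd (snd (snd (f j)))" for j
  have lim: "A \<longlonglongrightarrow> ?A0" "B \<longlonglongrightarrow> ?B0" "C \<longlonglongrightarrow> ?C0" "D \<longlonglongrightarrow> ?D0"
    using tendsto_fst[OF f] tendsto_fst[OF tendsto_snd[OF f]] tendsto_fst[OF tendsto_snd[OF tendsto_snd[OF f]]]
      tendsto_snd[OF tendsto_snd[OF tendsto_snd[OF f]]] by (simp_all only: A_def[abs_def] B_def[abs_def] C_def[abs_def] D_def[abs_def] fst_conv snd_conv)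
  have "\<exists>r. fibre_energy (A j) (B j) (C j) (D j) r = 0 \<and>
      norm (r - of_real a) ^ 4 \<le> norm (fibre_energy (A j) (B j) (C j) (D j) (of_real a))" for j
  proof -
    define p where "p = ([:D j, A j, - 1:] * [:4, 0, - 1:] + [:(B j)\<^sup>2 + (C j)\<^sup>2, - (B j * C j):] :: complex poly)"
    have p: "poly p x = fibre_energy (A j) (B j) (C j) (D j) x" for x
      by (simp add: p_def fibre_energy_def algebra_simps power2_eq_square)
    have "p = [:4 * D j + ((B j)\<^sup>2 + (C j)\<^sup>2), 4 * A j - B j * C j, - 4 - D j, - A j, 1:]"
      by (simp add: p_def)
    then have "degree p = 4" "lead_coeff p = 1" by simp_all
    then show ?thesis using monic_root_near[of p "of_real a"] unfolding p by auto
  qed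
  then obtain r where r: "\<And>j. fibre_energy (A j) (B j) (C j) (D j) (r j) = 0"
    "\<And>j. norm (r j - of_real a) ^ 4 \<le> norm (fibre_energy (A j) (B j) (C j) (D j) (of_real a))" by metis
  have "fibre_energy ?A0 ?B0 ?C0 ?D0 (of_real a) =
    of_real ((- (a\<^sup>2 + 2 * b\<^sup>2 + 2 * a * b\<^sup>2) + (2 * a + b\<^sup>2) * a - a\<^sup>2) * (4 - a\<^sup>2)
      + (2 * b + a * b)\<^sup>2 + (2 * b + a * b)\<^sup>2 - a * (2 * b + a * b) * (2 * b + a * b))"
    unfolding fibre_energy_def by simp
  also have "\<dots> = 0" unfolding of_real_eq_0_iff by algebra
  finally have "fibre_energy ?A0 ?B0 ?C0 ?D0 (of_real a) = 0" .
  moreover have "(\<lambda>j. norm (fibre_energy (A j) (B j) (C j) (D j) (of_real a))) \<longlonglongrightarrow> norm (fibre_energy ?A0 ?B0 ?C0 ?D0 (of_real a))"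
    unfolding fibre_energy_def by (intro tendsto_intros lim)
  ultimately have "(\<lambda>j. r j - of_real a) \<longlonglongrightarrow> 0"
    by (intro power_le_tendsto_zero[OF r(2)]) simp_all
  then have r_lim: "r \<longlonglongrightarrow> of_real a" by (simp add: LIM_zero_iff)
  have "a\<^sup>2 < 2\<^sup>2" using a by (intro power2_strict_mono) auto
  then have "of_real (4 - a\<^sup>2) \<noteq> (0 :: complex)" unfolding of_real_eq_0_iff by simp
  then have a4: "4 - (of_real a :: complex)\<^sup>2 \<noteq> 0" by simp
  have "fibre_center ?B0 ?C0 (of_real a) = of_real b"
    using a4 unfolding fibre_center_def by (simp add: nonzero_divide_eq_eq) (simp add: algebra_simps power2_eq_square)
  moreover have "(\<lambda>j. fibre_center (B j) (C j) (r j)) \<longlonglongrightarrow> fibre_center ?B0 ?C0 (of_real a)"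
    "(\<lambda>j. fibre_center (C j) (B j) (r j)) \<longlonglongrightarrow> fibre_center ?C0 ?B0 (of_real a)"
    unfolding fibre_center_def by (intro tendsto_intros lim r_lim a4)+
  ultimately have "(\<lambda>j. (r j, fibre_center (B j) (C j) (r j), fibre_center (C j) (B j) (r j))) \<longlonglongrightarrow> base_point a b"
    unfolding base_point_def by (intro tendsto_Pair r_lim) simp_all
  then have "\<forall>\<^sub>F j in sequentially. (r j, fibre_center (B j) (C j) (r j), fibre_center (C j) (B j) (r j)) \<in> ball (base_point a b) e"
    by (rule topological_tendstoD) (use \<open>e > 0\<close> in auto)
  moreover have "(\<lambda>j. 4 - (r j)\<^sup>2) \<longlonglongrightarrow> 4 - (of_real a)\<^sup>2" by (intro tendsto_intros r_lim)
  then have "\<forall>\<^sub>F j in sequentially. 4 - (r j)\<^sup>2 \<noteq> 0" using a4 by (rule tendsto_imp_eventually_ne)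
  ultimately have "\<forall>\<^sub>F j in sequentially. \<exists>x y z. (x, y, z) \<in> ball (base_point a b) e \<and> B j = 2 * y + x * z \<and> C j = 2 * z + x * y \<and>
      (x, y, z) \<in> cubic_surface (A j) (B j) (C j) (D j)"
  proof eventually_elim
    case (elim j)
    have r4: "(r j)\<^sup>2 \<noteq> 4" using elim(2) by auto
    show ?case
      by (rule exI[of _ "r j"], rule exI[of _ "fibre_center (B j) (C j) (r j)"], rule exI[of _ "fibre_center (C j) (B j) (r j)"])
        (use elim(1) in \<open>simp add: surface_fibre_iff[OF r4] r(1) fibre_center_eqs[OF r4]\<close>)
  qed
  then show "\<forall>\<^sub>F n in sequentially. ?P (f n)" by (simp only: A_def B_def C_def D_def)
qed

section \<open>Points of the Julia set\<close>

lemma fibre_u_point: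
  assumes \<rho>: "\<rho> \<noteq> 0" "\<rho>\<^sup>2 \<noteq> 1"
  shows "fibre_u B C \<rho> (fibre_point B C \<rho> u v) = u" "fibre_u B C (1 / \<rho>) (fibre_point B C \<rho> u v) = v"
proof -
  define d where "d = \<rho> - 1 / \<rho>"
  have d: "d \<noteq> 0" using square_ne_1 \<rho> by (simp add: d_def)
  have "d * ((\<rho> * v - u / \<rho>) / d + \<rho> * ((u - v) / d)) = d * u"
    "d * ((\<rho> * v - u / \<rho>) / d + (1 / \<rho>) * ((u - v) / d)) = d * v"
    using d \<rho>(1) by (simp_all add: distrib_left) (simp_all add: d_def algebra_simps diff_divide_distrib)
  then show "fibre_u B C \<rho> (fibre_point B C \<rho> u v) = u" "fibre_u B C (1 / \<rho>) (fibre_point B C \<rho> u v) = v"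
    using d unfolding fibre_u_def fibre_point_def fst_conv snd_conv d_def[symmetric] by simp_all
qed

lemma act_fibre_point:
  assumes "\<rho> \<noteq> 0" "\<rho>\<^sup>2 \<noteq> 1"
  shows "act A B C (concat (replicate n [LZ, LY])) (fibre_point B C \<rho> u v) =
    fibre_point B C \<rho> ((\<rho>\<^sup>2) ^ n * u) (v / (\<rho>\<^sup>2) ^ n)"
proof (induction n)
  case (Suc n)
  have "act A B C (concat (replicate (Suc n) [LZ, LY])) (fibre_point B C \<rho> u v) =
    s_z C (s_y B (act A B C (concat (replicate n [LZ, LY])) (fibre_point B C \<rho> u v)))" by simp
  also have "\<dots> = fibre_point B C \<rho> (\<rho>\<^sup>2 * ((\<rho>\<^sup>2) ^ n * u)) (v / (\<rho>\<^sup>2) ^ n / \<rho>\<^sup>2)"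
    unfolding Suc.IH by (rule fibre_point_step[OF assms])
  also have "\<dots> = fibre_point B C \<rho> ((\<rho>\<^sup>2) ^ Suc n * u) (v / (\<rho>\<^sup>2) ^ Suc n)" by (simp add: mult_ac)
  finally show ?case .
qed simp

lemma geometric_unbounded:
  fixes \<mu> :: complex
  assumes "norm \<mu> > 1" "c \<noteq> 0" "strict_mono r"
  shows "\<not> convergent (\<lambda>n. \<mu> ^ r n * c)"
proof
  assume "convergent (\<lambda>n. \<mu> ^ r n * c)"
  then have "Bseq (\<lambda>n. \<mu> ^ r n * c)" by (rule convergent_imp_Bseq)
  then obtain M where M: "\<And>n. norm (\<mu> ^ r n * c) \<le> M" unfolding Bseq_def by blast
  obtain n where "M / norm c < norm \<mu> ^ n" using real_arch_pow[OF assms(1)] by blast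
  also have "\<dots> \<le> norm \<mu> ^ r n" using assms(1) strict_mono_imp_increasing[OF assms(3)] by (intro power_increasing) auto
  finally have "M < norm (\<mu> ^ r n * c)" using assms(2) by (simp add: norm_mult norm_power divide_less_eq)
  then show False using M[of n] by simp
qed

text \<open>Iterates of \<open>g_x\<close> rotate the fibre over a real value, but diverge on nearby fibres over non-real
  values, so no subsequence converges or escapes on a neighbourhood.\<close>

theorem good_fibre_in_julia:
  assumes a: "good_fibre A B C D a" and p: "p \<in> cubic_surface A B C D" "fst p = of_real a"
  shows "p \<in> julia_set A B C D"
  unfolding julia_set_def
proof
  let ?S = "cubic_surface A B C D"
  show "p \<in> ?S" by fact
  show "p \<notin> fatou_set A B C D"
  proof
    assume "p \<in> fatou_set A B C D"
    then obtain U where U: "openin (top_of_set ?S) U" "p \<in> U" "normal_family_on ?S U (surface_group A B C D)"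
      unfolding fatou_set_def by blast
    obtain T where T: "open T" "U = ?S \<inter> T" using U(1) unfolding openin_open by blast
    obtain y z where p_eq: "p = (of_real a, y, z)" using p(2) by (cases p) auto
    \<comment> \<open>These values lead to a point \<open>q\<close> of \<open>U\<close> with
      non-real x and nonzero energy. Convergence is refuted at \<open>q\<close>, escape to infinity
      at \<open>p\<close> itself.\<close>
    define X where "X j = of_real a + \<i> * of_real (1 / real (Suc j))" for j
    have "(\<lambda>j. of_real a + \<i> * of_real (1 / real (Suc j))) \<longlonglongrightarrow> of_real a + \<i> * of_real 0"
      by (intro tendsto_intros LIMSEQ_Suc[OF lim_1_over_n])
    then have X: "X \<longlonglongrightarrow> of_real a" by (simp add: X_def[abs_def])
    have "(y, z, of_real a) \<in> cubic_surface B C A D"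
      using p(1) rot_in_surface[of p B C A D] by (simp add: p_eq)
    from surface_lift[OF this tendsto_const X] obtain Y where
      Y: "Y \<longlonglongrightarrow> y" "\<And>j. (Y j, z, X j) \<in> cubic_surface B C A D" by blast
    have in_S: "(X j, Y j, z) \<in> ?S" for j
      using Y(2)[of j] rot_in_surface[of "(X j, Y j, z)" B C A D] by simp
    have "(\<lambda>j. (X j, Y j, z)) \<longlonglongrightarrow> p" unfolding p_eq by (intro tendsto_intros X Y(1))
    then have "\<forall>\<^sub>F j in sequentially. (X j, Y j, z) \<in> T"
      by (rule topological_tendstoD) (use T U(2) in auto)
    moreover have "(\<lambda>j. fibre_energy A B C D (X j)) \<longlonglongrightarrow> fibre_energy A B C D (of_real a)"
      unfolding fibre_energy_def by (intro tendsto_intros X)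
    then have "\<forall>\<^sub>F j in sequentially. fibre_energy A B C D (X j) \<noteq> 0"
      by (rule tendsto_imp_eventually_ne) (use a in \<open>simp add: good_fibre_def\<close>)
    ultimately have "\<forall>\<^sub>F j in sequentially. (X j, Y j, z) \<in> T \<and> fibre_energy A B C D (X j) \<noteq> 0"
      by (rule eventually_conj)
    then obtain j where j: "(X j, Y j, z) \<in> T" "fibre_energy A B C D (X j) \<noteq> 0"
      using eventually_happens by fastforce
    define q where "q = (X j, Y j, z)"
    have q: "q \<in> U" "q \<in> ?S" using j(1) in_S by (simp_all add: q_def T(2))
    define \<rho> where "\<rho> = joukowsky_inv (X j)"
    have "Im (X j) \<noteq> 0" by (simp add: X_def)
    note N = norm_joukowsky_inv[OF this, folded \<rho>_def]
    have \<rho>0: "\<rho> \<noteq> 0" by (simp add: \<rho>_def)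
    have q_fst: "fst q = \<rho> + 1 / \<rho>" unfolding \<rho>_def joukowsky_inv_eq by (simp add: q_def)
    define u v where "u = fibre_u B C \<rho> q" and "v = fibre_u B C (1 / \<rho>) q"
    have q_eq: "fibre_point B C \<rho> u v = q" unfolding u_def v_def by (rule fibre_point_eq[OF \<rho>0 N(2) q_fst])
    have "(4 - (fst q)\<^sup>2) * (u * v) = fibre_energy A B C D (X j)"
      using fibre_u_product[OF \<rho>0 N(2) q_fst, of A B C D] q(2) by (simp add: u_def v_def q_def)
    then have uv: "u \<noteq> 0" "v \<noteq> 0" using j(2) by auto
    define w where "w n = concat (replicate n [LZ, LY])" for n
    have even_w: "even (length (w n))" for n unfolding w_def by (induction n) auto
    define f where "f n = restrict (act A B C (w n)) ?S" for n
    have "range f \<subseteq> surface_group A B C D"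
      unfolding surface_group_words f_def using even_w by blast
    then obtain r where r: "strict_mono r"
      "converges_locally_uniformly_on U (f \<circ> r) \<or> converges_to_infinity_on ?S U (f \<circ> r)"
      using U(3) unfolding normal_family_on_def by blast
    from r(2) show False
    proof
      assume "converges_locally_uniformly_on U (f \<circ> r)"
      then obtain g where g: "\<And>V. compact V \<Longrightarrow> V \<subseteq> U \<Longrightarrow> uniform_limit V (f \<circ> r) g sequentially"
        unfolding converges_locally_uniformly_on_def by blast
      have "uniform_limit {q} (f \<circ> r) g sequentially" by (rule g) (use q(1) in auto)
      then have "(\<lambda>n. (f \<circ> r) n q) \<longlonglongrightarrow> g q" by (rule tendsto_uniform_limitI) simp
      then have lim: "(\<lambda>n. fibre_point B C \<rho> ((\<rho>\<^sup>2) ^ r n * u) (v / (\<rho>\<^sup>2) ^ r n)) \<longlonglongrightarrow> g q"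
        using q(2) by (simp add: f_def w_def act_fibre_point[OF \<rho>0 N(2)] flip: q_eq)
      have nz: "4 - (fst (g q))\<^sup>2 \<noteq> 0"
      proof -
        have "(\<lambda>n. fst (fibre_point B C \<rho> ((\<rho>\<^sup>2) ^ r n * u) (v / (\<rho>\<^sup>2) ^ r n))) \<longlonglongrightarrow> fst (g q)"
          by (intro tendsto_intros lim)
        then have "fst (g q) = \<rho> + 1 / \<rho>" by (simp add: fibre_point_def LIMSEQ_const_iff)
        then show ?thesis using x_square_ne_4[OF \<rho>0 N(2)] by simp
      qed
      have "(\<lambda>n. fibre_u B C \<rho>' (fibre_point B C \<rho> ((\<rho>\<^sup>2) ^ r n * u) (v / (\<rho>\<^sup>2) ^ r n))) \<longlonglongrightarrow> fibre_u B C \<rho>' (g q)" for \<rho>'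
        unfolding fibre_u_def fibre_center_def by (intro tendsto_intros lim nz)
      from this[of \<rho>] this[of "1 / \<rho>"]
      have "convergent (\<lambda>n. (\<rho>\<^sup>2) ^ r n * u)" "convergent (\<lambda>n. v / (\<rho>\<^sup>2) ^ r n)"
        unfolding fibre_u_point[OF \<rho>0 N(2)] convergent_def by blast+
      moreover have "v / (\<rho>\<^sup>2) ^ r n = (1 / \<rho>\<^sup>2) ^ r n * v" for n by (simp add: power_one_over)
      ultimately have conv: "convergent (\<lambda>n. (\<rho>\<^sup>2) ^ r n * u)" "convergent (\<lambda>n. (1 / \<rho>\<^sup>2) ^ r n * v)" by simp_all
      show False
      proof (cases "norm \<rho> > 1")
        case True
        then have "norm (\<rho>\<^sup>2) > 1" by (simp add: norm_power one_less_power)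
        then show False using geometric_unbounded[OF _ uv(1) r(1)] conv(1) by blast
      next
        case False
        then have "norm \<rho> < 1" using N(1) by simp
        then have "norm (1 / \<rho>\<^sup>2) > 1" using \<rho>0 by (simp add: norm_power norm_divide power_less_one_iff)
        then show False using geometric_unbounded[OF _ uv(2) r(1)] conv(2) by blast
      qed
    next
      assume inf: "converges_to_infinity_on ?S U (f \<circ> r)"
      define \<sigma> where "\<sigma> = cis (arccos (a / 2))"
      have a2: "\<bar>a\<bar> < 2" and \<theta>: "\<And>n. n > 0 \<Longrightarrow> cis (2 * arccos (a / 2)) ^ n \<noteq> 1"
        using a unfolding good_fibre_def by blast+
      have \<sigma>: "\<sigma> \<noteq> 0" "\<sigma>\<^sup>2 \<noteq> 1" "norm \<sigma> = 1" using \<theta>[of 1] by (simp_all add: \<sigma>_def power2_eq_square cis_mult)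
      have "joukowsky_inv (of_real a) = \<sigma>" using joukowsky_inv_real[of a] a2 unfolding \<sigma>_def by linarith
      then have p_fst: "fst p = \<sigma> + 1 / \<sigma>" unfolding p(2) using joukowsky_inv_eq[of "of_real a"] by metis
      define u' v' where "u' = fibre_u B C \<sigma> p" and "v' = fibre_u B C (1 / \<sigma>) p"
      have p_fp: "fibre_point B C \<sigma> u' v' = p" unfolding u'_def v'_def by (rule fibre_point_eq[OF \<sigma>(1,2) p_fst])
      define R where "R = norm (\<sigma> + 1 / \<sigma>) + (norm (fibre_center B C (\<sigma> + 1 / \<sigma>)) + (norm v' + norm u') / norm (\<sigma> - 1 / \<sigma>))
        + (norm (fibre_center C B (\<sigma> + 1 / \<sigma>)) + (norm u' + norm v') / norm (\<sigma> - 1 / \<sigma>))"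
      have bd: "norm (f n p) \<le> R" for n
      proof -
        define s t where "s = (\<sigma>\<^sup>2) ^ n * u'" and "t = v' / (\<sigma>\<^sup>2) ^ n"
        have st: "norm s = norm u'" "norm t = norm v'" using \<sigma>(3) by (simp_all add: s_def t_def norm_mult norm_divide norm_power)
        have fnp: "f n p = fibre_point B C \<sigma> s t"
          using p(1) act_fibre_point[OF \<sigma>(1,2), of A B C n u' v'] unfolding p_fp by (simp add: f_def w_def s_def t_def)
        have "norm (fibre_point B C \<sigma> s t) \<le> norm (\<sigma> + 1 / \<sigma>)
          + norm (fibre_center B C (\<sigma> + 1 / \<sigma>) + (\<sigma> * t - s / \<sigma>) / (\<sigma> - 1 / \<sigma>))
          + norm (fibre_center C B (\<sigma> + 1 / \<sigma>) + (s - t) / (\<sigma> - 1 / \<sigma>))"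
          using norm_triple_le[of "fibre_point B C \<sigma> s t"] by (simp add: fibre_point_def)
        moreover have "norm (fibre_center B C (\<sigma> + 1 / \<sigma>) + (\<sigma> * t - s / \<sigma>) / (\<sigma> - 1 / \<sigma>)) \<le>
          norm (fibre_center B C (\<sigma> + 1 / \<sigma>)) + (norm v' + norm u') / norm (\<sigma> - 1 / \<sigma>)"
        proof (rule order_trans[OF norm_triangle_ineq add_left_mono])
          have "norm (\<sigma> * t - s / \<sigma>) \<le> norm v' + norm u'"
            using norm_triangle_ineq4[of "\<sigma> * t" "s / \<sigma>"] st \<sigma>(3) by (simp add: norm_mult norm_divide)
          then show "norm ((\<sigma> * t - s / \<sigma>) / (\<sigma> - 1 / \<sigma>)) \<le> (norm v' + norm u') / norm (\<sigma> - 1 / \<sigma>)"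
            unfolding norm_divide by (rule divide_right_mono) simp
        qed
        moreover have "norm (fibre_center C B (\<sigma> + 1 / \<sigma>) + (s - t) / (\<sigma> - 1 / \<sigma>)) \<le>
          norm (fibre_center C B (\<sigma> + 1 / \<sigma>)) + (norm u' + norm v') / norm (\<sigma> - 1 / \<sigma>)"
        proof (rule order_trans[OF norm_triangle_ineq add_left_mono])
          have "norm (s - t) \<le> norm u' + norm v'" using norm_triangle_ineq4[of s t] st by simp
          then show "norm ((s - t) / (\<sigma> - 1 / \<sigma>)) \<le> (norm u' + norm v') / norm (\<sigma> - 1 / \<sigma>)"
            unfolding norm_divide by (rule divide_right_mono) simp
        qed
        ultimately show ?thesis unfolding R_def fnp by linarith
      qed
      have "compact (?S \<inter> cball 0 R)" by (intro closed_Int_compact closed_cubic_surface compact_cball)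
      moreover have "compact {p}" "{p} \<subseteq> U" using U(2) by auto
      ultimately have "finite {i. (f \<circ> r) i ` {p} \<inter> (?S \<inter> cball 0 R) \<noteq> {}}"
        using inf unfolding converges_to_infinity_on_def by blast
      moreover have "(f \<circ> r) i p \<in> ?S \<inter> cball 0 R" for i
        using bd[of "r i"] p(1) by (simp add: f_def)
      then have "{i. (f \<circ> r) i ` {p} \<inter> (?S \<inter> cball 0 R) \<noteq> {}} = UNIV" by auto
      ultimately show False by simp
    qed
  qed
qed

section \<open>The orbit closure\<close>

text \<open>The complement of the orbit closure \<open>K\<close> is open; if it met \<open>W\<close>
  in the surface, it would contain a point whose orbit hits a wall. But the walls lie in
  \<open>K\<close>, and \<open>K\<close> is invariant under inverse words.\<close>

theorem big_orbit_closure: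
  assumes C: "Im C \<noteq> 0" and esc: "escapes A B C D" and q0: "q0 \<in> cubic_surface A B C D"
    and W: "open W" "q0 \<in> W"
    and cross: "\<And>U. open U \<Longrightarrow> U \<inter> W \<inter> cubic_surface A B C D \<noteq> {} \<Longrightarrow>
      \<exists>s\<in>U \<inter> cubic_surface A B C D. \<exists>w. even (length w) \<and>
        (fst (snd (act A B C w s)) \<in> of_real ` {- 2..2} \<or> snd (snd (act A B C w s)) \<in> of_real ` {- 2..2})"
  shows "\<exists>p\<in>julia_set A B C D.
    top_of_set (cubic_surface A B C D) interior_of orbit_closure A B C D p \<noteq> {} \<and>
    orbit_closure A B C D p \<noteq> cubic_surface A B C D"
proof -
  let ?S = "cubic_surface A B C D"
  obtain a b z where ab: "good_fibre A B C D a" "good_fibre B C A D b" "2 * Im B \<noteq> a * Im C"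
    and p: "(of_real a, of_real b, z) \<in> ?S" by (rule starting_point_exists[OF C])
  define p :: complex3 where "p = (of_real a, of_real b, z)"
  have pS: "p \<in> ?S" using p by (simp add: p_def)
  define orb where "orb = surface_orbit A B C D p"
  have orb: "orb = {act A B C w p | w. even (length w)}" unfolding orb_def by (rule surface_orbit_words[OF pS])
  have O_S: "orb \<subseteq> ?S" using pS by (auto simp: orb)
  define K where "K = closure orb"
  have K_S: "K \<subseteq> ?S" unfolding K_def by (rule closure_minimal[OF O_S closed_cubic_surface])
  have K: "orbit_closure A B C D p = K"
    using O_S K_S unfolding orbit_closure_def orb_def[symmetric] K_def
    by (simp add: closure_of_subtopology Int_absorb1 Int_absorb2)
  have inv: "closed_invariant A B C D K"
    unfolding closed_invariant_def
  proof (intro conjI allI impI K_S)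
    show "closed K" by (simp add: K_def)
    fix w :: "letter list" and s assume w: "even (length w)" and s: "s \<in> K"
    have "act A B C w ` closure orb \<subseteq> closure orb"
    proof (rule image_closure_subset)
      show "continuous_on (closure orb) (act A B C w)" using continuous_on_act[OF continuous_on_id] by simp
      have "act A B C w (act A B C w' p) \<in> orb" if "even (length w')" for w'
        unfolding orb using that w by (intro CollectI exI[of _ "w @ w'"]) simp
      then have "act A B C w ` orb \<subseteq> orb" by (auto simp: orb)
      then show "act A B C w ` orb \<subseteq> closure orb" using closure_subset by blast
    qed simp
    then show "act A B C w s \<in> K" using s unfolding K_def by blast
  qed
  have "p \<in> orb" unfolding orb by (intro CollectI exI[of _ "[]"]) simp
  then have pK: "(of_real a, of_real b, z) \<in> K" using closure_subset unfolding K_def p_def by blast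
  have absorbed: "s \<in> K" if "s \<in> ?S" "even (length w)"
    "fst (snd (act A B C w s)) \<in> of_real ` {- 2..2} \<or> snd (snd (act A B C w s)) \<in> of_real ` {- 2..2}" for s w
  proof -
    have "act A B C w s \<in> K"
      by (rule real_walls_absorbed[OF inv ab pK _ that(3)]) (use that(1) in simp)
    moreover have "even (length (rev w))" using that(2) by simp
    ultimately have "act A B C (rev w) (act A B C w s) \<in> K"
      using inv unfolding closed_invariant_def by blast
    then show ?thesis by simp
  qed
  have "?S \<inter> W \<subseteq> K"
  proof
    fix t assume t: "t \<in> ?S \<inter> W"
    show "t \<in> K"
    proof (rule ccontr)
      assume "t \<notin> K"
      then have "- K \<inter> W \<inter> ?S \<noteq> {}" "open (- K)" using t by (auto simp: K_def)
      then show False using cross[of "- K"] absorbed by blast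
    qed
  qed
  then have "?S \<inter> W \<subseteq> top_of_set ?S interior_of K"
    by (rule interior_of_maximal) (use W(1) in auto)
  then have "top_of_set ?S interior_of K \<noteq> {}" using q0 W(2) by blast
  moreover have "K \<noteq> ?S"
  proof
    assume "K = ?S"
    obtain q V where q: "q \<in> ?S" "open V" "q \<in> V" and V: "\<And>q' w. q' \<in> V \<Longrightarrow> 2 \<le> norm (fst (act A B C w q'))"
      using esc unfolding escapes_def by blast
    have "V \<inter> closure orb \<noteq> {}" using q \<open>K = ?S\<close> unfolding K_def by blast
    then have "V \<inter> orb \<noteq> {}" using open_Int_closure_eq_empty[OF q(2)] by blast
    then obtain w where "act A B C w p \<in> V" unfolding orb by blast
    \<comment> \<open>The inverse word leads from \<open>V\<close> back to \<open>p\<close>, whose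
      first coordinate has modulus below 2.\<close>
    from V[OF this, of "rev w"] have "2 \<le> norm (fst p)" by simp
    then have "2 \<le> \<bar>a\<bar>" by (simp add: p_def)
    then show False using ab(1) by (simp add: good_fibre_def)
  qed
  moreover have "p \<in> julia_set A B C D" by (rule good_fibre_in_julia[OF ab(1) pS]) (simp add: p_def)
  ultimately show ?thesis unfolding K[symmetric] by blast
qed

text \<open>The estimate for four words at the base parameter is an open condition, and
  \<open>comm_word_near_id\<close> passes it on to all indices; so one neighbourhood of the
  parameter serves every \<open>n\<close>.\<close>

lemma near_words:
  assumes a: "\<bar>a\<bar> < 2"
  obtains m r where "m \<ge> 1" "r > 0"
    "\<forall>\<^sub>F v in nhds (of_real (2 * a + b\<^sup>2), of_real (2 * b + a * b), of_real (2 * b + a * b), D0 :: complex). \<forall>n.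
      near_id (base_point a b) (r / 2) (r / 1000 / 4 ^ n) (act (fst v) (fst (snd v)) (fst (snd (snd v))) (comm_word m n)) \<and>
      near_id (base_point a b) (r / 2) (r / 1000 / 4 ^ n) (act (fst v) (fst (snd v)) (fst (snd (snd v))) (rev (comm_word m n)))"
proof -
  let ?p = "base_point a b"
  let ?v0 = "(of_real (2 * a + b\<^sup>2), of_real (2 * b + a * b), of_real (2 * b + a * b)) :: complex3"
  obtain m r where m: "m \<ge> 1" "r > 0"
    and close: "\<And>w p. w \<in> {comm_word m 0, rev (comm_word m 0), comm_word m 1, rev (comm_word m 1)} \<Longrightarrow>
       p \<in> cball ?p r \<Longrightarrow> norm (base_act a b w p - p) \<le> 1 / 8000 * r"
    using base_near_id[OF a, of "1 / 8000" b] by auto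
  have ev: "\<forall>\<^sub>F v in nhds (fst ?v0, fst (snd ?v0), snd (snd ?v0), D0).
      near_id ?p r (r / 4000) (act (fst v) (fst (snd v)) (fst (snd (snd v))) w)"
    if w: "w \<in> {comm_word m 0, rev (comm_word m 0), comm_word m 1, rev (comm_word m 1)}" for w
  proof -
    obtain X where X: "open X" "?v0 \<in> X"
      and XP: "\<And>A B C. (A, B, C) \<in> X \<Longrightarrow> near_id ?p r (2 * (1 / 8000) * r) (act A B C w)"
      by (rule near_id_params[OF close[OF w]]) (use m(2) in auto)
    let ?g = "\<lambda>v :: complex4. (fst v, fst (snd v), fst (snd (snd v)))"
    have "open (?g -` X)" by (intro open_vimage X(1) continuous_intros)
    moreover have "(fst ?v0, fst (snd ?v0), snd (snd ?v0), D0) \<in> ?g -` X" using X(2) by (simp only: vimage_eq fst_conv snd_conv)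
    ultimately have "\<forall>\<^sub>F v in nhds (fst ?v0, fst (snd ?v0), snd (snd ?v0), D0). v \<in> ?g -` X"
      by (rule eventually_nhds_in_open)
    then show ?thesis
    proof eventually_elim
      case (elim v)
      then show ?case using XP[of "fst v" "fst (snd v)" "fst (snd (snd v))"] by simp
    qed
  qed
  show ?thesis
  proof (rule that[OF m])
    have "\<forall>\<^sub>F v in nhds (fst ?v0, fst (snd ?v0), snd (snd ?v0), D0).
      near_id ?p r (r / 4000) (act (fst v) (fst (snd v)) (fst (snd (snd v))) (comm_word m 0)) \<and>
      near_id ?p r (r / 4000) (act (fst v) (fst (snd v)) (fst (snd (snd v))) (rev (comm_word m 0))) \<and>
      near_id ?p r (r / 4000) (act (fst v) (fst (snd v)) (fst (snd (snd v))) (comm_word m 1)) \<and>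
      near_id ?p r (r / 4000) (act (fst v) (fst (snd v)) (fst (snd (snd v))) (rev (comm_word m 1)))"
      by (intro eventually_conj ev) simp_all
    then show "\<forall>\<^sub>F v in nhds (of_real (2 * a + b\<^sup>2), of_real (2 * b + a * b), of_real (2 * b + a * b), D0 :: complex). \<forall>n.
      near_id ?p (r / 2) (r / 1000 / 4 ^ n) (act (fst v) (fst (snd v)) (fst (snd (snd v))) (comm_word m n)) \<and>
      near_id ?p (r / 2) (r / 1000 / 4 ^ n) (act (fst v) (fst (snd v)) (fst (snd (snd v))) (rev (comm_word m n)))"
      unfolding fst_conv snd_conv
    proof eventually_elim
      case (elim v)
      have le: "r / 4000 \<le> r / 1000" using m(2) by simp
      show ?case
      proof
        fix n
        have "r / 2 \<le> r / 2 * (1 + 1 / 2 ^ n)" using m(2) by (simp add: distrib_left)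
        then show "near_id ?p (r / 2) (r / 1000 / 4 ^ n) (act (fst v) (fst (snd v)) (fst (snd (snd v))) (comm_word m n)) \<and>
          near_id ?p (r / 2) (r / 1000 / 4 ^ n) (act (fst v) (fst (snd v)) (fst (snd (snd v))) (rev (comm_word m n)))"
          using comm_word_near_id[OF m(2) near_id_mono[OF _ order_refl le] near_id_mono[OF _ order_refl le], of ?p "fst v" "fst (snd v)" "fst (snd (snd v))" m n]
            elim near_id_mono by blast
      qed
    qed
  qed
qed

definition has_big_orbit_closure :: "complex4 \<Rightarrow> bool" where
  "has_big_orbit_closure = (\<lambda>(A, B, C, D). \<exists>p\<in>julia_set A B C D.
    top_of_set (cubic_surface A B C D) interior_of orbit_closure A B C D p \<noteq> {} \<and>
    orbit_closure A B C D p \<noteq> cubic_surface A B C D)"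

text \<open>The equation for \<open>t\<close> places (-t, -t, -t) on the base surface. The vertex is
  taken within \<open>r / 8\<close> of the base point, so that its ball of radius
  \<open>r / 8\<close> stays inside the ball of radius \<open>r / 4\<close> on which the words have
  small Lipschitz displacement.\<close>

lemma eventually_big_orbit_closure:
  assumes a: "\<bar>a\<bar> < 2"
    and t: "t > 2" "\<bar>2 * a + b\<^sup>2\<bar> < t * (t - 2)" "\<bar>2 * b + a * b\<bar> < t * (t - 2)"
      "3 * t\<^sup>2 - t ^ 3 = - (2 * a + b\<^sup>2) * t - 2 * (2 * b + a * b) * t - (a\<^sup>2 + 2 * b\<^sup>2 + 2 * a * b\<^sup>2)"
    and generic: "\<And>A B C D. (A, B, C, D) \<notin> H \<Longrightarrow> Im C \<noteq> 0 \<and>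
      (\<forall>x y z. B = 2 * y + x * z \<longrightarrow> C = 2 * z + x * y \<longrightarrow> (x, y, z) \<in> cubic_surface A B C D \<longrightarrow>
        Im (x\<^sup>2) \<noteq> 0 \<and> 2 * x + y * z \<noteq> A \<and>
        (\<forall>m n. m \<ge> 1 \<longrightarrow> act A B C (comm_word m n) (x, y, z) \<noteq> (x, y, z) \<or>
           act A B C (comm_word m (Suc n)) (x, y, z) \<noteq> (x, y, z)))"
  shows "\<forall>\<^sub>F v in nhds (of_real (2 * a + b\<^sup>2), of_real (2 * b + a * b), of_real (2 * b + a * b),
      of_real (- (a\<^sup>2 + 2 * b\<^sup>2 + 2 * a * b\<^sup>2))). v \<notin> H \<longrightarrow> has_big_orbit_closure v"
    (is "\<forall>\<^sub>F v in nhds ?v0. _")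
proof -
  obtain m r where m: "m \<ge> 1" "r > 0" and words: "\<forall>\<^sub>F v in nhds ?v0. \<forall>n.
      near_id (base_point a b) (r / 2) (r / 1000 / 4 ^ n) (act (fst v) (fst (snd v)) (fst (snd (snd v))) (comm_word m n)) \<and>
      near_id (base_point a b) (r / 2) (r / 1000 / 4 ^ n) (act (fst v) (fst (snd v)) (fst (snd (snd v))) (rev (comm_word m n)))"
    by (rule near_words[OF a])
  have "(- of_real t, - of_real t, - of_real t) \<in> cubic_surface (of_real (2 * a + b\<^sup>2)) (of_real (2 * b + a * b))
      (of_real (2 * b + a * b)) (of_real (- (a\<^sup>2 + 2 * b\<^sup>2 + 2 * a * b\<^sup>2)))"
  proof -
    have "(of_real (3 * t\<^sup>2 - t ^ 3) :: complex) = of_real (- (2 * a + b\<^sup>2) * t - 2 * (2 * b + a * b) * t - (a\<^sup>2 + 2 * b\<^sup>2 + 2 * a * b\<^sup>2))"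
      by (simp only: t(4))
    then show ?thesis by (simp add: cubic_surface_def power2_eq_square power3_eq_cube algebra_simps)
  qed
  then have esc: "\<forall>\<^sub>F v in nhds ?v0. escapes (fst v) (fst (snd v)) (fst (snd (snd v))) (snd (snd (snd v)))"
    by (intro eventually_escapes[OF t(1)]) (use t(2,3) in \<open>simp_all only: norm_of_real\<close>)
  have "r / 8 > 0" using m(2) by simp
  from words esc eventually_vertex[OF a this, of b] show ?thesis
  proof eventually_elim
    case (elim v)
    obtain A B C D where v: "v = (A, B, C, D)" by (cases v) auto
    show ?case
    proof
      assume "v \<notin> H"
      note G = generic[OF this[unfolded v]]
      obtain x y z where q0: "(x, y, z) \<in> ball (base_point a b) (r / 8)" "B = 2 * y + x * z" "C = 2 * z + x * y"
        "(x, y, z) \<in> cubic_surface A B C D" using elim(3) by (auto simp: v)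
      note G0 = G[THEN conjunct2, rule_format, OF q0(2,3,4)]
      interpret vertex A B C D x y z by unfold_locales (use q0 G0 in auto)
      have moves: "\<exists>w. moves_near (r / 8) \<epsilon> w" if "\<epsilon> > 0" for \<epsilon>
      proof -
        define K where "K = max 1 (r / 1000)"
        have K: "K \<ge> 1" "K \<ge> r / 1000" by (simp_all add: K_def)
        have "\<epsilon> / K > 0" using that K(1) by simp
        then obtain n where n: "(1 / 4) ^ n < \<epsilon> / K" using real_arch_pow_inv[of "\<epsilon> / K" "1 / 4"] by auto
        \<comment> \<open>One of two consecutive words moves the vertex, so \<open>n'\<close> is
          \<open>n\<close> or \<open>Suc n\<close>.\<close>
        obtain n' where n': "n' \<ge> n" "act A B C (comm_word m n') (x, y, z) \<noteq> (x, y, z)"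
          using G0 m(1) le_SucI[OF order_refl[of n]] by blast
        have "(1 / 4 :: real) ^ n' * K \<le> (1 / 4) ^ n * K"
          using K by (intro mult_right_mono power_decreasing[OF n'(1)]) auto
        also have "\<dots> < \<epsilon>" using n K(1) by (simp add: pos_less_divide_eq)
        finally have small: "1 / 4 ^ n' * K \<le> \<epsilon>" by (simp add: power_one_over)
        have "1 / 4 ^ n' * 1 \<le> 1 / 4 ^ n' * K" "1 / 4 ^ n' * (r / 1000) \<le> 1 / 4 ^ n' * K"
          using K by (intro mult_left_mono; simp)+
        then have small: "1 / 4 ^ n' \<le> \<epsilon>" "r / 1000 / 4 ^ n' \<le> \<epsilon>" using small by (simp_all add: mult.commute)
        have sub: "p \<in> ball (base_point a b) (r / 4)" if "p \<in> ball (x, y, z) (r / 8)" for p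
          using that q0(1) dist_triangle_less_add[of "base_point a b" "(x, y, z)" "r / 8" p "r / 8"] by (simp add: dist_commute)
        have near: "near_id (base_point a b) (r / 2) (r / 1000 / 4 ^ n') (act A B C (comm_word m n'))"
          "near_id (base_point a b) (r / 2) (r / 1000 / 4 ^ n') (act A B C (rev (comm_word m n')))"
          using elim(1) by (simp_all add: v)
        have "norm (act A B C w p - p) \<le> \<epsilon>"
          if w: "near_id (base_point a b) (r / 2) (r / 1000 / 4 ^ n') (act A B C w)" and "p \<in> ball (x, y, z) (r / 8)" for w p
        proof -
          have "p \<in> ball (base_point a b) (r / 2)" using sub[OF that(2)] m(2) by simp
          then show ?thesis using w small(2) unfolding near_id_def by (meson order_trans)
        qed
        moreover have "norm ((act A B C w p - p) - (act A B C w q - q)) \<le> \<epsilon> * norm (p - q)"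
          if w: "near_id (base_point a b) (r / 2) (r / 1000 / 4 ^ n') (act A B C w)"
            and "p \<in> ball (x, y, z) (r / 8)" "q \<in> ball (x, y, z) (r / 8)" for w p q
          using comm_word_lipschitz[OF m(2) w sub[OF that(2)] sub[OF that(3)]] mult_right_mono[OF small(1), of "norm (p - q)"]
          by simp
        ultimately show ?thesis unfolding moves_near_def using near n'(2) even_length_comm_word
          by (intro exI[of _ "comm_word m n'"]) auto
      qed
      from dense_crossings[OF _ moves] m(2) obtain W where W: "open W" "(x, y, z) \<in> W"
        "\<forall>U. open U \<longrightarrow> U \<inter> W \<inter> S \<noteq> {} \<longrightarrow> (\<exists>s\<in>U \<inter> S. crosses_real s)" by auto
      have "escapes A B C D" using elim(2) by (simp add: v)
      then show "has_big_orbit_closure v"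
        unfolding has_big_orbit_closure_def v prod.case
        using G W q0(4) unfolding crosses_real_def by (intro big_orbit_closure) blast+
    qed
  qed
qed

text \<open>With u = a + 2 the cubic says that (-t, -t, -t) lies on the surface of
  \<open>special_param a\<close>, and the inequality is the escape condition for A = B = C = 2u. The
  larger solution \<open>t1\<close> of t(t - 2) = 2u makes the cubic negative, so a root lies beyond
  it.\<close>

lemma cubic_root_exists:
  fixes u :: real
  assumes "u > 0"
  shows "\<exists>t>2. 2 * u < t * (t - 2) \<and> t ^ 3 - 3 * t\<^sup>2 - 6 * u * t + (4 - 4 * u - u\<^sup>2) = 0"
proof -
  define \<phi> where "\<phi> t = t ^ 3 - 3 * t\<^sup>2 - 6 * u * t + (4 - 4 * u - u\<^sup>2)" for t :: real
  define t1 where "t1 = 1 + sqrt (1 + 2 * u)"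
  have t1: "t1 > 2" using assms by (simp add: t1_def)
  have "(t1 - 1)\<^sup>2 = 1 + 2 * u" using assms by (simp add: t1_def)
  then have sq: "t1\<^sup>2 = 2 * t1 + 2 * u" by (simp add: power2_eq_square algebra_simps)
  have "\<phi> t1 = 4 - 2 * t1 - 4 * u * t1 - 6 * u - u\<^sup>2" unfolding \<phi>_def using sq by algebra
  moreover have "2 * t1 > 4" "4 * u * t1 \<ge> 0" "u\<^sup>2 \<ge> 0" using t1 assms by simp_all
  ultimately have neg: "\<phi> t1 < 0" using assms by linarith
  define T where "T = t1 + 20 + 20 * u"
  have T: "T \<ge> 20 + 20 * u" "T \<ge> 1" "T \<ge> u" using t1 assms by (simp_all add: T_def)
  have "\<phi> T \<ge> 0"
  proof -
    have "T * T * (20 + 20 * u) \<le> T * T * T" using T by (intro mult_left_mono) auto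
    then have 1: "20 * (T * T) + 20 * (u * (T * T)) \<le> T * T * T" by (simp add: algebra_simps)
    have "1 * T \<le> T * T" using T by (intro mult_right_mono) auto
    then have "T \<le> T * T" "1 \<le> T * T" using T(2) by linarith+
    then have 2: "u * T \<le> u * (T * T)" "u * 1 \<le> u * (T * T)" using T assms by (intro mult_left_mono; simp)+
    have 3: "u * u \<le> u * T" using T assms by (intro mult_left_mono) auto
    have 4: "0 \<le> T * T" "0 \<le> u * (T * T)" using assms by simp_all
    have "\<phi> T = T * T * T - 3 * (T * T) - 6 * (u * T) + 4 - 4 * u - u * u"
      by (simp add: \<phi>_def power2_eq_square power3_eq_cube)
    then show ?thesis using 1 2 3 4 by linarith
  qed
  moreover have "continuous_on {t1..T} \<phi>" unfolding \<phi>_def[abs_def] by (intro continuous_intros)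
  moreover have "t1 \<le> T" using assms by (simp add: T_def)
  ultimately obtain t where t: "t1 \<le> t" "\<phi> t = 0" using IVT'[of \<phi> t1 0 T] neg by fastforce
  have "t1 < t" using t neg by (cases "t = t1") auto
  have "(t - t1) * (t + t1 - 2) > 0" using \<open>t1 < t\<close> t1 by simp
  then have "2 * u < t * (t - 2)" using sq by (simp add: algebra_simps power2_eq_square)
  then show ?thesis using t t1 unfolding \<phi>_def by (intro exI[of _ t]) auto
qed

theorem mainTheorem10:
  "\<exists>(P :: complex4 set) (H :: complex4 set).
     open P \<and> (0, 0, 0, 0) \<in> P \<and> (\<forall>a \<in> {-2<..<2 :: real}. special_param a \<in> P) \<and>
     (\<exists>F. countable F \<and> (\<forall>Z \<in> F. real_algebraic_hypersurface Z) \<and> H = \<Union>F) \<and>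
     (\<forall>A B C D. (A, B, C, D) \<in> P - H \<longrightarrow>
       (\<exists>p \<in> julia_set A B C D.
          top_of_set (cubic_surface A B C D) interior_of orbit_closure A B C D p \<noteq> {} \<and>
          orbit_closure A B C D p \<noteq> cubic_surface A B C D))"
proof -
  obtain F where F: "countable F" "\<forall>Z\<in>F. real_algebraic_hypersurface Z"
    and generic: "\<forall>A B C D. (A, B, C, D) \<notin> \<Union>F \<longrightarrow> Im C \<noteq> 0 \<and>
      (\<forall>x y z. B = 2 * y + x * z \<longrightarrow> C = 2 * z + x * y \<longrightarrow> (x, y, z) \<in> cubic_surface A B C D \<longrightarrow>
        Im (x\<^sup>2) \<noteq> 0 \<and> 2 * x + y * z \<noteq> A \<and>
        (\<forall>m n. m \<ge> 1 \<longrightarrow> act A B C (comm_word m n) (x, y, z) \<noteq> (x, y, z) \<or>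
           act A B C (comm_word m (Suc n)) (x, y, z) \<noteq> (x, y, z)))"
    using generic_vertices by (elim exE conjE) (rule that)
  note big = eventually_big_orbit_closure[OF _ _ _ _ _ generic[rule_format]]
  define P where "P = interior {v. v \<notin> \<Union>F \<longrightarrow> has_big_orbit_closure v}"
  have in_P: "v \<in> P" if "\<forall>\<^sub>F v in nhds v. v \<notin> \<Union>F \<longrightarrow> has_big_orbit_closure v" for v
    using that unfolding P_def interior_def eventually_nhds by blast
  \<comment> \<open>For a = b = 0 the surface is x^2 + y^2 + z^2 + xyz = 0, which contains (-3, -3,
    -3); hence t = 3.\<close>
  have "(of_real (2 * 0 + 0\<^sup>2), of_real (2 * 0 + 0 * 0), of_real (2 * 0 + 0 * 0),
      of_real (- (0\<^sup>2 + 2 * 0\<^sup>2 + 2 * 0 * 0\<^sup>2))) \<in> P"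
    by (intro in_P big[of 0 3 0]) simp_all
  then have zero: "(0, 0, 0, 0) \<in> P" by simp
  have special: "special_param a \<in> P" if a: "a \<in> {-2<..<2}" for a
  proof -
    obtain t where t: "t > 2" "2 * (a + 2) < t * (t - 2)"
      "t ^ 3 - 3 * t\<^sup>2 - 6 * (a + 2) * t + (4 - 4 * (a + 2) - (a + 2)\<^sup>2) = 0"
      using cubic_root_exists[of "a + 2"] a by auto
    have "(of_real (2 * a + 2\<^sup>2), of_real (2 * 2 + a * 2), of_real (2 * 2 + a * 2),
        of_real (- (a\<^sup>2 + 2 * 2\<^sup>2 + 2 * a * 2\<^sup>2))) \<in> P"
    proof (intro in_P big)
      show "3 * t\<^sup>2 - t ^ 3 = - (2 * a + 2\<^sup>2) * t - 2 * (2 * 2 + a * 2) * t - (a\<^sup>2 + 2 * 2\<^sup>2 + 2 * a * 2\<^sup>2)"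
        using t(3) by algebra
    qed (use a t in auto)
    moreover have "(of_real (2 * a + 2\<^sup>2), of_real (2 * 2 + a * 2), of_real (2 * 2 + a * 2),
        of_real (- (a\<^sup>2 + 2 * 2\<^sup>2 + 2 * a * 2\<^sup>2))) = special_param a"
      by (simp add: special_param_def algebra_simps)
    ultimately show ?thesis by simp
  qed
  have concl: "\<exists>p \<in> julia_set A B C D.
      top_of_set (cubic_surface A B C D) interior_of orbit_closure A B C D p \<noteq> {} \<and>
      orbit_closure A B C D p \<noteq> cubic_surface A B C D" if "(A, B, C, D) \<in> P - \<Union>F" for A B C D
  proof -
    have "has_big_orbit_closure (A, B, C, D)" using that interior_subset unfolding P_def by blast
    then show ?thesis by (simp add: has_big_orbit_closure_def)
  qed
  show ?thesis
  proof (rule exI[of _ P], rule exI[of _ "\<Union>F"], intro conjI ballI allI impI)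
    show "open P" unfolding P_def by (rule open_interior)
    show "\<exists>F'. countable F' \<and> (\<forall>Z\<in>F'. real_algebraic_hypersurface Z) \<and> \<Union>F = \<Union>F'"
      by (rule exI[of _ F]) (simp add: F)
  qed (rule zero, rule special, assumption, rule concl)
qed

end
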